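(* Let $(R,\mathfrak n)$ be a Noetherian local ring with $\dim R>0$, maximal ideal $\mathfrak n$ and infinite residue field $k=R/\mathfrak n$, let $J$ be an $\mathfrak n$-primary ideal, and let $I_1,\ldots,I_s$ be ideals of $R$ such that $I=I_1\cdots I_s$ is non-nilpotent. Let $k_0,k_1,\ldots,k_s$ be non-negative integers with $k_0+k_1+\cdots+k_s=\dim R/(0:I^\infty)-1$. Then the following statements hold. (i) $e(J^{[k_0+1]},I_1^{[k_1]},\ldots,I_s^{[k_s]};R)\neq 0$ if and only if there exists a superficial sequence $x_1,\ldots,x_t$ of $(I_1,\ldots,I_s)$ with respect to $J$ consisting of $k_1$ elements of $I_1$, $\ldots$, $k_s$ elements of $I_s$ such that $\dim R/((x_1,\ldots,x_t):I^\infty)=\dim R/(0:I^\infty)-t$. (ii) Suppose that $e(J^{[k_0+1]},I_1^{[k_1]},\ldots,I_s^{[k_s]};R)\neq 0$ and that $x_1,\ldots,x_t$ is a superficial sequence of $(I_1,\ldots,I_s)$ with respect to $J$ consisting of $k_1$ elements of $I_1$, $\ldots$, $k_s$ elements of $I_s$. Set $\overline R=R/((x_1,\ldots,x_t):I^\infty)$. Then $$e(J^{[k_0+1]},I_1^{[k_1]},\ldots,I_s^{[k_s]};R)=e(J;\overline R).$$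
   Context: For ideals $\mathfrak a,\mathfrak b$ of $R$, $\mathfrak a:\mathfrak b^\infty=\bigcup_{n\ge0}(\mathfrak a:\mathfrak b^n)$. $e(J;\overline R)$ is the Hilbert–Samuel multiplicity of $\overline R$ with respect to $J$. "$n_0,\ldots,n_s\gg0$" means all $n_j\ge N$ for some integer $N$. Mixed multiplicities of ideals. Let $q=\dim R/(0:I^\infty)$ and $$T=\bigoplus_{n,n_1,\ldots,n_s\ge0}\frac{J^nI_1^{n_1}\cdots I_s^{n_s}}{J^{n+1}I_1^{n_1}\cdots I_s^{n_s}},$$ a finitely generated standard $(s+1)$-graded algebra over the Artinian local ring $R/J$. It is known that $\dim T^\triangle=q$, where $T^\triangle=\bigoplus_{n\ge 0}T_{(n,\ldots,n)}$ is the diagonal subring of $T$, and that for all large $n,n_1,\ldots,n_s$ the length of $J^nI_1^{n_1}\cdots I_s^{n_s}/J^{n+1}I_1^{n_1}\cdots I_s^{n_s}$ is a polynomial in $n,n_1,\ldots,n_s$ of total degree $q-1$. Its terms of total degree $q-1$ are written $$\sum_{k_0+k_1+\cdots+k_s=q-1}e(J^{[k_0+1]},I_1^{[k_1]},\ldots,I_s^{[k_s]};R)\frac{n^{k_0}n_1^{k_1}\cdots n_s^{k_s}}{k_0!k_1!\cdots k_s!},$$ and $e(J^{[k_0+1]},I_1^{[k_1]},\ldots,I_s^{[k_s]};R)$ is called the mixed multiplicity of $J,I_1,\ldots,I_s$ of type $(k_0,k_1,\ldots,k_s)$. Superficial sequences. Let $\mathfrak I=I_0$ be an ideal of $R$ such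 that $\mathfrak I I_1\cdots I_s$ is non-nilpotent. An element $x\in R$ is a superficial element of $(I_1,\ldots,I_s)$ with respect to $\mathfrak I$ if there exists $i\in\{0,1,\ldots,s\}$ such that $x\in I_i$ and (a) $(\mathfrak I I_0^{n_0}\cdots I_i^{n_i+1}\cdots I_s^{n_s}:x)\cap I_0^{n_0}\cdots I_s^{n_s}=\mathfrak I I_0^{n_0}\cdots I_i^{n_i}\cdots I_s^{n_s}$ for all $n_0,\ldots,n_s\gg0$; (b) $(x)\cap I_0^{n_0}\cdots I_i^{n_i+1}\cdots I_s^{n_s}=xI_0^{n_0}\cdots I_i^{n_i}\cdots I_s^{n_s}$ for all $n_0,\ldots,n_s\gg0$. A sequence $x_1,\ldots,x_t$ in $R$ is a superficial sequence of $(I_1,\ldots,I_s)$ with respect to $\mathfrak I$ if for each $i=0,\ldots,t-1$ the image of $x_{i+1}$ in $R_i=R/(x_1,\ldots,x_i)$ is a superficial element of $(I_1R_i,\ldots,I_sR_i)$ with respect to $\mathfrak I R_i$ (in the ring $R_i$). In the theorem $\mathfrak I=I_0=J$. *)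

theory Defs
  imports
    "HOL-Algebra.Ideal_Product"
    "HOL-Algebra.QuotRing"
    "HOL-Algebra.Module"
    "HOL-Algebra.Ring_Divisibility"
    "HOL-Library.Extended_Real"
    "HOL-Library.Poly_Mapping"
    "HOL-Computational_Algebra.Polynomial"
begin

definition local_ring :: "('a, 'm) ring_scheme \<Rightarrow> 'a set \<Rightarrow> bool" where
  "local_ring R \<nn> \<longleftrightarrow>
     cring R \<and> maximalideal \<nn> R \<and> (\<forall>\<mm>. maximalideal \<mm> R \<longrightarrow> \<mm> = \<nn>)"

(* The zero ring has no primes, hence dimension Sup {} = -\<infinity>. *)
definition krull_dim :: "('a, 'm) ring_scheme \<Rightarrow> ereal" where
  "krull_dim R = Sup {ereal (real n) | n.
     \<exists>P :: nat \<Rightarrow> 'a set. (\<forall>i\<le>n. primeideal (P i) R) \<and> (\<forall>i<n. P i \<subset> P (Suc i))}"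

definition radical_ideal :: "('a, 'm) ring_scheme \<Rightarrow> 'a set \<Rightarrow> 'a set" where
  "radical_ideal R J = {a \<in> carrier R. \<exists>n::nat. a [^]\<^bsub>R\<^esub> n \<in> J}"

definition primary_ideal :: "('a, 'm) ring_scheme \<Rightarrow> 'a set \<Rightarrow> bool" where
  "primary_ideal R J \<longleftrightarrow> ideal J R \<and> J \<noteq> carrier R \<and>
     (\<forall>a\<in>carrier R. \<forall>b\<in>carrier R. a \<otimes>\<^bsub>R\<^esub> b \<in> J \<longrightarrow> a \<in> J \<or> b \<in> radical_ideal R J)"

definition primary_to :: "('a, 'm) ring_scheme \<Rightarrow> 'a set \<Rightarrow> 'a set \<Rightarrow> bool" where
  "primary_to R P J \<longleftrightarrow> primary_ideal R J \<and> radical_ideal R J = P"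

(* Powers and finite products of ideals are those of the commutative monoid ideals_set R,
   whose multiplication is ideal_prod and whose unit is carrier R. *)
definition nonnilpotent_ideal :: "('a, 'm) ring_scheme \<Rightarrow> 'a set \<Rightarrow> bool" where
  "nonnilpotent_ideal R \<aa> \<longleftrightarrow> (\<forall>n::nat. \<aa> [^]\<^bsub>ideals_set R\<^esub> n \<noteq> {\<zero>\<^bsub>R\<^esub>})"

(* I_0^{n_0} I_1^{n_1} ... I_s^{n_s} *)
definition multi_power ::
    "('a, 'm) ring_scheme \<Rightarrow> nat \<Rightarrow> (nat \<Rightarrow> 'a set) \<Rightarrow> (nat \<Rightarrow> nat) \<Rightarrow> 'a set" where
  "multi_power R s I n = finprod (ideals_set R) (\<lambda>j. I j [^]\<^bsub>ideals_set R\<^esub> n j) {..s}"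

definition colon :: "('a, 'm) ring_scheme \<Rightarrow> 'a set \<Rightarrow> 'a set \<Rightarrow> 'a set" where
  "colon R \<aa> B = {x \<in> carrier R. \<forall>b\<in>B. x \<otimes>\<^bsub>R\<^esub> b \<in> \<aa>}"

definition saturation :: "('a, 'm) ring_scheme \<Rightarrow> 'a set \<Rightarrow> 'a set \<Rightarrow> 'a set" where
  "saturation R \<aa> \<bb> = (\<Union>n::nat. colon R \<aa> (\<bb> [^]\<^bsub>ideals_set R\<^esub> n))"

(* The extension of the ideal \<aa> to R Quot K; as R \<rightarrow> R/K is onto, this is the plain image. *)
definition quot_ext :: "('a, 'm) ring_scheme \<Rightarrow> 'a set \<Rightarrow> 'a set \<Rightarrow> 'a set set" where
  "quot_ext R K \<aa> = (\<lambda>a. K +>\<^bsub>R\<^esub> a) ` \<aa>"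


(* An ideal A of R as an R-module. *)
definition ideal_module :: "('a, 'm) ring_scheme \<Rightarrow> 'a set \<Rightarrow> ('a, 'a) module" where
  "ideal_module R A = \<lparr>carrier = A, monoid.mult = monoid.mult R, one = one R, zero = zero R, add = add R,
     module.smult = monoid.mult R\<rparr>"

(* The fields mult and one of a module record carry no meaning for a module. *)
definition quot_module ::
    "('r, 'a, 'm) module_scheme \<Rightarrow> 'a set \<Rightarrow> ('r, 'a set) module" where
  "quot_module M N = \<lparr>carrier = a_rcosets\<^bsub>M\<^esub> N, monoid.mult = undefined, one = undefined,
     zero = N, add = set_add M, module.smult = (\<lambda>a X. \<Union>x\<in>X. N +>\<^bsub>M\<^esub> (a \<odot>\<^bsub>M\<^esub> x))\<rparr>"

definition module_length ::
    "('r, 'k) ring_scheme \<Rightarrow> ('r, 'a, 'm) module_scheme \<Rightarrow> enat" where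
  "module_length R M = Sup {enat n | n.
     \<exists>N :: nat \<Rightarrow> 'a set. (\<forall>i\<le>n. submodule (N i) R M) \<and> (\<forall>i<n. N i \<subset> N (Suc i))}"


(* A polynomial in the variables X_0, X_1, ... is a finitely supported family of rational
   coefficients indexed by finitely supported exponent vectors. *)
type_synonym mpolynomial = "(nat \<Rightarrow>\<^sub>0 nat) \<Rightarrow>\<^sub>0 rat"

definition mpoly_eval :: "mpolynomial \<Rightarrow> (nat \<Rightarrow> nat) \<Rightarrow> rat" where
  "mpoly_eval p n = (\<Sum>m\<in>Poly_Mapping.keys p. Poly_Mapping.lookup p m *
     (\<Prod>j\<in>Poly_Mapping.keys m. of_nat (n j) ^ Poly_Mapping.lookup m j))"

(* p is a polynomial in X_0, ..., X_s whose value at (n_0, ..., n_s) is the length of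
   I_0^{n_0} I_1^{n_1} ... I_s^{n_s} / I_0^{n_0 + 1} I_1^{n_1} ... I_s^{n_s} for all large n_j.
   Such a p is unique if it exists. *)
definition is_bhattacharya_poly ::
    "('a, 'm) ring_scheme \<Rightarrow> nat \<Rightarrow> (nat \<Rightarrow> 'a set) \<Rightarrow> mpolynomial \<Rightarrow> bool" where
  "is_bhattacharya_poly R s I p \<longleftrightarrow>
     (\<forall>m\<in>Poly_Mapping.keys p. Poly_Mapping.keys m \<subseteq> {..s}) \<and>
     (\<exists>N. \<forall>n. (\<forall>j\<le>s. N \<le> n j) \<longrightarrow>
       (\<exists>l. module_length R (quot_module (ideal_module R (multi_power R s I n))
                (multi_power R s I (n(0 := Suc (n 0))))) = enat l
          \<and> of_nat l = mpoly_eval p n))"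

(* e(I_0^{[k_0 + 1]}, I_1^{[k_1]}, ..., I_s^{[k_s]}; R), i.e. k_0! ... k_s! times the coefficient of
   X_0^{k_0} ... X_s^{k_s}. It has the usual meaning for k_0 + ... + k_s = q - 1, the total degree
   of the polynomial, which is how it is used. *)
definition mixed_multiplicity ::
    "('a, 'm) ring_scheme \<Rightarrow> nat \<Rightarrow> (nat \<Rightarrow> 'a set) \<Rightarrow> (nat \<Rightarrow> nat) \<Rightarrow> rat" where
  "mixed_multiplicity R s I k =
     (\<Prod>j\<le>s. fact (k j)) *
     Poly_Mapping.lookup (THE p. is_bhattacharya_poly R s I p)
       (\<Sum>j\<le>s. Poly_Mapping.single j (k j))"

(* p is the Hilbert-Samuel polynomial: length (A / \<aa>^{n+1}) = p(n) for all large n. *)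
definition is_hilbert_samuel_poly ::
    "('a, 'm) ring_scheme \<Rightarrow> 'a set \<Rightarrow> rat poly \<Rightarrow> bool" where
  "is_hilbert_samuel_poly A \<aa> p \<longleftrightarrow>
     (\<exists>N. \<forall>n\<ge>N. \<exists>l.
        module_length A (quot_module (ideal_module A (carrier A))
          (\<aa> [^]\<^bsub>ideals_set A\<^esub> Suc n)) = enat l
        \<and> of_nat l = poly p (of_nat n))"

(* d! times the coefficient of X^d of the Hilbert-Samuel polynomial, d = dim A. *)
definition hilbert_samuel_multiplicity :: "('a, 'm) ring_scheme \<Rightarrow> 'a set \<Rightarrow> rat" where
  "hilbert_samuel_multiplicity A \<aa> =
     (THE e. \<exists>d p. krull_dim A = ereal (real d) \<and> is_hilbert_samuel_poly A \<aa> p \<and>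
        e = fact d * Polynomial.coeff p d)"


(* x is a superficial element of (I_1, ..., I_s) with respect to I_0, with the index i as the
   witness of the definition. The hypothesis that I_0 I_1 ... I_s be non-nilpotent, under which
   superficial elements are defined, is made part of the notion. *)
definition superficial_at ::
    "('a, 'm) ring_scheme \<Rightarrow> nat \<Rightarrow> (nat \<Rightarrow> 'a set) \<Rightarrow> nat \<Rightarrow> 'a \<Rightarrow> bool" where
  "superficial_at R s I i x \<longleftrightarrow>
     nonnilpotent_ideal R (finprod (ideals_set R) I {..s}) \<and>
     i \<le> s \<and> x \<in> I i \<and>
     (\<exists>N. \<forall>n. (\<forall>j\<le>s. N \<le> n j) \<longrightarrow>
        colon R (I 0 \<cdot>\<^bsub>R\<^esub> multi_power R s I (n(i := Suc (n i)))) {x} \<inter> multi_power R s I n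
          = I 0 \<cdot>\<^bsub>R\<^esub> multi_power R s I n) \<and>
     (\<exists>N. \<forall>n. (\<forall>j\<le>s. N \<le> n j) \<longrightarrow>
        (PIdl\<^bsub>R\<^esub> x) \<inter> multi_power R s I (n(i := Suc (n i)))
          = (\<lambda>y. x \<otimes>\<^bsub>R\<^esub> y) ` multi_power R s I n)"

(* A superficial sequence xs together with the list \<sigma> of the indices at which its members are
   superficial; list positions are counted from 0. *)
definition superficial_sequence ::
    "('a, 'm) ring_scheme \<Rightarrow> nat \<Rightarrow> (nat \<Rightarrow> 'a set) \<Rightarrow> nat list \<Rightarrow> 'a list \<Rightarrow> bool" where
  "superficial_sequence R s I \<sigma> xs \<longleftrightarrow>
     set xs \<subseteq> carrier R \<and> length \<sigma> = length xs \<and>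
     (\<forall>i<length xs. let K = Idl\<^bsub>R\<^esub> (set (take i xs)) in
        superficial_at (R Quot K) s (\<lambda>j. quot_ext R K (I j)) (\<sigma> ! i) (K +>\<^bsub>R\<^esub> (xs ! i)))"

(* A superficial sequence consisting of k_1 elements of I_1, ..., k_s elements of I_s, in any order.
   The index for which an element is counted is the one at which it is superficial; this matters
   if the ideals overlap. The value k 0 is not used. *)
definition superficial_sequence_of_type ::
    "('a, 'm) ring_scheme \<Rightarrow> nat \<Rightarrow> (nat \<Rightarrow> 'a set) \<Rightarrow> (nat \<Rightarrow> nat) \<Rightarrow> 'a list \<Rightarrow> bool" where
  "superficial_sequence_of_type R s I k xs \<longleftrightarrow>
     (\<exists>\<sigma>. superficial_sequence R s I \<sigma> xs \<and>
        (\<forall>i<length xs. \<sigma> ! i \<in> {1..s} \<and> xs ! i \<in> I (\<sigma> ! i)) \<and>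
        (\<forall>j\<in>{1..s}. count_list \<sigma> j = k j))"

end

(*
For an ideal K let h_K(n) be the length of (I^n + K)/(J I^n + K), where I^n = J^{n_0} I_1^{n_1} ... I_s^{n_s}.
If x in I_i is superficial modulo K, then h_{K + (x)}(n + e_i) = h_K(n + e_i) - h_K(n) for large n,
that is, superficial elements realise partial differences. By Noetherian induction on K this gives
that h_K is a polynomial of degree less than dim R/(K : I^\<infinity>). The mixed multiplicity of type
(k_0, ..., k_s) is the constant obtained from h_0 by taking k_j differences in each direction j.
Taking those in the directions 1, ..., s along a superficial sequence generating the ideal L leaves
the k_0-th difference of h_L in the direction of J, and this is the (k_0 + 1)-st difference of the
Hilbert-Samuel function of R/(L : I^\<infinity>), a ring of dimension at most k_0 + 1. So it is the
multiplicity of that ring if the dimension is k_0 + 1, and 0 otherwise. Conversely, superficial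
elements of every I_i exist because the residue field is infinite.
*)

theory Submission
  imports Defs
begin

section \<open>Iterated differences and polynomials\<close>

text \<open>A superficial sequence lives in successive quotient rings, and each quotient changes the
  element type, so an induction over K inside quotients cannot be stated. The inductions therefore
  stay in R: I^n (R/K) is represented by its preimage \<open>E K n\<close>, and quotient rings are
  compared with this picture only at the end. The degree bound is carried by chains of primes. A
  superficial element is regular in large degrees, and this lets a suitable chain of primes over K +
  (x) be prolonged downwards by one. For the same reason R/(L : I^\<infinity>) has dimension at most
  k_0 + 1. The Noetherian induction needs x outside K. This holds unless J I_1 ... I_s is nilpotent
  modulo K, and then h_K vanishes for large n. Existence of superficial elements and the Artin--Rees
  lemma rest on the Noetherianity of Rees modules, whose graded submodules are families of ideals
  indexed by exponent vectors. That a Hilbert--Samuel function has degree equal to the dimension is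
  proved as well: the upper bound is the degree bound for the family consisting of J alone, the
  lower bound compares R/P and R/P' for successive primes of a chain.\<close>

definition bump :: "nat \<Rightarrow> (nat \<Rightarrow> nat) \<Rightarrow> nat \<Rightarrow> nat" where
  "bump j n = n(j := Suc (n j))"

text \<open>All coordinates are made large, also those beyond \<open>s\<close>, so that shifts need
  no side conditions on indices. For predicates that read only the coordinates up to
  \<open>s\<close> this is the usual meaning (\<open>eventually_large_iff_depends\<close>).\<close>

definition large :: "(nat \<Rightarrow> nat) filter" where
  "large = (INF N. principal {n. \<forall>j. N \<le> n j})"

lemma eventually_large: "eventually P large \<longleftrightarrow> (\<exists>N. \<forall>n. (\<forall>j. N \<le> n j) \<longrightarrow> P n)"
  unfolding large_def
proof (subst eventually_INF_base)
  fix a b :: nat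
  show "\<exists>x\<in>UNIV. principal {n. \<forall>j. x \<le> n j}
      \<le> inf (principal {n. \<forall>j. a \<le> n j}) (principal {n. \<forall>j. b \<le> n (j::nat)})"
    by (rule bexI[of _ "max a b"]) auto
qed (auto simp: eventually_principal)

lemma large_neq_bot [simp]: "large \<noteq> bot"
  unfolding trivial_limit_def eventually_large by auto

lemma eventually_large_bump:
  assumes "eventually P large" shows "eventually (\<lambda>n. P (bump j n)) large"
proof -
  obtain N where N: "\<And>n. \<forall>j. N \<le> n j \<Longrightarrow> P n" using assms unfolding eventually_large by blast
  show ?thesis unfolding eventually_large
    by (rule exI[of _ N]) (auto intro!: N simp: bump_def le_SucI)
qed

text \<open>A vector with all coordinates at least \<open>Suc N\<close> is the \<open>bump\<close>
  of one with all coordinates at least \<open>N\<close>.\<close>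

lemma eventually_large_bumpD:
  assumes "eventually (\<lambda>n. P (bump j n)) large"
  shows "eventually P large"
proof -
  obtain N where N: "\<And>n. \<forall>j. N \<le> n j \<Longrightarrow> P (bump j n)"
    using assms unfolding eventually_large by blast
  have "P n" if "\<forall>i. Suc N \<le> n i" for n
  proof -
    have "Suc N \<le> n j" using that by blast
    then have "n = bump j (n(j := n j - 1))" by (simp add: bump_def)
    moreover have "N \<le> (n(j := n j - 1)) i" for i
      using that[rule_format, of i] that[rule_format, of j] by auto
    ultimately show ?thesis using N by metis
  qed
  then show ?thesis unfolding eventually_large by blast
qed

definition fdiff :: "nat \<Rightarrow> ((nat \<Rightarrow> nat) \<Rightarrow> rat) \<Rightarrow> (nat \<Rightarrow> nat) \<Rightarrow> rat" where
  "fdiff j f n = f (bump j n) - f n"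

definition fdiffs :: "nat list \<Rightarrow> ((nat \<Rightarrow> nat) \<Rightarrow> rat) \<Rightarrow> (nat \<Rightarrow> nat) \<Rightarrow> rat" where
  "fdiffs \<sigma> f = fold fdiff \<sigma> f"

lemma fdiffs_Nil [simp]: "fdiffs [] f = f"
  and fdiffs_Cons [simp]: "fdiffs (j # \<sigma>) f = fdiffs \<sigma> (fdiff j f)"
  and fdiffs_append: "fdiffs (\<sigma> @ \<tau>) f = fdiffs \<tau> (fdiffs \<sigma> f)"
  by (simp_all add: fdiffs_def)

lemma bump_commute: "bump i (bump j n) = bump j (bump i n)"
  by (auto simp: bump_def fun_eq_iff)

lemma fdiff_commute: "fdiff i \<circ> fdiff j = fdiff j \<circ> fdiff i"
  by (auto simp: fun_eq_iff fdiff_def bump_commute)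

lemma fdiffs_mset: "mset \<sigma> = mset \<tau> \<Longrightarrow> fdiffs \<sigma> f = fdiffs \<tau> f"
  unfolding fdiffs_def using fold_multiset_equiv[of \<sigma> fdiff \<tau>] fdiff_commute by metis

lemma fdiff_cong:
  assumes "eventually (\<lambda>n. f n = g n) large"
  shows "eventually (\<lambda>n. fdiff j f n = fdiff j g n) large"
  using assms eventually_large_bump[OF assms, of j]
  by eventually_elim (simp add: fdiff_def)

lemma fdiffs_cong:
  "eventually (\<lambda>n. f n = g n) large \<Longrightarrow> eventually (\<lambda>n. fdiffs \<sigma> f n = fdiffs \<sigma> g n) large"
  by (induction \<sigma> arbitrary: f g) (auto intro: fdiff_cong)

lemma fdiffs_zero: "fdiffs \<sigma> (\<lambda>_. 0) = (\<lambda>_. 0)"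
  by (induction \<sigma>) (simp_all add: fdiff_def[abs_def])

lemma fdiffs_diff: "fdiffs \<sigma> (\<lambda>n. f n - g n) = (\<lambda>n. fdiffs \<sigma> f n - fdiffs \<sigma> g n)"
proof (induction \<sigma> arbitrary: f g)
  case (Cons j \<sigma>)
  have "fdiff j (\<lambda>n. f n - g n) = (\<lambda>n. fdiff j f n - fdiff j g n)"
    by (auto simp: fdiff_def)
  then show ?case by (simp add: Cons)
qed simp

lemma fdiffs_sum_scale:
  "fdiffs \<sigma> (\<lambda>n. \<Sum>k\<in>A. c k * f k n) = (\<lambda>n. \<Sum>k\<in>A. c k * fdiffs \<sigma> (f k) n)"
proof (induction \<sigma> arbitrary: f)
  case (Cons j \<sigma>)
  have "fdiff j (\<lambda>n. \<Sum>k\<in>A. c k * f k n) = (\<lambda>n. \<Sum>k\<in>A. c k * fdiff j (f k) n)"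
    by (auto simp: fdiff_def sum_subtractf algebra_simps)
  then show ?case by (simp add: Cons)
qed simp

text \<open>For functions of the coordinates up to \<open>s\<close> this stands for being eventually
  a polynomial of total degree less than \<open>D\<close>, where \<open>D = 0\<close> means
  eventually zero; \<open>pdeg_imp_mpoly\<close> produces the polynomial. Differences are the
  primitive notion because the inductions deliver h_K only through them.\<close>

primrec pdeg :: "nat \<Rightarrow> nat \<Rightarrow> ((nat \<Rightarrow> nat) \<Rightarrow> rat) \<Rightarrow> bool" where
  "pdeg s 0 f \<longleftrightarrow> eventually (\<lambda>n. f n = 0) large"
| "pdeg s (Suc D) f \<longleftrightarrow> (\<forall>j\<le>s. pdeg s D (fdiff j f))"

lemma pdeg_iff:
  "pdeg s D f \<longleftrightarrow> (\<forall>\<sigma>. length \<sigma> = D \<and> set \<sigma> \<subseteq> {..s} \<longrightarrow> eventually (\<lambda>n. fdiffs \<sigma> f n = 0) large)"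
proof (induction D arbitrary: f)
  case (Suc D)
  show ?case
  proof
    assume L: "pdeg s (Suc D) f"
    show "\<forall>\<sigma>. length \<sigma> = Suc D \<and> set \<sigma> \<subseteq> {..s} \<longrightarrow> eventually (\<lambda>n. fdiffs \<sigma> f n = 0) large"
    proof safe
      fix \<sigma> :: "nat list" assume "length \<sigma> = Suc D" "set \<sigma> \<subseteq> {..s}"
      then show "eventually (\<lambda>n. fdiffs \<sigma> f n = 0) large"
        using L by (cases \<sigma>) (auto simp: Suc)
    qed
  next
    assume R: "\<forall>\<sigma>. length \<sigma> = Suc D \<and> set \<sigma> \<subseteq> {..s} \<longrightarrow> eventually (\<lambda>n. fdiffs \<sigma> f n = 0) large"
    show "pdeg s (Suc D) f"
    proof (simp add: Suc, safe)
      fix j and \<sigma> :: "nat list" assume "j \<le> s" "D = length \<sigma>" "set \<sigma> \<subseteq> {..s}"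
      then show "eventually (\<lambda>n. fdiffs \<sigma> (fdiff j f) n = 0) large"
        using R[rule_format, of "j # \<sigma>"] by simp
    qed
  qed
qed simp

lemma pdeg_cong:
  assumes "eventually (\<lambda>n. f n = g n) large" "pdeg s D f" shows "pdeg s D g"
  unfolding pdeg_iff
proof safe
  fix \<sigma> :: "nat list" assume "D = length \<sigma>" "set \<sigma> \<subseteq> {..s}"
  then have "eventually (\<lambda>n. fdiffs \<sigma> f n = 0) large" using assms(2) by (auto simp: pdeg_iff)
  then show "eventually (\<lambda>n. fdiffs \<sigma> g n = 0) large"
    using fdiffs_cong[OF assms(1), of \<sigma>] by eventually_elim simp
qed

lemma pdeg_Suc: "pdeg s D f \<Longrightarrow> pdeg s (Suc D) f"
proof (induction D arbitrary: f)
  case 0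
  then show ?case using fdiff_cong[of f "\<lambda>_. 0"] by (auto simp: fdiff_def)
qed simp

lemma pdeg_mono: "pdeg s D f \<Longrightarrow> D \<le> D' \<Longrightarrow> pdeg s D' f"
  by (induction D' rule: nat_induct) (auto simp: le_Suc_eq intro: pdeg_Suc simp del: pdeg.simps(2))

definition depends_on :: "nat \<Rightarrow> ((nat \<Rightarrow> nat) \<Rightarrow> 'b) \<Rightarrow> bool" where
  "depends_on s f \<longleftrightarrow> (\<forall>n m. (\<forall>j\<le>s. n j = m j) \<longrightarrow> f n = f m)"

lemma depends_on_fdiff: "depends_on s f \<Longrightarrow> depends_on s (fdiff j f)"
proof -
  assume a: "depends_on s f"
  have "fdiff j f n = fdiff j f m" if "\<forall>i\<le>s. n i = m i" for n m
  proof -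
    have "f n = f m" using a that unfolding depends_on_def by blast
    moreover have "\<forall>i\<le>s. bump j n i = bump j m i" using that by (auto simp: bump_def)
    then have "f (bump j n) = f (bump j m)" using a unfolding depends_on_def by blast
    ultimately show ?thesis by (simp add: fdiff_def)
  qed
  then show ?thesis unfolding depends_on_def by blast
qed

lemma depends_on_fdiffs: "depends_on s f \<Longrightarrow> depends_on s (fdiffs \<sigma> f)"
  by (induction \<sigma> arbitrary: f) (auto intro: depends_on_fdiff)

lemma pdeg_1_const:
  assumes "pdeg s 1 f" "depends_on s f"
  obtains c where "eventually (\<lambda>n. f n = c) large"
proof -
  have "\<forall>j\<in>{..s}. eventually (\<lambda>n. fdiff j f n = 0) large" using assms(1) by simp
  then have "eventually (\<lambda>n. \<forall>j\<in>{..s}. fdiff j f n = 0) large"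
    by (subst eventually_ball_finite_distrib) auto
  then obtain N where N: "\<And>n j. (\<forall>i. N \<le> n i) \<Longrightarrow> j \<le> s \<Longrightarrow> f (bump j n) = f n"
    unfolding eventually_large fdiff_def by (metis atMost_iff eq_iff_diff_eq_0)
  have "f n = f (\<lambda>_. N)" if "\<forall>i. N \<le> n i" for n
    using that
  \<comment> \<open>The total excess over the corner (N, ..., N) drops by one when a coordinate
    above \<open>N\<close> is lowered, and this does not change the value of \<open>f\<close>. At
    the end coordinates beyond \<open>s\<close> may still differ from the corner, whence
    \<open>depends_on\<close>.\<close>
  proof (induction "\<Sum>j\<le>s. n j - N" arbitrary: n)
    case 0
    then have "\<forall>j\<le>s. n j = N" by (simp add: le_antisym)
    then show ?case using assms(2) unfolding depends_on_def by simp
  next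
    case (Suc x)
    from Suc(2) have "(\<Sum>j\<le>s. n j - N) \<noteq> 0" by linarith
    then obtain j where j: "j \<le> s" "n j - N \<noteq> 0" by (elim sum.not_neutral_contains_not_neutral) simp
    define m where "m = n(j := n j - 1)"
    have nm: "n = bump j m" using j(2) by (auto simp: m_def bump_def)
    have mN: "\<forall>i. N \<le> m i" using j(2) Suc(3) by (auto simp: m_def)
    have "(\<Sum>i\<le>s. n i - N) = (n j - N) + (\<Sum>i\<in>{..s}-{j}. n i - N)"
      using j(1) by (subst sum.remove[of _ j]) auto
    also have "(\<Sum>i\<in>{..s}-{j}. n i - N) = (\<Sum>i\<in>{..s}-{j}. m i - N)"
      by (rule sum.cong) (auto simp: m_def)
    also have "n j - N = Suc (m j - N)" using j(2) by (simp add: m_def)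
    also have "Suc (m j - N) + (\<Sum>i\<in>{..s}-{j}. m i - N) = Suc (\<Sum>i\<le>s. m i - N)"
      using j(1) by (subst (2) sum.remove[of _ j]) auto
    finally have "x = (\<Sum>i\<le>s. m i - N)" using Suc(2) by simp
    then have "f m = f (\<lambda>_. N)" using Suc(1) mN by blast
    then show ?case using N[OF mN j(1)] nm by simp
  qed
  then show ?thesis using that unfolding eventually_large by blast
qed

lemma pdeg_top_const:
  assumes "pdeg s (Suc (length \<sigma>)) f" "depends_on s f" "set \<sigma> \<subseteq> {..s}"
  obtains c where "eventually (\<lambda>n. fdiffs \<sigma> f n = c) large"
proof -
  have "pdeg s 1 (fdiffs \<sigma> f)"
  proof (simp add: pdeg_iff, safe)
    fix \<tau> :: "nat list" assume "length \<tau> = Suc 0" "set \<tau> \<subseteq> {..s}"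
    then show "eventually (\<lambda>n. fdiffs \<tau> (fdiffs \<sigma> f) n = 0) large"
      using assms unfolding pdeg_iff by (simp flip: fdiffs_append)
  qed
  then show ?thesis using pdeg_1_const depends_on_fdiffs[OF assms(2)] that by blast
qed

section \<open>One-variable differences and monomials\<close>

definition dif :: "(nat \<Rightarrow> rat) \<Rightarrow> nat \<Rightarrow> rat" where
  "dif u x = u (Suc x) - u x"

lemma dif_pow_sum_scale:
  "(dif ^^ k) (\<lambda>n. \<Sum>i\<in>A. c i * f i n) = (\<lambda>n. \<Sum>i\<in>A. c i * (dif ^^ k) (f i) n)"
proof (induction k arbitrary: f)
  case (Suc k)
  have "dif (\<lambda>n. \<Sum>i\<in>A. c i * f i n) = (\<lambda>n. \<Sum>i\<in>A. c i * dif (f i) n)"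
    by (auto simp: dif_def sum_subtractf algebra_simps)
  then show ?case by (simp add: Suc funpow_Suc_right del: funpow.simps)
qed simp

text \<open>By the binomial theorem \<open>dif\<close> turns x^m into m x^(m-1) plus lower powers;
  so k steps kill all degrees below k and leave k! from x^k.\<close>

lemma dif_pow_monomial:
  "(\<forall>m<k. (dif ^^ k) (\<lambda>x. of_nat x ^ m) = (\<lambda>_. 0)) \<and> (dif ^^ k) (\<lambda>x. of_nat x ^ k) = (\<lambda>_. fact k)"
proof (induction k)
  case (Suc k)
  have d: "dif (\<lambda>x. of_nat x ^ m) = (\<lambda>x. \<Sum>i<m. of_nat (m choose i) * of_nat x ^ i)" for m
  proof
    fix x
    have "dif (\<lambda>x. of_nat x ^ m) x = (of_nat x + 1) ^ m - of_nat x ^ m"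
      by (simp add: dif_def add.commute)
    also have "\<dots> = (\<Sum>i<m. of_nat (m choose i) * of_nat x ^ i)"
      by (subst binomial_ring) (simp flip: lessThan_Suc_atMost)
    finally show "dif (\<lambda>x. of_nat x ^ m) x = (\<Sum>i<m. of_nat (m choose i) * of_nat x ^ i)" .
  qed
  have e: "(dif ^^ Suc k) (\<lambda>x. of_nat x ^ m)
      = (\<lambda>x. \<Sum>i<m. of_nat (m choose i) * (dif ^^ k) (\<lambda>x. of_nat x ^ i) x)" for m
    by (simp add: funpow_Suc_right d dif_pow_sum_scale del: funpow.simps)
  have "(dif ^^ Suc k) (\<lambda>x. of_nat x ^ m) = (\<lambda>_. 0)" if "m < Suc k" for m
  proof -
    have "of_nat (m choose i) * (dif ^^ k) (\<lambda>x. of_nat x ^ i) x = 0" if "i < m" for i x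
      using that \<open>m < Suc k\<close> Suc by simp
    then show ?thesis unfolding e by simp
  qed
  moreover have "(dif ^^ Suc k) (\<lambda>x. of_nat x ^ Suc k) = (\<lambda>_. fact (Suc k))"
    unfolding e using Suc by (simp add: lessThan_Suc algebra_simps)
  ultimately show ?case by blast
qed (simp add: fun_eq_iff)

text \<open>A difference in direction \<open>i\<close> touches only the factor with index
  \<open>i\<close>, so every direction acts on its own one-variable function.\<close>

lemma fdiffs_prod:
  assumes "set \<sigma> \<subseteq> {..s}"
  shows "fdiffs \<sigma> (\<lambda>n. \<Prod>j\<le>s. \<phi> j (n j)) = (\<lambda>n. \<Prod>j\<le>s. (dif ^^ count_list \<sigma> j) (\<phi> j) (n j))"
  using assms
proof (induction \<sigma> arbitrary: \<phi>)
  case (Cons i \<sigma>)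
  have "fdiff i (\<lambda>n. \<Prod>j\<le>s. \<phi> j (n j)) = (\<lambda>n. \<Prod>j\<le>s. (\<phi>(i := dif (\<phi> i))) j (n j))"
  proof
    fix n
    have *: "(\<Prod>j\<le>s. \<psi> j) = \<psi> i * (\<Prod>j\<in>{..s}-{i}. \<psi> j)" for \<psi> :: "nat \<Rightarrow> rat"
      using Cons.prems by (subst prod.remove[of _ i]) auto
    show "fdiff i (\<lambda>n. \<Prod>j\<le>s. \<phi> j (n j)) n = (\<Prod>j\<le>s. (\<phi>(i := dif (\<phi> i))) j (n j))"
      unfolding fdiff_def * by (simp add: bump_def dif_def algebra_simps)
  qed
  then have "fdiffs (i # \<sigma>) (\<lambda>n. \<Prod>j\<le>s. \<phi> j (n j))
      = (\<lambda>n. \<Prod>j\<le>s. (dif ^^ count_list \<sigma> j) ((\<phi>(i := dif (\<phi> i))) j) (n j))"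
    using Cons by (simp del: fun_upd_apply)
  also have "\<dots> = (\<lambda>n. \<Prod>j\<le>s. (dif ^^ count_list (i # \<sigma>) j) (\<phi> j) (n j))"
  proof
    fix n show "(\<Prod>j\<le>s. (dif ^^ count_list \<sigma> j) ((\<phi>(i := dif (\<phi> i))) j) (n j))
       = (\<Prod>j\<le>s. (dif ^^ count_list (i # \<sigma>) j) (\<phi> j) (n j))"
      by (intro prod.cong) (auto simp: funpow_Suc_right simp del: funpow.simps)
  qed
  finally show ?case .
qed simp

text \<open>If the exponents add up to at most the number of differences without being the counts of
  \<open>\<sigma>\<close>, then some variable is differenced more often than its exponent, and its
  factor vanishes.\<close>

lemma fdiffs_monomial:
  assumes "set \<sigma> \<subseteq> {..s}" "(\<Sum>j\<le>s. m j) \<le> length \<sigma>"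
  shows "fdiffs \<sigma> (\<lambda>n. \<Prod>j\<le>s. of_nat (n j) ^ m j) n =
    (if \<forall>j\<le>s. m j = count_list \<sigma> j then \<Prod>j\<le>s. fact (m j) else 0)"
proof (cases "\<forall>j\<le>s. m j = count_list \<sigma> j")
  case True
  have "(dif ^^ m j) (\<lambda>x. of_nat x ^ m j) (n j) = fact (m j)" for j
    using dif_pow_monomial[of "m j"] by metis
  then show ?thesis using True
    by (simp add: fdiffs_prod[OF assms(1), of "\<lambda>j x. of_nat x ^ m j"] flip: True)
next
  case False
  have "\<exists>j\<le>s. m j < count_list \<sigma> j"
  proof (rule ccontr)
    assume "\<not> ?thesis"
    then have *: "\<forall>j\<in>{..s}. count_list \<sigma> j \<le> m j" by auto
    have len: "(\<Sum>j\<le>s. count_list \<sigma> j) = length \<sigma>"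
      using assms(1) sum_count_set[of \<sigma> "{..s}"] by simp
    from False * obtain i where "i \<in> {..s}" "count_list \<sigma> i < m i" by (metis atMost_iff le_neq_implies_less)
    then have "(\<Sum>j\<le>s. count_list \<sigma> j) < (\<Sum>j\<le>s. m j)"
      by (intro sum_strict_mono_ex1) (use * in auto)
    then show False using len assms(2) by simp
  qed
  then obtain j where "j \<le> s" "m j < count_list \<sigma> j" by blast
  then have "(dif ^^ count_list \<sigma> j) (\<lambda>x. of_nat x ^ m j) (n j) = 0"
    using dif_pow_monomial by metis
  then have "(\<Prod>j\<le>s. (dif ^^ count_list \<sigma> j) (\<lambda>x. of_nat x ^ m j) (n j)) = 0"
    using \<open>j \<le> s\<close> by (intro prod_zero) auto
  then show ?thesis
    unfolding fdiffs_prod[OF assms(1), of "\<lambda>j x. of_nat x ^ m j"] using False by metis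
qed

section \<open>Polynomials in several variables and their top coefficients\<close>

definition mono_exp :: "nat \<Rightarrow> (nat \<Rightarrow> nat) \<Rightarrow> nat \<Rightarrow>\<^sub>0 nat" where
  "mono_exp s k = (\<Sum>j\<le>s. Poly_Mapping.single j (k j))"

lemma lookup_mono_exp: "Poly_Mapping.lookup (mono_exp s k) j = (if j \<le> s then k j else 0)"
  by (auto simp: mono_exp_def lookup_sum lookup_single when_def)

lemma mono_exp_lookup:
  "Poly_Mapping.keys m \<subseteq> {..s} \<Longrightarrow> mono_exp s (Poly_Mapping.lookup m) = m"
  by (rule poly_mapping_eqI) (auto simp: lookup_mono_exp in_keys_iff subset_iff)

lemma mpoly_eval_eq:
  assumes "finite A" "Poly_Mapping.keys p \<subseteq> A"
    and "\<And>m. m \<in> A \<Longrightarrow> Poly_Mapping.keys m \<subseteq> {..s}"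
  shows "mpoly_eval p n
    = (\<Sum>m\<in>A. Poly_Mapping.lookup p m * (\<Prod>j\<le>s. of_nat (n j) ^ Poly_Mapping.lookup m j))"
proof -
  have "mpoly_eval p n = (\<Sum>m\<in>A. Poly_Mapping.lookup p m *
     (\<Prod>j\<in>Poly_Mapping.keys m. of_nat (n j) ^ Poly_Mapping.lookup m j))"
    unfolding mpoly_eval_def using assms by (intro sum.mono_neutral_left) (auto simp: in_keys_iff)
  also have "\<dots> = (\<Sum>m\<in>A. Poly_Mapping.lookup p m * (\<Prod>j\<le>s. of_nat (n j) ^ Poly_Mapping.lookup m j))"
    using assms by (intro sum.cong refl arg_cong2[where f = times] prod.mono_neutral_left)
      (auto simp: in_keys_iff)
  finally show ?thesis .
qed

text \<open>Of all monomials of degree at most the length of \<open>\<sigma>\<close> only the one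
  with exponent vector \<open>k\<close> survives. This is the origin of the factor k_0! ... k_s! in
  a mixed multiplicity.\<close>

lemma fdiffs_mpoly_eval:
  assumes "\<And>m. m \<in> Poly_Mapping.keys p \<Longrightarrow> Poly_Mapping.keys m \<subseteq> {..s}"
    and "\<And>m. m \<in> Poly_Mapping.keys p \<Longrightarrow> (\<Sum>j\<le>s. Poly_Mapping.lookup m j) \<le> length \<sigma>"
    and "set \<sigma> \<subseteq> {..s}" "\<And>j. j \<le> s \<Longrightarrow> count_list \<sigma> j = k j"
  shows "fdiffs \<sigma> (mpoly_eval p) n = (\<Prod>j\<le>s. fact (k j)) * Poly_Mapping.lookup p (mono_exp s k)"
proof -
  let ?l = Poly_Mapping.lookup
  define A where "A = Poly_Mapping.keys p"
  have "mpoly_eval p = (\<lambda>n. \<Sum>m\<in>A. ?l p m * (\<Prod>j\<le>s. of_nat (n j) ^ ?l m j))"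
    by (rule ext, rule mpoly_eval_eq) (use assms(1) in \<open>auto simp: A_def\<close>)
  then have "fdiffs \<sigma> (mpoly_eval p) n
      = (\<Sum>m\<in>A. ?l p m * fdiffs \<sigma> (\<lambda>n. \<Prod>j\<le>s. of_nat (n j) ^ ?l m j) n)"
    by (simp add: fdiffs_sum_scale)
  also have "\<dots> = (\<Sum>m\<in>A. if m = mono_exp s k then ?l p m * (\<Prod>j\<le>s. fact (k j)) else 0)"
  proof (rule sum.cong)
    fix m assume m: "m \<in> A"
    have k: "Poly_Mapping.keys m \<subseteq> {..s}" using assms(1) m by (simp add: A_def)
    have "(\<forall>j\<le>s. ?l m j = count_list \<sigma> j) \<longleftrightarrow> m = mono_exp s k"
    proof
      assume "\<forall>j\<le>s. ?l m j = count_list \<sigma> j"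
      then have "mono_exp s (?l m) = mono_exp s k"
        unfolding mono_exp_def by (intro sum.cong) (simp_all add: assms(4))
      then show "m = mono_exp s k" using mono_exp_lookup[OF k] by simp
    qed (simp add: lookup_mono_exp assms(4))
    then show "?l p m * fdiffs \<sigma> (\<lambda>n. \<Prod>j\<le>s. of_nat (n j) ^ ?l m j) n
        = (if m = mono_exp s k then ?l p m * (\<Prod>j\<le>s. fact (k j)) else 0)"
      using fdiffs_monomial[OF assms(3), of "?l m" n] assms(2)[of m] m
      by (auto simp: A_def lookup_mono_exp intro!: prod.cong)
  qed simp
  also have "\<dots> = (\<Prod>j\<le>s. fact (k j)) * ?l p (mono_exp s k)"
    by (auto simp: A_def in_keys_iff)
  finally show ?thesis .
qed

lemma exists_list_count:
  fixes k :: "nat \<Rightarrow> nat"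
  obtains \<sigma> where "set \<sigma> \<subseteq> {..s}" "\<And>j. j \<le> s \<Longrightarrow> count_list \<sigma> j = k j"
    "length \<sigma> = (\<Sum>j\<le>s. k j)"
proof -
  have "\<exists>\<sigma>. set \<sigma> \<subseteq> {..s} \<and> (\<forall>j\<le>s. count_list \<sigma> j = k j)"
  proof (induction s)
    case 0
    show ?case by (rule exI[of _ "replicate (k 0) 0"]) (auto simp: count_list_eq_length_filter)
  next
    case (Suc s)
    then obtain \<sigma> where \<sigma>: "set \<sigma> \<subseteq> {..s}" "\<forall>j\<le>s. count_list \<sigma> j = k j" by blast
    then have "Suc s \<notin> set \<sigma>" by auto
    then have "count_list \<sigma> (Suc s) = 0" by simp
    with \<sigma> show ?case
      by (intro exI[of _ "\<sigma> @ replicate (k (Suc s)) (Suc s)"])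
        (auto simp: count_list_append le_Suc_eq count_list_eq_length_filter)
  qed
  then obtain \<sigma> where \<sigma>: "set \<sigma> \<subseteq> {..s}" "\<forall>j\<le>s. count_list \<sigma> j = k j" by blast
  moreover have "(\<Sum>j\<le>s. count_list \<sigma> j) = length \<sigma>"
    using \<sigma>(1) sum_count_set[of \<sigma> "{..s}"] by simp
  ultimately show ?thesis using that by auto
qed

text \<open>Differencing along the exponent vector of a monomial of maximal total degree isolates
  its coefficient, which would then be zero.\<close>

lemma mpoly_unique_zero:
  assumes "\<And>m. m \<in> Poly_Mapping.keys p \<Longrightarrow> Poly_Mapping.keys m \<subseteq> {..s}"
    and "eventually (\<lambda>n. mpoly_eval p n = 0) large"
  shows "p = 0"
proof (rule ccontr)
  assume "p \<noteq> 0"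
  let ?deg = "\<lambda>m. \<Sum>j\<le>s. Poly_Mapping.lookup m j"
  define D where "D = Max (?deg ` Poly_Mapping.keys p)"
  have "Poly_Mapping.keys p \<noteq> {}" using \<open>p \<noteq> 0\<close> by simp
  then have "D \<in> ?deg ` Poly_Mapping.keys p" unfolding D_def by (intro Max_in) auto
  then obtain m where m: "m \<in> Poly_Mapping.keys p" "?deg m = D" by auto
  obtain \<sigma> where \<sigma>: "set \<sigma> \<subseteq> {..s}" "\<And>j. j \<le> s \<Longrightarrow> count_list \<sigma> j = Poly_Mapping.lookup m j"
    "length \<sigma> = ?deg m" using exists_list_count by blast
  have "?deg m' \<le> length \<sigma>" if "m' \<in> Poly_Mapping.keys p" for m'
    unfolding \<sigma>(3) m(2) D_def using that by (intro Max_ge) auto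
  then have e: "fdiffs \<sigma> (mpoly_eval p) n
      = (\<Prod>j\<le>s. fact (Poly_Mapping.lookup m j)) * Poly_Mapping.lookup p m" for n
    using fdiffs_mpoly_eval[OF assms(1) _ \<sigma>(1,2)] mono_exp_lookup[OF assms(1)[OF m(1)]] by simp
  have "eventually (\<lambda>n. fdiffs \<sigma> (mpoly_eval p) n = fdiffs \<sigma> (\<lambda>_. 0) n) large"
    by (rule fdiffs_cong[OF assms(2)])
  then have "(\<Prod>j\<le>s. fact (Poly_Mapping.lookup m j)) * Poly_Mapping.lookup p m = (0::rat)"
    by (simp add: e fdiffs_zero)
  then show False using m(1) by (simp add: in_keys_iff)
qed

lemma mpoly_eval_diff:
  assumes "\<And>m. m \<in> Poly_Mapping.keys p \<Longrightarrow> Poly_Mapping.keys m \<subseteq> {..s}"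
    and "\<And>m. m \<in> Poly_Mapping.keys q \<Longrightarrow> Poly_Mapping.keys m \<subseteq> {..s}"
  shows "mpoly_eval (p - q) n = mpoly_eval p n - mpoly_eval q n"
proof -
  let ?A = "Poly_Mapping.keys p \<union> Poly_Mapping.keys q"
  have "Poly_Mapping.keys (p - q) \<subseteq> ?A" by (auto simp: in_keys_iff lookup_minus)
  then show ?thesis
    using assms
    by (subst (1 2 3) mpoly_eval_eq[of ?A _ s])
      (auto simp: lookup_minus algebra_simps sum_subtractf)
qed

lemma mpoly_unique:
  assumes "\<And>m. m \<in> Poly_Mapping.keys p \<Longrightarrow> Poly_Mapping.keys m \<subseteq> {..s}"
    and "\<And>m. m \<in> Poly_Mapping.keys q \<Longrightarrow> Poly_Mapping.keys m \<subseteq> {..s}"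
    and "eventually (\<lambda>n. mpoly_eval p n = mpoly_eval q n) large"
  shows "p = q"
proof -
  have "p - q = 0"
  proof (rule mpoly_unique_zero)
    fix m assume "m \<in> Poly_Mapping.keys (p - q)"
    then have "m \<in> Poly_Mapping.keys p \<or> m \<in> Poly_Mapping.keys q"
      by (auto simp: in_keys_iff lookup_minus)
    then show "Poly_Mapping.keys m \<subseteq> {..s}" using assms by blast
  next
    show "eventually (\<lambda>n. mpoly_eval (p - q) n = 0) large"
      using assms(3) by eventually_elim (use mpoly_eval_diff[OF assms(1,2)] in simp)
  qed
  then show ?thesis by simp
qed

text \<open>The D-fold differences are eventually constant and determine the homogeneous part of
  degree \<open>D\<close>; subtracting this part leaves a function of smaller degree.\<close>

lemma pdeg_imp_mpoly:
  assumes "pdeg s D f" "depends_on s f"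
  shows "\<exists>p. (\<forall>m\<in>Poly_Mapping.keys p. Poly_Mapping.keys m \<subseteq> {..s}
      \<and> (\<Sum>j\<le>s. Poly_Mapping.lookup m j) < D) \<and> eventually (\<lambda>n. f n = mpoly_eval p n) large"
  using assms
proof (induction D arbitrary: f)
  case 0
  then show ?case by (intro exI[of _ 0]) (simp add: mpoly_eval_def)
next
  case (Suc D)
  let ?l = Poly_Mapping.lookup
  define M where "M = {m :: nat \<Rightarrow>\<^sub>0 nat. Poly_Mapping.keys m \<subseteq> {..s} \<and> (\<Sum>j\<le>s. ?l m j) = D}"
  have "finite M"
  proof (rule finite_surj)
    show "finite ({..s} \<rightarrow>\<^sub>E {..D})" by (intro finite_PiE) auto
    show "M \<subseteq> mono_exp s ` ({..s} \<rightarrow>\<^sub>E {..D})"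
    proof
      fix m assume "m \<in> M"
      then have m: "Poly_Mapping.keys m \<subseteq> {..s}" "(\<Sum>j\<le>s. ?l m j) = D" by (auto simp: M_def)
      have "?l m j \<le> D" if "j \<le> s" for j
        using member_le_sum[of j "{..s}" "?l m"] that m(2) by simp
      then have "restrict (?l m) {..s} \<in> {..s} \<rightarrow>\<^sub>E {..D}" by auto
      moreover have "m = mono_exp s (restrict (?l m) {..s})"
        using mono_exp_lookup[OF m(1)] unfolding mono_exp_def by simp
      ultimately show "m \<in> mono_exp s ` ({..s} \<rightarrow>\<^sub>E {..D})" by blast
    qed
  qed
  have "\<exists>c. \<forall>\<sigma>. set \<sigma> \<subseteq> {..s} \<longrightarrow> (\<forall>j\<le>s. count_list \<sigma> j = ?l m j) \<longrightarrow>
      eventually (\<lambda>n. fdiffs \<sigma> f n = c) large" if "m \<in> M" for m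
  proof -
    obtain \<sigma> where \<sigma>: "set \<sigma> \<subseteq> {..s}" "\<And>j. j \<le> s \<Longrightarrow> count_list \<sigma> j = ?l m j"
      "length \<sigma> = (\<Sum>j\<le>s. ?l m j)" using exists_list_count by blast
    then have "length \<sigma> = D" using that by (simp add: M_def)
    then obtain c where c: "eventually (\<lambda>n. fdiffs \<sigma> f n = c) large"
      using pdeg_top_const[OF _ Suc.prems(2) \<sigma>(1)] Suc.prems(1) by metis
    \<comment> \<open>Differences commute, so lists with the same counts give the same constant,
      which can then be chosen per exponent vector \<open>m\<close>.\<close>
    have "fdiffs \<tau> f = fdiffs \<sigma> f" if \<tau>: "set \<tau> \<subseteq> {..s}" "\<forall>j\<le>s. count_list \<tau> j = ?l m j" for \<tau>
    proof (rule fdiffs_mset, rule multiset_eqI)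
      fix j show "count (mset \<tau>) j = count (mset \<sigma>) j"
      proof (cases "j \<le> s")
        case False
        then have "j \<notin> set \<tau>" "j \<notin> set \<sigma>" using \<tau>(1) \<sigma>(1) by auto
        then show ?thesis by (simp add: count_mset)
      qed (use \<tau>(2) \<sigma>(2) in \<open>simp add: count_mset\<close>)
    qed
    then show ?thesis using c by metis
  qed
  then obtain c where c: "\<And>m \<sigma>. m \<in> M \<Longrightarrow> set \<sigma> \<subseteq> {..s} \<Longrightarrow> \<forall>j\<le>s. count_list \<sigma> j = ?l m j
      \<Longrightarrow> eventually (\<lambda>n. fdiffs \<sigma> f n = c m) large" by metis
  \<comment> \<open>The division undoes the factorials that \<open>fdiffs_mpoly_eval\<close>
    produces.\<close>
  define a where "a m = c m / (\<Prod>j\<le>s. fact (?l m j))" for m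
  define p where "p = (\<Sum>m\<in>M. Poly_Mapping.single m (a m))"
  have lp: "?l p m = (if m \<in> M then a m else 0)" for m
    using \<open>finite M\<close> by (auto simp: p_def lookup_sum lookup_single when_def)
  have kp: "Poly_Mapping.keys p \<subseteq> M" by (auto simp: in_keys_iff lp split: if_splits)
  define g where "g n = f n - mpoly_eval p n" for n
  have depp: "depends_on s (mpoly_eval p)"
    unfolding depends_on_def
    by (subst (1 2) mpoly_eval_eq[OF \<open>finite M\<close> kp, of s]) (auto simp: M_def intro!: sum.cong prod.cong)
  have "pdeg s D g"
    unfolding pdeg_iff
  proof safe
    fix \<sigma> :: "nat list" assume D: "D = length \<sigma>" and \<sigma>: "set \<sigma> \<subseteq> {..s}"
    define m where "m = mono_exp s (count_list \<sigma>)"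
    have cm: "\<forall>j\<le>s. count_list \<sigma> j = ?l m j" by (simp add: m_def lookup_mono_exp)
    have "(\<Sum>j\<le>s. ?l m j) = D" using sum_count_set[OF \<sigma>] cm D by simp
    moreover have "Poly_Mapping.keys m \<subseteq> {..s}"
      by (auto simp: m_def in_keys_iff lookup_mono_exp split: if_splits)
    ultimately have mM: "m \<in> M" by (simp add: M_def)
    have "fdiffs \<sigma> (mpoly_eval p) n = c m" for n
    proof -
      have "fdiffs \<sigma> (mpoly_eval p) n = (\<Prod>j\<le>s. fact (?l m j)) * ?l p (mono_exp s (?l m))"
        using fdiffs_mpoly_eval[of p s \<sigma> "?l m" n] kp \<sigma> cm D by (auto simp: M_def subset_iff)
      also have "mono_exp s (?l m) = m" using mM by (simp add: M_def mono_exp_lookup)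
      finally show ?thesis using mM by (simp add: lp a_def)
    qed
    moreover have "eventually (\<lambda>n. fdiffs \<sigma> f n = c m) large" using c[OF mM \<sigma> cm] .
    ultimately show "eventually (\<lambda>n. fdiffs \<sigma> g n = 0) large"
      unfolding g_def[abs_def] fdiffs_diff by (auto elim: eventually_mono)
  qed
  moreover have "depends_on s g" using depp Suc.prems(2) unfolding g_def depends_on_def by metis
  ultimately obtain q where q: "\<forall>m\<in>Poly_Mapping.keys q. Poly_Mapping.keys m \<subseteq> {..s}
      \<and> (\<Sum>j\<le>s. ?l m j) < D" and gq: "eventually (\<lambda>n. g n = mpoly_eval q n) large"
    using Suc.IH by blast
  show ?case
  \<comment> \<open>This is p + q, in the form to which \<open>mpoly_eval_diff\<close>
    applies.\<close>
  proof (intro exI[of _ "p - (0 - q)"] conjI ballI)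
    fix m assume "m \<in> Poly_Mapping.keys (p - (0 - q))"
    then have "m \<in> Poly_Mapping.keys p \<or> m \<in> Poly_Mapping.keys q"
      by (auto simp: in_keys_iff lookup_minus lookup_add)
    then show "Poly_Mapping.keys m \<subseteq> {..s}" "(\<Sum>j\<le>s. ?l m j) < Suc D"
      using kp q by (auto simp: M_def)
  next
    have "mpoly_eval (p - (0 - q)) n = mpoly_eval p n + mpoly_eval q n" for n
    proof -
      have k0: "Poly_Mapping.keys (0 - q) = Poly_Mapping.keys q" by (auto simp: in_keys_iff lookup_minus)
      have "mpoly_eval (p - (0 - q)) n = mpoly_eval p n - mpoly_eval (0 - q) n"
        using kp q k0 by (intro mpoly_eval_diff[where s = s]) (auto simp: M_def)
      also have "mpoly_eval (0 - q) n = mpoly_eval 0 n - mpoly_eval q n"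
        using q by (intro mpoly_eval_diff[where s = s]) auto
      finally show ?thesis by (simp add: mpoly_eval_def)
    qed
    then show "eventually (\<lambda>n. f n = mpoly_eval (p - (0 - q)) n) large"
      using gq unfolding g_def by (auto elim: eventually_mono)
  qed
qed

section \<open>Growth of polynomial sequences\<close>

lemma dif_pow_Suc: "(dif ^^ Suc D) u m = (dif ^^ D) u (Suc m) - (dif ^^ D) u m"
  by (simp add: dif_def)

lemma dif_pow_cong:
  assumes "eventually (\<lambda>m. u m = v m) sequentially"
  shows "eventually (\<lambda>m. (dif ^^ D) u m = (dif ^^ D) v m) sequentially"
proof (induction D)
  case (Suc D)
  then have "eventually (\<lambda>m. (dif ^^ D) u (Suc m) = (dif ^^ D) v (Suc m)) sequentially"
    using eventually_sequentially_Suc[of "\<lambda>m. (dif ^^ D) u m = (dif ^^ D) v m"] by blast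
  with Suc show ?case by eventually_elim (simp add: dif_pow_Suc del: funpow.simps)
qed (use assms in simp)

lemma dif_pow_diff: "(dif ^^ D) (\<lambda>m. u m - v m) = (\<lambda>m. (dif ^^ D) u m - (dif ^^ D) v m)"
  by (induction D) (auto simp: dif_pow_Suc simp del: funpow.simps(2))

lemma dif_pow_add: "(dif ^^ D) (\<lambda>m. u m + v m) = (\<lambda>m. (dif ^^ D) u m + (dif ^^ D) v m)"
  by (induction D) (auto simp: dif_pow_Suc simp del: funpow.simps(2))

lemma dif_pow_shift: "(dif ^^ D) (\<lambda>m. u (m + c)) m = (dif ^^ D) u (m + c)"
  by (induction D arbitrary: m) (auto simp: dif_pow_Suc simp del: funpow.simps(2))

text \<open>Truncated subtraction alters the delayed sequence only below \<open>c\<close>; read at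
  \<open>m + c\<close> it is \<open>u\<close> again.\<close>

lemma eventually_dif_pow_delay:
  assumes "eventually (\<lambda>m. (dif ^^ D) u m = a) sequentially"
  shows "eventually (\<lambda>m. (dif ^^ D) (\<lambda>m. u (m - c)) m = a) sequentially"
proof -
  have "(dif ^^ D) (\<lambda>m. u (m - c)) (m + c) = (dif ^^ D) u m" for m
    using dif_pow_shift[of D "\<lambda>m. u (m - c)" c m] by simp
  then have "eventually (\<lambda>m. (dif ^^ D) (\<lambda>m. u (m - c)) (m + c) = a) sequentially"
    using assms by simp
  then show ?thesis
    using eventually_sequentially_seg[of "\<lambda>m. (dif ^^ D) (\<lambda>m. u (m - c)) m = a" c] by blast
qed

lemma dif_zero_imp_const:
  assumes "eventually (\<lambda>m. dif u m = 0) sequentially"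
  obtains c where "eventually (\<lambda>m. u m = c) sequentially"
proof -
  obtain N where N: "\<And>m. N \<le> m \<Longrightarrow> u (Suc m) = u m"
    using assms unfolding eventually_sequentially dif_def by auto
  have "u m = u N" if "N \<le> m" for m
    using that by (induction rule: dec_induct) (simp_all add: N)
  then show ?thesis using that unfolding eventually_sequentially by blast
qed

lemma dif_pow_mono_deg:
  assumes "eventually (\<lambda>m. (dif ^^ D) u m = 0) sequentially" "D \<le> D'"
  shows "eventually (\<lambda>m. (dif ^^ D') u m = 0) sequentially"
  using assms(2)
proof (induction rule: dec_induct)
  case (step n)
  then have "eventually (\<lambda>m. (dif ^^ n) u (Suc m) = 0) sequentially"
    using eventually_sequentially_Suc[of "\<lambda>m. (dif ^^ n) u m = 0"] by blast
  with step(3) show ?case by eventually_elim (simp add: dif_pow_Suc del: funpow.simps)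
qed (use assms in simp)

text \<open>A sequence that eventually falls by at least \<open>e\<close> per step drops below -1,
  so a negative upper bound passes from a difference to the sequence it is taken of.\<close>

lemma dif_pow_neg:
  assumes "eventually (\<lambda>m. (dif ^^ D) u m \<le> - e) sequentially" "e > 0"
  shows "\<exists>e'>0. eventually (\<lambda>m. u m \<le> - e') sequentially"
  using assms
proof (induction D arbitrary: e)
  case (Suc D)
  define w where "w = (dif ^^ D) u"
  obtain N where N: "\<And>m. N \<le> m \<Longrightarrow> w (Suc m) \<le> w m - e"
    using Suc.prems(1) unfolding eventually_sequentially by (force simp: dif_def w_def)
  have lin: "w (N + i) \<le> w N - of_nat i * e" for i
  proof (induction i)
    case (Suc i)
    have "w (N + Suc i) \<le> w (N + i) - e" using N[of "N + i"] by simp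
    with Suc show ?case by (simp add: algebra_simps)
  qed simp
  obtain i0 :: nat where "w N + 1 < of_nat i0 * e" using ex_less_of_nat_mult[OF Suc.prems(2)] by blast
  have "w m \<le> - 1" if "N + i0 \<le> m" for m
  proof -
    have "w m \<le> w N - of_nat (m - N) * e" using lin[of "m - N"] that by simp
    moreover have "of_nat i0 * e \<le> of_nat (m - N) * e"
      using that Suc.prems(2) by (intro mult_right_mono) auto
    ultimately show ?thesis using \<open>w N + 1 < of_nat i0 * e\<close> by linarith
  qed
  then have "eventually (\<lambda>m. (dif ^^ D) u m \<le> - 1) sequentially"
    unfolding w_def eventually_sequentially by blast
  then show ?case using Suc.IH zero_less_one by blast
qed auto

text \<open>This compares leading coefficients: for \<open>a > b\<close> the D-th difference of v -
  u would eventually be a negative constant, and then v - u itself would become negative.\<close>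

lemma dif_pow_compare:
  assumes "eventually (\<lambda>m. (dif ^^ D) u m = a) sequentially"
    and "eventually (\<lambda>m. (dif ^^ D) v m = b) sequentially"
    and "eventually (\<lambda>m. u m \<le> v m) sequentially"
  shows "a \<le> b"
proof (rule ccontr)
  assume "\<not> a \<le> b"
  have "eventually (\<lambda>m. (dif ^^ D) (\<lambda>m. v m - u m) m \<le> - (a - b)) sequentially"
    using assms(1,2) by eventually_elim (simp add: dif_pow_diff)
  then obtain e' where "e' > 0" "eventually (\<lambda>m. v m - u m \<le> - e') sequentially"
    using dif_pow_neg[of D "\<lambda>m. v m - u m" "a - b"] \<open>\<not> a \<le> b\<close> by auto
  from eventually_conj[OF this(2) assms(3)] obtain m where "v m - u m \<le> - e'" "u m \<le> v m"
    unfolding eventually_sequentially by blast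
  with \<open>e' > 0\<close> show False by linarith
qed

text \<open>As long as the a priori bound on the degree of \<open>u\<close> is above
  \<open>E\<close>, the constant top difference of \<open>u\<close> is compared with those of 0 and
  of \<open>v\<close>, which both vanish. So the bound can be lowered down to
  \<open>E\<close>.\<close>

lemma dif_pow_squeeze:
  assumes "eventually (\<lambda>m. 0 \<le> u m) sequentially" "eventually (\<lambda>m. u m \<le> v m) sequentially"
    and "eventually (\<lambda>m. (dif ^^ E) v m = 0) sequentially"
    and "eventually (\<lambda>m. (dif ^^ E') u m = 0) sequentially"
  shows "eventually (\<lambda>m. (dif ^^ E) u m = 0) sequentially"
  using assms(4)
proof (induction E')
  case 0
  then show ?case by (rule dif_pow_mono_deg) simp
next
  case (Suc E')
  show ?case
  proof (cases "E \<le> E'")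
    case True
    obtain c where c: "eventually (\<lambda>m. (dif ^^ E') u m = c) sequentially"
      using dif_zero_imp_const Suc.prems by auto
    have "(dif ^^ E') (\<lambda>_. 0) = (\<lambda>_. 0)"
      by (induction E') (auto simp: dif_pow_Suc simp del: funpow.simps(2))
    then have z: "eventually (\<lambda>m. (dif ^^ E') (\<lambda>_. 0) m = 0) sequentially" by simp
    have "c \<le> 0" by (rule dif_pow_compare[OF c dif_pow_mono_deg[OF assms(3) True] assms(2)])
    moreover have "0 \<le> c" by (rule dif_pow_compare[OF z c assms(1)])
    ultimately show ?thesis using c Suc.IH by simp
  next
    case False
    then show ?thesis using dif_pow_mono_deg[OF Suc.prems] by simp
  qed
qed

lemma dif_pow_poly:
  assumes "\<forall>i>d. coeff p i = 0"
  shows "(dif ^^ d) (\<lambda>m. poly p (of_nat m)) m = fact d * coeff p d"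
proof -
  have "degree p \<le> d" using assms by (simp add: degree_le)
  then have "poly p x = (\<Sum>i\<le>d. coeff p i * x ^ i)" for x
    unfolding poly_altdef by (intro sum.mono_neutral_left) (auto simp: coeff_eq_0)
  then have "(dif ^^ d) (\<lambda>m. poly p (of_nat m)) m
      = (\<Sum>i\<le>d. coeff p i * (dif ^^ d) (\<lambda>x. of_nat x ^ i) m)"
    by (simp add: dif_pow_sum_scale)
  also have "\<dots> = (\<Sum>i\<in>{d}. coeff p i * (dif ^^ d) (\<lambda>x. of_nat x ^ i) m)"
    using dif_pow_monomial[of d] by (intro sum.mono_neutral_right) (auto simp: le_less)
  finally show ?thesis using dif_pow_monomial[of d] by simp
qed

lemma dif_pow_imp_poly:
  assumes "eventually (\<lambda>m. (dif ^^ D) u m = 0) sequentially"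
  shows "\<exists>p. (\<forall>i\<ge>D. coeff p i = 0) \<and> eventually (\<lambda>m. u m = poly p (of_nat m)) sequentially"
  using assms
proof (induction D arbitrary: u)
  case 0
  then show ?case by (intro exI[of _ 0]) simp
next
  case (Suc D)
  obtain c where c: "eventually (\<lambda>m. (dif ^^ D) u m = c) sequentially"
    using dif_zero_imp_const Suc.prems by auto
  define q where "q = monom (c / fact D) D"
  have q: "(dif ^^ D) (\<lambda>m. poly q (of_nat m)) m = c" for m
    using dif_pow_poly[of D q m] by (auto simp: q_def)
  have "eventually (\<lambda>m. (dif ^^ D) (\<lambda>m. u m - poly q (of_nat m)) m = 0) sequentially"
    using c by eventually_elim (simp add: dif_pow_diff q)
  from Suc.IH[OF this] obtain p where "\<forall>i\<ge>D. coeff p i = 0"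
    "eventually (\<lambda>m. u m - poly q (of_nat m) = poly p (of_nat m)) sequentially" by blast
  then show ?case
    by (intro exI[of _ "p + q"]) (auto simp: q_def algebra_simps)
qed

lemma poly_unique_sequentially:
  fixes p q :: "rat poly"
  assumes "eventually (\<lambda>m. poly p (of_nat m) = poly q (of_nat m)) sequentially"
  shows "p = q"
proof -
  obtain N where N: "\<And>m. N \<le> m \<Longrightarrow> poly (p - q) (of_nat m) = 0"
    using assms unfolding eventually_sequentially by auto
  have "infinite ((of_nat :: nat \<Rightarrow> rat) ` {N..})"
    by (subst finite_image_iff) (auto simp: infinite_Ici inj_on_def)
  moreover have "of_nat ` {N..} \<subseteq> {x. poly (p - q) x = 0}" using N by auto
  ultimately have "infinite {x. poly (p - q) x = 0}" using finite_subset by blast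
  then show ?thesis using poly_roots_finite[of "p - q"] by auto
qed

section \<open>Lengths of quotients of ideals\<close>

no_notation Sum_Type.Plus (infixr "<+>" 65)

text \<open>The common shape of \<open>module_length\<close> and \<open>ideal_length\<close>;
  lengths can then be compared through monotone maps between families of sets. The number
  \<open>n\<close> counts strict steps.\<close>

definition has_chain :: "'a set set \<Rightarrow> nat \<Rightarrow> bool" where
  "has_chain \<S> n \<longleftrightarrow> (\<exists>N :: nat \<Rightarrow> 'a set. (\<forall>i\<le>n. N i \<in> \<S>) \<and> (\<forall>i<n. N i \<subset> N (Suc i)))"

definition chain_length :: "'a set set \<Rightarrow> enat" where
  "chain_length \<S> = Sup {enat n | n. has_chain \<S> n}"

lemma has_chain_le: "has_chain \<S> n \<Longrightarrow> m \<le> n \<Longrightarrow> has_chain \<S> m"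
  unfolding has_chain_def by (meson le_trans less_le_trans)

lemma has_chain_imp_le: "has_chain \<S> n \<Longrightarrow> enat n \<le> chain_length \<S>"
  unfolding chain_length_def by (rule Sup_upper) auto

text \<open>Chain lengths are downward closed, so every finite bound below the supremum is attained.
  For the empty family the supremum is still 0, although there is no chain with 0 steps.\<close>

lemma le_chain_length_iff:
  assumes "\<S> \<noteq> {}"
  shows "enat n \<le> chain_length \<S> \<longleftrightarrow> has_chain \<S> n"
proof
  assume L: "enat n \<le> chain_length \<S>"
  show "has_chain \<S> n"
  proof (rule ccontr)
    assume no: "\<not> has_chain \<S> n"
    have "has_chain \<S> 0" using assms by (auto simp: has_chain_def)
    with no have "n \<noteq> 0" by (intro notI) simp
    have "m \<le> n - 1" if "has_chain \<S> m" for m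
      using no has_chain_le[OF that, of n] by (cases "n \<le> m") auto
    then have "chain_length \<S> \<le> enat (n - 1)"
      unfolding chain_length_def by (intro Sup_least) auto
    with L have "enat n \<le> enat (n - 1)" by (rule order_trans)
    with \<open>n \<noteq> 0\<close> show False by simp
  qed
qed (rule has_chain_imp_le)

lemma enat_unbounded_imp_ge:
  assumes "\<And>m. enat m \<le> c" shows "a \<le> c"
proof (cases c)
  case (enat k)
  then show ?thesis using assms[of "Suc k"] by simp
qed simp

lemma has_chain_map:
  assumes "\<And>X. X \<in> \<S> \<Longrightarrow> f X \<in> \<T>" "\<And>X Y. X \<in> \<S> \<Longrightarrow> Y \<in> \<S> \<Longrightarrow> X \<subset> Y \<Longrightarrow> f X \<subset> f Y"
    and "has_chain \<S> n"
  shows "has_chain \<T> n"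
proof -
  obtain N where "\<forall>i\<le>n. N i \<in> \<S>" "\<forall>i<n. N i \<subset> N (Suc i)"
    using assms(3) unfolding has_chain_def by blast
  then show ?thesis
    unfolding has_chain_def using assms(1,2) by (intro exI[of _ "f \<circ> N"]) simp
qed

lemma chain_length_le_map:
  assumes "\<And>X. X \<in> \<S> \<Longrightarrow> f X \<in> \<T>" "\<And>X Y. X \<in> \<S> \<Longrightarrow> Y \<in> \<S> \<Longrightarrow> X \<subset> Y \<Longrightarrow> f X \<subset> f Y"
  shows "chain_length \<S> \<le> chain_length \<T>"
proof -
  have "has_chain \<T> n" if "has_chain \<S> n" for n
    using assms that by (rule has_chain_map)
  then have "{enat n |n. has_chain \<S> n} \<subseteq> {enat n |n. has_chain \<T> n}" by auto
  then show ?thesis unfolding chain_length_def by (rule Sup_subset_mono)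
qed

lemma chain_length_eq_map:
  assumes "\<And>X. X \<in> \<S> \<Longrightarrow> f X \<in> \<T>" "\<And>Y. Y \<in> \<T> \<Longrightarrow> g Y \<in> \<S>"
    and "\<And>X. X \<in> \<S> \<Longrightarrow> g (f X) = X" "\<And>Y. Y \<in> \<T> \<Longrightarrow> f (g Y) = Y"
    and "\<And>X Y. X \<in> \<S> \<Longrightarrow> Y \<in> \<S> \<Longrightarrow> X \<subseteq> Y \<Longrightarrow> f X \<subseteq> f Y"
    and "\<And>X Y. X \<in> \<T> \<Longrightarrow> Y \<in> \<T> \<Longrightarrow> X \<subseteq> Y \<Longrightarrow> g X \<subseteq> g Y"
  shows "chain_length \<S> = chain_length \<T>"
proof (rule antisym)
  show "chain_length \<S> \<le> chain_length \<T>"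
    by (rule chain_length_le_map[of _ f]) (use assms in \<open>auto simp: psubset_eq\<close>, metis assms(3))
  show "chain_length \<T> \<le> chain_length \<S>"
    by (rule chain_length_le_map[of _ g]) (use assms in \<open>auto simp: psubset_eq\<close>, metis assms(4))
qed

text \<open>Repetitions are omitted. The induction also records that the last member is
  \<open>W p\<close>, which tells where the next step attaches.\<close>

lemma has_chain_weak:
  assumes "\<And>i. i \<le> p \<Longrightarrow> W i \<in> \<S>" "\<And>i. i < p \<Longrightarrow> W i \<subseteq> W (Suc i)"
  shows "has_chain \<S> (card {i. i < p \<and> W i \<noteq> W (Suc i)})"
proof -
  have "\<exists>N. (\<forall>i\<le>card {i. i < p \<and> W i \<noteq> W (Suc i)}. N i \<in> \<S>)
     \<and> (\<forall>i<card {i. i < p \<and> W i \<noteq> W (Suc i)}. N i \<subset> N (Suc i))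
     \<and> N (card {i. i < p \<and> W i \<noteq> W (Suc i)}) = W p"
    using assms
  proof (induction p)
    case 0
    then show ?case by (intro exI[of _ W]) simp
  next
    case (Suc p)
    let ?c = "card {i. i < p \<and> W i \<noteq> W (Suc i)}"
    obtain N where N: "\<forall>i\<le>?c. N i \<in> \<S>" "\<forall>i<?c. N i \<subset> N (Suc i)" "N ?c = W p"
      using Suc by (auto simp: less_Suc_eq le_Suc_eq)
    have fin: "finite {i. i < p \<and> W i \<noteq> W (Suc i)}" by simp
    show ?case
    proof (cases "W p = W (Suc p)")
      case True
      then have "{i. i < Suc p \<and> W i \<noteq> W (Suc i)} = {i. i < p \<and> W i \<noteq> W (Suc i)}"
        by (auto simp: less_Suc_eq)
      then show ?thesis using N True by auto
    next
      case False
      then have "{i. i < Suc p \<and> W i \<noteq> W (Suc i)} = insert p {i. i < p \<and> W i \<noteq> W (Suc i)}"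
        by (auto simp: less_Suc_eq)
      then have c: "card {i. i < Suc p \<and> W i \<noteq> W (Suc i)} = Suc ?c" by simp
      show ?thesis
        unfolding c
        using N False Suc.prems(1)[of "Suc p"] Suc.prems(2)[of p]
        by (intro exI[of _ "N(Suc ?c := W (Suc p))"]) (auto simp: le_Suc_eq less_Suc_eq)
    qed
  qed
  then show ?thesis unfolding has_chain_def by blast
qed

section \<open>Sums of ideals and the modular law\<close>

lemma (in ring) set_add_iff: "x \<in> A <+> B \<longleftrightarrow> (\<exists>a\<in>A. \<exists>b\<in>B. x = a \<oplus> b)"
  by (auto simp: set_add_def')

lemma (in ring) idealD:
  assumes "ideal A R"
  shows "A \<subseteq> carrier R" "\<zero> \<in> A"
    "\<And>x. x \<in> A \<Longrightarrow> x \<in> carrier R"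
    "\<And>x y. x \<in> A \<Longrightarrow> y \<in> A \<Longrightarrow> x \<oplus> y \<in> A"
    "\<And>x y. x \<in> A \<Longrightarrow> y \<in> A \<Longrightarrow> x \<ominus> y \<in> A"
    "\<And>x. x \<in> A \<Longrightarrow> \<ominus> x \<in> A"
    "\<And>x r. x \<in> A \<Longrightarrow> r \<in> carrier R \<Longrightarrow> r \<otimes> x \<in> A"
    "\<And>x r. x \<in> A \<Longrightarrow> r \<in> carrier R \<Longrightarrow> x \<otimes> r \<in> A"
proof -
  interpret A: ideal A R by fact
  show "A \<subseteq> carrier R" "\<zero> \<in> A" "\<And>x. x \<in> A \<Longrightarrow> x \<in> carrier R"
    "\<And>x y. x \<in> A \<Longrightarrow> y \<in> A \<Longrightarrow> x \<oplus> y \<in> A" "\<And>x. x \<in> A \<Longrightarrow> \<ominus> x \<in> A"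
    "\<And>x r. x \<in> A \<Longrightarrow> r \<in> carrier R \<Longrightarrow> r \<otimes> x \<in> A"
    "\<And>x r. x \<in> A \<Longrightarrow> r \<in> carrier R \<Longrightarrow> x \<otimes> r \<in> A"
    by (auto simp: A.I_l_closed A.I_r_closed A.a_subset)
  then show "\<And>x y. x \<in> A \<Longrightarrow> y \<in> A \<Longrightarrow> x \<ominus> y \<in> A" by (simp add: a_minus_def)
qed

lemma (in cring) idealI_simple:
  assumes "A \<subseteq> carrier R" "\<zero> \<in> A" "\<And>x y. x \<in> A \<Longrightarrow> y \<in> A \<Longrightarrow> x \<oplus> y \<in> A"
    "\<And>x r. x \<in> A \<Longrightarrow> r \<in> carrier R \<Longrightarrow> r \<otimes> x \<in> A"
  shows "ideal A R"
proof (rule idealI[OF ring_axioms])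
  show "subgroup A (add_monoid R)"
  proof (rule add.subgroupI)
    show "A \<subseteq> carrier R" "A \<noteq> {}" using assms by auto
    fix a assume a: "a \<in> A"
    then have "\<ominus> a = (\<ominus> \<one>) \<otimes> a" using assms(1) by (auto simp: l_minus)
    then show "\<ominus> a \<in> A" using assms(4)[OF a, of "\<ominus> \<one>"] by simp
  qed (use assms in auto)
  fix a x assume "a \<in> A" "x \<in> carrier R"
  then show "x \<otimes> a \<in> A" "a \<otimes> x \<in> A" using assms by (auto simp: m_comm subset_iff)
qed

lemma (in ring) ideal_sum_upper:
  assumes "ideal A R" "ideal B R"
  shows "A \<subseteq> A <+> B" "B \<subseteq> A <+> B"
proof -
  show "A \<subseteq> A <+> B"
    using idealD[OF assms(1)] idealD[OF assms(2)] unfolding set_add_iff[abs_def] subset_iff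
    by (metis r_zero set_add_iff)
  show "B \<subseteq> A <+> B"
    using idealD[OF assms(1)] idealD[OF assms(2)] unfolding set_add_iff[abs_def] subset_iff
    by (metis l_zero set_add_iff)
qed

lemma (in ring) ideal_sum_least:
  assumes "ideal C R" "A \<subseteq> C" "B \<subseteq> C"
  shows "A <+> B \<subseteq> C"
  unfolding subset_iff set_add_iff using assms idealD(4)[OF assms(1)] by blast

lemma (in ring) ideal_sum_mono: "A \<subseteq> A' \<Longrightarrow> B \<subseteq> B' \<Longrightarrow> A <+> B \<subseteq> A' <+> B'"
  unfolding subset_iff set_add_iff by blast

lemma (in ring) ideal_sum_absorb:
  assumes "ideal A R" "ideal B R" "B \<subseteq> A"
  shows "A <+> B = A"
  using ideal_sum_least[OF assms(1) order_refl assms(3)] ideal_sum_upper(1)[OF assms(1,2)] by blast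

lemma (in ring) ideal_modular:
  assumes "ideal A R" "ideal B R" "ideal C R" "B \<subseteq> A"
  shows "A \<inter> (B <+> C) = B <+> (A \<inter> C)"
proof
  show "A \<inter> (B <+> C) \<subseteq> B <+> (A \<inter> C)"
  proof
    fix x assume "x \<in> A \<inter> (B <+> C)"
    then obtain b c where x: "x \<in> A" "b \<in> B" "c \<in> C" "x = b \<oplus> c" by (auto simp: set_add_iff)
    have car: "b \<in> carrier R" "c \<in> carrier R" "x \<in> carrier R"
      using x assms idealD(3) by blast+
    then have "x \<ominus> b = c \<oplus> (b \<oplus> \<ominus> b)" using x(4) by (simp add: a_minus_def a_ac)
    then have "c = x \<ominus> b" using car by (simp add: r_neg)
    then have "c \<in> A" using x assms idealD(5)[OF assms(1), of x b] by blast
    then show "x \<in> B <+> (A \<inter> C)" using x by (auto simp: set_add_iff)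
  qed
  show "B <+> (A \<inter> C) \<subseteq> A \<inter> (B <+> C)"
    using assms(4) idealD(4)[OF assms(1)] unfolding subset_iff Int_iff set_add_iff by blast
qed

lemma (in ring) ideal_sum_assoc:
  assumes "ideal A R" "ideal B R" "ideal C R"
  shows "A <+> B <+> C = A <+> (B <+> C)"
  using assms by (simp add: add.set_mult_assoc idealD(1) set_add_defs(1))

text \<open>The length of A/B, measured by chains of ideals between \<open>B\<close> and
  \<open>A\<close>; \<open>module_length_quot\<close> identifies it with the length of the quotient
  module.\<close>

definition ideal_length :: "('a, 'm) ring_scheme \<Rightarrow> 'a set \<Rightarrow> 'a set \<Rightarrow> enat" where
  "ideal_length R A B = chain_length {N. ideal N R \<and> B \<subseteq> N \<and> N \<subseteq> A}"

context cring
begin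

lemma le_ideal_length_iff:
  assumes "ideal A R" "B \<subseteq> A"
  shows "enat n \<le> ideal_length R A B \<longleftrightarrow> has_chain {N. ideal N R \<and> B \<subseteq> N \<and> N \<subseteq> A} n"
proof -
  have "A \<in> {N. ideal N R \<and> B \<subseteq> N \<and> N \<subseteq> A}" using assms by simp
  then show ?thesis unfolding ideal_length_def by (intro le_chain_length_iff) auto
qed

text \<open>In one direction a chain between \<open>C\<close> and \<open>A\<close> is projected to
  \<open>B\<close> by intersection and to A/B by sum with \<open>B\<close>; in the other direction
  chains are concatenated.\<close>

lemma ideal_length_add:
  assumes A: "ideal A R" and B: "ideal B R" and C: "ideal C R" and "C \<subseteq> B" "B \<subseteq> A"
  shows "ideal_length R A C = ideal_length R A B + ideal_length R B C"
proof (rule antisym)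
  let ?S = "\<lambda>A B. {N. ideal N R \<and> B \<subseteq> N \<and> N \<subseteq> A}"
  show "ideal_length R A C \<le> ideal_length R A B + ideal_length R B C"
    unfolding ideal_length_def[of R A C] chain_length_def
  proof (rule Sup_least, safe)
    fix p assume "has_chain (?S A C) p"
    then obtain P where P0: "\<forall>i\<le>p. P i \<in> ?S A C" and P1: "\<forall>i<p. P i \<subset> P (Suc i)"
      unfolding has_chain_def by (elim exE conjE) (rule that)
    have P: "ideal (P i) R \<and> C \<subseteq> P i \<and> P i \<subseteq> A" if "i \<le> p" for i using P0 that by simp
    define U V where "U i = P i \<inter> B" and "V i = P i <+> B" for i
    have u: "has_chain (?S B C) (card {i. i < p \<and> U i \<noteq> U (Suc i)})"
    proof (rule has_chain_weak)
      show "U i \<in> ?S B C" if "i \<le> p" for i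
        using P[OF that] assms by (auto simp: U_def intro: i_intersect)
      show "U i \<subseteq> U (Suc i)" if "i < p" for i using P1 that by (auto simp: U_def)
    qed
    have v: "has_chain (?S A B) (card {i. i < p \<and> V i \<noteq> V (Suc i)})"
    proof (rule has_chain_weak)
      fix i assume "i \<le> p"
      then have i: "ideal (P i) R" "P i \<subseteq> A" using P by auto
      show "V i \<in> ?S A B"
        unfolding V_def
        using add_ideals[OF i(1) B] ideal_sum_upper(2)[OF i(1) B] ideal_sum_least[OF A i(2) \<open>B \<subseteq> A\<close>]
        by blast
    next
      fix i assume "i < p"
      then show "V i \<subseteq> V (Suc i)" unfolding V_def using P1 by (intro ideal_sum_mono) auto
    qed
    \<comment> \<open>By the modular law a strict step cannot become an equality in both
      projections.\<close>
    have "{..<p} \<subseteq> {i. i < p \<and> U i \<noteq> U (Suc i)} \<union> {i. i < p \<and> V i \<noteq> V (Suc i)}"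
    proof
      fix i assume "i \<in> {..<p}"
      then have i: "i < p" by simp
      have id: "ideal (P i) R" "ideal (P (Suc i)) R" using P i by auto
      have sub: "P i \<subset> P (Suc i)" using P1 i by blast
      have False if eq: "U i = U (Suc i)" "V i = V (Suc i)"
      proof -
        have "P (Suc i) = P (Suc i) \<inter> (P i <+> B)"
          using eq(2) ideal_sum_upper(1)[OF id(2) B] by (auto simp: V_def)
        also have "\<dots> = P i <+> (P (Suc i) \<inter> B)" using ideal_modular[OF id(2) id(1) B] sub by blast
        also have "\<dots> = P i <+> (P i \<inter> B)" using eq(1) by (simp add: U_def)
        also have "\<dots> \<subseteq> P i" by (rule ideal_sum_least) (use id in auto)
        finally show False using sub by blast
      qed
      then show "i \<in> {i. i < p \<and> U i \<noteq> U (Suc i)} \<union> {i. i < p \<and> V i \<noteq> V (Suc i)}"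
        using i by blast
    qed
    then have "card {..<p} \<le> card ({i. i < p \<and> U i \<noteq> U (Suc i)} \<union> {i. i < p \<and> V i \<noteq> V (Suc i)})"
      by (rule card_mono[rotated]) simp
    also have "\<dots> \<le> card {i. i < p \<and> U i \<noteq> U (Suc i)} + card {i. i < p \<and> V i \<noteq> V (Suc i)}"
      by (rule card_Un_le)
    also have "card {..<p} = p" by simp
    finally have "enat p \<le> enat (card {i. i < p \<and> V i \<noteq> V (Suc i)})
        + enat (card {i. i < p \<and> U i \<noteq> U (Suc i)})" by simp
    also have "\<dots> \<le> ideal_length R A B + ideal_length R B C"
      using has_chain_imp_le[OF u] has_chain_imp_le[OF v] unfolding ideal_length_def by (rule add_mono[rotated])
    finally show "enat p \<le> ideal_length R A B + ideal_length R B C" .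
  qed
  \<comment> \<open>Stated for arbitrary lower bounds \<open>m\<close> and \<open>n\<close>, so that
    it also serves when one of the two lengths is infinite.\<close>
  have key: "enat (m + n) \<le> ideal_length R A C"
    if "enat m \<le> ideal_length R B C" "enat n \<le> ideal_length R A B" for m n
  proof -
    have "has_chain (?S B C) m" "has_chain (?S A B) n"
      using that le_ideal_length_iff[OF B \<open>C \<subseteq> B\<close>] le_ideal_length_iff[OF A \<open>B \<subseteq> A\<close>] by simp_all
    then obtain N M where N: "\<forall>i\<le>m. N i \<in> ?S B C" "\<forall>i<m. N i \<subset> N (Suc i)"
      and M: "\<forall>i\<le>n. M i \<in> ?S A B" "\<forall>i<n. M i \<subset> M (Suc i)"
      unfolding has_chain_def by (elim exE conjE) (rule that)
    define P where "P i = (if i \<le> m then N i else M (i - m))" for i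
    have "P i \<in> ?S A C" if "i \<le> m + n" for i
    proof -
      have "i - m \<le> n" using that by linarith
      then show ?thesis
        using N(1)[rule_format, of i] M(1)[rule_format, of "i - m"] assms
        by (cases "i \<le> m") (auto simp: P_def)
    qed
    moreover have "P i \<subset> P (Suc i)" if "i < m + n" for i
    proof -
      consider "i < m" | "i = m" | "i > m" by linarith
      then show ?thesis
      proof cases
        case 2
        have "N m \<subseteq> B" "B \<subseteq> M 0" "M 0 \<subset> M (Suc 0)" using N M that 2 by auto
        then show ?thesis using 2 by (auto simp: P_def)
      next
        case 3
        then show ?thesis using M(2)[rule_format, of "i - m"] that by (simp add: P_def Suc_diff_le)
      qed (use N in \<open>simp add: P_def\<close>)
    qed
    ultimately have "has_chain (?S A C) (m + n)" unfolding has_chain_def by blast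
    then show ?thesis unfolding ideal_length_def by (rule has_chain_imp_le)
  qed
  show "ideal_length R A B + ideal_length R B C \<le> ideal_length R A C"
  proof (cases "ideal_length R A B"; cases "ideal_length R B C")
    fix n m assume "ideal_length R A B = enat n" "ideal_length R B C = enat m"
    then show ?thesis using key[of m n] by (simp add: add.commute)
  next
    fix n assume "ideal_length R B C = \<infinity>"
    then have "enat m \<le> ideal_length R A C" for m using key[of m 0] by (simp add: zero_enat_def[symmetric])
    then show ?thesis by (rule enat_unbounded_imp_ge)
  next
    fix n assume "ideal_length R A B = \<infinity>"
    then have "enat m \<le> ideal_length R A C" for m using key[of 0 m] by (simp add: zero_enat_def[symmetric])
    then show ?thesis by (rule enat_unbounded_imp_ge)
  next
    assume "ideal_length R A B = \<infinity>"
    then have "enat m \<le> ideal_length R A C" for m using key[of 0 m] by (simp add: zero_enat_def[symmetric])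
    then show ?thesis by (rule enat_unbounded_imp_ge)
  qed
qed

lemma ideal_length_mono:
  assumes "A' \<subseteq> A" "B \<subseteq> B'"
  shows "ideal_length R A' B' \<le> ideal_length R A B"
  unfolding ideal_length_def by (rule chain_length_le_map[of _ id]) (use assms in auto)

lemma ideal_length_self: "ideal_length R A A = 0"
proof -
  have "n = 0" if "has_chain {N. ideal N R \<and> A \<subseteq> N \<and> N \<subseteq> A} n" for n :: nat
  proof (rule ccontr)
    assume "n \<noteq> 0"
    from that obtain N where N: "\<forall>i\<le>n. N i \<in> {N. ideal N R \<and> A \<subseteq> N \<and> N \<subseteq> A}"
      "\<forall>i<n. N i \<subset> N (Suc i)" unfolding has_chain_def by (elim exE conjE)
    have "N 0 = A" "N (Suc 0) = A" "N 0 \<subset> N (Suc 0)"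
      using N(1)[rule_format, of 0] N(1)[rule_format, of "Suc 0"] N(2)[rule_format, of 0] \<open>n \<noteq> 0\<close>
      by auto
    then show False by blast
  qed
  then have "{enat n |n. has_chain {N. ideal N R \<and> A \<subseteq> N \<and> N \<subseteq> A} n} \<subseteq> {0}"
    by (auto simp: zero_enat_def)
  then show ?thesis
    unfolding ideal_length_def chain_length_def
    by (intro antisym Sup_least) auto
qed

lemma ideal_length_pos:
  assumes "ideal A R" "ideal B R" "B \<subset> A"
  shows "1 \<le> ideal_length R A B"
proof -
  have "has_chain {N. ideal N R \<and> B \<subseteq> N \<and> N \<subseteq> A} 1"
    unfolding has_chain_def using assms by (intro exI[of _ "\<lambda>i. if i = 0 then B else A"]) auto
  then show ?thesis unfolding ideal_length_def one_enat_def by (rule has_chain_imp_le)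
qed

text \<open>The second isomorphism theorem on the level of intermediate ideals; the modular law
  makes the two maps inverse to each other.\<close>

lemma ideal_length_sum:
  assumes A: "ideal A R" and B: "ideal B R"
  shows "ideal_length R (A <+> B) B = ideal_length R A (A \<inter> B)"
  unfolding ideal_length_def
proof (rule chain_length_eq_map[of _ "\<lambda>N. A \<inter> N" _ "\<lambda>N. N <+> B"])
  fix X assume "X \<in> {N. ideal N R \<and> B \<subseteq> N \<and> N \<subseteq> A <+> B}"
  then have X: "ideal X R" "B \<subseteq> X" "X \<subseteq> A <+> B" by auto
  show "A \<inter> X \<in> {N. ideal N R \<and> A \<inter> B \<subseteq> N \<and> N \<subseteq> A}" using X A by (auto intro: i_intersect)
  have "X \<inter> (B <+> A) = B <+> (X \<inter> A)" by (rule ideal_modular) (use X A B in auto)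
  moreover have "X \<subseteq> B <+> A" using X(3) set_add_comm[OF idealD(1)[OF A] idealD(1)[OF B]] by simp
  moreover have "A \<inter> X <+> B = B <+> (X \<inter> A)"
    using set_add_comm[of "A \<inter> X" B] idealD(1)[OF A] idealD(1)[OF B] by (auto simp: Int_commute)
  ultimately show "A \<inter> X <+> B = X" by blast
next
  fix Y assume "Y \<in> {N. ideal N R \<and> A \<inter> B \<subseteq> N \<and> N \<subseteq> A}"
  then have Y: "ideal Y R" "A \<inter> B \<subseteq> Y" "Y \<subseteq> A" by auto
  show "Y <+> B \<in> {N. ideal N R \<and> B \<subseteq> N \<and> N \<subseteq> A <+> B}"
    using Y A B ideal_sum_upper(2)[OF Y(1) B] by (auto intro: add_ideals ideal_sum_mono[THEN subsetD])
  have "A \<inter> (Y <+> B) = Y <+> (A \<inter> B)" by (rule ideal_modular) (use Y A B in auto)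
  then show "A \<inter> (Y <+> B) = Y" using ideal_sum_absorb[OF Y(1) i_intersect[OF A B] Y(2)] by simp
next
  fix X Y assume "X \<in> {N. ideal N R \<and> A \<inter> B \<subseteq> N \<and> N \<subseteq> A}" "Y \<in> {N. ideal N R \<and> A \<inter> B \<subseteq> N \<and> N \<subseteq> A}" "X \<subseteq> Y"
  then show "X <+> B \<subseteq> Y <+> B" by (intro ideal_sum_mono) auto
qed auto

lemma smult_ideal:
  assumes "ideal A R" "x \<in> carrier R"
  shows "ideal ((\<lambda>y. x \<otimes> y) ` A) R"
proof (rule idealI_simple)
  note A = idealD[OF assms(1)]
  show "(\<lambda>y. x \<otimes> y) ` A \<subseteq> carrier R" using A(3) assms(2) by auto
  show "\<zero> \<in> (\<lambda>y. x \<otimes> y) ` A" using A(2) assms(2) by (intro image_eqI[of _ _ \<zero>]) auto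
  fix u assume "u \<in> (\<lambda>y. x \<otimes> y) ` A"
  then obtain a where a: "a \<in> A" "u = x \<otimes> a" by auto
  show "u \<oplus> v \<in> (\<lambda>y. x \<otimes> y) ` A" if "v \<in> (\<lambda>y. x \<otimes> y) ` A" for v
  proof -
    from that obtain b where b: "b \<in> A" "v = x \<otimes> b" by auto
    show ?thesis
      using a b A(3,4) assms(2) by (intro image_eqI[of _ _ "a \<oplus> b"]) (auto simp: r_distr)
  qed
  show "r \<otimes> u \<in> (\<lambda>y. x \<otimes> y) ` A" if "r \<in> carrier R" for r
    using a A(3,7) assms(2) that by (intro image_eqI[of _ _ "r \<otimes> a"]) (auto simp: m_lcomm)
qed

lemma mem_colon_singleton: "y \<in> colon R B {x} \<longleftrightarrow> y \<in> carrier R \<and> y \<otimes> x \<in> B"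
  by (simp add: colon_def)

lemma colon_ideal:
  assumes "ideal B R" "S \<subseteq> carrier R"
  shows "ideal (colon R B S) R"
proof (rule idealI_simple)
  note B = idealD[OF assms(1)]
  show "colon R B S \<subseteq> carrier R" by (auto simp: colon_def)
  show "\<zero> \<in> colon R B S" using assms(2) B(2) by (auto simp: colon_def subset_iff)
  fix u assume u: "u \<in> colon R B S"
  show "u \<oplus> v \<in> colon R B S" if "v \<in> colon R B S" for v
    using u that assms(2) B(4) by (auto simp: colon_def l_distr subset_iff)
  show "r \<otimes> u \<in> colon R B S" if "r \<in> carrier R" for r
    using u that assms(2) B(7) by (auto simp: colon_def m_assoc subset_iff)
qed

text \<open>Multiplication by \<open>x\<close> induces an isomorphism from A/((B : x) \<inter> A)
  onto (xA + B)/B. It is realised as a bijection between the intermediate ideals.\<close>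

lemma ideal_length_smult:
  assumes A: "ideal A R" and B: "ideal B R" and x: "x \<in> carrier R"
  shows "ideal_length R ((\<lambda>y. x \<otimes> y) ` A <+> B) B = ideal_length R A (colon R B {x} \<inter> A)"
  unfolding ideal_length_def
proof (rule chain_length_eq_map[of _ "\<lambda>X. colon R X {x} \<inter> A" _ "\<lambda>Y. (\<lambda>y. x \<otimes> y) ` Y <+> B"])
  fix X assume "X \<in> {N. ideal N R \<and> B \<subseteq> N \<and> N \<subseteq> (\<lambda>y. x \<otimes> y) ` A <+> B}"
  then have X: "ideal X R" "B \<subseteq> X" "X \<subseteq> (\<lambda>y. x \<otimes> y) ` A <+> B" by auto
  have "ideal (colon R X {x}) R" using X(1) x by (intro colon_ideal) auto
  then show "colon R X {x} \<inter> A \<in> {N. ideal N R \<and> colon R B {x} \<inter> A \<subseteq> N \<and> N \<subseteq> A}"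
    using X A i_intersect by (auto simp: mem_colon_singleton)
  show "(\<lambda>y. x \<otimes> y) ` (colon R X {x} \<inter> A) <+> B = X"
  proof
    show "(\<lambda>y. x \<otimes> y) ` (colon R X {x} \<inter> A) <+> B \<subseteq> X"
      by (rule ideal_sum_least) (use X x in \<open>auto simp: mem_colon_singleton m_comm\<close>)
    show "X \<subseteq> (\<lambda>y. x \<otimes> y) ` (colon R X {x} \<inter> A) <+> B"
    proof
      fix u assume u: "u \<in> X"
      then obtain a b where ab: "a \<in> A" "b \<in> B" "u = x \<otimes> a \<oplus> b"
        using X(3) by (auto simp: set_add_iff subset_iff)
      have car: "a \<in> carrier R" "b \<in> carrier R" using ab A B idealD(3) by blast+
      have "u \<ominus> b \<in> X" using u ab(2) X(2) idealD(5)[OF X(1)] by blast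
      moreover have "u \<ominus> b = x \<otimes> a" using ab(3) car x by (simp add: a_minus_def a_assoc r_neg)
      ultimately have "a \<in> colon R X {x} \<inter> A"
        using ab(1) car x by (simp add: mem_colon_singleton m_comm)
      then show "u \<in> (\<lambda>y. x \<otimes> y) ` (colon R X {x} \<inter> A) <+> B"
        using ab unfolding set_add_iff by blast
    qed
  qed
next
  fix Y assume "Y \<in> {N. ideal N R \<and> colon R B {x} \<inter> A \<subseteq> N \<and> N \<subseteq> A}"
  then have Y: "ideal Y R" "colon R B {x} \<inter> A \<subseteq> Y" "Y \<subseteq> A" by auto
  note iY = smult_ideal[OF Y(1) x]
  show "(\<lambda>y. x \<otimes> y) ` Y <+> B \<in> {N. ideal N R \<and> B \<subseteq> N \<and> N \<subseteq> (\<lambda>y. x \<otimes> y) ` A <+> B}"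
    using add_ideals[OF iY B] ideal_sum_upper(2)[OF iY B] ideal_sum_mono[OF image_mono[OF Y(3)] order_refl]
    by simp
  show "colon R ((\<lambda>y. x \<otimes> y) ` Y <+> B) {x} \<inter> A = Y"
  proof
    show "colon R ((\<lambda>y. x \<otimes> y) ` Y <+> B) {x} \<inter> A \<subseteq> Y"
    proof
      fix a assume a: "a \<in> colon R ((\<lambda>y. x \<otimes> y) ` Y <+> B) {x} \<inter> A"
      then obtain y b where yb: "y \<in> Y" "b \<in> B" "a \<otimes> x = x \<otimes> y \<oplus> b"
        by (auto simp: mem_colon_singleton set_add_iff)
      have car: "a \<in> carrier R" "y \<in> carrier R" "b \<in> carrier R"
        using a yb A B Y idealD(3) by blast+
      have "(a \<ominus> y) \<otimes> x = a \<otimes> x \<ominus> x \<otimes> y"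
        using car x m_comm[of y x] by (simp add: a_minus_def l_distr l_minus)
      also have "\<dots> = b" unfolding yb(3) using car x by (simp add: a_minus_def a_ac r_neg r_neg1 r_neg2)
      finally have "a \<ominus> y \<in> colon R B {x} \<inter> A"
        using yb a Y(3) car idealD(5)[OF A, of a y] by (auto simp: mem_colon_singleton)
      then have "(a \<ominus> y) \<oplus> y \<in> Y" using Y yb(1) idealD(4)[OF Y(1)] by blast
      then show "a \<in> Y" using car by (simp add: a_minus_def a_assoc l_neg)
    qed
    show "Y \<subseteq> colon R ((\<lambda>y. x \<otimes> y) ` Y <+> B) {x} \<inter> A"
    proof
      fix y assume y: "y \<in> Y"
      then have "y \<in> carrier R" using Y(1) idealD(3) by blast
      moreover have "x \<otimes> y \<in> (\<lambda>y. x \<otimes> y) ` Y <+> B" using y ideal_sum_upper(1)[OF iY B] by blast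
      ultimately show "y \<in> colon R ((\<lambda>y. x \<otimes> y) ` Y <+> B) {x} \<inter> A"
        using y Y(3) x by (auto simp: mem_colon_singleton m_comm)
    qed
  qed
next
  fix X Y :: "'a set" assume XY: "X \<subseteq> Y"
  then show "colon R X {x} \<inter> A \<subseteq> colon R Y {x} \<inter> A" by (auto simp: mem_colon_singleton)
  show "(\<lambda>y. x \<otimes> y) ` X <+> B \<subseteq> (\<lambda>y. x \<otimes> y) ` Y <+> B"
    using XY by (intro ideal_sum_mono) auto
qed

lemma cgenideal_iff: "y \<in> PIdl x \<longleftrightarrow> (\<exists>r\<in>carrier R. y = r \<otimes> x)"
  by (auto simp: cgenideal_def)

lemma mem_sum_cgenideal:
  assumes "ideal B R" "x \<in> carrier R"
  shows "y \<in> B <+> PIdl x \<longleftrightarrow> (\<exists>b\<in>B. \<exists>r\<in>carrier R. y = b \<oplus> r \<otimes> x)"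
  unfolding set_add_iff Bex_def cgenideal_iff by blast

lemma mem_sum_cgenideal_self:
  assumes "ideal B R" "x \<in> carrier R"
  shows "x \<in> B <+> PIdl x" "B \<subseteq> B <+> PIdl x" "ideal (B <+> PIdl x) R"
  using ideal_sum_upper[OF assms(1) cgenideal_ideal[OF assms(2)]] cgenideal_self[OF assms(2)]
    add_ideals[OF assms(1) cgenideal_ideal[OF assms(2)]] by auto

lemma sum_cgenideal_least:
  assumes "ideal C R" "B \<subseteq> C" "x \<in> C"
  shows "B <+> PIdl x \<subseteq> C"
  using assms by (intro ideal_sum_least cgenideal_minimal) auto

end

section \<open>Rees modules of a family of ideals\<close>

lemma bump_apply: "bump j n i = (if i = j then Suc (n i) else n i)"
  by (simp add: bump_def)

lemma bump_pred: "0 < n j \<Longrightarrow> bump j (n(j := n j - 1)) = n"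
  by (auto simp: bump_def fun_eq_iff)

context noetherian_ring
begin

lemma ideals_have_maximal:
  assumes "\<S> \<noteq> {}" "\<And>A. A \<in> \<S> \<Longrightarrow> ideal A R"
  shows "\<exists>M\<in>\<S>. \<forall>X\<in>\<S>. M \<subseteq> X \<longrightarrow> X = M"
proof (rule subset_Zorn_nonempty[OF assms(1)])
  fix C assume C: "C \<noteq> {}" "subset.chain \<S> C"
  then have "subset.chain {A. ideal A R} C"
    using assms(2) by (auto simp: subset.chain_def)
  then have "\<Union>C \<in> C" using ideal_chain_is_trivial C(1) by blast
  then show "\<Union>C \<in> \<S>" using C(2) by (auto simp: subset.chain_def)
qed

lemma noetherian_induct [consumes 1, case_names step]:
  assumes "ideal K R"
    and "\<And>K. ideal K R \<Longrightarrow> (\<And>K'. ideal K' R \<Longrightarrow> K \<subset> K' \<Longrightarrow> P K') \<Longrightarrow> P K"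
  shows "P K"
proof (rule ccontr)
  assume "\<not> P K"
  then have ne: "{K. ideal K R \<and> \<not> P K} \<noteq> {}" using assms(1) by blast
  obtain M where M: "M \<in> {K. ideal K R \<and> \<not> P K}"
    and max: "\<And>X. X \<in> {K. ideal K R \<and> \<not> P K} \<Longrightarrow> M \<subseteq> X \<Longrightarrow> X = M"
    using ideals_have_maximal[OF ne] by blast
  have "P M"
  proof (rule assms(2))
    show "ideal M R" using M by simp
    show "P K'" if "ideal K' R" "M \<subset> K'" for K' using max[of K'] that by blast
  qed
  with M show False by simp
qed

lemma ideal_acc:
  assumes "\<And>i. ideal (A i) R" "\<And>i. A i \<subseteq> A (Suc i)"
  obtains m where "\<And>i. m \<le> i \<Longrightarrow> A i = A m"
proof -
  have "\<exists>M\<in>range A. \<forall>X\<in>range A. M \<subseteq> X \<longrightarrow> X = M"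
    by (rule ideals_have_maximal) (use assms(1) in auto)
  then obtain m where m: "\<And>i. A m \<subseteq> A i \<Longrightarrow> A i = A m" by auto
  show ?thesis
  proof (rule that[of m])
    show "A i = A m" if "m \<le> i" for i
      using m lift_Suc_mono_le[of A m i] assms(2) that by simp
  qed
qed

end

text \<open>Index 0 is an ordinary member here and becomes the primary ideal J only in
  \<open>local_primary_family\<close>. The number \<open>s\<close> is a parameter because the case s
  = 0 is instantiated later for J alone.\<close>

locale ideal_family = cring R + noetherian_ring R for R (structure) +
  fixes s :: nat and I :: "nat \<Rightarrow> 'a set"
  assumes I_ideal: "j \<le> s \<Longrightarrow> ideal (I j) R"
begin

abbreviation mp :: "(nat \<Rightarrow> nat) \<Rightarrow> 'a set" where
  "mp n \<equiv> multi_power R s I n"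

sublocale ids: comm_monoid "ideals_set R"
  by (rule ideals_set_is_comm_monoid)

lemma ideals_set_simps [simp]:
  "carrier (ideals_set R) = {A. ideal A R}" "A \<otimes>\<^bsub>ideals_set R\<^esub> B = A \<cdot> B"
  "\<one>\<^bsub>ideals_set R\<^esub> = carrier R"
  by (simp_all add: ideals_set_def)

lemma ideal_pow: "ideal A R \<Longrightarrow> ideal (A [^]\<^bsub>ideals_set R\<^esub> (k::nat)) R"
  using ids.nat_pow_closed[of A k] by simp

lemma pow_pi: "(\<lambda>j. I j [^]\<^bsub>ideals_set R\<^esub> (n j :: nat)) \<in> {..s} \<rightarrow> carrier (ideals_set R)"
  using I_ideal ideal_pow by auto

lemma mp_ideal: "ideal (mp n) R"
  unfolding multi_power_def using ids.finprod_closed[OF pow_pi] by simp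

lemma mp_cong: "(\<And>j. j \<le> s \<Longrightarrow> n j = m j) \<Longrightarrow> mp n = mp m"
  unfolding multi_power_def using I_ideal ideal_pow by (intro ids.finprod_cong') auto

lemma mp_add: "mp (\<lambda>j. n j + m j) = mp n \<cdot> mp m"
proof -
  have "mp (\<lambda>j. n j + m j) = (\<Otimes>\<^bsub>ideals_set R\<^esub>j\<in>{..s}. I j [^]\<^bsub>ideals_set R\<^esub> n j \<otimes>\<^bsub>ideals_set R\<^esub> I j [^]\<^bsub>ideals_set R\<^esub> m j)"
    unfolding multi_power_def
  proof (rule ids.finprod_cong')
    show "(\<lambda>j. I j [^]\<^bsub>ideals_set R\<^esub> n j \<otimes>\<^bsub>ideals_set R\<^esub> I j [^]\<^bsub>ideals_set R\<^esub> m j) \<in> {..s} \<rightarrow> carrier (ideals_set R)"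
      using I_ideal ideal_pow ideal_prod_is_ideal by auto
    fix j assume "j \<in> {..s}"
    then show "I j [^]\<^bsub>ideals_set R\<^esub> (n j + m j) = I j [^]\<^bsub>ideals_set R\<^esub> n j \<otimes>\<^bsub>ideals_set R\<^esub> I j [^]\<^bsub>ideals_set R\<^esub> m j"
      using ids.nat_pow_mult[of "I j" "n j" "m j"] I_ideal by simp
  qed simp
  also have "\<dots> = mp n \<otimes>\<^bsub>ideals_set R\<^esub> mp m"
    unfolding multi_power_def by (rule ids.finprod_multf[OF pow_pi pow_pi])
  finally show ?thesis by simp
qed

lemma mp_zero: "(\<And>j. j \<le> s \<Longrightarrow> n j = 0) \<Longrightarrow> mp n = carrier R"
proof -
  assume "\<And>j. j \<le> s \<Longrightarrow> n j = 0"
  then have "mp n = mp (\<lambda>_. 0)" by (rule mp_cong)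
  also have "\<dots> = carrier R"
    unfolding multi_power_def using ids.finprod_one_eqI[of "{..s}" "\<lambda>_. carrier R"] by simp
  finally show ?thesis .
qed

lemma one_ideal_prod: "ideal A R \<Longrightarrow> carrier R \<cdot> A = A"
  using ideal_prod_commute[OF oneideal] ideal_prod_one by simp

lemma mp_single: "j \<le> s \<Longrightarrow> mp (\<lambda>i. if i = j then 1 else 0) = I j"
proof -
  assume j: "j \<le> s"
  have "mp (\<lambda>i. if i = j then 1 else 0)
      = (\<Otimes>\<^bsub>ideals_set R\<^esub>i\<in>{..s}. if j = i then I i else \<one>\<^bsub>ideals_set R\<^esub>)"
    unfolding multi_power_def
  proof (rule ids.finprod_cong')
    fix i assume "i \<in> {..s}"
    then show "I i [^]\<^bsub>ideals_set R\<^esub> (if i = j then 1 else 0 :: nat) = (if j = i then I i else \<one>\<^bsub>ideals_set R\<^esub>)"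
      using one_ideal_prod[OF I_ideal[of i]] by (simp add: ids.nat_pow_Suc)
  qed (use I_ideal oneideal in auto)
  also have "\<dots> = I j"
    using j I_ideal by (intro ids.finprod_singleton) auto
  finally show ?thesis .
qed

lemma mp_bump: "j \<le> s \<Longrightarrow> mp (bump j n) = I j \<cdot> mp n"
  using mp_add[of "\<lambda>i. if i = j then 1 else 0" n] mp_single[of j]
    mp_cong[of "bump j n" "\<lambda>i. (if i = j then 1 else 0) + n i"] by (simp add: bump_apply)

text \<open>The preimage in R of the power product I^n formed in R/K.\<close>

definition E :: "'a set \<Rightarrow> (nat \<Rightarrow> nat) \<Rightarrow> 'a set" where
  "E K n = mp n <+> K"

context
  fixes K assumes K: "ideal K R"
begin

lemma E_ideal: "ideal (E K n) R"
  unfolding E_def using add_ideals mp_ideal K by blast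

lemma mp_sub_E: "mp n \<subseteq> E K n" and K_sub_E: "K \<subseteq> E K n"
  unfolding E_def using ideal_sum_upper[OF mp_ideal K] by auto

lemma E_cong: "(\<And>j. j \<le> s \<Longrightarrow> n j = m j) \<Longrightarrow> E K n = E K m"
  unfolding E_def by (simp add: mp_cong[of n m])

lemma E_least: "ideal B R \<Longrightarrow> mp n \<subseteq> B \<Longrightarrow> K \<subseteq> B \<Longrightarrow> E K n \<subseteq> B"
  unfolding E_def by (rule ideal_sum_least)

lemma ideal_prod_least:
  assumes "ideal C R" "\<And>a b. a \<in> A \<Longrightarrow> b \<in> B \<Longrightarrow> a \<otimes> b \<in> C"
  shows "A \<cdot> B \<subseteq> C"
proof
  fix x assume "x \<in> A \<cdot> B"
  then show "x \<in> C" by induction (use assms idealD(4) in blast)+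
qed

lemma E_bump_least:
  assumes "j \<le> s" "ideal B R" "K \<subseteq> B" "\<And>a z. a \<in> I j \<Longrightarrow> z \<in> mp n \<Longrightarrow> a \<otimes> z \<in> B"
  shows "E K (bump j n) \<subseteq> B"
  using ideal_prod_least[OF assms(2,4)] mp_bump[OF assms(1)] assms(2,3) by (intro E_least) simp_all

lemma E_mult:
  assumes "u \<in> E K m" "v \<in> E K n"
  shows "u \<otimes> v \<in> E K (\<lambda>j. m j + n j)"
proof -
  obtain a k b l where u: "a \<in> mp m" "k \<in> K" "u = a \<oplus> k" and v: "b \<in> mp n" "l \<in> K" "v = b \<oplus> l"
    using assms by (auto simp: E_def set_add_iff)
  have car: "a \<in> carrier R" "b \<in> carrier R" "k \<in> carrier R" "l \<in> carrier R"
    using u v idealD(3) mp_ideal K by blast+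
  have "a \<otimes> b \<in> mp (\<lambda>j. m j + n j)" unfolding mp_add using u(1) v(1) by (rule ideal_prod.prod)
  moreover have "a \<otimes> l \<oplus> k \<otimes> (b \<oplus> l) \<in> K"
    using u v car idealD(4,7,8)[OF K] by simp
  moreover have "u \<otimes> v = a \<otimes> b \<oplus> (a \<otimes> l \<oplus> k \<otimes> (b \<oplus> l))"
    unfolding u(3) v(3) using car by (simp add: l_distr r_distr a_ac)
  ultimately show ?thesis unfolding E_def set_add_iff by blast
qed

lemma E_bump_mult:
  assumes "j \<le> s" "a \<in> I j" "z \<in> E K n"
  shows "a \<otimes> z \<in> E K (bump j n)"
proof -
  have "a \<in> E K (\<lambda>i. if i = j then 1 else 0)"
    using mp_sub_E mp_single[OF assms(1)] assms(2) by blast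
  from E_mult[OF this assms(3)] show ?thesis
    using E_cong[of "bump j n" "\<lambda>i. (if i = j then 1 else 0) + n i"] by (simp add: bump_apply)
qed

lemma mp_antimono:
  assumes "\<And>j. j \<le> s \<Longrightarrow> m j \<le> n j"
  shows "mp n \<subseteq> mp m"
proof -
  have "mp n = mp m \<cdot> mp (\<lambda>j. n j - m j)"
    unfolding mp_add[symmetric] using assms by (intro mp_cong) simp
  also have "\<dots> \<subseteq> mp m" using ideal_prod_inter[OF mp_ideal mp_ideal] by blast
  finally show ?thesis .
qed

lemma E_antimono: "(\<And>j. j \<le> s \<Longrightarrow> m j \<le> n j) \<Longrightarrow> E K n \<subseteq> E K m"
  unfolding E_def using mp_antimono by (intro ideal_sum_mono) auto

lemma E_zero: "(\<And>j. j \<le> s \<Longrightarrow> n j = 0) \<Longrightarrow> E K n = carrier R"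
  using ideal_sum_absorb[OF oneideal K idealD(1)[OF K]] by (simp add: E_def mp_zero)

end

text \<open>The graded submodules of the Rees module \<open>\<Oplus>\<^sub>n (I\<^sup>n + K)/K\<close>.\<close>

definition gfam :: "'a set \<Rightarrow> ((nat \<Rightarrow> nat) \<Rightarrow> 'a set) \<Rightarrow> bool" where
  "gfam K A \<longleftrightarrow> (\<forall>n. ideal (A n) R \<and> K \<subseteq> A n \<and> A n \<subseteq> E K n) \<and>
     (\<forall>n j a z. j \<le> s \<longrightarrow> a \<in> I j \<longrightarrow> z \<in> A n \<longrightarrow> a \<otimes> z \<in> A (bump j n)) \<and> depends_on s A"

lemma gfamD:
  assumes "gfam K A"
  shows "ideal (A n) R" "K \<subseteq> A n" "A n \<subseteq> E K n"
    "j \<le> s \<Longrightarrow> a \<in> I j \<Longrightarrow> z \<in> A n \<Longrightarrow> a \<otimes> z \<in> A (bump j n)"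
    "(\<And>j. j \<le> s \<Longrightarrow> n j = m j) \<Longrightarrow> A n = A m"
proof -
  show "ideal (A n) R" "K \<subseteq> A n" "A n \<subseteq> E K n"
    using assms by (simp_all add: gfam_def)
  show "j \<le> s \<Longrightarrow> a \<in> I j \<Longrightarrow> z \<in> A n \<Longrightarrow> a \<otimes> z \<in> A (bump j n)"
    using assms by (simp add: gfam_def)
  show "(\<And>j. j \<le> s \<Longrightarrow> n j = m j) \<Longrightarrow> A n = A m"
    using assms by (simp add: gfam_def depends_on_def)
qed

text \<open>Closure under single elements of the I_j extends to products by induction on the total
  degree; the summand from \<open>K\<close> is harmless because \<open>K\<close> lies in every
  member of the family.\<close>

lemma gfam_mult:
  assumes K: "ideal K R" and A: "gfam K A" and "u \<in> E K m" "z \<in> A n"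
  shows "u \<otimes> z \<in> A (\<lambda>j. m j + n j)"
proof -
  have mp: "u \<otimes> z \<in> A (\<lambda>j. m j + n j)" if "u \<in> mp m" for u
    using that
  proof (induction "\<Sum>j\<le>s. m j" arbitrary: m u)
    case 0
    then have "A (\<lambda>j. m j + n j) = A n" by (intro gfamD(5)[OF A]) simp
    moreover have "u \<in> carrier R" using 0 mp_ideal idealD(3) by blast
    ultimately show ?case using idealD(7)[OF gfamD(1)[OF A]] \<open>z \<in> A n\<close> by simp
  next
    case (Suc x)
    then have "(\<Sum>j\<le>s. m j) \<noteq> 0" by linarith
    then obtain j where j: "j \<le> s" "m j \<noteq> 0" by (elim sum.not_neutral_contains_not_neutral) simp
    define m' where "m' = m(j := m j - 1)"
    have mm: "m = bump j m'" using j(2) bump_pred[of m j] by (simp add: m'_def)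
    have "(\<Sum>i\<le>s. m i) = m j + (\<Sum>i\<in>{..s}-{j}. m i)" using j(1) by (subst sum.remove[of _ j]) auto
    also have "(\<Sum>i\<in>{..s}-{j}. m i) = (\<Sum>i\<in>{..s}-{j}. m' i)" by (rule sum.cong) (auto simp: m'_def)
    also have "m j = Suc (m' j)" using j(2) by (simp add: m'_def)
    also have "Suc (m' j) + (\<Sum>i\<in>{..s}-{j}. m' i) = Suc (\<Sum>i\<le>s. m' i)"
      using j(1) by (subst (2) sum.remove[of _ j]) auto
    finally have x: "x = (\<Sum>i\<le>s. m' i)" using Suc(2) by simp
    have e: "(\<lambda>i. m i + n i) = bump j (\<lambda>i. m' i + n i)" using mm by (auto simp: fun_eq_iff bump_apply)
    have zc: "z \<in> carrier R" using \<open>z \<in> A n\<close> gfamD(1)[OF A] idealD(3) by blast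
    \<comment> \<open>The elements that multiply \<open>z\<close> into an ideal form an ideal, so it
      suffices to treat products of two factors.\<close>
    have "mp m \<subseteq> colon R (A (\<lambda>j. m j + n j)) {z}"
      unfolding mm mp_bump[OF j(1)]
    proof (rule ideal_prod_least[OF K])
      show "ideal (colon R (A (\<lambda>i. bump j m' i + n i)) {z}) R"
        using gfamD(1)[OF A] zc by (intro colon_ideal) auto
      fix a b assume a: "a \<in> I j" and b: "b \<in> mp m'"
      have car: "a \<in> carrier R" "b \<in> carrier R"
        using a b mp_ideal I_ideal[OF j(1)] idealD(3) by blast+
      have "a \<otimes> (b \<otimes> z) \<in> A (bump j (\<lambda>i. m' i + n i))"
        using gfamD(4)[OF A j(1) a] Suc(1)[OF x b] by blast
      then show "a \<otimes> b \<in> colon R (A (\<lambda>i. bump j m' i + n i)) {z}"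
        using car zc e mm by (simp add: mem_colon_singleton m_assoc)
    qed
    then show ?case using Suc(3) by (auto simp: mem_colon_singleton)
  qed
  obtain a k where u: "a \<in> mp m" "k \<in> K" "u = a \<oplus> k"
    using \<open>u \<in> E K m\<close> by (auto simp: E_def set_add_iff)
  have car: "a \<in> carrier R" "k \<in> carrier R" "z \<in> carrier R"
    using u \<open>z \<in> A n\<close> mp_ideal K gfamD(1)[OF A] idealD(3) by blast+
  have "k \<otimes> z \<in> A (\<lambda>j. m j + n j)"
    using idealD(8)[OF K u(2) car(3)] gfamD(2)[OF A] by blast
  then show ?thesis
    unfolding u(3) using mp[OF u(1)] car idealD(4)[OF gfamD(1)[OF A]] by (simp add: l_distr)
qed

definition mclosed :: "'a set \<Rightarrow> (nat \<times> 'a) set \<Rightarrow> ((nat \<Rightarrow> nat) \<Rightarrow> 'a set) \<Rightarrow> bool" where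
  "mclosed K X A \<longleftrightarrow> (\<forall>(j,x)\<in>X. \<forall>n. \<forall>z\<in>E K n. x \<otimes> z \<in> A (bump j n))"

text \<open>The next property says that the Rees module modulo the submodules generated by the
  multiplications with the elements in \<^term>\<open>X\<close> is Noetherian. It is clear if \<^term>\<open>X\<close> contains
  generators of all ideals, and, as in Hilbert's basis theorem, elements can be removed from
  \<^term>\<open>X\<close> one at a time.\<close>

definition gfam_acc :: "'a set \<Rightarrow> (nat \<times> 'a) set \<Rightarrow> bool" where
  "gfam_acc K X \<longleftrightarrow> (\<forall>A :: nat \<Rightarrow> (nat \<Rightarrow> nat) \<Rightarrow> 'a set.
     (\<forall>i. gfam K (A i) \<and> mclosed K X (A i)) \<longrightarrow> (\<forall>i n. A i n \<subseteq> A (Suc i) n) \<longrightarrow>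
     (\<exists>m. \<forall>i\<ge>m. A i = A m))"

text \<open>If \<open>X\<close> provides generators of every I_j, then \<open>A\<close> is
  everything in each degree with a positive coordinate among 0, ..., s. Only the component of degree
  0 can vary, and there the chain condition of R applies.\<close>

lemma gfam_acc_base:
  assumes K: "ideal K R" and X: "\<And>j. j \<le> s \<Longrightarrow> Idl {x. (j, x) \<in> X} = I j"
    "\<And>j. j \<le> s \<Longrightarrow> {x. (j, x) \<in> X} \<subseteq> carrier R"
  shows "gfam_acc K X"
  unfolding gfam_acc_def
proof (intro allI impI)
  fix A :: "nat \<Rightarrow> (nat \<Rightarrow> nat) \<Rightarrow> 'a set"
  assume "\<forall>i. gfam K (A i) \<and> mclosed K X (A i)" and up: "\<forall>i n. A i n \<subseteq> A (Suc i) n"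
  then have g: "gfam K (A i)" and c: "mclosed K X (A i)" for i by simp_all
  have full: "A i (bump j n) = E K (bump j n)" if j: "j \<le> s" for i j n
  proof
    show "E K (bump j n) \<subseteq> A i (bump j n)"
    proof (rule E_bump_least[OF K j gfamD(1,2)[OF g]])
      fix a z assume a: "a \<in> I j" and z: "z \<in> mp n"
      have zc: "z \<in> carrier R" using z mp_ideal idealD(3) by blast
      have "ideal (colon R (A i (bump j n)) {z}) R"
        using gfamD(1)[OF g] zc by (intro colon_ideal) auto
      moreover have "{x. (j, x) \<in> X} \<subseteq> colon R (A i (bump j n)) {z}"
      proof
        fix x assume x: "x \<in> {x. (j, x) \<in> X}"
        have "z \<in> E K n" using z mp_sub_E[OF K] by blast
        then have "x \<otimes> z \<in> A i (bump j n)" using c[of i] x unfolding mclosed_def by blast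
        then show "x \<in> colon R (A i (bump j n)) {z}"
          using x X(2)[OF j] by (auto simp: mem_colon_singleton)
      qed
      ultimately have "I j \<subseteq> colon R (A i (bump j n)) {z}"
        using genideal_minimal X(1)[OF j] by metis
      then show "a \<otimes> z \<in> A i (bump j n)" using a by (auto simp: mem_colon_singleton)
    qed
  qed (rule gfamD(3)[OF g])
  obtain m where m: "\<And>i. m \<le> i \<Longrightarrow> A i (\<lambda>_. 0) = A m (\<lambda>_. 0)"
    using ideal_acc[of "\<lambda>i. A i (\<lambda>_. 0)"] gfamD(1)[OF g] up by blast
  have "A i n = A m n" if "m \<le> i" for i n
  proof (cases "\<exists>j\<le>s. 0 < n j")
    case True
    then obtain j where j: "j \<le> s" "0 < n j" by blast
    show ?thesis using full[OF j(1), of _ "n(j := n j - 1)"] bump_pred[of n j] j(2) by simp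
  next
    case False
    then have "A k n = A k (\<lambda>_. 0)" for k by (intro gfamD(5)[OF g]) simp
    then show ?thesis using m[OF that] by simp
  qed
  then show "\<exists>m. \<forall>i\<ge>m. A i = A m" by blast
qed

end

section \<open>Noetherianity of the Rees module\<close>

context ideal_family
begin

text \<open>The colon submodule A : x for \<open>x\<close> placed in degree e_j.\<close>

definition cfam :: "'a set \<Rightarrow> nat \<Rightarrow> 'a \<Rightarrow> ((nat \<Rightarrow> nat) \<Rightarrow> 'a set) \<Rightarrow> (nat \<Rightarrow> nat) \<Rightarrow> 'a set" where
  "cfam K j x A n = {z \<in> E K n. x \<otimes> z \<in> A (bump j n)}"

lemma gfam_cfam:
  assumes K: "ideal K R" and A: "gfam K A" and j: "j \<le> s" "x \<in> I j"
  shows "gfam K (cfam K j x A)"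
  unfolding gfam_def
proof (intro conjI allI impI)
  note e = idealD[OF E_ideal[OF K]]
  have xc: "x \<in> carrier R" using j I_ideal idealD(3) by blast
  note a = idealD[OF gfamD(1)[OF A]]
  show "cfam K j x A n \<subseteq> E K n" for n by (auto simp: cfam_def)
  show "K \<subseteq> cfam K j x A n" for n
    using K_sub_E[OF K, of n] gfamD(2)[OF A, of "bump j n"] idealD(7)[OF K _ xc] by (auto simp: cfam_def)
  show "ideal (cfam K j x A n) R" for n
  proof (rule idealI_simple)
    show "cfam K j x A n \<subseteq> carrier R" using e(3) by (auto simp: cfam_def)
    show "\<zero> \<in> cfam K j x A n" using e(2) a(2) xc by (auto simp: cfam_def)
    fix u assume u: "u \<in> cfam K j x A n"
    then have uc: "u \<in> carrier R" "u \<in> E K n" "x \<otimes> u \<in> A (bump j n)" using e(3) by (auto simp: cfam_def)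
    show "u \<oplus> v \<in> cfam K j x A n" if v: "v \<in> cfam K j x A n" for v
      using u v e(3,4) a(4) xc uc by (auto simp: cfam_def r_distr)
    show "r \<otimes> u \<in> cfam K j x A n" if "r \<in> carrier R" for r
      using uc that e(7) a(7)[OF uc(3) that] xc by (auto simp: cfam_def m_lcomm)
  qed
  fix n i b z assume i: "i \<le> s" "b \<in> I i" and "z \<in> cfam K j x A n"
  then have z: "z \<in> E K n" "x \<otimes> z \<in> A (bump j n)" by (simp_all add: cfam_def)
  have bc: "b \<in> carrier R" by (rule idealD(3)[OF I_ideal[OF i(1)] i(2)])
  have zc: "z \<in> carrier R" by (rule idealD(3)[OF E_ideal[OF K] z(1)])
  have "b \<otimes> (x \<otimes> z) \<in> A (bump j (bump i n))"
    using gfamD(4)[OF A, OF i z(2)] bump_commute[of i j n] by simp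
  then have "x \<otimes> (b \<otimes> z) \<in> A (bump j (bump i n))" using m_lcomm[OF bc xc zc] by simp
  then show "b \<otimes> z \<in> cfam K j x A (bump i n)"
    using E_bump_mult[OF K i z(1)] by (simp add: cfam_def)
next
  show "depends_on s (cfam K j x A)"
    unfolding depends_on_def
  proof (intro allI impI)
    fix n m :: "nat \<Rightarrow> nat" assume nm: "\<forall>i\<le>s. n i = m i"
    have "E K n = E K m" by (rule E_cong[OF K]) (use nm in simp)
    moreover have "A (bump j n) = A (bump j m)" by (rule gfamD(5)[OF A]) (use nm in \<open>simp add: bump_apply\<close>)
    ultimately show "cfam K j x A n = cfam K j x A m" by (simp add: cfam_def)
  qed
qed

lemma cfam_upper:
  assumes "gfam K A" "j \<le> s" "x \<in> I j"
  shows "A n \<subseteq> cfam K j x A n"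
proof
  fix z assume z: "z \<in> A n"
  then show "z \<in> cfam K j x A n"
    using gfamD(4)[OF assms(1), OF assms(2,3) z] subsetD[OF gfamD(3)[OF assms(1)] z] by (simp add: cfam_def)
qed

lemma cfam_mono: "A (bump j n) \<subseteq> B (bump j n) \<Longrightarrow> cfam K j x A n \<subseteq> cfam K j x B n"
  by (auto simp: cfam_def)

lemma gfam_sum:
  assumes K: "ideal K R" and A: "gfam K A" and B: "gfam K B"
  shows "gfam K (\<lambda>n. A n <+> B n)"
  unfolding gfam_def
proof (intro conjI allI impI)
  fix n
  show "ideal (A n <+> B n) R" by (rule add_ideals[OF gfamD(1)[OF A] gfamD(1)[OF B]])
  show "K \<subseteq> A n <+> B n"
    using gfamD(2)[OF A] ideal_sum_upper(1)[OF gfamD(1)[OF A] gfamD(1)[OF B]] by blast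
  show "A n <+> B n \<subseteq> E K n"
    using E_ideal[OF K] gfamD(3)[OF A] gfamD(3)[OF B] by (rule ideal_sum_least)
  fix j a z assume j: "j \<le> s" "a \<in> I j" "z \<in> A n <+> B n"
  then obtain u v where uv: "u \<in> A n" "v \<in> B n" "z = u \<oplus> v" by (auto simp: set_add_iff)
  have car: "a \<in> carrier R" "u \<in> carrier R" "v \<in> carrier R"
    using j uv I_ideal gfamD(1)[OF A] gfamD(1)[OF B] idealD(3) by blast+
  show "a \<otimes> z \<in> A (bump j n) <+> B (bump j n)"
    unfolding uv(3) set_add_iff r_distr[OF car(2,3,1)]
    using gfamD(4)[OF A, OF j(1,2) uv(1)] gfamD(4)[OF B, OF j(1,2) uv(2)] by blast
next
  show "depends_on s (\<lambda>n. A n <+> B n)"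
    unfolding depends_on_def
  proof (intro allI impI)
    fix n m :: "nat \<Rightarrow> nat" assume nm: "\<forall>i\<le>s. n i = m i"
    have "A n = A m" "B n = B m" using nm by (intro gfamD(5)[OF A] gfamD(5)[OF B]; simp)+
    then show "A n <+> B n = A m <+> B m" by simp
  qed
qed

text \<open>The graded submodule generated by \<open>z\<close> in degree \<open>n\<close>. In
  degrees that do not dominate \<open>n\<close> truncated subtraction would produce unwanted
  multiples of \<open>z\<close>, whence the case distinction.\<close>

definition zfam :: "'a set \<Rightarrow> (nat \<Rightarrow> nat) \<Rightarrow> 'a \<Rightarrow> (nat \<Rightarrow> nat) \<Rightarrow> 'a set" where
  "zfam K n z m =
    (if \<forall>j\<le>s. n j \<le> m j then (\<lambda>w. z \<otimes> w) ` E K (\<lambda>j. m j - n j) <+> K else K)"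

lemma gfam_zfam:
  assumes K: "ideal K R" and z: "z \<in> E K n"
  shows "gfam K (zfam K n z)"
  unfolding gfam_def
proof (intro conjI allI impI)
  have zc: "z \<in> carrier R" by (rule idealD(3)[OF E_ideal[OF K] z])
  note sm = smult_ideal[OF E_ideal[OF K] zc]
  have Ksub: "K \<subseteq> zfam K n z m" for m using ideal_sum_upper(2)[OF sm K] by (simp add: zfam_def)
  fix m
  show "ideal (zfam K n z m) R" using K add_ideals[OF sm K] by (simp add: zfam_def)
  show "K \<subseteq> zfam K n z m" by (rule Ksub)
  show "zfam K n z m \<subseteq> E K m"
  proof (cases "\<forall>j\<le>s. n j \<le> m j")
    case True
    then have "E K (\<lambda>j. n j + (m j - n j)) = E K m" by (intro E_cong[OF K]) simp
    then have "(\<lambda>w. z \<otimes> w) ` E K (\<lambda>j. m j - n j) \<subseteq> E K m"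
      using E_mult[OF K z] by auto
    then show ?thesis using True ideal_sum_least[OF E_ideal[OF K] _ K_sub_E[OF K]] by (simp add: zfam_def)
  qed (use K_sub_E[OF K] in \<open>auto simp: zfam_def\<close>)
  fix i a u assume i: "i \<le> s" "a \<in> I i" and u: "u \<in> zfam K n z m"
  have ac: "a \<in> carrier R" by (rule idealD(3)[OF I_ideal[OF i(1)] i(2)])
  show "a \<otimes> u \<in> zfam K n z (bump i m)"
  proof (cases "\<forall>j\<le>s. n j \<le> m j")
    case True
    then have "u \<in> (\<lambda>w. z \<otimes> w) ` E K (\<lambda>j. m j - n j) <+> K" using u by (simp add: zfam_def)
    then obtain e k where ek: "e \<in> E K (\<lambda>j. m j - n j)" "k \<in> K" "u = z \<otimes> e \<oplus> k"
      by (auto simp: set_add_iff)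
    have eq: "bump i (\<lambda>j. m j - n j) = (\<lambda>j. bump i m j - n j)"
      using True i(1) by (auto simp: fun_eq_iff bump_apply Suc_diff_le)
    have "a \<otimes> e \<in> E K (\<lambda>j. bump i m j - n j)"
      using E_bump_mult[OF K i ek(1)] by (simp add: eq)
    moreover have "a \<otimes> u = z \<otimes> (a \<otimes> e) \<oplus> a \<otimes> k"
      unfolding ek(3) using ac zc idealD(3)[OF K ek(2)] idealD(3)[OF E_ideal[OF K] ek(1)]
      by (simp add: r_distr m_lcomm)
    moreover have "a \<otimes> k \<in> K" by (rule idealD(7)[OF K ek(2) ac])
    ultimately have "a \<otimes> u \<in> (\<lambda>w. z \<otimes> w) ` E K (\<lambda>j. bump i m j - n j) <+> K"
      unfolding set_add_iff by blast
    moreover have "\<forall>j\<le>s. n j \<le> bump i m j" using True by (simp add: bump_apply le_SucI)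
    ultimately show ?thesis by (simp add: zfam_def)
  next
    case False
    then have "zfam K n z m = K" unfolding zfam_def by (rule if_not_P)
    then have "a \<otimes> u \<in> K" using idealD(7)[OF K _ ac] u by simp
    then show ?thesis using Ksub by blast
  qed
next
  show "depends_on s (zfam K n z)"
    unfolding depends_on_def
  proof (intro allI impI)
    fix m m' :: "nat \<Rightarrow> nat" assume mm: "\<forall>i\<le>s. m i = m' i"
    have "E K (\<lambda>j. m j - n j) = E K (\<lambda>j. m' j - n j)" by (rule E_cong[OF K]) (use mm in simp)
    moreover have "(\<forall>j\<le>s. n j \<le> m j) = (\<forall>j\<le>s. n j \<le> m' j)" using mm by auto
    ultimately show "zfam K n z m = zfam K n z m'" unfolding zfam_def by (simp only:)
  qed
qed

abbreviation unit_exp :: "nat \<Rightarrow> nat \<Rightarrow> nat" where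
  "unit_exp j \<equiv> (\<lambda>i. if i = j then 1 else 0)"

lemma mem_E_unit_exp: "ideal K R \<Longrightarrow> j \<le> s \<Longrightarrow> x \<in> I j \<Longrightarrow> x \<in> E K (unit_exp j)"
  using mp_sub_E[of K "unit_exp j"] mp_single[of j] by auto

definition xfam :: "'a set \<Rightarrow> nat \<Rightarrow> 'a \<Rightarrow> (nat \<Rightarrow> nat) \<Rightarrow> 'a set" where
  "xfam K j x = zfam K (unit_exp j) x"

lemma gfam_xfam: "ideal K R \<Longrightarrow> j \<le> s \<Longrightarrow> x \<in> I j \<Longrightarrow> gfam K (xfam K j x)"
  unfolding xfam_def by (intro gfam_zfam mem_E_unit_exp)

lemma xfam_eq:
  assumes "j \<le> s"
  shows "xfam K j x n = (if 0 < n j then (\<lambda>z. x \<otimes> z) ` E K (n(j := n j - 1)) <+> K else K)"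
proof -
  have "(\<lambda>i. n i - unit_exp j i) = n(j := n j - 1)" by auto
  moreover have "(\<forall>i\<le>s. unit_exp j i \<le> n i) \<longleftrightarrow> 0 < n j" using assms by auto
  ultimately show ?thesis by (simp add: xfam_def zfam_def)
qed

text \<open>The colon modules A_i : x^k, taken modulo multiples of \<open>x\<close>, play the part
  of the ideals of leading coefficients in degree k in Hilbert's basis theorem. Once they are
  stationary in i for all k simultaneously, so are the A_i.\<close>

lemma gfam_acc_step:
  assumes K: "ideal K R" and j: "j \<le> s" "x \<in> I j" and acc: "gfam_acc K (insert (j, x) X)"
  shows "gfam_acc K X"
  unfolding gfam_acc_def
proof (intro allI impI)
  fix A :: "nat \<Rightarrow> (nat \<Rightarrow> nat) \<Rightarrow> 'a set"
  assume "\<forall>i. gfam K (A i) \<and> mclosed K X (A i)" and up: "\<forall>i n. A i n \<subseteq> A (Suc i) n"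
  then have g: "gfam K (A i)" and c: "mclosed K X (A i)" for i by simp_all
  have xc: "x \<in> carrier R" using j I_ideal idealD(3) by blast
  note sm = smult_ideal[OF E_ideal[OF K] xc]
  define C where "C i k = (cfam K j x ^^ k) (A i)" for i k
  define B where "B i k n = C i k n <+> xfam K j x n" for i k n
  have C0: "C i 0 = A i" and CS: "C i (Suc k) = cfam K j x (C i k)" for i k by (simp_all add: C_def)
  have gC: "gfam K (C i k)" for i k
    by (induction k) (simp_all add: C0 CS g gfam_cfam[OF K _ j])
  have gB: "gfam K (B i k)" for i k
    unfolding B_def by (rule gfam_sum[OF K gC gfam_xfam[OF K j]])
  have Ci: "C i k n \<subseteq> C (Suc i) k n" for i k n
    by (induction k arbitrary: n) (use up in \<open>simp_all add: C0 CS cfam_mono\<close>)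
  have Ck: "C i k n \<subseteq> C i (Suc k) n" for i k n
    unfolding CS by (rule cfam_upper[OF gC j])
  have Bi: "B i k n \<subseteq> B i' k n" if "i \<le> i'" for i i' k n
    using lift_Suc_mono_le[of "\<lambda>i. B i k n", OF _ that] Ci by (simp add: B_def ideal_sum_mono)
  have Bk: "B i k n \<subseteq> B i k' n" if "k \<le> k'" for i k k' n
    using lift_Suc_mono_le[of "\<lambda>k. B i k n", OF _ that] Ck by (simp add: B_def ideal_sum_mono)
  have AC: "A i n \<subseteq> C i k n" for i k n
    using lift_Suc_mono_le[of "\<lambda>k. C i k n" 0 k] Ck C0 by simp
  have cB: "mclosed K (insert (j, x) X) (B i k)" for i k
    unfolding mclosed_def
  proof safe
    fix n z assume z: "z \<in> E K n"
    have "0 < bump j n j" "(bump j n)(j := bump j n j - 1) = n" by (auto simp: bump_def)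
    then have "x \<otimes> z \<in> (\<lambda>z. x \<otimes> z) ` E K ((bump j n)(j := bump j n j - 1))" using z by simp
    then have "x \<otimes> z \<in> xfam K j x (bump j n)"
      using ideal_sum_upper(1)[OF sm K] \<open>0 < bump j n j\<close> unfolding xfam_eq[OF j(1)] by auto
    then show "x \<otimes> z \<in> B i k (bump j n)"
      unfolding B_def using ideal_sum_upper(2)[OF gfamD(1)[OF gC] gfamD(1)[OF gfam_xfam[OF K j]]] by blast
  next
    fix i' y n z assume y: "(i', y) \<in> X" and z: "z \<in> E K n"
    have "y \<otimes> z \<in> A i (bump i' n)" using c[of i] y z unfolding mclosed_def by blast
    then show "y \<otimes> z \<in> B i k (bump i' n)"
      unfolding B_def
      using AC ideal_sum_upper(1)[OF gfamD(1)[OF gC] gfamD(1)[OF gfam_xfam[OF K j]]] by blast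
  qed
  have stab: "\<exists>m. \<forall>i\<ge>m. F i = F m" if "\<And>i. gfam K (F i) \<and> mclosed K (insert (j, x) X) (F i)"
    "\<And>i n. F i n \<subseteq> F (Suc i) n" for F :: "nat \<Rightarrow> (nat \<Rightarrow> nat) \<Rightarrow> 'a set"
    using acc that unfolding gfam_acc_def by simp
  \<comment> \<open>\<open>B\<close> is monotone in both indices, so the index \<open>m0\<close> at
    which the diagonal stabilises controls every k from \<open>m0\<close> on. The finitely many
    smaller k are treated one by one.\<close>
  have "\<exists>m. \<forall>i\<ge>m. B i i = B m m"
  proof (rule stab)
    show "gfam K (B i i) \<and> mclosed K (insert (j, x) X) (B i i)" for i using gB cB by simp
    show "B i i n \<subseteq> B (Suc i) (Suc i) n" for i n
      using Bi[of i "Suc i" i n] Bk[of i "Suc i" "Suc i" n] by (meson le_Suc_eq order_refl subset_trans)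
  qed
  then obtain m0 where m0: "\<And>i. m0 \<le> i \<Longrightarrow> B i i = B m0 m0" by blast
  have "\<exists>m. \<forall>i\<ge>m. B i k = B m k" for k
    by (rule stab) (use gB cB Bi in simp_all)
  then obtain mk where mk: "\<And>k i. mk k \<le> i \<Longrightarrow> B i k = B (mk k) k" by metis
  define M where "M = Max (insert m0 (mk ` {..<m0}))"
  have M0: "m0 \<le> M" and Mk: "k < m0 \<Longrightarrow> mk k \<le> M" for k by (auto simp: M_def)
  have BM: "B i k = B M k" if "M \<le> i" for i k
  proof (cases "k < m0")
    case True
    then have "B i k = B (mk k) k" "B M k = B (mk k) k" using Mk[OF True] that by (auto intro!: mk)
    then show ?thesis by simp
  next
    case False
    have "B i k = B m0 m0" if "m0 \<le> i" for i
    proof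
      fix n
      have "B m0 m0 n \<subseteq> B i k n"
        using Bi[OF that, of m0 n] Bk[of m0 k i n] False by simp
      moreover have "B i k n \<subseteq> B (max i k) (max i k) n"
        using Bi[of i "max i k" k n] Bk[of k "max i k" "max i k" n] by simp
      moreover have "B (max i k) (max i k) = B m0 m0" by (rule m0) (use that in simp)
      ultimately show "B i k n = B m0 m0 n" by auto
    qed
    then show ?thesis using that M0 by (metis order_trans)
  qed
  \<comment> \<open>Cancelling a factor \<open>x\<close> lowers the j-th degree and raises the colon
    exponent, so the induction on \<open>n j\<close> keeps \<open>k\<close> arbitrary, although only
    k = 0 is wanted in the end.\<close>
  have "z \<in> C M k n" if "M \<le> i" "z \<in> C i k n" for i k n z
    using that(2)
  proof (induction "n j" arbitrary: n k z)
    case 0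
    have "z \<in> B i k n" using 0 ideal_sum_upper(1)[OF gfamD(1)[OF gC] gfamD(1)[OF gfam_xfam[OF K j]]]
      unfolding B_def by blast
    then have "z \<in> B M k n" using BM[OF that(1)] by simp
    then have "z \<in> C M k n <+> K" using 0(1) by (simp add: B_def xfam_eq[OF j(1)])
    then show ?case using ideal_sum_absorb[OF gfamD(1)[OF gC] K gfamD(2)[OF gC]] by blast
  next
    case (Suc m)
    let ?n = "n(j := n j - 1)"
    have nj: "0 < n j" "m = ?n j" using Suc.hyps(2) by auto
    have bn: "bump j ?n = n" using bump_pred[of n j] nj by simp
    have "z \<in> B i k n" using Suc.prems ideal_sum_upper(1)[OF gfamD(1)[OF gC] gfamD(1)[OF gfam_xfam[OF K j]]]
      unfolding B_def by blast
    then have "z \<in> B M k n" using BM[OF that(1)] by simp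
    then have "z \<in> C M k n <+> ((\<lambda>z. x \<otimes> z) ` E K ?n <+> K)"
      using nj by (simp add: B_def xfam_eq[OF j(1)])
    then obtain z' e \<kappa> where z: "z' \<in> C M k n" "e \<in> E K ?n" "\<kappa> \<in> K" "z = z' \<oplus> (x \<otimes> e \<oplus> \<kappa>)"
      by (auto simp: set_add_iff)
    have car: "z' \<in> carrier R" "e \<in> carrier R" "\<kappa> \<in> carrier R"
      using z K gfamD(1)[OF gC] E_ideal[OF K] idealD(3) by blast+
    have CM: "C M k n \<subseteq> C i k n"
      using lift_Suc_mono_le[of "\<lambda>i. C i k n", OF _ that(1)] Ci by simp
    have "z \<ominus> z' \<ominus> \<kappa> \<in> C i k n"
    proof (intro idealD(5)[OF gfamD(1)[OF gC]])
      show "z \<in> C i k n" by (rule Suc.prems)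
      show "z' \<in> C i k n" using CM z(1) by (rule subsetD)
      show "\<kappa> \<in> C i k n" using gfamD(2)[OF gC] z(3) by (rule subsetD)
    qed
    moreover have "z \<ominus> z' \<ominus> \<kappa> = x \<otimes> e"
      unfolding z(4) using car xc by (simp add: a_minus_def a_ac r_neg r_neg1 r_neg2)
    ultimately have "x \<otimes> e \<in> C i k n" by simp
    then have "e \<in> C i (Suc k) ?n" using z(2) bn by (simp add: CS cfam_def)
    then have "e \<in> C M (Suc k) ?n" using Suc.hyps(1)[of ?n e "Suc k"] nj(2) by simp
    then have "x \<otimes> e \<in> C M k n" using bn by (simp add: CS cfam_def)
    then show ?case
      unfolding z(4) by (intro idealD(4)[OF gfamD(1)[OF gC]] z(1) subsetD[OF gfamD(2)[OF gC] z(3)])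
  qed
  from this[of _ _ 0] have "A i n \<subseteq> A M n" if "M \<le> i" for i n using that by (auto simp: C0)
  moreover have "A M n \<subseteq> A i n" if "M \<le> i" for i n
    using lift_Suc_mono_le[of "\<lambda>i. A i n", OF _ that] up by simp
  ultimately have "A i = A M" if "M \<le> i" for i
    using that by (intro ext equalityI) simp_all
  then show "\<exists>m. \<forall>i\<ge>m. A i = A m" by blast
qed

text \<open>Finite generating systems of all I_j are taken away one element after another;
  \<open>D\<close> is the part already removed.\<close>

lemma gfam_acc_empty:
  assumes K: "ideal K R"
  shows "gfam_acc K {}"
proof -
  have "\<forall>j. \<exists>G. j \<le> s \<longrightarrow> G \<subseteq> carrier R \<and> finite G \<and> I j = Idl G"
    using finetely_gen[OF I_ideal] by blast
  then obtain G where G: "\<And>j. j \<le> s \<Longrightarrow> G j \<subseteq> carrier R \<and> finite (G j) \<and> I j = Idl (G j)"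
    by metis
  define X where "X = Sigma {..s} G"
  have fin: "finite X" unfolding X_def using G by (intro finite_SigmaI) auto
  have "gfam_acc K (X - D)" if "finite D" "D \<subseteq> X" for D
    using that
  proof (induction D rule: finite_induct)
    case empty
    have "{x. (j, x) \<in> X} = G j" if "j \<le> s" for j using that by (auto simp: X_def)
    then show ?case using G by (intro gfam_acc_base[OF K]) auto
  next
    case (insert p D)
    obtain j x where p: "p = (j, x)" by (cases p)
    have jx: "j \<le> s" "x \<in> G j" using insert p by (auto simp: X_def)
    then have "x \<in> I j" using G genideal_self by blast
    moreover have "insert (j, x) (X - insert p D) = X - D" using insert p by auto
    ultimately show ?case using gfam_acc_step[OF K jx(1)] insert by simp
  qed
  from this[OF fin order_refl] show ?thesis by simp
qed

lemma gfam_chain_stable: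
  assumes "ideal K R" "\<And>i. gfam K (A i)" "\<And>i n. A i n \<subseteq> A (Suc i) n"
  obtains m where "\<And>i. m \<le> i \<Longrightarrow> A i = A m"
proof -
  have "\<exists>m. \<forall>i\<ge>m. A i = A m"
    using gfam_acc_empty[OF assms(1)] assms(2,3) by (simp add: gfam_acc_def mclosed_def)
  then show ?thesis using that by blast
qed

lemma gfam_maximal:
  assumes K: "ideal K R" and "\<S> \<noteq> {}" "\<And>A. A \<in> \<S> \<Longrightarrow> gfam K A"
  shows "\<exists>M\<in>\<S>. \<forall>X\<in>\<S>. M \<le> X \<longrightarrow> X = M"
proof (rule ccontr)
  assume "\<not> ?thesis"
  then obtain f where f: "\<And>M. M \<in> \<S> \<Longrightarrow> f M \<in> \<S> \<and> M \<le> f M \<and> f M \<noteq> M" by metis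
  obtain A0 where "A0 \<in> \<S>" using assms(2) by blast
  define A where "A i = (f ^^ i) A0" for i
  have AS: "A i \<in> \<S>" for i by (induction i) (simp_all add: A_def f \<open>A0 \<in> \<S>\<close>)
  have A_Suc: "A (Suc i) = f (A i)" for i by (simp add: A_def)
  have "A i n \<subseteq> A (Suc i) n" for i n
    using f[OF AS[of i]] unfolding A_Suc le_fun_def by blast
  then obtain m where "\<And>i. m \<le> i \<Longrightarrow> A i = A m"
    using gfam_chain_stable[OF K, of A] assms(3)[OF AS] by blast
  from this[of "Suc m"] have "A (Suc m) = A m" by simp
  then show False using f[OF AS[of m]] unfolding A_Suc by blast
qed

section \<open>The Artin--Rees lemma for several ideals\<close>

lemma ideal_prod_mono: "A \<subseteq> A' \<Longrightarrow> B \<subseteq> B' \<Longrightarrow> A \<cdot> B \<subseteq> A' \<cdot> B'"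
proof
  fix x assume s: "A \<subseteq> A'" "B \<subseteq> B'" and "x \<in> A \<cdot> B"
  from this(3) show "x \<in> A' \<cdot> B'"
    by induction (use s in \<open>auto intro: ideal_prod.intros\<close>)
qed

text \<open>The families I^(n - c) a + K, cut down to the intersection of \<open>a\<close> with
  \<open>E K n\<close>, are graded submodules that increase with \<open>c\<close>, so they become
  stationary. For fixed \<open>n\<close> and huge \<open>c\<close> they exhaust that intersection.
  The subtraction is truncated in each coordinate.\<close>

theorem artin_rees:
  assumes K: "ideal K R" and a: "ideal a R" and Ka: "K \<subseteq> a"
  shows "\<exists>c. \<forall>n. a \<inter> E K n \<subseteq> mp (\<lambda>j. n j - c) \<cdot> a <+> K"
proof -
  define P where "P c n = mp (\<lambda>j. n j - c) \<cdot> a" for c n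
  define G where "G c n = a \<inter> E K n \<inter> (P c n <+> K)" for c n
  have P: "ideal (P c n) R" for c n
    unfolding P_def by (rule ideal_prod_is_ideal[OF mp_ideal a])
  have PK: "ideal (P c n <+> K) R" for c n by (rule add_ideals[OF P K])
  have step: "b \<otimes> w \<in> P c (bump j n)" if "j \<le> s" "b \<in> I j" "w \<in> P c n" for b w c j n
  \<comment> \<open>Below \<open>c\<close> the truncated exponent does not move, and the factor
    \<open>b\<close> is absorbed by the ideal.\<close>
  proof (cases "c \<le> n j")
    case True
    have "(\<lambda>i. bump j n i - c) = bump j (\<lambda>i. n i - c)"
      using True by (auto simp: fun_eq_iff bump_apply Suc_diff_le)
    then have "P c (bump j n) = I j \<cdot> P c n"
      unfolding P_def using mp_bump[OF that(1)] ideal_prod_assoc[OF I_ideal[OF that(1)] mp_ideal a] by simp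
    then show ?thesis using that(2,3) by (simp add: ideal_prod.prod)
  next
    case False
    have "(\<lambda>i. bump j n i - c) = (\<lambda>i. n i - c)"
      using False by (auto simp: fun_eq_iff bump_apply)
    then have "P c (bump j n) = P c n" unfolding P_def by simp
    then show ?thesis
      using idealD(7)[OF P that(3) idealD(3)[OF I_ideal[OF that(1)] that(2)]] by simp
  qed
  have gG: "gfam K (G c)" for c
    unfolding gfam_def
  proof (intro conjI allI impI)
    fix n
    show "ideal (G c n) R" unfolding G_def by (intro i_intersect a E_ideal[OF K] PK)
    show "K \<subseteq> G c n" unfolding G_def using Ka K_sub_E[OF K] ideal_sum_upper(2)[OF P K] by blast
    show "G c n \<subseteq> E K n" unfolding G_def by blast
    fix j b z assume j: "j \<le> s" "b \<in> I j" and z: "z \<in> G c n"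
    have bc: "b \<in> carrier R" by (rule idealD(3)[OF I_ideal[OF j(1)] j(2)])
    have z3: "z \<in> a" "z \<in> E K n" "z \<in> P c n <+> K" using z by (auto simp: G_def)
    obtain w k where wk: "w \<in> P c n" "k \<in> K" "z = w \<oplus> k" using z3(3) by (auto simp: set_add_iff)
    have "b \<otimes> z = b \<otimes> w \<oplus> b \<otimes> k"
      unfolding wk(3) using bc idealD(3)[OF P wk(1)] idealD(3)[OF K wk(2)] by (simp add: r_distr)
    moreover have "b \<otimes> w \<in> P c (bump j n)" by (rule step[OF j wk(1)])
    moreover have "b \<otimes> k \<in> K" by (rule idealD(7)[OF K wk(2) bc])
    ultimately have "b \<otimes> z \<in> P c (bump j n) <+> K" unfolding set_add_iff by blast
    then show "b \<otimes> z \<in> G c (bump j n)"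
      unfolding G_def using idealD(7)[OF a z3(1) bc] E_bump_mult[OF K j z3(2)] by blast
  next
    show "depends_on s (G c)"
      unfolding depends_on_def
    proof (intro allI impI)
      fix n m :: "nat \<Rightarrow> nat" assume nm: "\<forall>i\<le>s. n i = m i"
      have "E K n = E K m" by (rule E_cong[OF K]) (use nm in simp)
      moreover have "mp (\<lambda>j. n j - c) = mp (\<lambda>j. m j - c)" by (rule mp_cong) (use nm in simp)
      ultimately show "G c n = G c m" by (simp add: G_def P_def)
    qed
  qed
  have up: "G c n \<subseteq> G (Suc c) n" for c n
  proof -
    have "mp (\<lambda>j. n j - c) \<subseteq> mp (\<lambda>j. n j - Suc c)" by (rule mp_antimono[OF K]) simp
    then have "P c n \<subseteq> P (Suc c) n" unfolding P_def by (intro ideal_prod_mono) auto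
    then show ?thesis unfolding G_def using ideal_sum_mono[of "P c n" "P (Suc c) n" K K] by blast
  qed
  obtain m where m: "\<And>i. m \<le> i \<Longrightarrow> G i = G m" using gfam_chain_stable[of K G, OF K gG up] by blast
  have "a \<inter> E K n \<subseteq> P m n <+> K" for n
  proof -
    \<comment> \<open>\<open>i\<close> is past the point of stabilisation and bounds all exponents,
      so I^(n - i) is the unit ideal.\<close>
    define i where "i = m + (\<Sum>j\<le>s. n j)"
    have "n j \<le> i" if "j \<le> s" for j
      using member_le_sum[of j "{..s}" n] that by (simp add: i_def)
    then have "mp (\<lambda>j. n j - i) = carrier R" by (intro mp_zero) simp
    then have "P i n = a" unfolding P_def by (simp add: one_ideal_prod[OF a])
    then have "a \<inter> E K n \<subseteq> G i n" unfolding G_def using ideal_sum_upper(1)[OF a K] by auto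
    also have "G i n = G m n" using m[of i] by (simp add: i_def)
    finally show ?thesis by (auto simp: G_def)
  qed
  then show ?thesis unfolding P_def by blast
qed

end

section \<open>Superficial elements\<close>

lemma (in ring) add_minus_cancel:
  assumes "a \<in> carrier R" "b \<in> carrier R"
  shows "a \<oplus> b \<ominus> b = a" "a \<oplus> b \<ominus> a = b"
proof -
  have *: "a \<oplus> b \<ominus> b = a" if "a \<in> carrier R" "b \<in> carrier R" for a b
    using that by (simp add: a_minus_def a_assoc r_neg)
  show "a \<oplus> b \<ominus> b = a" by (rule *) (rule assms)+
  show "a \<oplus> b \<ominus> a = b" unfolding a_comm[OF assms] by (rule *) (rule assms)+
qed

section \<open>Filter-regular elements and annihilators of homogeneous elements\<close>

context ideal_family
begin

text \<open>The graded annihilator of the class of \<open>z\<close>, an element of degree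
  \<open>n\<close>, modulo \<open>A\<close>.\<close>

definition afam :: "'a set \<Rightarrow> ((nat \<Rightarrow> nat) \<Rightarrow> 'a set) \<Rightarrow> (nat \<Rightarrow> nat) \<Rightarrow> 'a \<Rightarrow> (nat \<Rightarrow> nat) \<Rightarrow> 'a set" where
  "afam K A n z m = {w \<in> E K m. w \<otimes> z \<in> A (\<lambda>j. m j + n j)}"

lemma gfam_afam:
  assumes K: "ideal K R" and A: "gfam K A" and z: "z \<in> E K n"
  shows "gfam K (afam K A n z)"
  unfolding gfam_def
proof (intro conjI allI impI)
  have zc: "z \<in> carrier R" by (rule idealD(3)[OF E_ideal[OF K] z])
  fix m
  have ic: "ideal (colon R (A (\<lambda>j. m j + n j)) {z}) R"
    using gfamD(1)[OF A] zc by (intro colon_ideal) auto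
  have "afam K A n z m = E K m \<inter> colon R (A (\<lambda>j. m j + n j)) {z}"
    using idealD(3)[OF E_ideal[OF K]] by (auto simp: afam_def mem_colon_singleton)
  then show "ideal (afam K A n z m) R" using i_intersect[OF E_ideal[OF K] ic] by simp
  show "K \<subseteq> afam K A n z m"
  proof
    fix k assume k: "k \<in> K"
    have "k \<otimes> z \<in> A (\<lambda>j. m j + n j)"
      using idealD(8)[OF K k zc] gfamD(2)[OF A] by blast
    then show "k \<in> afam K A n z m" using k K_sub_E[OF K] by (auto simp: afam_def)
  qed
  show "afam K A n z m \<subseteq> E K m" by (auto simp: afam_def)
  fix i b w assume i: "i \<le> s" "b \<in> I i" and w: "w \<in> afam K A n z m"
  have w2: "w \<in> E K m" "w \<otimes> z \<in> A (\<lambda>j. m j + n j)" using w by (simp_all add: afam_def)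
  have bc: "b \<in> carrier R" by (rule idealD(3)[OF I_ideal[OF i(1)] i(2)])
  have wc: "w \<in> carrier R" by (rule idealD(3)[OF E_ideal[OF K] w2(1)])
  have "bump i (\<lambda>j. m j + n j) = (\<lambda>j. bump i m j + n j)" by (auto simp: fun_eq_iff bump_apply)
  then have "b \<otimes> (w \<otimes> z) \<in> A (\<lambda>j. bump i m j + n j)"
    using gfamD(4)[OF A, OF i w2(2)] by simp
  then show "b \<otimes> w \<in> afam K A n z (bump i m)"
    using E_bump_mult[OF K i w2(1)] bc wc zc by (simp add: afam_def m_assoc)
next
  show "depends_on s (afam K A n z)"
    unfolding depends_on_def
  proof (intro allI impI)
    fix m m' :: "nat \<Rightarrow> nat" assume mm: "\<forall>i\<le>s. m i = m' i"
    have "E K m = E K m'" by (rule E_cong[OF K]) (use mm in simp)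
    moreover have "A (\<lambda>j. m j + n j) = A (\<lambda>j. m' j + n j)" by (rule gfamD(5)[OF A]) (use mm in simp)
    ultimately show "afam K A n z m = afam K A n z m'" by (simp add: afam_def)
  qed
qed

lemma unit_exp_add: "(\<lambda>j. unit_exp i j + n j) = bump i n" "(\<lambda>j. n j + unit_exp i j) = bump i n"
  by (auto simp: fun_eq_iff bump_apply)

text \<open>The classical argument that a maximal annihilator is prime, for a factor
  \<open>x\<close> of degree e_i: if \<open>x\<close> does not kill the class of \<open>z\<close>,
  then the annihilator of x z contains that of \<open>z\<close> and so equals it.\<close>

lemma afam_prime:
  assumes K: "ideal K R" and A: "gfam K A" and z: "z \<in> E K n"
    and max: "\<And>n' z'. z' \<in> E K n' \<Longrightarrow> z' \<notin> A n' \<Longrightarrow> afam K A n z \<le> afam K A n' z'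
        \<Longrightarrow> afam K A n' z' = afam K A n z"
    and i: "i \<le> s" "x \<in> I i" and xn: "x \<notin> afam K A n z (unit_exp i)"
    and u: "u \<in> E K m" "x \<otimes> u \<in> afam K A n z (bump i m)"
  shows "u \<in> afam K A n z m"
proof -
  have xc: "x \<in> carrier R" by (rule idealD(3)[OF I_ideal[OF i(1)] i(2)])
  have zc: "z \<in> carrier R" by (rule idealD(3)[OF E_ideal[OF K] z])
  have uc: "u \<in> carrier R" by (rule idealD(3)[OF E_ideal[OF K] u(1)])
  have bc: "bump i (\<lambda>j. p j + n j) = (\<lambda>j. p j + bump i n j)"
    "(\<lambda>j. bump i p j + n j) = (\<lambda>j. p j + bump i n j)" for p
    by (auto simp: fun_eq_iff bump_apply)
  have xz: "x \<otimes> z \<in> E K (bump i n)" by (rule E_bump_mult[OF K i z])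
  have xzn: "x \<otimes> z \<notin> A (bump i n)"
    using xn mem_E_unit_exp[OF K i] by (simp add: afam_def unit_exp_add)
  have "afam K A n z \<le> afam K A (bump i n) (x \<otimes> z)"
    unfolding le_fun_def
  proof (intro allI subsetI)
    fix p w assume "w \<in> afam K A n z p"
    then have w: "w \<in> E K p" "w \<otimes> z \<in> A (\<lambda>j. p j + n j)" by (simp_all add: afam_def)
    have wc: "w \<in> carrier R" by (rule idealD(3)[OF E_ideal[OF K] w(1)])
    have "x \<otimes> (w \<otimes> z) \<in> A (\<lambda>j. p j + bump i n j)"
      using gfamD(4)[OF A, OF i w(2)] by (simp add: bc)
    moreover have "x \<otimes> (w \<otimes> z) = w \<otimes> (x \<otimes> z)" using xc wc zc by (simp add: m_lcomm)
    ultimately show "w \<in> afam K A (bump i n) (x \<otimes> z) p" using w(1) by (simp add: afam_def)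
  qed
  then have eq: "afam K A (bump i n) (x \<otimes> z) = afam K A n z" using max[OF xz xzn] by simp
  have "x \<otimes> u \<otimes> z \<in> A (\<lambda>j. m j + bump i n j)" using u(2) by (simp add: afam_def bc)
  moreover have "x \<otimes> u \<otimes> z = u \<otimes> (x \<otimes> z)" using xc uc zc by (simp add: m_comm m_lcomm m_assoc)
  ultimately have "u \<in> afam K A (bump i n) (x \<otimes> z) m" using u(1) by (simp add: afam_def)
  then show ?thesis using eq by simp
qed

text \<open>Elements of I_i outside the finitely many proper subideals are filter-regular modulo
  \<open>A\<close>, that is, what they kill vanishes in large degrees. The exceptional ideals are
  traces of associated primes on I_i.\<close>

definition avoids :: "'a set \<Rightarrow> nat \<Rightarrow> ((nat \<Rightarrow> nat) \<Rightarrow> 'a set) \<Rightarrow> 'a set set \<Rightarrow> bool" where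
  "avoids K i A \<B> \<longleftrightarrow> finite \<B> \<and> (\<forall>B\<in>\<B>. ideal B R \<and> B \<subset> I i) \<and>
     (\<forall>x\<in>I i - \<Union>\<B>. eventually (\<lambda>n. cfam K i x A n \<subseteq> A n) large)"

text \<open>One step of a prime filtration: adjoining \<open>z\<close> to \<open>A\<close> adds a
  copy of the Rees module modulo the prime Q = Ann z. If I_i lies in Q, this piece vanishes in large
  degrees and no exception is added; otherwise the trace of Q on I_i becomes one further
  exception.\<close>

lemma filter_regular_step:
  assumes K: "ideal K R" and i: "i \<le> s" and A: "gfam K A" and z: "z \<in> E K n"
    and max: "\<And>n' z'. z' \<in> E K n' \<Longrightarrow> z' \<notin> A n' \<Longrightarrow> afam K A n z \<le> afam K A n' z'
        \<Longrightarrow> afam K A n' z' = afam K A n z"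
    and IH: "avoids K i (\<lambda>m. A m <+> zfam K n z m) \<B>"
  shows "\<exists>\<B>. avoids K i A \<B>"
proof -
  let ?Q = "afam K A n z" and ?A' = "\<lambda>m. A m <+> zfam K n z m"
  have zc: "z \<in> carrier R" by (rule idealD(3)[OF E_ideal[OF K] z])
  note gQ = gfam_afam[OF K A z] and gZ = gfam_zfam[OF K z]
  have AA': "A m \<subseteq> ?A' m" for m by (rule ideal_sum_upper(1)[OF gfamD(1)[OF A] gfamD(1)[OF gZ]])
  have zA': "zfam K n z m \<subseteq> ?A' m" for m by (rule ideal_sum_upper(2)[OF gfamD(1)[OF A] gfamD(1)[OF gZ]])
  have \<B>: "finite \<B>" "\<And>B. B \<in> \<B> \<Longrightarrow> ideal B R \<and> B \<subset> I i"
    "\<And>x. x \<in> I i \<Longrightarrow> x \<notin> \<Union>\<B> \<Longrightarrow> eventually (\<lambda>n. cfam K i x ?A' n \<subseteq> ?A' n) large"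
    using IH unfolding avoids_def by auto
  \<comment> \<open>The strict inequality leaves room for one factor from I_i in degree m -
    n.\<close>
  have ge: "eventually (\<lambda>m. \<forall>j\<le>s. n j < m j) large"
  proof -
    have "n j < m j" if "\<forall>j. Suc (\<Sum>j\<le>s. n j) \<le> m j" "j \<le> s" for m j
      using that(1)[rule_format, of j] member_le_sum[of j "{..s}" n] that(2) by simp
    then show ?thesis unfolding eventually_large by blast
  qed
  have dec: "\<exists>a e k. a \<in> A m \<and> e \<in> E K (\<lambda>j. m j - n j) \<and> k \<in> K \<and> w = a \<oplus> (z \<otimes> e \<oplus> k)"
    if "w \<in> ?A' m" "\<forall>j\<le>s. n j < m j" for w m
  proof -
    have "\<forall>j\<le>s. n j \<le> m j" using that(2) less_imp_le by blast
    then have "zfam K n z m = (\<lambda>w. z \<otimes> w) ` E K (\<lambda>j. m j - n j) <+> K"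
      unfolding zfam_def by (rule if_P)
    then have "w \<in> A m <+> ((\<lambda>w. z \<otimes> w) ` E K (\<lambda>j. m j - n j) <+> K)" using that(1) by simp
    then obtain a b where ab: "a \<in> A m" "b \<in> (\<lambda>w. z \<otimes> w) ` E K (\<lambda>j. m j - n j) <+> K" "w = a \<oplus> b"
      unfolding set_add_iff by (elim bexE) (rule that)
    from ab(2) obtain e k where ek: "e \<in> E K (\<lambda>j. m j - n j)" "k \<in> K" "b = z \<otimes> e \<oplus> k"
      by (auto simp: set_add_iff)
    show ?thesis
    proof (intro exI conjI)
      show "w = a \<oplus> (z \<otimes> e \<oplus> k)" unfolding ab(3) ek(3) ..
    qed (rule ab ek)+
  qed
  have cong: "A (\<lambda>j. m j - n j + n j) = A m" if "\<forall>j\<le>s. n j < m j" for m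
    by (rule gfamD(5)[OF A]) (use that in \<open>simp add: less_imp_le\<close>)
  show ?thesis
  proof (cases "I i \<subseteq> ?Q (unit_exp i)")
    case True
    have "avoids K i A \<B>"
      unfolding avoids_def
    proof (intro conjI ballI \<B>(1))
      show "ideal B R" "B \<subset> I i" if "B \<in> \<B>" for B using \<B>(2)[OF that] by auto
      fix x assume x: "x \<in> I i - \<Union>\<B>"
      from \<B>(3)[of x] x have "eventually (\<lambda>n. cfam K i x ?A' n \<subseteq> ?A' n) large" by blast
      then show "eventually (\<lambda>n. cfam K i x A n \<subseteq> A n) large"
        using ge
      proof eventually_elim
        case (elim m)
        show ?case
        proof
          fix w assume w: "w \<in> cfam K i x A m"
          then have "w \<in> cfam K i x ?A' m" using AA' by (auto simp: cfam_def)
          then obtain a e k where aek: "a \<in> A m" "e \<in> E K (\<lambda>j. m j - n j)" "k \<in> K" "w = a \<oplus> (z \<otimes> e \<oplus> k)"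
            using dec[OF _ elim(2)] elim(1) by blast
          define m' where "m' = (\<lambda>j. m j - n j)(i := m i - n i - 1)"
          have mm: "(\<lambda>j. m j - n j) = bump i m'"
            using elim(2) i by (auto simp: fun_eq_iff bump_apply m'_def)
          \<comment> \<open>I_i kills the class of \<open>z\<close>, and modulo \<open>K\<close>
            everything of degree m - n is a sum of products with a factor from I_i. So
            \<open>A\<close> and its enlargement by \<open>z\<close> agree in degree
            \<open>m\<close>.\<close>
          have "E K (bump i m') \<subseteq> colon R (A m) {z}"
          proof (rule E_bump_least[OF K i])
            show "ideal (colon R (A m) {z}) R" using gfamD(1)[OF A] zc by (intro colon_ideal) auto
            show "K \<subseteq> colon R (A m) {z}"
            proof
              fix k assume k: "k \<in> K"
              have "k \<otimes> z \<in> A m" using idealD(8)[OF K k zc] gfamD(2)[OF A] by blast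
              then show "k \<in> colon R (A m) {z}" using idealD(3)[OF K k] by (simp add: mem_colon_singleton)
            qed
            fix b v assume b: "b \<in> I i" and v: "v \<in> mp m'"
            have bc: "b \<in> carrier R" by (rule idealD(3)[OF I_ideal[OF i] b])
            have vc: "v \<in> carrier R" by (rule idealD(3)[OF mp_ideal v])
            have "b \<otimes> z \<in> A (bump i n)"
              using True b by (auto simp: afam_def unit_exp_add)
            moreover have "v \<in> E K m'" using v mp_sub_E[OF K] by blast
            ultimately have "v \<otimes> (b \<otimes> z) \<in> A (\<lambda>j. m' j + bump i n j)"
              using gfam_mult[OF K A, of v m' "b \<otimes> z" "bump i n"] by blast
            also have "A (\<lambda>j. m' j + bump i n j) = A (\<lambda>j. m j - n j + n j)"
              by (rule gfamD(5)[OF A]) (use elim(2) i in \<open>auto simp: bump_apply m'_def\<close>)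
            also have "\<dots> = A m" by (rule cong[OF elim(2)])
            finally have "v \<otimes> (b \<otimes> z) \<in> A m" .
            moreover have "v \<otimes> (b \<otimes> z) = b \<otimes> v \<otimes> z" using bc vc zc by (simp add: m_lcomm m_assoc)
            ultimately show "b \<otimes> v \<in> colon R (A m) {z}" using bc vc by (simp add: mem_colon_singleton)
          qed
          then have "e \<in> colon R (A m) {z}" using aek(2) mm by auto
          then have "z \<otimes> e \<in> A m" using zc by (simp add: mem_colon_singleton m_comm)
          moreover have "k \<in> A m" using aek(3) gfamD(2)[OF A] by blast
          ultimately show "w \<in> A m"
            unfolding aek(4) using aek(1) by (intro idealD(4)[OF gfamD(1)[OF A]])
        qed
      qed
    qed
    then show ?thesis by blast
  next
    case False
    define B0 where "B0 = ?Q (unit_exp i) \<inter> I i"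
    have "avoids K i A (insert B0 \<B>)"
      unfolding avoids_def
    proof (intro conjI ballI)
      show "finite (insert B0 \<B>)" using \<B>(1) by simp
      show "ideal B R" "B \<subset> I i" if "B \<in> insert B0 \<B>" for B
        using that \<B>(2) i_intersect[OF gfamD(1)[OF gQ] I_ideal[OF i]] False unfolding B0_def by auto
      fix x assume x: "x \<in> I i - \<Union> (insert B0 \<B>)"
      then have xi: "x \<in> I i" and xQ: "x \<notin> ?Q (unit_exp i)" by (auto simp: B0_def)
      have xc: "x \<in> carrier R" by (rule idealD(3)[OF I_ideal[OF i] xi])
      from \<B>(3)[of x] x have "eventually (\<lambda>n. cfam K i x ?A' n \<subseteq> ?A' n) large" by blast
      then show "eventually (\<lambda>n. cfam K i x A n \<subseteq> A n) large"
        using ge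
      proof eventually_elim
        case (elim m)
        show ?case
        proof
          fix w assume w: "w \<in> cfam K i x A m"
          then have "w \<in> cfam K i x ?A' m" using AA' by (auto simp: cfam_def)
          then obtain a e k where aek: "a \<in> A m" "e \<in> E K (\<lambda>j. m j - n j)" "k \<in> K" "w = a \<oplus> (z \<otimes> e \<oplus> k)"
            using dec[OF _ elim(2)] elim(1) by blast
          let ?m = "\<lambda>j. m j - n j"
          have kA: "k \<in> A m" using aek(3) gfamD(2)[OF A] by blast
          have car: "a \<in> carrier R" "e \<in> carrier R" "k \<in> carrier R"
            using idealD(3)[OF gfamD(1)[OF A] aek(1)] idealD(3)[OF E_ideal[OF K] aek(2)] idealD(3)[OF K aek(3)] .
          have xw: "x \<otimes> w \<in> A (bump i m)" using w by (simp add: cfam_def)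
          have xa: "x \<otimes> a \<in> A (bump i m)" by (rule gfamD(4)[OF A, OF i xi aek(1)])
          have xk: "x \<otimes> k \<in> A (bump i m)" by (rule gfamD(4)[OF A, OF i xi kA])
          have "x \<otimes> w \<ominus> x \<otimes> a \<ominus> x \<otimes> k \<in> A (bump i m)"
            by (intro idealD(5)[OF gfamD(1)[OF A]] xw xa xk)
          moreover have "x \<otimes> w \<ominus> x \<otimes> a \<ominus> x \<otimes> k = x \<otimes> e \<otimes> z"
          proof -
            have "x \<otimes> w = x \<otimes> a \<oplus> (x \<otimes> e \<otimes> z \<oplus> x \<otimes> k)"
              unfolding aek(4) using car xc zc m_comm[of z e] by (simp add: r_distr m_assoc)
            then show ?thesis using car xc zc by (simp add: add_minus_cancel)
          qed
          moreover have "A (bump i m) = A (\<lambda>j. bump i ?m j + n j)"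
            by (rule gfamD(5)[OF A]) (use elim(2) in \<open>simp add: bump_apply less_imp_le\<close>)
          ultimately have "x \<otimes> e \<in> ?Q (bump i ?m)"
            using E_bump_mult[OF K i xi aek(2)] by (simp add: afam_def)
          then have "e \<in> ?Q ?m"
            by (intro afam_prime[OF K A z _ i xi xQ aek(2)] max)
          then have "e \<otimes> z \<in> A m" using cong[OF elim(2)] by (simp add: afam_def)
          then have "z \<otimes> e \<in> A m" using car zc by (simp add: m_comm)
          then show "w \<in> A m"
            unfolding aek(4) using aek(1) kA by (intro idealD(4)[OF gfamD(1)[OF A]])
        qed
      qed
    qed
    then show ?thesis by blast
  qed
qed

text \<open>A maximal counterexample \<open>A\<close> is enlarged by an element \<open>z\<close>
  whose annihilator is maximal. The enlargement is strict, so the claim holds for it and descends to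
  \<open>A\<close>.\<close>

theorem filter_regular:
  assumes K: "ideal K R" and i: "i \<le> s" and A: "gfam K A"
  shows "\<exists>\<B>. avoids K i A \<B>"
proof (rule ccontr)
  assume "\<nexists>\<B>. avoids K i A \<B>"
  then have "{A. gfam K A \<and> (\<nexists>\<B>. avoids K i A \<B>)} \<noteq> {}" using A by blast
  from gfam_maximal[OF K this] obtain A where A: "gfam K A" and no: "\<nexists>\<B>. avoids K i A \<B>"
    and maxA: "\<And>X. gfam K X \<Longrightarrow> (\<nexists>\<B>. avoids K i X \<B>) \<Longrightarrow> A \<le> X \<Longrightarrow> X = A" by blast
  have "A \<noteq> E K"
  proof
    assume "A = E K"
    then have "avoids K i A {}" unfolding avoids_def by (auto simp: cfam_def)
    then show False using no by blast
  qed
  then obtain n0 where "A n0 \<noteq> E K n0" by (auto simp: fun_eq_iff)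
  then obtain z0 where z0: "z0 \<in> E K n0" "z0 \<notin> A n0" using gfamD(3)[OF A, of n0] by blast
  let ?S = "{Q. \<exists>n z. z \<in> E K n \<and> z \<notin> A n \<and> Q = afam K A n z}"
  have "?S \<noteq> {}" using z0 by blast
  moreover have "gfam K Q" if "Q \<in> ?S" for Q using that gfam_afam[OF K A] by blast
  ultimately have "\<exists>M\<in>?S. \<forall>X\<in>?S. M \<le> X \<longrightarrow> X = M" by (rule gfam_maximal[OF K])
  then obtain n z where z: "z \<in> E K n" "z \<notin> A n"
    and max: "\<And>n' z'. z' \<in> E K n' \<Longrightarrow> z' \<notin> A n' \<Longrightarrow> afam K A n z \<le> afam K A n' z'
        \<Longrightarrow> afam K A n' z' = afam K A n z" by blast
  let ?A' = "\<lambda>m. A m <+> zfam K n z m"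
  note gZ = gfam_zfam[OF K z(1)]
  have g': "gfam K ?A'" by (rule gfam_sum[OF K A gZ])
  have le: "A \<le> ?A'" unfolding le_fun_def using ideal_sum_upper(1)[OF gfamD(1)[OF A] gfamD(1)[OF gZ]] by blast
  have "z \<in> ?A' n"
  proof -
    have zc: "z \<in> carrier R" by (rule idealD(3)[OF E_ideal[OF K] z(1)])
    have "E K (\<lambda>j. n j - n j) = carrier R" by (rule E_zero[OF K]) simp
    then have "z \<in> (\<lambda>w. z \<otimes> w) ` E K (\<lambda>j. n j - n j)"
      using zc by (intro image_eqI[of _ _ \<one>]) auto
    then have "z \<in> zfam K n z n"
      unfolding zfam_def using ideal_sum_upper(1)[OF smult_ideal[OF E_ideal[OF K] zc] K] by auto
    then show ?thesis using ideal_sum_upper(2)[OF gfamD(1)[OF A] gfamD(1)[OF gZ]] by blast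
  qed
  then have "?A' \<noteq> A" using z(2) by (metis (no_types))
  then have "\<exists>\<B>. avoids K i ?A' \<B>" using maxA[OF g' _ le] by blast
  then obtain \<B> where "avoids K i ?A' \<B>" by blast
  then have "\<exists>\<B>. avoids K i A \<B>" by (intro filter_regular_step[OF K i A z(1)] max)
  then show False using no by blast
qed

end

section \<open>Local rings with infinite residue field\<close>

locale local_ideal_family = ideal_family +
  fixes \<nn>
  assumes local: "local_ring R \<nn>" and residue_field: "infinite (carrier (R Quot \<nn>))"
begin

lemma max_ideal: "maximalideal \<nn> R"
  using local by (simp add: local_ring_def)

lemma max_unique: "maximalideal \<mm> R \<Longrightarrow> \<mm> = \<nn>"
  using local by (simp add: local_ring_def)

lemma \<nn>_ideal: "ideal \<nn> R"
  by (rule maximalideal.axioms(1)[OF max_ideal])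

lemma \<nn>_proper: "\<nn> \<noteq> carrier R"
  using maximalideal.I_notcarr[OF max_ideal] by (rule not_sym)

lemma proper_sub_max:
  assumes A: "ideal A R" "A \<noteq> carrier R"
  shows "A \<subseteq> \<nn>"
proof -
  let ?S = "{B. ideal B R \<and> A \<subseteq> B \<and> B \<noteq> carrier R}"
  have "?S \<noteq> {}" using A by blast
  moreover have "ideal B R" if "B \<in> ?S" for B using that by simp
  ultimately have "\<exists>M\<in>?S. \<forall>X\<in>?S. M \<subseteq> X \<longrightarrow> X = M" by (rule ideals_have_maximal)
  then obtain M where MS: "M \<in> ?S" and mx: "\<forall>X\<in>?S. M \<subseteq> X \<longrightarrow> X = M"
    by (elim bexE) (rule that)
  have M: "ideal M R" "A \<subseteq> M" "M \<noteq> carrier R" using MS by simp_all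
  have max: "X = M" if "ideal X R" "M \<subseteq> X" "X \<noteq> carrier R" for X
    using mx[rule_format, of X] that M(2) by simp
  have "maximalideal M R"
  proof (rule maximalidealI[OF M(1)])
    show "carrier R \<noteq> M" using M(3) by simp
    show "X = M \<or> X = carrier R" if "ideal X R" "M \<subseteq> X" for X using max[OF that] by blast
  qed
  then show ?thesis using max_unique M(2) by simp
qed

lemma not_in_max_unit:
  assumes "x \<in> carrier R" "x \<notin> \<nn>"
  obtains y where "y \<in> carrier R" "y \<otimes> x = \<one>"
proof -
  have "PIdl x = carrier R"
    using proper_sub_max[OF cgenideal_ideal[OF assms(1)]] cgenideal_self[OF assms(1)] assms(2) by blast
  then have "\<one> \<in> PIdl x" by simp
  then obtain r where "r \<in> carrier R" "\<one> = r \<otimes> x" unfolding cgenideal_iff by blast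
  then show ?thesis using that[of r] by simp
qed

lemma residue_representatives:
  obtains C where "C \<subseteq> carrier R" "infinite C" "\<And>c c'. c \<in> C \<Longrightarrow> c' \<in> C \<Longrightarrow> c \<noteq> c' \<Longrightarrow> c \<ominus> c' \<notin> \<nn>"
proof -
  have "\<forall>X\<in>carrier (R Quot \<nn>). \<exists>c\<in>carrier R. X = \<nn> +> c"
    by (auto simp: FactRing_def A_RCOSETS_def')
  then obtain f where f: "\<And>X. X \<in> carrier (R Quot \<nn>) \<Longrightarrow> f X \<in> carrier R \<and> X = \<nn> +> f X" by metis
  have inj: "inj_on f (carrier (R Quot \<nn>))" using f by (intro inj_onI) metis
  show ?thesis
  proof (rule that[of "f ` carrier (R Quot \<nn>)"])
    show "f ` carrier (R Quot \<nn>) \<subseteq> carrier R" using f by blast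
    show "infinite (f ` carrier (R Quot \<nn>))" using inj residue_field by (simp add: finite_image_iff)
    fix c c' assume "c \<in> f ` carrier (R Quot \<nn>)" "c' \<in> f ` carrier (R Quot \<nn>)" "c \<noteq> c'"
    then obtain X Y where XY: "X \<in> carrier (R Quot \<nn>)" "Y \<in> carrier (R Quot \<nn>)" "c = f X" "c' = f Y" "X \<noteq> Y"
      by blast
    have "\<nn> +> c \<noteq> \<nn> +> c'" using XY f by metis
    then show "c \<ominus> c' \<notin> \<nn>"
      using quotient_eq_iff_same_a_r_cos[OF \<nn>_ideal] XY f by blast
  qed
qed

text \<open>Among the elements \<^term>\<open>b \<oplus> c \<otimes> a\<close>, where \<^term>\<open>c\<close> runs through representatives of the
  residue field, each proper subideal that does not contain \<^term>\<open>a\<close> contains at most one.\<close>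

lemma ideal_avoidance:
  assumes "finite \<B>" "\<And>B. B \<in> \<B> \<Longrightarrow> ideal B R \<and> B \<subset> A" and A: "ideal A R"
  shows "\<exists>x\<in>A. x \<notin> \<Union>\<B>"
  using assms(1,2)
proof (induction \<B> rule: finite_induct)
  case empty
  then show ?case using idealD(2)[OF A] by blast
next
  case (insert B \<B>)
  then obtain a where a: "a \<in> A" "a \<notin> \<Union>\<B>" by blast
  show ?case
  proof (cases "a \<in> B")
    case True
    have B: "ideal B R" "B \<subset> A" using insert.prems by auto
    then obtain b where b: "b \<in> A" "b \<notin> B" by blast
    obtain C where C: "C \<subseteq> carrier R" "infinite C" "\<And>c c'. c \<in> C \<Longrightarrow> c' \<in> C \<Longrightarrow> c \<noteq> c' \<Longrightarrow> c \<ominus> c' \<notin> \<nn>"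
      using residue_representatives by blast
    have ac: "a \<in> carrier R" and bc: "b \<in> carrier R" using a b idealD(3)[OF A] by auto
    have "finite {c \<in> C. b \<oplus> c \<otimes> a \<in> B'}" if B': "B' \<in> \<B>" for B'
    proof (rule ccontr)
      assume inf: "infinite {c \<in> C. b \<oplus> c \<otimes> a \<in> B'}"
      have iB: "ideal B' R" using insert.prems B' by auto
      obtain c where c: "c \<in> C" "b \<oplus> c \<otimes> a \<in> B'" using infinite_imp_nonempty[OF inf] by blast
      have "infinite ({c \<in> C. b \<oplus> c \<otimes> a \<in> B'} - {c})" using inf by simp
      from infinite_imp_nonempty[OF this] obtain d where d: "d \<in> C" "b \<oplus> d \<otimes> a \<in> B'" "d \<noteq> c"
        by blast
      have cc: "c \<in> carrier R" "d \<in> carrier R" using c d C(1) by auto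
      have "(b \<oplus> c \<otimes> a) \<ominus> (b \<oplus> d \<otimes> a) \<in> B'" by (rule idealD(5)[OF iB c(2) d(2)])
      moreover have "(b \<oplus> c \<otimes> a) \<ominus> (b \<oplus> d \<otimes> a) = (c \<ominus> d) \<otimes> a"
      proof -
        have "\<ominus> (b \<oplus> d \<otimes> a) = \<ominus> b \<oplus> \<ominus> (d \<otimes> a)" using cc ac bc by (simp add: minus_add)
        then have "(b \<oplus> c \<otimes> a) \<ominus> (b \<oplus> d \<otimes> a) = c \<otimes> a \<oplus> b \<oplus> (\<ominus> b \<oplus> \<ominus> (d \<otimes> a))"
          using cc ac bc by (simp add: a_minus_def a_comm)
        also have "\<dots> = c \<otimes> a \<oplus> \<ominus> (d \<otimes> a)" using cc ac bc by (simp add: a_assoc r_neg2)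
        finally show ?thesis using cc ac by (simp add: a_minus_def l_distr l_minus)
      qed
      ultimately have m: "(c \<ominus> d) \<otimes> a \<in> B'" by simp
      obtain y where y: "y \<in> carrier R" "y \<otimes> (c \<ominus> d) = \<one>"
        using not_in_max_unit[of "c \<ominus> d"] C(3)[OF c(1) d(1)] d(3) cc by auto
      have "y \<otimes> ((c \<ominus> d) \<otimes> a) = a" using y cc ac by (simp add: m_assoc[symmetric])
      then have "a \<in> B'" using idealD(7)[OF iB m y(1)] by simp
      then show False using a(2) B' by blast
    qed
    then have "finite (\<Union>B'\<in>\<B>. {c \<in> C. b \<oplus> c \<otimes> a \<in> B'})" using insert.hyps by blast
    then have "\<not> C \<subseteq> (\<Union>B'\<in>\<B>. {c \<in> C. b \<oplus> c \<otimes> a \<in> B'})" using C(2) finite_subset by blast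
    then obtain c where c: "c \<in> C" "\<And>B'. B' \<in> \<B> \<Longrightarrow> b \<oplus> c \<otimes> a \<notin> B'" by blast
    have cc: "c \<in> carrier R" using c(1) C(1) by blast
    have "b \<oplus> c \<otimes> a \<notin> B"
    proof
      assume "b \<oplus> c \<otimes> a \<in> B"
      then have "(b \<oplus> c \<otimes> a) \<ominus> c \<otimes> a \<in> B"
        using idealD(5)[OF B(1)] idealD(7)[OF B(1) True cc] by blast
      moreover have "(b \<oplus> c \<otimes> a) \<ominus> c \<otimes> a = b"
        using cc ac bc by (simp add: a_minus_def a_assoc r_neg)
      ultimately show False using b(2) by simp
    qed
    moreover have "b \<oplus> c \<otimes> a \<in> A" by (intro idealD(4)[OF A] idealD(7)[OF A] a b cc)
    ultimately show ?thesis using c(2) by blast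
  qed (use a in blast)
qed

text \<open>Conditions (a) and (b) for the image of \<^term>\<open>x\<close> in \<open>R/K\<close>, pulled back to \<open>R\<close>.\<close>

definition superficial_mod :: "'a set \<Rightarrow> nat \<Rightarrow> 'a \<Rightarrow> bool" where
  "superficial_mod K i x \<longleftrightarrow> x \<in> carrier R \<and>
     eventually (\<lambda>n. colon R (E K (bump 0 (bump i n))) {x} \<inter> E K n = E K (bump 0 n)) large \<and>
     eventually (\<lambda>n. (PIdl x <+> K) \<inter> E K (bump i n) = (\<lambda>y. x \<otimes> y) ` mp n <+> K) large"

lemma E_bump_subset: "ideal K R \<Longrightarrow> E K (bump j n) \<subseteq> E K n"
  by (rule E_antimono) (simp_all add: bump_apply)

lemma gfam_E_shift:
  assumes K: "ideal K R"
  shows "gfam K (\<lambda>n. E K (\<lambda>j. n j + v j))"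
  unfolding gfam_def
proof (intro conjI allI impI)
  fix n
  show "ideal (E K (\<lambda>j. n j + v j)) R" by (rule E_ideal[OF K])
  show "K \<subseteq> E K (\<lambda>j. n j + v j)" by (rule K_sub_E[OF K])
  show "E K (\<lambda>j. n j + v j) \<subseteq> E K n" by (rule E_antimono[OF K]) simp
  fix j a z assume j: "j \<le> s" "a \<in> I j" and z: "z \<in> E K (\<lambda>j. n j + v j)"
  have "bump j (\<lambda>j. n j + v j) = (\<lambda>i. bump j n i + v i)" by (auto simp: fun_eq_iff bump_apply)
  then show "a \<otimes> z \<in> E K (\<lambda>i. bump j n i + v i)" using E_bump_mult[OF K j z] by simp
next
  show "depends_on s (\<lambda>n. E K (\<lambda>j. n j + v j))"
    unfolding depends_on_def
  proof (intro allI impI)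
    fix n m :: "nat \<Rightarrow> nat" assume nm: "\<forall>i\<le>s. n i = m i"
    show "E K (\<lambda>j. n j + v j) = E K (\<lambda>j. m j + v j)" by (rule E_cong[OF K]) (use nm in simp)
  qed
qed

text \<open>Filter-regularity with respect to the quotients of degree \<open>(1, 0, ..., 0)\<close> yields condition (a).
  Regularity with respect to those of degree \<open>(1, ..., 1)\<close> improves the Artin--Rees bound to
  condition (b).\<close>

theorem superficial_mod_exists:
  assumes K: "ideal K R" and i: "i \<le> s"
  shows "\<exists>x\<in>I i. superficial_mod K i x"
proof -
  let ?A = "\<lambda>n. E K (\<lambda>j. n j + unit_exp 0 j)" and ?B = "\<lambda>n. E K (\<lambda>j. n j + 1)"
  obtain \<A> where \<A>: "avoids K i ?A \<A>"
    using filter_regular[OF K i gfam_E_shift[OF K, of "unit_exp 0"]] by (elim exE)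
  obtain \<B> where \<B>: "avoids K i ?B \<B>"
    using filter_regular[OF K i gfam_E_shift[OF K, of "\<lambda>_. 1"]] by (elim exE)
  have AB: "ideal B R \<and> B \<subset> I i" if "B \<in> \<A> \<union> \<B>" for B
    using \<A> \<B> that unfolding avoids_def by auto
  have AB4: "eventually (\<lambda>n. cfam K i x ?A n \<subseteq> ?A n) large" if "x \<in> I i - \<Union>\<A>" for x
    using \<A> that unfolding avoids_def by (elim conjE) (erule bspec)
  have AB5: "eventually (\<lambda>n. cfam K i x ?B n \<subseteq> ?B n) large" if "x \<in> I i - \<Union>\<B>" for x
    using \<B> that unfolding avoids_def by (elim conjE) (erule bspec)
  have fin: "finite (\<A> \<union> \<B>)" using \<A> \<B> unfolding avoids_def by simp
  obtain x where x: "x \<in> I i" "x \<notin> \<Union>(\<A> \<union> \<B>)"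
    using ideal_avoidance[OF fin AB I_ideal[OF i]] by blast
  have xc: "x \<in> carrier R" by (rule idealD(3)[OF I_ideal[OF i] x(1)])
  have evA: "eventually (\<lambda>n. cfam K i x ?A n \<subseteq> ?A n) large"
    and evB: "eventually (\<lambda>n. cfam K i x ?B n \<subseteq> ?B n) large" using AB4[of x] AB5[of x] x by simp_all
  have "eventually (\<lambda>n. colon R (E K (bump 0 (bump i n))) {x} \<inter> E K n = E K (bump 0 n)) large"
    using evA
  proof eventually_elim
    case (elim n)
    have mem: "z \<in> colon R (E K (bump 0 (bump i n))) {x} \<longleftrightarrow> x \<otimes> z \<in> E K (bump 0 (bump i n))"
      if "z \<in> E K n" for z
      using idealD(3)[OF E_ideal[OF K] that] xc by (simp add: mem_colon_singleton m_comm)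
    show ?case
    proof
      show "colon R (E K (bump 0 (bump i n))) {x} \<inter> E K n \<subseteq> E K (bump 0 n)"
        using elim mem by (auto simp: cfam_def unit_exp_add)
      show "E K (bump 0 n) \<subseteq> colon R (E K (bump 0 (bump i n))) {x} \<inter> E K n"
      proof
        fix z assume z: "z \<in> E K (bump 0 n)"
        have "z \<in> E K n" using z E_bump_subset[OF K] by (rule subsetD[rotated])
        moreover have "x \<otimes> z \<in> E K (bump 0 (bump i n))"
          using E_bump_mult[OF K i x(1) z] bump_commute[of i 0 n] by simp
        ultimately show "z \<in> colon R (E K (bump 0 (bump i n))) {x} \<inter> E K n" using mem by blast
      qed
    qed
  qed
  moreover have "eventually (\<lambda>n. (PIdl x <+> K) \<inter> E K (bump i n) = (\<lambda>y. x \<otimes> y) ` mp n <+> K) large"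
  proof -
    have iP: "ideal (PIdl x) R" by (rule cgenideal_ideal[OF xc])
    have iPK: "ideal (PIdl x <+> K) R" by (rule add_ideals[OF iP K])
    obtain c where c: "\<And>n. (PIdl x <+> K) \<inter> E K n \<subseteq> mp (\<lambda>j. n j - c) \<cdot> (PIdl x <+> K) <+> K"
      using artin_rees[OF K iPK ideal_sum_upper(2)[OF iP K]] by blast
    obtain N where N: "\<And>n. (\<forall>j. N \<le> n j) \<Longrightarrow> cfam K i x ?B n \<subseteq> ?B n"
      using evB unfolding eventually_large by blast
    have "(PIdl x <+> K) \<inter> E K (bump i n) = (\<lambda>y. x \<otimes> y) ` mp n <+> K" if n: "\<forall>j. N + c \<le> n j" for n
    proof
      have sm: "ideal ((\<lambda>y. x \<otimes> y) ` mp n) R" for n by (rule smult_ideal[OF mp_ideal xc])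
      show "(\<lambda>y. x \<otimes> y) ` mp n <+> K \<subseteq> (PIdl x <+> K) \<inter> E K (bump i n)"
      proof (rule ideal_sum_least)
        show "ideal ((PIdl x <+> K) \<inter> E K (bump i n)) R" by (rule i_intersect[OF iPK E_ideal[OF K]])
        show "K \<subseteq> (PIdl x <+> K) \<inter> E K (bump i n)"
          using ideal_sum_upper(2)[OF iP K] K_sub_E[OF K] by blast
        show "(\<lambda>y. x \<otimes> y) ` mp n \<subseteq> (PIdl x <+> K) \<inter> E K (bump i n)"
        proof
          fix u assume "u \<in> (\<lambda>y. x \<otimes> y) ` mp n"
          then obtain y where y: "y \<in> mp n" "u = x \<otimes> y" by blast
          have yc: "y \<in> carrier R" by (rule idealD(3)[OF mp_ideal y(1)])
          have "u \<in> PIdl x" unfolding y(2) cgenideal_iff using yc xc m_comm by blast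
          moreover have "u \<in> E K (bump i n)"
            unfolding y(2) using y(1) mp_sub_E[OF K] by (intro E_bump_mult[OF K i x(1)]) blast
          ultimately show "u \<in> (PIdl x <+> K) \<inter> E K (bump i n)" using ideal_sum_upper(1)[OF iP K] by blast
        qed
      qed
      show "(PIdl x <+> K) \<inter> E K (bump i n) \<subseteq> (\<lambda>y. x \<otimes> y) ` mp n <+> K"
      proof
        fix u assume u: "u \<in> (PIdl x <+> K) \<inter> E K (bump i n)"
        let ?n = "\<lambda>j. n j - c"
        \<comment> \<open>Artin--Rees for (x) + K gives u = x z + k with \<open>z\<close> in I^(n -
          c) only; the loss of \<open>c\<close> in each exponent is made good below.\<close>
        have "mp ?n \<cdot> (PIdl x <+> K) \<subseteq> (\<lambda>y. x \<otimes> y) ` mp ?n <+> K"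
        proof (rule ideal_prod_least[OF K add_ideals[OF sm K]])
          fix a b assume a: "a \<in> mp ?n" and b: "b \<in> PIdl x <+> K"
          obtain r k where rk: "r \<in> carrier R" "k \<in> K" "b = r \<otimes> x \<oplus> k"
            using b by (auto simp: set_add_iff cgenideal_iff)
          have ac: "a \<in> carrier R" by (rule idealD(3)[OF mp_ideal a])
          have "a \<otimes> b = x \<otimes> (r \<otimes> a) \<oplus> a \<otimes> k"
            unfolding rk(3) using ac xc rk(1) idealD(3)[OF K rk(2)] by (simp add: r_distr m_ac)
          moreover have "r \<otimes> a \<in> mp ?n" by (rule idealD(7)[OF mp_ideal a rk(1)])
          moreover have "a \<otimes> k \<in> K" by (rule idealD(7)[OF K rk(2) ac])
          ultimately show "a \<otimes> b \<in> (\<lambda>y. x \<otimes> y) ` mp ?n <+> K" unfolding set_add_iff by blast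
        qed
        then have "mp ?n \<cdot> (PIdl x <+> K) <+> K \<subseteq> (\<lambda>y. x \<otimes> y) ` mp ?n <+> K"
          using ideal_sum_upper(2)[OF sm K] by (intro ideal_sum_least add_ideals[OF sm K]) auto
        moreover have "u \<in> (PIdl x <+> K) \<inter> E K n"
          using u subsetD[OF E_bump_subset[OF K, of i n]] by simp
        ultimately have "u \<in> (\<lambda>y. x \<otimes> y) ` mp ?n <+> K" using c[of n] by blast
        then obtain z k where zk: "z \<in> mp ?n" "k \<in> K" "u = x \<otimes> z \<oplus> k" by (auto simp: set_add_iff)
        have zc: "z \<in> carrier R" by (rule idealD(3)[OF mp_ideal zk(1)])
        have kc: "k \<in> carrier R" by (rule idealD(3)[OF K zk(2)])
        have "u \<ominus> k \<in> E K (bump i n)"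
          using u zk(2) K_sub_E[OF K] by (intro idealD(5)[OF E_ideal[OF K]]) auto
        moreover have "u \<ominus> k = x \<otimes> z" unfolding zk(3) using xc zc kc by (simp add: a_minus_def a_assoc r_neg)
        ultimately have xz: "x \<otimes> z \<in> E K (bump i n)" by simp
        \<comment> \<open>Each use of regularity raises the degree of \<open>z\<close> by (1, ...,
          1). Since x z has degree n + e_i, this can be repeated \<open>c\<close> times, and
          \<open>n\<close> was taken large enough to stay above the threshold \<open>N\<close>
          throughout.\<close>
        have "z \<in> E K (\<lambda>j. n j - c + l)" if "l \<le> c" for l
          using that
        proof (induction l)
          case 0
          then show ?case using zk(1) mp_sub_E[OF K] by auto
        next
          case (Suc l)
          have "E K (bump i n) \<subseteq> E K (\<lambda>j. bump i (\<lambda>j. n j - c + l) j + 1)"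
          proof (rule E_antimono[OF K])
            fix j show "bump i (\<lambda>j. n j - c + l) j + 1 \<le> bump i n j"
              using n[rule_format, of j] Suc.prems by (auto simp: bump_apply)
          qed
          then have "z \<in> cfam K i x ?B (\<lambda>j. n j - c + l)" using Suc xz by (auto simp: cfam_def)
          moreover have "N \<le> n j - c + l" for j using n[rule_format, of j] by simp
          ultimately have "z \<in> E K (\<lambda>j. n j - c + l + 1)" using N[of "\<lambda>j. n j - c + l"] by blast
          then show ?case by simp
        qed
        from this[of c] have "z \<in> E K (\<lambda>j. n j - c + c)" by simp
        moreover have "(\<lambda>j. n j - c + c) = n" using n by (auto simp: fun_eq_iff) (metis add.commute le_add_diff_inverse2 add_leD2)
        ultimately have "z \<in> E K n" by simp
        then obtain y k' where yk: "y \<in> mp n" "k' \<in> K" "z = y \<oplus> k'" by (auto simp: E_def set_add_iff)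
        have "u = x \<otimes> y \<oplus> (x \<otimes> k' \<oplus> k)"
          unfolding zk(3) yk(3) using xc kc idealD(3)[OF mp_ideal yk(1)] idealD(3)[OF K yk(2)]
          by (simp add: r_distr a_assoc)
        moreover have "x \<otimes> k' \<oplus> k \<in> K" by (intro idealD(4)[OF K] idealD(7)[OF K] yk zk xc)
        ultimately show "u \<in> (\<lambda>y. x \<otimes> y) ` mp n <+> K" unfolding set_add_iff using yk(1) by blast
      qed
    qed
    then show ?thesis unfolding eventually_large by blast
  qed
  ultimately show ?thesis using x(1) xc unfolding superficial_mod_def by blast
qed

end

section \<open>The Hilbert function of a family of ideals\<close>

lemma (in noetherian_ring) obtain_maximal_ideal_family:
  assumes "A \<in> \<S>" "\<And>B. B \<in> \<S> \<Longrightarrow> ideal B R"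
  obtains M where "M \<in> \<S>" "\<forall>X\<in>\<S>. M \<subseteq> X \<longrightarrow> X = M"
proof -
  have "\<S> \<noteq> {}" using assms(1) by blast
  then have "\<exists>M\<in>\<S>. \<forall>X\<in>\<S>. M \<subseteq> X \<longrightarrow> X = M" by (rule ideals_have_maximal) (rule assms(2))
  then show ?thesis by (elim bexE) (rule that)
qed

lemma (in ring) primeideal_pow:
  assumes "primeideal P R" "a \<in> carrier R" "a [^] (n::nat) \<in> P"
  shows "a \<in> P"
  using assms(3)
proof (induction n)
  case 0
  then have "\<one> \<in> P" by simp
  then have "P = carrier R" using ideal.one_imp_carrier primeideal.axioms(1)[OF assms(1)] by blast
  then show ?case using assms(2) by simp
next
  case (Suc n)
  then show ?case using primeideal.I_prime[OF assms(1), of "a [^] n" a] assms(2) by auto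
qed

section \<open>Finite length, Nakayama's lemma and Krull's intersection theorem\<close>

locale local_primary_family = local_ideal_family +
  assumes primary: "primary_to R \<nn> (I 0)"
begin

lemma J_ideal: "ideal (I 0) R"
  using I_ideal by simp

lemma J_sub: "I 0 \<subseteq> \<nn>"
proof
  fix a assume a: "a \<in> I 0"
  then have "a \<in> carrier R" using idealD(3)[OF J_ideal] by blast
  then have "a \<in> radical_ideal R (I 0)"
    unfolding radical_ideal_def using a by (auto intro!: exI[of _ "1::nat"])
  then show "a \<in> \<nn>" using primary by (simp add: primary_to_def)
qed

lemma prime_over_J:
  assumes P: "primeideal P R" and "I 0 \<subseteq> P"
  shows "P = \<nn>"
proof
  show "P \<subseteq> \<nn>" using proper_sub_max primeideal.axioms(1)[OF P] primeideal.I_notcarr[OF P] by blast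
  show "\<nn> \<subseteq> P"
  proof
    fix a assume "a \<in> \<nn>"
    then have "a \<in> radical_ideal R (I 0)" using primary by (simp add: primary_to_def)
    then obtain n :: nat where "a \<in> carrier R" "a [^] n \<in> I 0" by (auto simp: radical_ideal_def)
    then show "a \<in> P" using primeideal_pow[OF P] assms(2) by blast
  qed
qed

lemma length_residue_field: "ideal_length R (carrier R) \<nn> \<le> 1"
proof -
  have "n \<le> 1" if "has_chain {N. ideal N R \<and> \<nn> \<subseteq> N \<and> N \<subseteq> carrier R} n" for n
  proof (rule ccontr)
    assume n: "\<not> n \<le> 1"
    from that obtain N where N: "\<forall>i\<le>n. N i \<in> {N. ideal N R \<and> \<nn> \<subseteq> N \<and> N \<subseteq> carrier R}"
      and st: "\<forall>i<n. N i \<subset> N (Suc i)"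
      unfolding has_chain_def by (elim exE conjE)
    have mx: "N i = \<nn> \<or> N i = carrier R" if "i \<le> n" for i
      using N that proper_sub_max[of "N i"] by auto
    have "N 0 \<subset> N 1" "N 1 \<subset> N 2" using st n by (auto simp: numeral_2_eq_2)
    then show False using mx[of 0] mx[of 1] mx[of 2] n idealD(1)[OF \<nn>_ideal] by auto
  qed
  then show ?thesis
    unfolding ideal_length_def chain_length_def by (intro Sup_least) (auto simp: one_enat_def)
qed

text \<open>The prime is a maximal member among the ideals B : x. Multiplying \<open>x\<close> by an
  element outside this ideal gives another admissible element, whose annihilator is no
  larger.\<close>

lemma maximal_annihilator:
  assumes B: "ideal B R" and A: "ideal A R" and ne: "\<not> A \<subseteq> B"
  obtains x where "x \<in> A" "x \<notin> B" "primeideal (colon R B {x}) R"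
proof -
  let ?S = "(\<lambda>x. colon R B {x}) ` (A - B)"
  obtain x0 where "x0 \<in> A - B" using ne by blast
  then have x0: "colon R B {x0} \<in> ?S" by (rule imageI)
  have iS: "ideal Q R" if Q: "Q \<in> ?S" for Q
  proof -
    from Q obtain x where "x \<in> A" "Q = colon R B {x}" by blast
    then show ?thesis using colon_ideal[OF B, of "{x}"] idealD(3)[OF A] by simp
  qed
  obtain Q where Q: "Q \<in> ?S" and max0: "\<forall>X\<in>?S. Q \<subseteq> X \<longrightarrow> X = Q"
    by (rule obtain_maximal_ideal_family[OF x0 iS])
  have max: "X = Q" if "X \<in> ?S" "Q \<subseteq> X" for X using max0 that by blast
  from Q obtain x where x: "x \<in> A" "x \<notin> B" "Q = colon R B {x}" by blast
  have xc: "x \<in> carrier R" by (rule idealD(3)[OF A x(1)])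
  have "primeideal Q R"
  proof (rule primeidealI[OF iS[OF Q] is_cring])
    have "\<one> \<notin> Q" using x xc by (simp add: mem_colon_singleton)
    then show "carrier R \<noteq> Q" by auto
    fix a b assume ab: "a \<in> carrier R" "b \<in> carrier R" "a \<otimes> b \<in> Q"
    show "a \<in> Q \<or> b \<in> Q"
    proof (rule disjCI)
      assume "b \<notin> Q"
      then have bx: "b \<otimes> x \<notin> B" using ab x(3) by (simp add: mem_colon_singleton)
      have bA: "b \<otimes> x \<in> A" by (rule idealD(7)[OF A x(1) ab(2)])
      have "Q \<subseteq> colon R B {b \<otimes> x}"
      proof
        fix c assume c: "c \<in> Q"
        then have cc: "c \<in> carrier R" "c \<otimes> x \<in> B" using x(3) by (simp_all add: mem_colon_singleton)
        have "c \<otimes> (b \<otimes> x) = b \<otimes> (c \<otimes> x)" using cc ab xc by (simp add: m_lcomm)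
        then show "c \<in> colon R B {b \<otimes> x}" using cc idealD(7)[OF B cc(2) ab(2)] by (simp add: mem_colon_singleton)
      qed
      then have "colon R B {b \<otimes> x} = Q" using max[of "colon R B {b \<otimes> x}"] bA bx by blast
      moreover have "a \<in> colon R B {b \<otimes> x}"
        using ab x(3) xc by (simp add: mem_colon_singleton m_assoc)
      ultimately show "a \<in> Q" by simp
    qed
  qed
  then show ?thesis using that x by blast
qed

lemma cgenideal_eq_image: "x \<in> carrier R \<Longrightarrow> PIdl x = (\<lambda>y. x \<otimes> y) ` carrier R"
  by (auto simp: cgenideal_iff m_comm)

text \<open>Take \<open>C\<close> maximal with A/C of infinite length. An associated prime of A/C
  contains J and so is the maximal ideal; adjoining the corresponding \<open>x\<close> costs length
  at most 1, which contradicts maximality.\<close>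

lemma finite_length:
  assumes A: "ideal A R" and B: "ideal B R" and BA: "B \<subseteq> A"
    and JA: "\<And>j a. j \<in> I 0 \<Longrightarrow> a \<in> A \<Longrightarrow> j \<otimes> a \<in> B"
  shows "ideal_length R A B \<noteq> \<infinity>"
proof
  assume "ideal_length R A B = \<infinity>"
  then have "B \<in> {C. ideal C R \<and> B \<subseteq> C \<and> C \<subseteq> A \<and> ideal_length R A C = \<infinity>}" (is "_ \<in> ?S")
    using B BA by simp
  then obtain C where "C \<in> ?S" and max0: "\<forall>X\<in>?S. C \<subseteq> X \<longrightarrow> X = C"
    by (rule obtain_maximal_ideal_family) simp
  have max: "X = C" if "X \<in> ?S" "C \<subseteq> X" for X using max0 that by blast
  from \<open>C \<in> ?S\<close> have C: "ideal C R" "B \<subseteq> C" "C \<subseteq> A" "ideal_length R A C = \<infinity>" by simp_all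
  have "C \<noteq> A" using C(4) ideal_length_self[of A] by auto
  then have "\<not> A \<subseteq> C" using C(3) by blast
  then obtain x where x: "x \<in> A" "x \<notin> C" "primeideal (colon R C {x}) R"
    by (rule maximal_annihilator[OF C(1) A])
  have xc: "x \<in> carrier R" by (rule idealD(3)[OF A x(1)])
  have "I 0 \<subseteq> colon R C {x}"
    using subsetD[OF C(2) JA[OF _ x(1)]] idealD(3)[OF J_ideal] by (auto simp: mem_colon_singleton)
  then have "colon R C {x} = \<nn>" by (rule prime_over_J[OF x(3)])
  let ?D = "PIdl x <+> C"
  have D: "ideal ?D R" "C \<subseteq> ?D" "x \<in> ?D" "?D \<subseteq> A"
    using ideal_sum_upper[OF cgenideal_ideal[OF xc] C(1)] cgenideal_self[OF xc]
      add_ideals[OF cgenideal_ideal[OF xc] C(1)] ideal_sum_least[OF A cgenideal_minimal[OF A x(1)] C(3)]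
    by auto
  have "ideal_length R ?D C = ideal_length R (carrier R) (colon R C {x} \<inter> carrier R)"
    unfolding cgenideal_eq_image[OF xc] by (rule ideal_length_smult[OF oneideal C(1) xc])
  also have "colon R C {x} \<inter> carrier R = \<nn>"
    using \<open>colon R C {x} = \<nn>\<close> idealD(1)[OF \<nn>_ideal] by blast
  finally have l1: "ideal_length R ?D C \<le> 1" using length_residue_field by simp
  have "ideal_length R A C = ideal_length R A ?D + ideal_length R ?D C"
    by (rule ideal_length_add[OF A D(1) C(1) D(2,4)])
  moreover have "ideal_length R ?D C \<noteq> \<infinity>" using l1 by (cases "ideal_length R ?D C") (simp_all add: one_enat_def)
  ultimately have "ideal_length R A ?D = \<infinity>" using C(4) by (metis plus_eq_infty_iff_enat)
  then have "?D = C" using max[of ?D] D C(2) by simp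
  then show False using D(3) x(2) by simp
qed

text \<open>Let \<open>B\<close> be maximal among the ideals between \<open>K\<close> and
  \<open>a\<close> other than \<open>a\<close>. A product c y outside \<open>B\<close>, with c in J,
  would generate \<open>a\<close> modulo \<open>B\<close>. Then y = b + r c y with 1 - r c a unit,
  so y and hence c y lie in \<open>B\<close>. Thus J a + K lies in \<open>B\<close>.\<close>

lemma nakayama:
  assumes K: "ideal K R" and a: "ideal a R" and Ka: "K \<subseteq> a" and sub: "a \<subseteq> I 0 \<cdot> a <+> K"
  shows "a = K"
proof (rule ccontr)
  assume "a \<noteq> K"
  then have "K \<in> {B. ideal B R \<and> K \<subseteq> B \<and> B \<subset> a}" (is "_ \<in> ?S") using K Ka by blast
  then obtain B where "B \<in> ?S" and max0: "\<forall>X\<in>?S. B \<subseteq> X \<longrightarrow> X = B"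
    by (rule obtain_maximal_ideal_family) simp
  have max: "X = B" if "X \<in> ?S" "B \<subseteq> X" for X using max0 that by blast
  from \<open>B \<in> ?S\<close> have B: "ideal B R" "K \<subseteq> B" "B \<subset> a" by simp_all
  have "c \<otimes> y \<in> B" if c: "c \<in> I 0" and y: "y \<in> a" for c y
  proof (rule ccontr)
    assume cy: "c \<otimes> y \<notin> B"
    have cn: "c \<in> \<nn>" using c J_sub by blast
    have cc: "c \<in> carrier R" by (rule idealD(3)[OF \<nn>_ideal cn])
    have yc: "y \<in> carrier R" by (rule idealD(3)[OF a y])
    have cya: "c \<otimes> y \<in> a" by (rule idealD(7)[OF a y cc])
    have cyc: "c \<otimes> y \<in> carrier R" using cc yc by simp
    note D = mem_sum_cgenideal_self[OF B(1) cyc]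
    have "B <+> PIdl (c \<otimes> y) = a"
    proof (rule ccontr)
      assume "B <+> PIdl (c \<otimes> y) \<noteq> a"
      moreover have "B <+> PIdl (c \<otimes> y) \<subseteq> a" using B(3) by (intro sum_cgenideal_least[OF a _ cya]) blast
      ultimately have "B <+> PIdl (c \<otimes> y) = B" using max[of "B <+> PIdl (c \<otimes> y)"] D B(2) by blast
      then show False using D(1) cy by simp
    qed
    then have "y \<in> B <+> PIdl (c \<otimes> y)" using y by simp
    then obtain b r where br: "b \<in> B" "r \<in> carrier R" "y = b \<oplus> r \<otimes> (c \<otimes> y)"
      unfolding mem_sum_cgenideal[OF B(1) cyc] by blast
    have bc: "b \<in> carrier R" by (rule idealD(3)[OF B(1) br(1)])
    have "y \<ominus> r \<otimes> (c \<otimes> y) = b"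
      using add_minus_cancel(1)[OF bc, of "r \<otimes> (c \<otimes> y)"] br cc yc by simp
    then have e: "(\<one> \<ominus> r \<otimes> c) \<otimes> y \<in> B"
      using br(1,2) cc yc by (simp add: a_minus_def l_distr l_minus m_assoc)
    have rc: "r \<otimes> c \<in> \<nn>" by (rule idealD(7)[OF \<nn>_ideal cn br(2)])
    have "\<one> \<ominus> r \<otimes> c \<notin> \<nn>"
    proof
      assume "\<one> \<ominus> r \<otimes> c \<in> \<nn>"
      then have "\<one> \<ominus> r \<otimes> c \<oplus> r \<otimes> c \<in> \<nn>" using rc by (rule idealD(4)[OF \<nn>_ideal])
      then have "\<one> \<in> \<nn>" using br(2) cc by (simp add: a_minus_def a_assoc l_neg)
      then show False using ideal.one_imp_carrier[OF \<nn>_ideal] \<nn>_proper by blast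
    qed
    then obtain u where u: "u \<in> carrier R" "u \<otimes> (\<one> \<ominus> r \<otimes> c) = \<one>"
      using not_in_max_unit[of "\<one> \<ominus> r \<otimes> c"] br(2) cc by auto
    have "u \<otimes> ((\<one> \<ominus> r \<otimes> c) \<otimes> y) \<in> B" by (rule idealD(7)[OF B(1) e u(1)])
    moreover have "u \<otimes> ((\<one> \<ominus> r \<otimes> c) \<otimes> y) = y" using u br(2) cc yc by (simp flip: m_assoc)
    ultimately have "y \<in> B" by simp
    then show False using cy idealD(7)[OF B(1) _ cc] by blast
  qed
  then have "I 0 \<cdot> a <+> K \<subseteq> B" by (intro ideal_sum_least[OF B(1) _ B(2)] ideal_prod_least[OF K B(1)])
  then show False using sub B(3) by blast
qed

text \<open>At the exponent (c + 1, 0, ..., 0) the Artin--Rees lemma puts the intersection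
  \<open>a\<close> into J a + K, and Nakayama's lemma applies.\<close>

lemma krull_intersection:
  assumes K: "ideal K R" and "\<And>m. y \<in> E K (\<lambda>j. if j = 0 then m else 0)"
  shows "y \<in> K"
proof -
  define a where "a = (\<Inter>m. E K (\<lambda>j. if j = 0 then m else 0))"
  have ia: "ideal a R" unfolding a_def using E_ideal[OF K] by (intro i_Intersect) auto
  have Ka: "K \<subseteq> a" unfolding a_def using K_sub_E[OF K] by blast
  obtain c where c: "\<And>n. a \<inter> E K n \<subseteq> mp (\<lambda>j. n j - c) \<cdot> a <+> K"
    using artin_rees[OF K ia Ka] by blast
  let ?n = "\<lambda>j::nat. if j = 0 then Suc c else 0"
  have "a \<subseteq> E K ?n" unfolding a_def by blast
  moreover have "mp (\<lambda>j. ?n j - c) = mp (unit_exp 0)" by (rule mp_cong) auto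
  ultimately have "a \<subseteq> I 0 \<cdot> a <+> K" using c[of ?n] mp_single[of 0] by auto
  then have "a = K" by (rule nakayama[OF K ia Ka])
  then show ?thesis using assms(2) unfolding a_def by blast
qed

text \<open>The exponent of J is raised again and again until Krull's intersection theorem
  applies.\<close>

lemma E_tower:
  assumes K: "ideal K R" and st: "\<And>m. (\<forall>j. N \<le> m j) \<Longrightarrow> y \<in> E K m \<Longrightarrow> y \<in> E K (bump 0 m)"
    and n: "\<forall>j. N \<le> n j" "y \<in> E K n"
  shows "y \<in> K"
proof (rule krull_intersection[OF K])
  fix m
  have "y \<in> E K (n(0 := n 0 + m))"
  proof (induction m)
    case (Suc m)
    have eq: "n(0 := n 0 + Suc m) = bump 0 (n(0 := n 0 + m))" by (auto simp: bump_def)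
    have "\<forall>j. N \<le> (n(0 := n 0 + m)) j" using n(1) by (simp add: trans_le_add1)
    then show ?case unfolding eq using st Suc by blast
  qed (use n in simp)
  then show "y \<in> E K (\<lambda>j. if j = 0 then m else 0)"
    by (rule subsetD[OF E_antimono[OF K], rotated]) simp
qed

section \<open>The Hilbert function modulo a superficial element\<close>

definition nilp_mod :: "'a set \<Rightarrow> bool" where
  "nilp_mod K \<longleftrightarrow> (\<exists>m. mp (\<lambda>_. m) \<subseteq> K)"

text \<open>If x y lies in \<open>K\<close>, condition (a) pushes \<open>y\<close> one J-step
  higher, and it can be applied again; by \<open>E_tower\<close> this ends in
  \<open>K\<close>.\<close>

lemma superficial_mod_regular:
  assumes K: "ideal K R" and x: "superficial_mod K i x"
  shows "eventually (\<lambda>n. \<forall>y\<in>E K n. x \<otimes> y \<in> K \<longrightarrow> y \<in> K) large"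
proof -
  have xc: "x \<in> carrier R" using x by (simp add: superficial_mod_def)
  have "eventually (\<lambda>n. colon R (E K (bump 0 (bump i n))) {x} \<inter> E K n = E K (bump 0 n)) large"
    using x by (simp add: superficial_mod_def)
  then obtain N where N: "\<And>n. \<forall>j. N \<le> n j \<Longrightarrow> colon R (E K (bump 0 (bump i n))) {x} \<inter> E K n = E K (bump 0 n)"
    unfolding eventually_large by blast
  have "y \<in> K" if n: "\<forall>j. N \<le> n j" and y: "y \<in> E K n" and xy: "x \<otimes> y \<in> K" for n y
  proof (rule E_tower[OF K _ n y])
    fix m assume m: "\<forall>j. N \<le> m j" and ym: "y \<in> E K m"
    have yc: "y \<in> carrier R" by (rule idealD(3)[OF E_ideal[OF K] y])
    have "x \<otimes> y \<in> E K (bump 0 (bump i m))" using xy K_sub_E[OF K] by blast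
    then have "y \<in> colon R (E K (bump 0 (bump i m))) {x} \<inter> E K m"
      using ym yc xc by (simp add: mem_colon_singleton m_comm)
    then show "y \<in> E K (bump 0 m)" using N[OF m] by blast
  qed
  then show ?thesis unfolding eventually_large by blast
qed

text \<open>For \<open>x\<close> in \<open>K\<close> regularity would push a whole power of the
  product ideal into \<open>K\<close>. This makes \<open>K\<close> grow strictly in the Noetherian
  induction.\<close>

lemma superficial_mod_not_mem:
  assumes K: "ideal K R" and x: "superficial_mod K i x" and nn: "\<not> nilp_mod K"
  shows "x \<notin> K"
proof
  assume xK: "x \<in> K"
  obtain N where N: "\<And>n y. \<forall>j. N \<le> n j \<Longrightarrow> y \<in> E K n \<Longrightarrow> x \<otimes> y \<in> K \<Longrightarrow> y \<in> K"
    using superficial_mod_regular[OF K x] unfolding eventually_large by blast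
  have "mp (\<lambda>_. N) \<subseteq> K"
  proof
    fix y assume y: "y \<in> mp (\<lambda>_. N)"
    have "x \<otimes> y \<in> K" by (rule idealD(8)[OF K xK idealD(3)[OF mp_ideal y]])
    then show "y \<in> K" using N[of "\<lambda>_. N" y] y mp_sub_E[OF K] by auto
  qed
  then show False using nn unfolding nilp_mod_def by blast
qed

text \<open>The function h_K. The length is finite by \<open>hlen_finite\<close>, so
  \<open>the_enat\<close> loses nothing; it is made rational in order to take differences.\<close>

definition hlen :: "'a set \<Rightarrow> (nat \<Rightarrow> nat) \<Rightarrow> rat" where
  "hlen K n = of_nat (the_enat (ideal_length R (E K n) (E K (bump 0 n))))"

lemma hlen_finite:
  assumes "ideal K R"
  shows "ideal_length R (E K n) (E K (bump 0 n)) \<noteq> \<infinity>"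
  using E_bump_mult[OF assms, of 0]
  by (intro finite_length E_ideal[OF assms] E_bump_subset[OF assms]) simp_all

text \<open>The layer A/C of R/K in degree n + e_i is cut at D = xB + C. By condition (b) A/D is the
  layer for K + (x); by condition (a) multiplication by \<open>x\<close> identifies D/C with the
  layer of R/K in degree \<open>n\<close>.\<close>

lemma superficial_mod_hlen:
  assumes K: "ideal K R" and i: "i \<le> s" "x \<in> I i" and x: "superficial_mod K i x"
  shows "eventually (\<lambda>n. hlen (K <+> PIdl x) (bump i n) = hlen K (bump i n) - hlen K n) large"
proof -
  have xc: "x \<in> carrier R" using x by (simp add: superficial_mod_def)
  let ?X = "PIdl x" and ?K = "K <+> PIdl x"
  have X: "ideal ?X R" by (rule cgenideal_ideal[OF xc])
  have K': "ideal ?K R" by (rule add_ideals[OF K X])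
  have EK: "E ?K m = E K m <+> ?X" for m
    unfolding E_def by (rule ideal_sum_assoc[OF mp_ideal K X, symmetric])
  show ?thesis
    using x[unfolded superficial_mod_def, THEN conjunct2, THEN conjunct1]
      x[unfolded superficial_mod_def, THEN conjunct2, THEN conjunct2]
  proof eventually_elim
    case (elim n)
    define A C B where "A = E K (bump i n)" and "C = E K (bump 0 (bump i n))" and "B = E K n"
    have A: "ideal A R" and C: "ideal C R" and B: "ideal B R" unfolding A_def B_def C_def by (rule E_ideal[OF K])+
    have CA: "C \<subseteq> A" unfolding A_def C_def by (rule E_bump_subset[OF K])
    have KC: "K \<subseteq> C" unfolding C_def by (rule K_sub_E[OF K])
    define D where "D = (\<lambda>y. x \<otimes> y) ` B <+> C"
    have sB: "ideal ((\<lambda>y. x \<otimes> y) ` B) R" by (rule smult_ideal[OF B xc])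
    have D: "ideal D R" unfolding D_def by (rule add_ideals[OF sB C])
    have CD: "C \<subseteq> D" unfolding D_def by (rule ideal_sum_upper(2)[OF sB C])
    have DA: "D \<subseteq> A"
      unfolding D_def
    proof (rule ideal_sum_least[OF A _ CA])
      show "(\<lambda>y. x \<otimes> y) ` B \<subseteq> A" unfolding A_def B_def using E_bump_mult[OF K i] by blast
    qed
    have smp: "ideal ((\<lambda>y. x \<otimes> y) ` mp n) R" by (rule smult_ideal[OF mp_ideal xc])
    have DAX: "A \<inter> (C <+> ?X) = D"
    proof
      show "D \<subseteq> A \<inter> (C <+> ?X)"
      proof -
        have "(\<lambda>y. x \<otimes> y) ` B \<subseteq> ?X"
          unfolding cgenideal_eq_image[OF xc] using idealD(1)[OF B] by blast
        then have "D \<subseteq> C <+> ?X"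
          unfolding D_def using ideal_sum_upper[OF C X] by (intro ideal_sum_least add_ideals[OF C X]) auto
        then show ?thesis using DA by blast
      qed
      have "A \<inter> (C <+> ?X) = C <+> (A \<inter> ?X)" by (rule ideal_modular[OF A C X CA])
      also have "\<dots> \<subseteq> D"
      proof (rule ideal_sum_least[OF D CD])
        have "A \<inter> ?X \<subseteq> (?X <+> K) \<inter> A" using ideal_sum_upper(1)[OF X K] by blast
        also have "\<dots> = (\<lambda>y. x \<otimes> y) ` mp n <+> K" unfolding A_def by (rule elim(2))
        also have "\<dots> \<subseteq> D"
        proof (rule ideal_sum_least[OF D])
          have "(\<lambda>y. x \<otimes> y) ` mp n \<subseteq> (\<lambda>y. x \<otimes> y) ` B" unfolding B_def using mp_sub_E[OF K] by (rule image_mono)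
          then show "(\<lambda>y. x \<otimes> y) ` mp n \<subseteq> D" unfolding D_def using ideal_sum_upper(1)[OF sB C] by blast
          show "K \<subseteq> D" using KC CD by blast
        qed
        finally show "A \<inter> ?X \<subseteq> D" .
      qed
      finally show "A \<inter> (C <+> ?X) \<subseteq> D" .
    qed
    have CX: "ideal (C <+> ?X) R" by (rule add_ideals[OF C X])
    have "A <+> (C <+> ?X) = A <+> ?X"
    proof
      show "A <+> (C <+> ?X) \<subseteq> A <+> ?X"
        using ideal_sum_upper[OF A X] CA by (intro ideal_sum_least add_ideals[OF A X] add_ideals[OF C X]) auto
      show "A <+> ?X \<subseteq> A <+> (C <+> ?X)"
        using ideal_sum_upper(2)[OF C X] by (intro ideal_sum_mono) auto
    qed
    then have l1: "ideal_length R (E ?K (bump i n)) (E ?K (bump 0 (bump i n))) = ideal_length R A D"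
      using ideal_length_sum[OF A CX] DAX by (simp add: EK A_def C_def)
    have l2: "ideal_length R A C = ideal_length R A D + ideal_length R D C"
      by (rule ideal_length_add[OF A D C CD DA])
    have "ideal_length R D C = ideal_length R B (colon R C {x} \<inter> B)"
      unfolding D_def by (rule ideal_length_smult[OF B C xc])
    also have "colon R C {x} \<inter> B = E K (bump 0 n)" unfolding B_def C_def by (rule elim(1))
    finally have l3: "ideal_length R D C = ideal_length R (E K n) (E K (bump 0 n))" by (simp add: B_def)
    obtain p where p: "ideal_length R A D = enat p"
      using hlen_finite[OF K', of "bump i n"] unfolding l1 by auto
    obtain q where q: "ideal_length R (E K n) (E K (bump 0 n)) = enat q"
      using hlen_finite[OF K, of n] by auto
    have "ideal_length R A C = enat (p + q)" using l2 l3 p q by simp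
    then show ?case
      unfolding hlen_def using l1 p q by (simp add: A_def C_def)
  qed
qed

text \<open>Krull's construction: an ideal maximal among those over \<open>K\<close> that contain no
  member of \<open>\<S>\<close> is prime. The members are sets and closure under products is tested
  by ideals, so that powers of a product ideal, elements x^l y and products y I^N are covered at
  once.\<close>

lemma prime_avoiding:
  assumes K: "ideal K R" and ne: "\<S> \<noteq> {}" and car: "\<And>S. S \<in> \<S> \<Longrightarrow> S \<subseteq> carrier R"
    and avoid: "\<And>S. S \<in> \<S> \<Longrightarrow> \<not> S \<subseteq> K"
    and mult: "\<And>S T. S \<in> \<S> \<Longrightarrow> T \<in> \<S> \<Longrightarrow> \<exists>U\<in>\<S>. \<forall>Q. ideal Q R \<longrightarrow>
        (\<forall>a\<in>S. \<forall>b\<in>T. a \<otimes> b \<in> Q) \<longrightarrow> U \<subseteq> Q"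
  shows "\<exists>P. primeideal P R \<and> K \<subseteq> P \<and> (\<forall>S\<in>\<S>. \<not> S \<subseteq> P)"
proof -
  have "K \<in> {Q. ideal Q R \<and> K \<subseteq> Q \<and> (\<forall>S\<in>\<S>. \<not> S \<subseteq> Q)}" (is "_ \<in> ?F") using K avoid by simp
  then obtain P where "P \<in> ?F" and max0: "\<forall>X\<in>?F. P \<subseteq> X \<longrightarrow> X = P"
    by (rule obtain_maximal_ideal_family) simp
  have max: "X = P" if "X \<in> ?F" "P \<subseteq> X" for X using max0 that by blast
  have P: "ideal P R" "K \<subseteq> P" "\<And>S. S \<in> \<S> \<Longrightarrow> \<not> S \<subseteq> P" using \<open>P \<in> ?F\<close> by auto
  have hit: "\<exists>S\<in>\<S>. S \<subseteq> P <+> PIdl a" if a: "a \<in> carrier R" "a \<notin> P" for a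
  proof (rule ccontr)
    assume "\<not> ?thesis"
    then have "P <+> PIdl a = P"
      using mem_sum_cgenideal_self[OF P(1) a(1)] P(2) by (intro max) auto
    then show False using mem_sum_cgenideal_self(1)[OF P(1) a(1)] a(2) by simp
  qed
  have "primeideal P R"
  proof (rule primeidealI[OF P(1) is_cring])
    show "carrier R \<noteq> P" using ne car P(3) by blast
    fix a b assume ab: "a \<in> carrier R" "b \<in> carrier R" "a \<otimes> b \<in> P"
    show "a \<in> P \<or> b \<in> P"
    proof (rule ccontr)
      assume "\<not> (a \<in> P \<or> b \<in> P)"
      then obtain S T where S: "S \<in> \<S>" "S \<subseteq> P <+> PIdl a" and T: "T \<in> \<S>" "T \<subseteq> P <+> PIdl b"
        using hit ab by metis
      obtain U where U: "U \<in> \<S>" and U2: "\<forall>Q. ideal Q R \<longrightarrow> (\<forall>a\<in>S. \<forall>b\<in>T. a \<otimes> b \<in> Q) \<longrightarrow> U \<subseteq> Q"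
        using mult[OF S(1) T(1)] by (elim bexE) (rule that)
      have "u \<otimes> v \<in> P" if u: "u \<in> S" and v: "v \<in> T" for u v
      proof -
        obtain p r where p: "p \<in> P" "r \<in> carrier R" "u = p \<oplus> r \<otimes> a"
          using S(2) u mem_sum_cgenideal[OF P(1) ab(1)] by blast
        obtain q t where q: "q \<in> P" "t \<in> carrier R" "v = q \<oplus> t \<otimes> b"
          using T(2) v mem_sum_cgenideal[OF P(1) ab(2)] by blast
        have c: "p \<in> carrier R" "q \<in> carrier R" using p q idealD(3)[OF P(1)] by auto
        have "u \<otimes> v = p \<otimes> v \<oplus> ((r \<otimes> a) \<otimes> q \<oplus> (r \<otimes> t) \<otimes> (a \<otimes> b))"
          unfolding p(3) q(3) using c p(2) q(2) ab by (simp add: l_distr r_distr m_ac a_ac)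
        moreover have "p \<otimes> v \<in> P" using p(1) q c ab by (intro idealD(8)[OF P(1)]) auto
        moreover have "(r \<otimes> a) \<otimes> q \<in> P" using p(2) q(1) ab by (intro idealD(7)[OF P(1)]) auto
        moreover have "(r \<otimes> t) \<otimes> (a \<otimes> b) \<in> P" using p(2) q(2) by (intro idealD(7)[OF P(1) ab(3)]) simp
        ultimately show ?thesis by (simp add: idealD(4)[OF P(1)])
      qed
      then have "U \<subseteq> P" using U2 P(1) by blast
      then show False using P(3) U by blast
    qed
  qed
  then show ?thesis using P(2,3) by (intro exI[of _ P]) simp
qed

lemma mp_const_add: "mp (\<lambda>_. m) \<cdot> mp (\<lambda>_. m') = mp (\<lambda>_. m + m')"
  using mp_add[of "\<lambda>_. m" "\<lambda>_. m'"] by simp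

lemma mp_sub_I: "j \<le> s \<Longrightarrow> mp (\<lambda>_. 1) \<subseteq> I j"
  using mp_antimono[OF zeroideal, of "unit_exp j" "\<lambda>_. 1"] mp_single[of j] by auto

lemma mp_sub_prime:
  assumes P: "primeideal P R" and "mp n \<subseteq> P"
  shows "\<exists>j\<le>s. 0 < n j \<and> I j \<subseteq> P"
  using assms(2)
proof (induction "\<Sum>j\<le>s. n j" arbitrary: n)
  case 0
  then have "mp n = carrier R" by (intro mp_zero) simp
  then show ?case
    using 0 primeideal.I_notcarr[OF P] idealD(1)[OF primeideal.axioms(1)[OF P]] by blast
next
  case (Suc x)
  then have "(\<Sum>j\<le>s. n j) \<noteq> 0" by linarith
  then obtain j where j: "j \<le> s" "n j \<noteq> 0" by (elim sum.not_neutral_contains_not_neutral) simp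
  define n' where "n' = n(j := n j - 1)"
  have nn: "n = bump j n'" using j(2) bump_pred[of n j] by (simp add: n'_def)
  have "(\<Sum>i\<le>s. n i) = n j + (\<Sum>i\<in>{..s}-{j}. n i)" using j(1) by (subst sum.remove[of _ j]) auto
  also have "(\<Sum>i\<in>{..s}-{j}. n i) = (\<Sum>i\<in>{..s}-{j}. n' i)" by (rule sum.cong) (auto simp: n'_def)
  also have "n j = Suc (n' j)" using j(2) by (simp add: n'_def)
  also have "Suc (n' j) + (\<Sum>i\<in>{..s}-{j}. n' i) = Suc (\<Sum>i\<le>s. n' i)"
    using j(1) by (subst (2) sum.remove[of _ j]) auto
  finally have x: "x = (\<Sum>i\<le>s. n' i)" using Suc(2) by simp
  have "I j \<cdot> mp n' \<subseteq> P" using Suc(3) unfolding nn mp_bump[OF j(1)] .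
  then have "I j \<subseteq> P \<or> mp n' \<subseteq> P"
    by (rule primeideal_divides_ideal_prod[OF P I_ideal[OF j(1)] mp_ideal])
  moreover have "0 < n i" if "0 < n' i" for i using that by (simp add: n'_def split: if_splits)
  ultimately show ?case using Suc(1)[OF x] j by blast
qed

text \<open>A chain of primes containing \<^term>\<open>K\<close> whose least member contains none of the ideals
  \<open>I\<^sub>1, ..., I\<^sub>s\<close> is a chain in the spectrum of \<open>R/(K : I\<^sup>\<infinity>)\<close>.\<close>

definition prime_chain :: "'a set \<Rightarrow> nat \<Rightarrow> bool" where
  "prime_chain K d \<longleftrightarrow> (\<exists>P :: nat \<Rightarrow> 'a set. (\<forall>i\<le>d. primeideal (P i) R) \<and> (\<forall>i<d. P i \<subset> P (Suc i)) \<and>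
     K \<subseteq> P 0 \<and> (\<forall>j\<in>{1..s}. \<not> I j \<subseteq> P 0))"

lemma prime_chain_extend:
  assumes "\<forall>i\<le>d. primeideal (P i) R" "\<forall>i<d. P i \<subset> P (Suc i)"
    and "primeideal Q R" "Q \<subset> P 0" "K \<subseteq> Q" "\<forall>j\<in>{1..s}. \<not> I j \<subseteq> Q"
  shows "prime_chain K (Suc d)"
  unfolding prime_chain_def
proof (intro exI[of _ "\<lambda>i. case i of 0 \<Rightarrow> Q | Suc i \<Rightarrow> P i"] conjI allI impI)
  fix i
  show "i \<le> Suc d \<Longrightarrow> primeideal (case i of 0 \<Rightarrow> Q | Suc i \<Rightarrow> P i) R"
    using assms(1,3) by (cases i) auto
  show "i < Suc d \<Longrightarrow> (case i of 0 \<Rightarrow> Q | Suc i \<Rightarrow> P i) \<subset> (case Suc i of 0 \<Rightarrow> Q | Suc i \<Rightarrow> P i)"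
    using assms(2,4) by (cases i) auto
qed (use assms in auto)

text \<open>A prime over \<open>K\<close> that contains no power of J I_1 ... I_s does not contain
  J, hence lies strictly below the maximal ideal.\<close>

lemma not_nilp_mod_prime_chain:
  assumes K: "ideal K R" and nn: "\<not> nilp_mod K"
  shows "prime_chain K 1"
proof -
  have "\<exists>P. primeideal P R \<and> K \<subseteq> P \<and> (\<forall>S\<in>range (\<lambda>m. mp (\<lambda>_. m)). \<not> S \<subseteq> P)"
  proof (rule prime_avoiding[OF K, of "range (\<lambda>m. mp (\<lambda>_. m))"])
    fix S assume "S \<in> range (\<lambda>m. mp (\<lambda>_. m))"
    then obtain m where m: "S = mp (\<lambda>_. m)" by blast
    show "S \<subseteq> carrier R" unfolding m by (rule idealD(1)[OF mp_ideal])
    show "\<not> S \<subseteq> K" using nn unfolding m nilp_mod_def by blast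
    fix T assume "T \<in> range (\<lambda>m. mp (\<lambda>_. m))"
    then obtain m' where m': "T = mp (\<lambda>_. m')" by blast
    have "mp (\<lambda>_. m + m') \<subseteq> Q" if "ideal Q R" "\<forall>a\<in>S. \<forall>b\<in>T. a \<otimes> b \<in> Q" for Q
      unfolding mp_const_add[symmetric] using that m m' by (intro ideal_prod_least[OF K]) auto
    then show "\<exists>U\<in>range (\<lambda>m. mp (\<lambda>_. m)). \<forall>Q. ideal Q R \<longrightarrow> (\<forall>a\<in>S. \<forall>b\<in>T. a \<otimes> b \<in> Q) \<longrightarrow> U \<subseteq> Q"
      by (intro bexI[of _ "mp (\<lambda>_. m + m')"] allI impI) auto
  qed auto
  then obtain P where P: "primeideal P R" "K \<subseteq> P" and "\<forall>S\<in>range (\<lambda>m. mp (\<lambda>_. m)). \<not> S \<subseteq> P"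
    by (elim exE conjE)
  then have np: "\<not> mp (\<lambda>_. m) \<subseteq> P" for m by simp
  have nI: "\<not> I j \<subseteq> P" if "j \<le> s" for j using mp_sub_I[OF that] np[of 1] by blast
  have iP: "ideal P R" by (rule primeideal.axioms(1)[OF P(1)])
  have "P \<subseteq> \<nn>" using proper_sub_max[OF iP] primeideal.I_notcarr[OF P(1)] by blast
  moreover have "P \<noteq> \<nn>" using nI[of 0] J_sub by blast
  ultimately have "P \<subset> \<nn>" by blast
  then have "prime_chain K (Suc 0)"
    using P nI maximalideal_prime[OF max_ideal] by (intro prime_chain_extend[of 0 "\<lambda>_. \<nn>" P]) auto
  then show ?thesis by simp
qed

text \<open>Wanted is a prime over \<open>K\<close> strictly below P_0, found by avoiding
  \<open>x\<close>. The obstacle is that \<open>x\<close> may be nilpotent in the localisation of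
  R/K at P_0. Then regularity in large degrees forces P_0 to be the maximal ideal, so d = 0, and a
  chain of length 1 exists anyway.\<close>

lemma superficial_mod_prime_chain:
  assumes K: "ideal K R" and x: "superficial_mod K i x" and nn: "\<not> nilp_mod K"
    and ch: "prime_chain (K <+> PIdl x) d"
  shows "prime_chain K (Suc d)"
proof -
  obtain P where P: "\<forall>i\<le>d. primeideal (P i) R" "\<forall>i<d. P i \<subset> P (Suc i)" "K <+> PIdl x \<subseteq> P 0"
    "\<forall>j\<in>{1..s}. \<not> I j \<subseteq> P 0" using ch unfolding prime_chain_def by (elim exE conjE)
  have xc: "x \<in> carrier R" using x by (simp add: superficial_mod_def)
  have P0: "primeideal (P 0) R" using P(1) by simp
  have iP0: "ideal (P 0) R" by (rule primeideal.axioms(1)[OF P0])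
  have KP: "K \<subseteq> P 0" "x \<in> P 0" using P(3) mem_sum_cgenideal_self[OF K xc] by auto
  obtain N where N: "\<And>n y. \<forall>j. N \<le> n j \<Longrightarrow> y \<in> E K n \<Longrightarrow> x \<otimes> y \<in> K \<Longrightarrow> y \<in> K"
    using superficial_mod_regular[OF K x] unfolding eventually_large by blast
  show ?thesis
  \<comment> \<open>The condition says that \<open>x\<close> is nilpotent in the localisation of R/K
    at P_0.\<close>
  proof (cases "\<exists>l y. y \<in> carrier R \<and> y \<notin> P 0 \<and> x [^] (l::nat) \<otimes> y \<in> K")
    case True
    then obtain l :: nat and y where y: "y \<in> carrier R" "y \<notin> P 0" "x [^] l \<otimes> y \<in> K" by blast
    have zK: "z \<in> K" if "z \<in> mp (\<lambda>_. N)" "x [^] l' \<otimes> z \<in> K" for l' :: nat and z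
      using that(2)
    proof (induction l')
      case 0
      then show ?case using idealD(3)[OF mp_ideal that(1)] by simp
    next
      case (Suc l')
      have zc: "z \<in> carrier R" by (rule idealD(3)[OF mp_ideal that(1)])
      have "x [^] l' \<otimes> z \<in> mp (\<lambda>_. N)" using xc by (intro idealD(7)[OF mp_ideal that(1)]) simp
      then have "x [^] l' \<otimes> z \<in> E K (\<lambda>_. N)" using mp_sub_E[OF K] by blast
      moreover have "x \<otimes> (x [^] l' \<otimes> z) \<in> K" using Suc.prems xc zc by (simp add: m_ac)
      ultimately have "x [^] l' \<otimes> z \<in> K" using N[of "\<lambda>_. N"] by blast
      then show ?case by (rule Suc.IH)
    qed
    have "mp (\<lambda>_. N) \<subseteq> P 0"
    proof
      fix w assume w: "w \<in> mp (\<lambda>_. N)"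
      have wc: "w \<in> carrier R" by (rule idealD(3)[OF mp_ideal w])
      have "x [^] l \<otimes> (y \<otimes> w) \<in> K" using idealD(8)[OF K y(3) wc] xc wc y(1) by (simp add: m_assoc)
      then have "y \<otimes> w \<in> K" using zK idealD(7)[OF mp_ideal w y(1)] by blast
      then have "y \<otimes> w \<in> P 0" using KP by blast
      then show "w \<in> P 0" using primeideal.I_prime[OF P0 y(1) wc] y(2) by blast
    qed
    \<comment> \<open>Only j = 0 is possible, since P_0 contains none of I_1, ..., I_s.\<close>
    then obtain j where j: "j \<le> s" "I j \<subseteq> P 0" using mp_sub_prime[OF P0] by blast
    then have "I 0 \<subseteq> P 0" using P(4) by (cases "j = 0") auto
    then have P0n: "P 0 = \<nn>" by (rule prime_over_J[OF P0])
    have "d = 0"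
    proof (rule ccontr)
      assume "d \<noteq> 0"
      then have "\<nn> \<subset> P 1" "primeideal (P 1) R" using P(1,2) P0n by auto
      then show False
        using proper_sub_max[of "P 1"] primeideal.axioms(1)[of "P 1" R] primeideal.I_notcarr[of "P 1" R] by blast
    qed
    then show ?thesis using not_nilp_mod_prime_chain[OF K nn] by simp
  next
    case False
    let ?S = "{{x [^] (l::nat) \<otimes> y} | l y. y \<in> carrier R \<and> y \<notin> P 0}"
    have oneP: "\<one> \<notin> P 0" using ideal.one_imp_carrier[OF iP0] primeideal.I_notcarr[OF P0] by blast
    have "\<exists>Q. primeideal Q R \<and> K \<subseteq> Q \<and> (\<forall>S\<in>?S. \<not> S \<subseteq> Q)"
    proof (rule prime_avoiding[OF K, of ?S])
      show "?S \<noteq> {}" using oneP by blast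
      fix S assume "S \<in> ?S"
      then obtain l :: nat and y where S: "S = {x [^] l \<otimes> y}" "y \<in> carrier R" "y \<notin> P 0" by blast
      show "S \<subseteq> carrier R" unfolding S(1) using xc S(2) by simp
      show "\<not> S \<subseteq> K" using False S by blast
      fix T assume "T \<in> ?S"
      then obtain l' :: nat and y' where T: "T = {x [^] l' \<otimes> y'}" "y' \<in> carrier R" "y' \<notin> P 0" by blast
      have "y \<otimes> y' \<notin> P 0" using primeideal.I_prime[OF P0 S(2) T(2)] S(3) T(3) by blast
      then have U: "{x [^] (l + l') \<otimes> (y \<otimes> y')} \<in> ?S" using S(2) T(2) m_closed by blast
      have "x [^] (l + l') \<otimes> (y \<otimes> y') = (x [^] l \<otimes> y) \<otimes> (x [^] l' \<otimes> y')"
        using xc S(2) T(2) by (simp add: nat_pow_mult[symmetric] m_ac)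
      then show "\<exists>U\<in>?S. \<forall>Q. ideal Q R \<longrightarrow> (\<forall>a\<in>S. \<forall>b\<in>T. a \<otimes> b \<in> Q) \<longrightarrow> U \<subseteq> Q"
        using S(1) T(1) by (intro bexI[OF _ U]) simp
    qed
    then obtain Q where Q: "primeideal Q R" "K \<subseteq> Q" and nQ0: "\<forall>S\<in>?S. \<not> S \<subseteq> Q"
      by (elim exE conjE)
    have nQ: "\<not> S \<subseteq> Q" if "S \<in> ?S" for S using nQ0 that by (rule bspec)
    have QP: "Q \<subseteq> P 0"
    proof
      fix y assume y: "y \<in> Q"
      have yc: "y \<in> carrier R" by (rule idealD(3)[OF primeideal.axioms(1)[OF Q(1)] y])
      show "y \<in> P 0"
      proof (rule ccontr)
        assume "y \<notin> P 0"
        then have "{x [^] (0::nat) \<otimes> y} \<in> ?S" using yc by blast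
        from nQ[OF this] show False using y yc by simp
      qed
    qed
    have "{x [^] (1::nat) \<otimes> \<one>} \<in> ?S" using oneP by blast
    then have "x \<notin> Q" using nQ[of "{x [^] (1::nat) \<otimes> \<one>}"] xc by simp
    then have "Q \<subset> P 0" using QP KP(2) by blast
    moreover have "\<forall>j\<in>{1..s}. \<not> I j \<subseteq> Q" using P(4) QP by blast
    ultimately show ?thesis using prime_chain_extend[OF P(1,2) Q(1) _ Q(2)] by blast
  qed
qed

section \<open>Degree of the Hilbert function\<close>

lemma hlen_depends_on: "ideal K R \<Longrightarrow> depends_on s (hlen K)"
proof -
  assume K: "ideal K R"
  have "hlen K n = hlen K m" if nm: "\<forall>j\<le>s. n j = m j" for n m
  proof -
    have "E K n = E K m" by (rule E_cong[OF K]) (use nm in simp)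
    moreover have "E K (bump 0 n) = E K (bump 0 m)" by (rule E_cong[OF K]) (use nm in \<open>simp add: bump_apply\<close>)
    ultimately show ?thesis by (simp add: hlen_def)
  qed
  then show ?thesis unfolding depends_on_def by blast
qed

lemma fdiffs_bump: "fdiffs \<sigma> (\<lambda>n. f (bump i n)) = (\<lambda>n. fdiffs \<sigma> f (bump i n))"
proof (induction \<sigma> arbitrary: f)
  case (Cons j \<sigma>)
  have "fdiff j (\<lambda>n. f (bump i n)) = (\<lambda>n. fdiff j f (bump i n))"
    by (auto simp: fdiff_def bump_commute)
  then show ?case by (simp add: Cons)
qed simp

lemma pdeg_bump: "pdeg s D f \<Longrightarrow> pdeg s D (\<lambda>n. f (bump i n))"
  unfolding pdeg_iff fdiffs_bump by (auto intro: eventually_large_bump)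

lemma nilp_mod_hlen:
  assumes K: "ideal K R" and "nilp_mod K"
  shows "eventually (\<lambda>n. hlen K n = 0) large"
proof -
  obtain m where m: "mp (\<lambda>_. m) \<subseteq> K" using assms(2) by (auto simp: nilp_mod_def)
  have "hlen K n = 0" if n: "\<forall>j. m \<le> n j" for n
  proof -
    have e: "E K n' = K" if "\<forall>j. m \<le> n' j" for n'
    proof -
      have "mp n' \<subseteq> mp (\<lambda>_. m)" using that by (intro mp_antimono[OF K]) simp
      then show ?thesis using E_least[OF K K] K_sub_E[OF K, of n'] m by blast
    qed
    have "\<forall>j. m \<le> bump 0 n j" using n by (simp add: bump_apply le_SucI)
    then show ?thesis using e n by (simp add: hlen_def ideal_length_self zero_enat_def)
  qed
  then show ?thesis unfolding eventually_large by blast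
qed

text \<open>Passing from K + (x) back to \<open>K\<close> undoes one difference and prolongs the
  chain of primes by one, so both numbers grow together. The alternative \<open>D = 0\<close> covers
  the nilpotent case, where no chain need exist.\<close>

theorem hlen_pdeg:
  assumes "ideal K R"
  shows "\<exists>D. pdeg s D (hlen K) \<and> (D = 0 \<or> prime_chain K D)"
  using assms
proof (induction K rule: noetherian_induct)
  case (step K)
  show ?case
  proof (cases "nilp_mod K")
    case True
    then show ?thesis using nilp_mod_hlen[OF step(1)] by (intro exI[of _ 0]) simp
  next
    case nn: False
    have "\<exists>D. pdeg s D (fdiff i (hlen K)) \<and> (D = 0 \<or> prime_chain K (Suc D))" if i: "i \<le> s" for i
    proof -
      obtain x where x: "x \<in> I i" "superficial_mod K i x"
        using superficial_mod_exists[OF step(1) i] by blast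
      have xc: "x \<in> carrier R" using x(2) by (simp add: superficial_mod_def)
      let ?K = "K <+> PIdl x"
      have "K \<subset> ?K" using mem_sum_cgenideal_self[OF step(1) xc] superficial_mod_not_mem[OF step(1) x(2) nn] by blast
      then obtain D where D: "pdeg s D (hlen ?K)" "D = 0 \<or> prime_chain ?K D"
        using step(2) mem_sum_cgenideal_self(3)[OF step(1) xc] by blast
      have "eventually (\<lambda>n. hlen ?K (bump i n) = fdiff i (hlen K) n) large"
        using superficial_mod_hlen[OF step(1) i x] by (simp add: fdiff_def)
      from pdeg_cong[OF this pdeg_bump[OF D(1)]] have "pdeg s D (fdiff i (hlen K))" .
      moreover have "D = 0 \<or> prime_chain K (Suc D)"
        using D(2) superficial_mod_prime_chain[OF step(1) x(2) nn] by blast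
      ultimately show ?thesis by blast
    qed
    then obtain D where D: "\<And>i. i \<le> s \<Longrightarrow> pdeg s (D i) (fdiff i (hlen K))"
      "\<And>i. i \<le> s \<Longrightarrow> D i = 0 \<or> prime_chain K (Suc (D i))" by metis
    \<comment> \<open>The direction with the largest bound determines the degree, and its chain is
      the one that is used.\<close>
    define M where "M = Max (D ` {..s})"
    have "D i \<le> M" if "i \<le> s" for i unfolding M_def using that by (intro Max_ge) auto
    then have "pdeg s (Suc M) (hlen K)" using pdeg_mono[OF D(1)] by simp
    moreover have "prime_chain K (Suc M)"
    \<comment> \<open>For M = 0 no chain is handed down from a direction; non-nilpotency supplies
      one of length 1.\<close>
    proof (cases "M = 0")
      case True
      then show ?thesis using not_nilp_mod_prime_chain[OF step(1) nn] by simp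
    next
      case False
      have "M \<in> D ` {..s}" unfolding M_def by (intro Max_in) auto
      then obtain i where "i \<le> s" "M = D i" by auto
      then show ?thesis using D(2)[of i] False by auto
    qed
    ultimately show ?thesis by blast
  qed
qed

section \<open>Hilbert--Samuel functions and saturations\<close>

definition Jpow :: "nat \<Rightarrow> 'a set" where
  "Jpow m = I 0 [^]\<^bsub>ideals_set R\<^esub> m"

lemma Jpow_ideal: "ideal (Jpow m) R"
  unfolding Jpow_def by (rule ideal_pow[OF J_ideal])

lemma Jpow_Suc: "Jpow (Suc m) = I 0 \<cdot> Jpow m"
  unfolding Jpow_def using ideal_prod_commute[OF J_ideal ideal_pow[OF J_ideal]] by simp

lemma Jpow_0: "Jpow 0 = carrier R"
  by (simp add: Jpow_def)

lemma mp_split_J: "mp (n(0 := m)) = Jpow m \<cdot> mp (n(0 := 0))"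
proof (induction m)
  case 0
  then show ?case by (simp add: Jpow_0 one_ideal_prod[OF mp_ideal])
next
  case (Suc m)
  have "n(0 := Suc m) = bump 0 (n(0 := m))" by (auto simp: bump_def)
  then have "mp (n(0 := Suc m)) = I 0 \<cdot> mp (n(0 := m))" using mp_bump[of 0] by simp
  then show ?case
    using Suc ideal_prod_assoc[OF J_ideal Jpow_ideal mp_ideal, of m "n(0 := 0)"]
    by (simp only: Jpow_Suc)
qed

lemma mp_J: "mp ((\<lambda>_. 0)(0 := m)) = Jpow m"
  using mp_split_J[of "\<lambda>_. 0" m] mp_zero[of "(\<lambda>_. 0)(0 := 0)"] ideal_prod_one[OF Jpow_ideal] by simp

lemma Jpow_sub_max: "0 < m \<Longrightarrow> Jpow m \<subseteq> \<nn>"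
  using Jpow_Suc[of "m - 1"] ideal_prod_inter[OF J_ideal Jpow_ideal, of "m - 1"] J_sub by auto

lemma Jpow_antimono: "m \<le> m' \<Longrightarrow> Jpow m' \<subseteq> Jpow m"
  by (rule lift_Suc_antimono_le[of Jpow])
    (use ideal_prod_inter[OF J_ideal Jpow_ideal] in \<open>auto simp: Jpow_Suc\<close>)

text \<open>The exponent is \<open>m\<close> itself, whereas the Hilbert--Samuel polynomial refers
  to J^(n+1); \<open>hilbert_samuel_multiplicity_quot\<close> accounts for the shift.\<close>

definition hs :: "'a set \<Rightarrow> nat \<Rightarrow> rat" where
  "hs Q m = of_nat (the_enat (ideal_length R (carrier R) (Jpow m <+> Q)))"

lemma JQ_ideal: "ideal Q R \<Longrightarrow> ideal (Jpow m <+> Q) R"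
  by (rule add_ideals[OF Jpow_ideal])

lemma JQ_step:
  assumes "ideal Q R" shows "Jpow (Suc m) <+> Q \<subseteq> Jpow m <+> Q"
  using Jpow_antimono[of m "Suc m"] by (intro ideal_sum_mono) auto

text \<open>Each of the successive layers between J^m A + Q and J^(m+1) A + Q is killed by J and so
  has finite length.\<close>

lemma finite_length_Jpow:
  assumes A: "ideal A R" and Q: "ideal Q R" and QA: "Q \<subseteq> A"
  shows "ideal_length R A (Jpow m \<cdot> A <+> Q) \<noteq> \<infinity>"
proof (induction m)
  case 0
  then show ?case
    using ideal_sum_absorb[OF A Q QA] one_ideal_prod[OF A] by (simp add: Jpow_0 ideal_length_self)
next
  case (Suc m)
  have i: "ideal (Jpow k \<cdot> A <+> Q) R" for k by (intro add_ideals Q ideal_prod_is_ideal Jpow_ideal A)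
  have JA: "Jpow k \<cdot> A \<subseteq> A" for k using ideal_prod_inter[OF Jpow_ideal A] by blast
  have sub: "Jpow (Suc m) \<cdot> A <+> Q \<subseteq> Jpow m \<cdot> A <+> Q"
    using Jpow_antimono[of m "Suc m"] by (intro ideal_sum_mono ideal_prod_mono) auto
  have subA: "Jpow m \<cdot> A <+> Q \<subseteq> A" by (rule ideal_sum_least[OF A JA QA])
  have "ideal_length R (Jpow m \<cdot> A <+> Q) (Jpow (Suc m) \<cdot> A <+> Q) \<noteq> \<infinity>"
  proof (rule finite_length[OF i i sub])
    fix j a assume j: "j \<in> I 0" and "a \<in> Jpow m \<cdot> A <+> Q"
    then obtain b q where bq: "b \<in> Jpow m \<cdot> A" "q \<in> Q" "a = b \<oplus> q" by (auto simp: set_add_iff)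
    have jc: "j \<in> carrier R" by (rule idealD(3)[OF J_ideal j])
    have bc: "b \<in> carrier R" using bq(1) JA idealD(3)[OF A] by blast
    have "j \<otimes> b \<in> I 0 \<cdot> (Jpow m \<cdot> A)" using j bq(1) by (rule ideal_prod.prod)
    then have "j \<otimes> b \<in> Jpow (Suc m) \<cdot> A"
      using ideal_prod_assoc[OF J_ideal Jpow_ideal A] by (simp add: Jpow_Suc)
    moreover have "j \<otimes> q \<in> Q" by (rule idealD(7)[OF Q bq(2) jc])
    moreover have "j \<otimes> a = j \<otimes> b \<oplus> j \<otimes> q"
      unfolding bq(3) using jc bc idealD(3)[OF Q bq(2)] by (rule r_distr[rotated 2])
    ultimately show "j \<otimes> a \<in> Jpow (Suc m) \<cdot> A <+> Q" unfolding set_add_iff by blast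
  qed
  then show ?case using Suc ideal_length_add[OF A i i sub subA] by (simp add: plus_eq_infty_iff_enat)
qed

lemma hs_finite: "ideal Q R \<Longrightarrow> ideal_length R (carrier R) (Jpow m <+> Q) \<noteq> \<infinity>"
  using finite_length_Jpow[OF oneideal, of Q m] idealD(1)[of Q] ideal_prod_one[OF Jpow_ideal] by simp

lemma hs_enat: "ideal Q R \<Longrightarrow> \<exists>l. ideal_length R (carrier R) (Jpow m <+> Q) = enat l"
  using hs_finite[of Q m] by simp

lemma hs_nonneg: "0 \<le> hs Q m"
  by (simp add: hs_def)

lemma the_enat_mono: "a \<le> b \<Longrightarrow> b \<noteq> \<infinity> \<Longrightarrow> the_enat a \<le> the_enat b"
  by (cases a; cases b) auto

lemma hs_antimono:
  assumes "ideal Q R" "Q \<subseteq> Q'"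
  shows "hs Q' m \<le> hs Q m"
proof -
  have "ideal_length R (carrier R) (Jpow m <+> Q') \<le> ideal_length R (carrier R) (Jpow m <+> Q)"
    using assms(2) by (intro ideal_length_mono ideal_sum_mono) auto
  then show ?thesis unfolding hs_def using the_enat_mono hs_finite[OF assms(1)] by simp
qed

lemma hs_step:
  assumes Q: "ideal Q R"
  shows "hs Q (Suc m) = hs Q m + of_nat (the_enat (ideal_length R (Jpow m <+> Q) (Jpow (Suc m) <+> Q)))"
proof -
  have "ideal_length R (carrier R) (Jpow (Suc m) <+> Q)
      = ideal_length R (carrier R) (Jpow m <+> Q) + ideal_length R (Jpow m <+> Q) (Jpow (Suc m) <+> Q)"
    by (rule ideal_length_add[OF oneideal JQ_ideal[OF Q] JQ_ideal[OF Q] JQ_step[OF Q] idealD(1)[OF JQ_ideal[OF Q]]])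
  then show ?thesis
    using hs_finite[OF Q, of m] hs_finite[OF Q, of "Suc m"] unfolding hs_def
    by (cases "ideal_length R (carrier R) (Jpow m <+> Q)";
        cases "ideal_length R (Jpow m <+> Q) (Jpow (Suc m) <+> Q)") auto
qed

section \<open>The degree of a Hilbert--Samuel function is the dimension\<close>

definition spec_chain :: "'a set \<Rightarrow> nat \<Rightarrow> bool" where
  "spec_chain Q d \<longleftrightarrow> (\<exists>P :: nat \<Rightarrow> 'a set. (\<forall>i\<le>d. primeideal (P i) R) \<and> (\<forall>i<d. P i \<subset> P (Suc i)) \<and>
     Q \<subseteq> P 0)"

lemma spec_chain_le: "spec_chain Q d \<Longrightarrow> d' \<le> d \<Longrightarrow> spec_chain Q d'"
proof -
  assume "spec_chain Q d" and le: "d' \<le> d"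
  then obtain P where "\<forall>i\<le>d. primeideal (P i) R" "\<forall>i<d. P i \<subset> P (Suc i)" "Q \<subseteq> P 0"
    unfolding spec_chain_def by (elim exE conjE)
  then show ?thesis unfolding spec_chain_def using le by (intro exI[of _ P]) simp
qed

lemma dif_pow_fdiffs:
  "(dif ^^ D) (\<lambda>m. f (n(0 := m))) m = fdiffs (replicate D 0) f (n(0 := m))"
proof (induction D arbitrary: f)
  case (Suc D)
  have "dif (\<lambda>m. f (n(0 := m))) = (\<lambda>m. fdiff 0 f (n(0 := m)))"
    by (auto simp: dif_def fdiff_def bump_def)
  then show ?case
    using Suc[of "fdiff 0 f"] by (simp only: funpow_Suc_right o_apply replicate_Suc fdiffs_Cons)
qed simp

lemma primeideal_proper: "primeideal P R \<Longrightarrow> P \<noteq> carrier R"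
  using primeideal.I_notcarr by blast

lemma primeideal_ideal: "primeideal P R \<Longrightarrow> ideal P R"
  by (rule primeideal.axioms(1))

text \<open>J viewed as a family with one member, which makes all results on families available for
  the J-adic filtration.\<close>

lemma family_0: "local_primary_family R 0 I \<nn>"
  using local_primary_family_axioms I_ideal unfolding local_primary_family_def local_ideal_family_def
    ideal_family_def ideal_family_axioms_def by simp

text \<open>The first difference of \<open>hs Q\<close> is the Hilbert function of the family
  consisting of J alone, for which the condition on I_1, ..., I_s in a prime chain is void.
  Summation raises the degree by one, hence \<open>Suc D\<close>.\<close>

lemma hs_degree_aux:
  assumes Q: "ideal Q R"
  shows "\<exists>D. eventually (\<lambda>m. (dif ^^ Suc D) (hs Q) m = 0) sequentially
    \<and> (Q \<noteq> carrier R \<longrightarrow> spec_chain Q D)"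
proof -
  interpret Z: local_primary_family R 0 I \<nn> by (rule family_0)
  have EJ: "Z.E Q ((\<lambda>_. 0)(0 := m)) = Jpow m <+> Q" for m
    unfolding Z.E_def using Z.mp_J by (simp add: Z.Jpow_def Jpow_def)
  obtain D where D: "pdeg 0 D (Z.hlen Q)" "D = 0 \<or> Z.prime_chain Q D"
    using Z.hlen_pdeg[OF Q] by blast
  have "eventually (\<lambda>n. fdiffs (replicate D 0) (Z.hlen Q) n = 0) large"
    using D(1)[unfolded pdeg_iff, rule_format, of "replicate D 0"] by (simp add: set_replicate_conv_if)
  then obtain N where N: "\<And>n. \<forall>j. N \<le> n j \<Longrightarrow> fdiffs (replicate D 0) (Z.hlen Q) n = 0"
    unfolding eventually_large by blast
  have dep: "depends_on 0 (fdiffs (replicate D 0) (Z.hlen Q))"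
    by (rule depends_on_fdiffs[OF Z.hlen_depends_on[OF Q]])
  have "dif (hs Q) m = Z.hlen Q ((\<lambda>_. 0)(0 := m))" for m
  proof -
    have "bump 0 ((\<lambda>_. 0)(0 := m)) = (\<lambda>_. 0)(0 := Suc m)" by (auto simp: bump_def)
    then have "Z.hlen Q ((\<lambda>_. 0)(0 := m)) = of_nat (the_enat (ideal_length R (Jpow m <+> Q) (Jpow (Suc m) <+> Q)))"
      unfolding Z.hlen_def by (simp only: EJ)
    then show ?thesis using hs_step[OF Q, of m] by (simp add: dif_def)
  qed
  then have h: "dif (hs Q) = (\<lambda>m. Z.hlen Q ((\<lambda>_. 0)(0 := m)))" by blast
  have "(dif ^^ Suc D) (hs Q) m = 0" if "N \<le> m" for m
  proof -
    have "(dif ^^ Suc D) (hs Q) m = fdiffs (replicate D 0) (Z.hlen Q) ((\<lambda>_. 0)(0 := m))"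
      using dif_pow_fdiffs[of D "Z.hlen Q" "\<lambda>_. 0" m] by (simp only: funpow_Suc_right o_apply h)
    \<comment> \<open>This family reads only coordinate 0, so the other coordinates may be made
      large too.\<close>
    also have "\<dots> = fdiffs (replicate D 0) (Z.hlen Q) (\<lambda>_. m)"
      by (rule dep[unfolded depends_on_def, rule_format]) simp
    also have "\<dots> = 0" by (rule N) (use that in simp)
    finally show ?thesis .
  qed
  then have ev: "eventually (\<lambda>m. (dif ^^ Suc D) (hs Q) m = 0) sequentially"
    unfolding eventually_sequentially by blast
  have "spec_chain Q D" if ne: "Q \<noteq> carrier R"
  proof (cases "D = 0")
    case True
    have "Q \<subseteq> \<nn>" by (rule proper_sub_max[OF Q ne])
    then show ?thesis
      unfolding spec_chain_def using True maximalideal_prime[OF max_ideal] by (intro exI[of _ "\<lambda>_. \<nn>"]) simp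
  next
    case False
    then have "Z.prime_chain Q D" using D(2) by simp
    then show ?thesis unfolding Z.prime_chain_def spec_chain_def by meson
  qed
  then show ?thesis using ev by blast
qed

lemma hs_eventually_poly:
  assumes "ideal Q R"
  shows "\<exists>D. eventually (\<lambda>m. (dif ^^ D) (hs Q) m = 0) sequentially"
  using hs_degree_aux[OF assms] by blast

text \<open>The inequality degree \<le> dimension. For Q = R there are no primes and
  \<open>hs\<close> is zero.\<close>

lemma hs_degree_le:
  assumes Q: "ideal Q R" and no: "\<not> spec_chain Q d"
  shows "eventually (\<lambda>m. (dif ^^ d) (hs Q) m = 0) sequentially"
proof (cases "Q = carrier R")
  case True
  have "hs Q m = 0" for m
    unfolding hs_def True using ideal_sum_upper(2)[OF Jpow_ideal oneideal, of m]
      idealD(1)[OF JQ_ideal[OF oneideal, of m]] ideal_length_self[of "carrier R"]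
    by (simp add: zero_enat_def subset_antisym)
  then have "eventually (\<lambda>m. (dif ^^ 0) (hs Q) m = 0) sequentially" by simp
  then show ?thesis by (rule dif_pow_mono_deg) simp
next
  case False
  then obtain D where ev: "eventually (\<lambda>m. (dif ^^ Suc D) (hs Q) m = 0) sequentially" and "spec_chain Q D"
    using hs_degree_aux[OF Q] by blast
  then have "Suc D \<le> d" using no spec_chain_le by (meson not_less_eq_eq)
  then show ?thesis by (rule dif_pow_mono_deg[OF ev])
qed

lemma artin_rees_J:
  assumes K: "ideal K R" and a: "ideal a R" and Ka: "K \<subseteq> a"
  shows "\<exists>c. \<forall>m. a \<inter> (Jpow m <+> K) \<subseteq> Jpow (m - c) \<cdot> a <+> K"
proof -
  interpret Z: local_primary_family R 0 I \<nn> by (rule family_0)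
  have EJ: "Z.E K ((\<lambda>_. 0)(0 := m)) = Jpow m <+> K" for m
    unfolding Z.E_def using Z.mp_J by (simp add: Z.Jpow_def Jpow_def)
  obtain c where c: "\<And>n. a \<inter> Z.E K n \<subseteq> Z.mp (\<lambda>j. n j - c) \<cdot> a <+> K"
    using Z.artin_rees[OF K a Ka] by blast
  have "Z.mp (\<lambda>j. ((\<lambda>_. 0)(0 := m)) j - c) = Jpow (m - c)" for m
  proof -
    have "Z.mp (\<lambda>j. ((\<lambda>_. 0)(0 := m)) j - c) = Z.mp ((\<lambda>_. 0)(0 := m - c))" by (rule Z.mp_cong) simp
    then show ?thesis using Z.mp_J[of "m - c"] by (simp only: Z.Jpow_def Jpow_def)
  qed
  then have "a \<inter> (Jpow m <+> K) \<subseteq> Jpow (m - c) \<cdot> a <+> K" for m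
    using c[of "(\<lambda>_. 0)(0 := m)"] EJ[of m] by simp
  then show ?thesis by blast
qed

text \<open>An \<open>x\<close> in \<open>P'\<close> outside \<open>P\<close> is regular on R/P. By
  Artin--Rees (J^m + P) : x lies in J^(m - c) + P, so hs P' m \<le> hs P m - hs P (m - c), and the
  right side has smaller degree than \<open>hs P\<close>.\<close>

lemma hs_prime_strict:
  assumes P: "primeideal P R" and P': "primeideal P' R" and PP: "P \<subset> P'"
    and ev: "eventually (\<lambda>m. (dif ^^ Suc d) (hs P) m = 0) sequentially"
  shows "eventually (\<lambda>m. (dif ^^ d) (hs P') m = 0) sequentially"
proof -
  have iP: "ideal P R" and iP': "ideal P' R" using P P' by (auto intro: primeideal_ideal)
  obtain x where x: "x \<in> P'" "x \<notin> P" using PP by blast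
  have xc: "x \<in> carrier R" by (rule idealD(3)[OF iP' x(1)])
  let ?X = "PIdl x"
  have X: "ideal ?X R" by (rule cgenideal_ideal[OF xc])
  have XP: "ideal (?X <+> P) R" by (rule add_ideals[OF X iP])
  obtain c where c: "\<And>m. (?X <+> P) \<inter> (Jpow m <+> P) \<subseteq> Jpow (m - c) \<cdot> (?X <+> P) <+> P"
    using artin_rees_J[OF iP XP ideal_sum_upper(2)[OF X iP]] by blast
  have colon: "colon R (Jpow m <+> P) {x} \<subseteq> Jpow (m - c) <+> P" for m
  proof
    fix y assume "y \<in> colon R (Jpow m <+> P) {x}"
    then have y: "y \<in> carrier R" "y \<otimes> x \<in> Jpow m <+> P" by (simp_all add: mem_colon_singleton)
    have sm: "ideal ((\<lambda>z. x \<otimes> z) ` Jpow (m - c)) R" by (rule smult_ideal[OF Jpow_ideal xc])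
    have "y \<otimes> x \<in> ?X" using y(1) cgenideal_iff by blast
    then have "y \<otimes> x \<in> ?X <+> P" using ideal_sum_upper(1)[OF X iP] by blast
    then have "y \<otimes> x \<in> Jpow (m - c) \<cdot> (?X <+> P) <+> P" using c[of m] y(2) by blast
    also have "\<dots> \<subseteq> (\<lambda>z. x \<otimes> z) ` Jpow (m - c) <+> P"
    proof (rule ideal_sum_least[OF add_ideals[OF sm iP] _ ideal_sum_upper(2)[OF sm iP]])
      show "Jpow (m - c) \<cdot> (?X <+> P) \<subseteq> (\<lambda>z. x \<otimes> z) ` Jpow (m - c) <+> P"
      proof (rule ideal_prod_least[OF iP add_ideals[OF sm iP]])
        fix a b assume a: "a \<in> Jpow (m - c)" and "b \<in> ?X <+> P"
        then obtain r k where rk: "r \<in> carrier R" "k \<in> P" "b = r \<otimes> x \<oplus> k"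
          by (auto simp: set_add_iff cgenideal_iff)
        have ac: "a \<in> carrier R" by (rule idealD(3)[OF Jpow_ideal a])
        have "a \<otimes> b = x \<otimes> (r \<otimes> a) \<oplus> a \<otimes> k"
          unfolding rk(3) using ac xc rk(1) idealD(3)[OF iP rk(2)] by (simp add: r_distr m_ac)
        moreover have "r \<otimes> a \<in> Jpow (m - c)" by (rule idealD(7)[OF Jpow_ideal a rk(1)])
        moreover have "a \<otimes> k \<in> P" by (rule idealD(7)[OF iP rk(2) ac])
        ultimately show "a \<otimes> b \<in> (\<lambda>z. x \<otimes> z) ` Jpow (m - c) <+> P" unfolding set_add_iff by blast
      qed
    qed
    finally obtain z p where z: "z \<in> Jpow (m - c)" "p \<in> P" "y \<otimes> x = x \<otimes> z \<oplus> p"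
      by (auto simp: set_add_iff)
    have zc: "z \<in> carrier R" by (rule idealD(3)[OF Jpow_ideal z(1)])
    have pc: "p \<in> carrier R" by (rule idealD(3)[OF iP z(2)])
    have "(y \<ominus> z) \<otimes> x = y \<otimes> x \<ominus> x \<otimes> z"
      using y(1) zc xc m_comm[of z x] by (simp add: a_minus_def l_distr l_minus)
    also have "\<dots> = p" unfolding z(3) using xc zc pc by (simp add: add_minus_cancel)
    finally have "(y \<ominus> z) \<otimes> x \<in> P" using z(2) by simp
    then have "y \<ominus> z \<in> P" using primeideal.I_prime[OF P _ xc, of "y \<ominus> z"] x(2) y(1) zc by auto
    moreover have "y = z \<oplus> (y \<ominus> z)" using y(1) zc by (simp add: a_minus_def a_ac r_neg r_neg2)
    ultimately show "y \<in> Jpow (m - c) <+> P" unfolding set_add_iff using z(1) by blast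
  qed
  have le: "hs P' m \<le> hs P m - hs P (m - c)" for m
  proof -
    let ?A = "Jpow m <+> P"
    have A: "ideal ?A R" by (rule JQ_ideal[OF iP])
    have D: "ideal (?X <+> ?A) R" by (rule add_ideals[OF X A])
    have cA: "ideal (colon R ?A {x}) R" by (rule colon_ideal[OF A]) (use xc in simp)
    have "ideal_length R (?X <+> ?A) ?A = ideal_length R (carrier R) (colon R ?A {x} \<inter> carrier R)"
      unfolding cgenideal_eq_image[OF xc] by (rule ideal_length_smult[OF oneideal A xc])
    then have l1: "ideal_length R (?X <+> ?A) ?A = ideal_length R (carrier R) (colon R ?A {x})"
      using idealD(1)[OF cA] by (simp add: Int_absorb2)
    have l2: "ideal_length R (carrier R) ?A = ideal_length R (carrier R) (?X <+> ?A) + ideal_length R (?X <+> ?A) ?A"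
      by (rule ideal_length_add[OF oneideal D A ideal_sum_upper(2)[OF X A] idealD(1)[OF D]])
    have "?X <+> ?A \<subseteq> Jpow m <+> P'"
    proof (rule ideal_sum_least[OF JQ_ideal[OF iP']])
      have "?X \<subseteq> P'" by (rule cgenideal_minimal[OF iP' x(1)])
      then show "?X \<subseteq> Jpow m <+> P'" using ideal_sum_upper(2)[OF Jpow_ideal iP'] by blast
      show "?A \<subseteq> Jpow m <+> P'" using PP by (intro ideal_sum_mono) auto
    qed
    then have l3: "ideal_length R (carrier R) (Jpow m <+> P') \<le> ideal_length R (carrier R) (?X <+> ?A)"
      by (intro ideal_length_mono) auto
    have l4: "ideal_length R (carrier R) (Jpow (m - c) <+> P) \<le> ideal_length R (carrier R) (colon R ?A {x})"
      using colon by (intro ideal_length_mono) auto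
    obtain p where p: "ideal_length R (carrier R) ?A = enat p" using hs_enat[OF iP] by blast
    obtain u where u: "ideal_length R (carrier R) (?X <+> ?A) = enat u" using p l2 by (cases "ideal_length R (carrier R) (?X <+> ?A)") auto
    obtain v where v: "ideal_length R (carrier R) (colon R ?A {x}) = enat v" using p l2 l1
      by (cases "ideal_length R (carrier R) (colon R ?A {x})") auto
    obtain w where w: "ideal_length R (carrier R) (Jpow m <+> P') = enat w" using hs_enat[OF iP'] by blast
    obtain z where z: "ideal_length R (carrier R) (Jpow (m - c) <+> P) = enat z" using hs_enat[OF iP] by blast
    have "p = u + v" "w \<le> u" "z \<le> v" using p u v w z l1 l2 l3 l4 by simp_all
    then have "w + z \<le> p" by simp
    then have "rat_of_nat w + rat_of_nat z \<le> rat_of_nat p" by (simp flip: of_nat_add)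
    then show ?thesis using p w z by (simp add: hs_def)
  qed
  have "eventually (\<lambda>m. dif ((dif ^^ d) (hs P)) m = 0) sequentially" using ev by simp
  then obtain k where k: "eventually (\<lambda>m. (dif ^^ d) (hs P) m = k) sequentially"
    by (rule dif_zero_imp_const)
  \<comment> \<open>Both terms have the same constant d-th difference \<open>k\<close>, which
    cancels.\<close>
  have "eventually (\<lambda>m. (dif ^^ d) (\<lambda>m. hs P m - hs P (m - c)) m = 0) sequentially"
    using k eventually_dif_pow_delay[OF k, of c] by eventually_elim (simp add: dif_pow_diff)
  moreover obtain d' where "eventually (\<lambda>m. (dif ^^ d') (hs P') m = 0) sequentially"
    using hs_eventually_poly[OF iP'] by blast
  ultimately show ?thesis
    using le hs_nonneg by (intro dif_pow_squeeze[of "hs P'" "\<lambda>m. hs P m - hs P (m - c)" d]) simp_all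
qed

text \<open>The inequality dimension \<le> degree. Each step of the chain lowers the degree bound by
  one, so \<open>hs (P d)\<close> would eventually be 0, although R/(J^m + P_d) is not zero for m >
  0.\<close>

lemma hs_degree_ge:
  assumes Q: "ideal Q R" and ev: "eventually (\<lambda>m. (dif ^^ d) (hs Q) m = 0) sequentially"
  shows "\<not> spec_chain Q d"
proof
  assume "spec_chain Q d"
  then obtain P where P: "\<forall>i\<le>d. primeideal (P i) R" "\<forall>i<d. P i \<subset> P (Suc i)" "Q \<subseteq> P 0"
    unfolding spec_chain_def by (elim exE conjE)
  have "eventually (\<lambda>m. (dif ^^ (d - i)) (hs (P i)) m = 0) sequentially" if "i \<le> d" for i
    using that
  proof (induction i)
    case 0
    have iP: "ideal (P 0) R" using P(1) by (auto intro: primeideal_ideal)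
    obtain d' where "eventually (\<lambda>m. (dif ^^ d') (hs (P 0)) m = 0) sequentially"
      using hs_eventually_poly[OF iP] by blast
    from dif_pow_squeeze[OF _ _ ev this] show ?case
      using hs_antimono[OF Q P(3)] hs_nonneg by simp
  next
    case (Suc i)
    then have "eventually (\<lambda>m. (dif ^^ Suc (d - Suc i)) (hs (P i)) m = 0) sequentially"
      by (simp only: Suc_diff_Suc Suc_le_eq)
    then show ?case using P(1,2) Suc.prems by (intro hs_prime_strict[of "P i" "P (Suc i)"]) auto
  qed
  from this[of d] have "eventually (\<lambda>m. hs (P d) m = 0) sequentially" by simp
  then obtain N where N: "\<And>m. N \<le> m \<Longrightarrow> hs (P d) m = 0" unfolding eventually_sequentially by blast
  have pP: "primeideal (P d) R" using P(1) by simp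
  have iP: "ideal (P d) R" by (rule primeideal_ideal[OF pP])
  have "P d \<subseteq> \<nn>" by (rule proper_sub_max[OF iP primeideal_proper[OF pP]])
  then have "Jpow (Suc N) <+> P d \<subseteq> \<nn>" using Jpow_sub_max[of "Suc N"] by (intro ideal_sum_least \<nn>_ideal) auto
  then have "Jpow (Suc N) <+> P d \<subset> carrier R" using \<nn>_proper idealD(1)[OF \<nn>_ideal] by blast
  then have "1 \<le> ideal_length R (carrier R) (Jpow (Suc N) <+> P d)"
    by (intro ideal_length_pos oneideal JQ_ideal iP)
  moreover obtain l where l: "ideal_length R (carrier R) (Jpow (Suc N) <+> P d) = enat l" using hs_enat[OF iP] by blast
  ultimately have "1 \<le> l" by (simp add: one_enat_def)
  then show False using N[of "Suc N"] l by (simp add: hs_def)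
qed

section \<open>Saturation by the powers of I = I_1 ... I_s\<close>

definition mp1 :: "nat \<Rightarrow> 'a set" where
  "mp1 N = mp ((\<lambda>_. N)(0 := 0))"

lemma mp1_ideal: "ideal (mp1 N) R"
  unfolding mp1_def by (rule mp_ideal)

lemma mp1_add: "mp1 (N + M) = mp1 N \<cdot> mp1 M"
proof -
  have "mp (\<lambda>j. ((\<lambda>_. N)(0 := 0)) j + ((\<lambda>_. M)(0 := 0)) j) = mp ((\<lambda>_. N + M)(0 := 0))"
    by (rule mp_cong) simp
  then show ?thesis using mp_add[of "(\<lambda>_. N)(0 := 0)" "(\<lambda>_. M)(0 := 0)"] by (simp only: mp1_def)
qed

lemma mp1_0: "mp1 0 = carrier R"
  unfolding mp1_def by (rule mp_zero) simp

lemma mp1_antimono: "N \<le> M \<Longrightarrow> mp1 M \<subseteq> mp1 N"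
  unfolding mp1_def by (rule mp_antimono[OF zeroideal]) simp

lemma mp1_sub_prime:
  assumes "primeideal P R" "mp1 N \<subseteq> P" shows "\<exists>j\<in>{1..s}. I j \<subseteq> P"
proof -
  obtain j where "j \<le> s" "0 < ((\<lambda>_. N)(0 := 0)) j" "I j \<subseteq> P"
    using mp_sub_prime[OF assms(1)] assms(2) unfolding mp1_def by blast
  then show ?thesis by (intro bexI[of _ j]) (auto split: if_splits)
qed

lemma mp1_sub_I: "j \<in> {1..s} \<Longrightarrow> mp1 1 \<subseteq> I j"
  unfolding mp1_def using mp_antimono[OF zeroideal, of "unit_exp j" "(\<lambda>_. 1)(0 := 0)"] mp_single[of j] by auto

text \<open>This is K : I^\<infinity>, written with the powers \<open>mp1 N\<close> of I;
  \<open>saturation_eq\<close> gives the agreement with \<open>saturation\<close>.\<close>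

definition satur :: "'a set \<Rightarrow> 'a set" where
  "satur K = {y \<in> carrier R. \<exists>N. \<forall>w\<in>mp1 N. y \<otimes> w \<in> K}"

lemma satur_eq: "satur K = (\<Union>N. colon R K (mp1 N))"
  by (auto simp: satur_def colon_def)

lemma satur_stable:
  assumes K: "ideal K R"
  obtains N where "satur K = colon R K (mp1 N)" "ideal (satur K) R"
proof -
  have c: "ideal (colon R K (mp1 N)) R" for N by (rule colon_ideal[OF K idealD(1)[OF mp1_ideal]])
  have up: "colon R K (mp1 N) \<subseteq> colon R K (mp1 (Suc N))" for N
    using mp1_antimono[of N "Suc N"] by (auto simp: colon_def)
  obtain m where m: "\<And>i. m \<le> i \<Longrightarrow> colon R K (mp1 i) = colon R K (mp1 m)"
    using ideal_acc[of "\<lambda>N. colon R K (mp1 N)", OF c up] by blast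
  have "colon R K (mp1 i) \<subseteq> colon R K (mp1 m)" for i
    using m[of "max i m"] lift_Suc_mono_le[of "\<lambda>N. colon R K (mp1 N)", OF up, of i "max i m"] by simp
  then have "satur K = colon R K (mp1 m)" unfolding satur_eq by blast
  then show ?thesis using that c by simp
qed

lemma satur_ideal: "ideal K R \<Longrightarrow> ideal (satur K) R"
  using satur_stable by blast

lemma satur_upper: "ideal K R \<Longrightarrow> K \<subseteq> satur K"
proof
  fix y assume K: "ideal K R" and y: "y \<in> K"
  have "y \<otimes> w \<in> K" if "w \<in> mp1 0" for w by (rule idealD(8)[OF K y idealD(3)[OF mp1_ideal that]])
  then show "y \<in> satur K" using idealD(3)[OF K y] unfolding satur_def by blast
qed

lemma satur_in_prime:
  assumes P: "primeideal P R" and KP: "K \<subseteq> P" and nI: "\<forall>j\<in>{1..s}. \<not> I j \<subseteq> P"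
  shows "satur K \<subseteq> P"
proof
  fix y assume "y \<in> satur K"
  then obtain N where y: "y \<in> carrier R" "\<forall>w\<in>mp1 N. y \<otimes> w \<in> K" by (auto simp: satur_def)
  have "\<not> mp1 N \<subseteq> P" using mp1_sub_prime[OF P] nI by blast
  then obtain w where w: "w \<in> mp1 N" "w \<notin> P" by blast
  have "y \<otimes> w \<in> P" using y(2) w(1) KP by blast
  then show "y \<in> P" using primeideal.I_prime[OF P y(1) idealD(3)[OF mp1_ideal w(1)]] w(2) by blast
qed

text \<open>P' avoids all products y I^N with y outside \<open>P\<close>; such a product inside
  \<open>K\<close> would put y into the saturation and so into \<open>P\<close>. The products with N
  = 0 keep P' inside \<open>P\<close>, and y = 1 with N = 1 keeps every I_j out of P'.\<close>

lemma prime_over_satur: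
  assumes K: "ideal K R" and P: "primeideal P R" and QP: "satur K \<subseteq> P"
  shows "\<exists>P'. primeideal P' R \<and> K \<subseteq> P' \<and> P' \<subseteq> P \<and> (\<forall>j\<in>{1..s}. \<not> I j \<subseteq> P')"
proof -
  have oneP: "\<one> \<notin> P" using ideal.one_imp_carrier[OF primeideal_ideal[OF P]] primeideal_proper[OF P] by blast
  let ?S = "{(\<lambda>w. y \<otimes> w) ` mp1 N | y N. y \<in> carrier R \<and> y \<notin> P}"
  have "\<exists>P'. primeideal P' R \<and> K \<subseteq> P' \<and> (\<forall>S\<in>?S. \<not> S \<subseteq> P')"
  proof (rule prime_avoiding[OF K, of ?S])
    show "?S \<noteq> {}" using oneP by blast
    fix S assume "S \<in> ?S"
    then obtain y N where S: "S = (\<lambda>w. y \<otimes> w) ` mp1 N" "y \<in> carrier R" "y \<notin> P" by blast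
    show "S \<subseteq> carrier R" unfolding S(1) by (rule idealD(1)[OF smult_ideal[OF mp1_ideal S(2)]])
    show "\<not> S \<subseteq> K"
    proof
      assume "S \<subseteq> K"
      then have "y \<in> satur K" using S by (auto simp: satur_def)
      then show False using QP S(3) by blast
    qed
    fix T assume "T \<in> ?S"
    then obtain y' N' where T: "T = (\<lambda>w. y' \<otimes> w) ` mp1 N'" "y' \<in> carrier R" "y' \<notin> P" by blast
    have "y \<otimes> y' \<notin> P" using primeideal.I_prime[OF P S(2) T(2)] S(3) T(3) by blast
    then have U: "(\<lambda>w. y \<otimes> y' \<otimes> w) ` mp1 (N + N') \<in> ?S" using S(2) T(2) m_closed by blast
    have "(\<lambda>w. y \<otimes> y' \<otimes> w) ` mp1 (N + N') \<subseteq> Q" if Q: "ideal Q R" and ST: "\<forall>a\<in>S. \<forall>b\<in>T. a \<otimes> b \<in> Q" for Q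
    proof -
      have yc: "y \<otimes> y' \<in> carrier R" using S(2) T(2) by simp
      have "mp1 N \<cdot> mp1 N' \<subseteq> colon R Q {y \<otimes> y'}"
      proof (rule ideal_prod_least[OF K colon_ideal[OF Q]])
        fix a b assume ab: "a \<in> mp1 N" "b \<in> mp1 N'"
        have c: "a \<in> carrier R" "b \<in> carrier R" using ab idealD(3)[OF mp1_ideal] by auto
        have "(y \<otimes> a) \<otimes> (y' \<otimes> b) \<in> Q" using ST ab S(1) T(1) by blast
        moreover have "(y \<otimes> a) \<otimes> (y' \<otimes> b) = a \<otimes> b \<otimes> (y \<otimes> y')" using c S(2) T(2) by (simp add: m_ac)
        ultimately show "a \<otimes> b \<in> colon R Q {y \<otimes> y'}" using c by (simp add: mem_colon_singleton)
      qed (use yc in simp)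
      then show ?thesis using yc idealD(3)[OF mp1_ideal]
        by (auto simp: mp1_add mem_colon_singleton m_comm)
    qed
    then show "\<exists>U\<in>?S. \<forall>Q. ideal Q R \<longrightarrow> (\<forall>a\<in>S. \<forall>b\<in>T. a \<otimes> b \<in> Q) \<longrightarrow> U \<subseteq> Q"
      by (intro bexI[OF _ U]) simp
  qed
  then obtain P' where P': "primeideal P' R" "K \<subseteq> P'" and n0: "\<forall>S\<in>?S. \<not> S \<subseteq> P'" by (elim exE conjE)
  have n: "\<not> S \<subseteq> P'" if "S \<in> ?S" for S using n0 that by (rule bspec)
  have "P' \<subseteq> P"
  proof
    fix y assume y: "y \<in> P'"
    have yc: "y \<in> carrier R" by (rule idealD(3)[OF primeideal_ideal[OF P'(1)] y])
    show "y \<in> P"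
    proof (rule ccontr)
      assume "y \<notin> P"
      then have "(\<lambda>w. y \<otimes> w) ` mp1 0 \<in> ?S" using yc by blast
      moreover have "(\<lambda>w. y \<otimes> w) ` mp1 0 \<subseteq> P'"
        using idealD(8)[OF primeideal_ideal[OF P'(1)] y] by (auto simp: mp1_0)
      ultimately show False using n by blast
    qed
  qed
  moreover have "\<not> I j \<subseteq> P'" if "j \<in> {1..s}" for j
  proof
    assume "I j \<subseteq> P'"
    then have "mp1 1 \<subseteq> P'" using mp1_sub_I[OF that] by blast
    then have "(\<lambda>w. \<one> \<otimes> w) ` mp1 1 \<subseteq> P'" using idealD(3)[OF mp1_ideal] by auto
    moreover have "(\<lambda>w. \<one> \<otimes> w) ` mp1 1 \<in> ?S" using oneP by blast
    ultimately show False using n by blast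
  qed
  ultimately show ?thesis using P' by blast
qed

text \<open>At most the least prime has to be exchanged: a prime over \<open>K\<close> without any
  I_j contains the saturation, and below a prime over the saturation there is one of the former
  kind.\<close>

lemma prime_chain_iff_spec_chain:
  assumes K: "ideal K R"
  shows "prime_chain K d \<longleftrightarrow> spec_chain (satur K) d"
proof
  assume "prime_chain K d"
  then obtain P where P: "\<forall>i\<le>d. primeideal (P i) R" "\<forall>i<d. P i \<subset> P (Suc i)" "K \<subseteq> P 0"
    "\<forall>j\<in>{1..s}. \<not> I j \<subseteq> P 0" unfolding prime_chain_def by (elim exE conjE)
  then have "satur K \<subseteq> P 0" by (intro satur_in_prime) auto
  then show "spec_chain (satur K) d"
    unfolding spec_chain_def using P by (intro exI[of _ P]) simp
next
  assume "spec_chain (satur K) d"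
  then obtain P where P: "\<forall>i\<le>d. primeideal (P i) R" "\<forall>i<d. P i \<subset> P (Suc i)" "satur K \<subseteq> P 0"
    unfolding spec_chain_def by (elim exE conjE)
  obtain P' where P': "primeideal P' R" "K \<subseteq> P'" "P' \<subseteq> P 0" "\<forall>j\<in>{1..s}. \<not> I j \<subseteq> P'"
    using prime_over_satur[OF K _ P(3)] P(1) by blast
  have "\<forall>i\<le>d. primeideal ((P(0 := P')) i) R" using P(1) P'(1) by simp
  moreover have "\<forall>i<d. (P(0 := P')) i \<subset> (P(0 := P')) (Suc i)" using P(2) P'(3) by auto
  ultimately show "prime_chain K d"
    unfolding prime_chain_def using P'(2,4) by (intro exI[of _ "P(0 := P')"]) simp
qed

text \<open>The least prime contains some I_j, so the prime below it that contains no I_j is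
  strictly smaller. This gives dim R/(I^N + Q) < dim R/Q for the saturation Q, when these are finite
  and Q is proper.\<close>

lemma spec_chain_satur_plus:
  assumes K: "ideal K R" and ch: "spec_chain (mp1 N <+> satur K) d"
  shows "spec_chain (satur K) (Suc d)"
proof -
  obtain P where P: "\<forall>i\<le>d. primeideal (P i) R" "\<forall>i<d. P i \<subset> P (Suc i)" "mp1 N <+> satur K \<subseteq> P 0"
    using ch unfolding spec_chain_def by (elim exE conjE)
  have P0: "primeideal (P 0) R" using P(1) by simp
  have "mp1 N \<subseteq> P 0" "satur K \<subseteq> P 0" using P(3) ideal_sum_upper[OF mp1_ideal satur_ideal[OF K], of N] by auto
  then obtain P' where P': "primeideal P' R" "K \<subseteq> P'" "P' \<subseteq> P 0" "\<forall>j\<in>{1..s}. \<not> I j \<subseteq> P'"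
    using prime_over_satur[OF K P0] by blast
  obtain j where "j \<in> {1..s}" "I j \<subseteq> P 0" using mp1_sub_prime[OF P0 \<open>mp1 N \<subseteq> P 0\<close>] by blast
  then have "P' \<subset> P 0" using P'(3,4) by blast
  then have "prime_chain K (Suc d)" by (rule prime_chain_extend[OF P(1,2) P'(1) _ P'(2,4)])
  then show ?thesis using prime_chain_iff_spec_chain[OF K] by simp
qed

section \<open>Superficial sequences\<close>

text \<open>By Artin--Rees the intersection lies in I^(n - c) (K : I^\<infinity>) + K, and a high
  power of I carries the saturation into \<open>K\<close>. Hence saturating \<open>K\<close> does
  not change its layers in large degrees.\<close>

lemma satur_inter:
  assumes K: "ideal K R"
  shows "\<exists>N. \<forall>n. (\<forall>j. N \<le> n j) \<longrightarrow> E K n \<inter> satur K = K"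
proof -
  obtain N where N: "satur K = colon R K (mp1 N)" and Q: "ideal (satur K) R"
    by (rule satur_stable[OF K])
  obtain c where c: "\<And>n. satur K \<inter> E K n \<subseteq> mp (\<lambda>j. n j - c) \<cdot> satur K <+> K"
    using artin_rees[OF K Q satur_upper[OF K]] by blast
  have "E K n \<inter> satur K = K" if n: "\<forall>j. N + c \<le> n j" for n
  proof
    show "K \<subseteq> E K n \<inter> satur K" using K_sub_E[OF K] satur_upper[OF K] by blast
    have "mp (\<lambda>j. n j - c) \<subseteq> mp1 N"
      unfolding mp1_def
    proof (rule mp_antimono[OF K])
      fix j show "((\<lambda>_. N)(0 := 0)) j \<le> n j - c" using n[rule_format, of j] by auto
    qed
    then have "mp (\<lambda>j. n j - c) \<cdot> satur K \<subseteq> mp1 N \<cdot> satur K" by (intro ideal_prod_mono) auto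
    also have "\<dots> \<subseteq> K"
    proof (rule ideal_prod_least[OF K K])
      fix a b assume a: "a \<in> mp1 N" and b: "b \<in> satur K"
      have "b \<otimes> a \<in> K" using b a unfolding N by (simp add: colon_def)
      then show "a \<otimes> b \<in> K" using m_comm[OF idealD(3)[OF mp1_ideal a] idealD(3)[OF Q b]] by simp
    qed
    finally have "mp (\<lambda>j. n j - c) \<cdot> satur K <+> K \<subseteq> K" by (rule ideal_sum_least[OF K]) simp
    then show "E K n \<inter> satur K \<subseteq> K" using c[of n] by blast
  qed
  then show ?thesis by blast
qed

text \<open>Let \<open>Q = K : I\<^sup>\<infinity>\<close> and \<open>M = I\<^sup>N + Q\<close> for large \<open>N\<close>. Then \<^term>\<open>hlen K\<close> is the difference of the
  length of \<open>M/(J\<^sup>m M + Q)\<close>, which by Artin--Rees agrees with the length of \<open>R/(J\<^sup>m + Q)\<close> up to terms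
  of lower degree, since \<open>dim R/M < dim R/Q\<close>.\<close>

theorem hs_compare:
  assumes K: "ideal K R"
    and ev: "eventually (\<lambda>n. fdiffs (replicate D 0) (hlen K) n = e) large"
    and dim: "\<not> spec_chain (satur K) (Suc (Suc D))"
  shows "eventually (\<lambda>m. (dif ^^ Suc D) (hs (satur K)) m = e) sequentially"
proof -
  define Q where "Q = satur K"
  have Q: "ideal Q R" and KQ: "K \<subseteq> Q" unfolding Q_def using satur_ideal[OF K] satur_upper[OF K] by auto
  obtain N1 where N1: "\<And>n. \<forall>j. N1 \<le> n j \<Longrightarrow> fdiffs (replicate D 0) (hlen K) n = e"
    using ev unfolding eventually_large by blast
  obtain N2 where N2: "\<And>n. \<forall>j. N2 \<le> n j \<Longrightarrow> E K n \<inter> Q = K"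
    using satur_inter[OF K] unfolding Q_def by blast
  define N where "N = max N1 N2"
  \<comment> \<open>The exponent of J varies while the others are frozen at \<open>N\<close> inside
    the stable range.\<close>
  define nn :: "nat \<Rightarrow> nat \<Rightarrow> nat" where "nn m = (\<lambda>_. N)(0 := m)" for m
  have bump_nn: "bump 0 (nn m) = nn (Suc m)" for m by (auto simp: nn_def bump_def)
  have mp_nn: "mp (nn m) = Jpow m \<cdot> mp1 N" for m
    using mp_split_J[of "\<lambda>_. N" m] by (simp only: nn_def mp1_def)
  define M where "M = mp1 N <+> Q"
  have M: "ideal M R" and QM: "Q \<subseteq> M" and mM: "mp1 N \<subseteq> M"
    unfolding M_def using add_ideals[OF mp1_ideal Q] ideal_sum_upper[OF mp1_ideal Q] by auto
  define T where "T m = Jpow m \<cdot> M <+> Q" for m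
  have JM: "ideal (Jpow m \<cdot> M) R" for m by (rule ideal_prod_is_ideal[OF Jpow_ideal M])
  have T: "ideal (T m) R" for m unfolding T_def by (rule add_ideals[OF JM Q])
  have TM: "T m \<subseteq> M" for m
    unfolding T_def using ideal_prod_inter[OF Jpow_ideal M] QM by (intro ideal_sum_least[OF M]) auto
  have T_Suc: "T (Suc m) \<subseteq> T m" for m
    unfolding T_def using Jpow_antimono[of m "Suc m"] by (intro ideal_sum_mono ideal_prod_mono) auto
  have ET: "E K (nn m) <+> Q = T m" for m
  proof
    show "E K (nn m) <+> Q \<subseteq> T m"
    proof (rule ideal_sum_least[OF T])
      show "Q \<subseteq> T m" unfolding T_def by (rule ideal_sum_upper(2)[OF JM Q])
      then have "K \<subseteq> T m" using KQ by blast
      moreover have "mp (nn m) \<subseteq> T m"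
        unfolding mp_nn T_def using ideal_sum_upper(1)[OF JM Q, of m] ideal_prod_mono[OF order_refl mM, of "Jpow m"] by blast
      ultimately show "E K (nn m) \<subseteq> T m" by (intro E_least[OF K T])
    qed
    have EQ: "ideal (E K (nn m) <+> Q) R" by (rule add_ideals[OF E_ideal[OF K] Q])
    have up: "E K (nn m) \<subseteq> E K (nn m) <+> Q" "Q \<subseteq> E K (nn m) <+> Q"
      using ideal_sum_upper[OF E_ideal[OF K] Q] by auto
    show "T m \<subseteq> E K (nn m) <+> Q"
      unfolding T_def
    proof (rule ideal_sum_least[OF EQ _ up(2)])
      show "Jpow m \<cdot> M \<subseteq> E K (nn m) <+> Q"
      proof (rule ideal_prod_least[OF K EQ])
        fix a b assume a: "a \<in> Jpow m" and "b \<in> M"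
        then obtain w q where b: "w \<in> mp1 N" "q \<in> Q" "b = w \<oplus> q" by (auto simp: M_def set_add_iff)
        have ac: "a \<in> carrier R" by (rule idealD(3)[OF Jpow_ideal a])
        have "a \<otimes> w \<in> mp (nn m)" unfolding mp_nn using a b(1) by (rule ideal_prod.prod)
        then have "a \<otimes> w \<in> E K (nn m)" using mp_sub_E[OF K] by blast
        moreover have "a \<otimes> q \<in> Q" by (rule idealD(7)[OF Q b(2) ac])
        moreover have "a \<otimes> b = a \<otimes> w \<oplus> a \<otimes> q"
          unfolding b(3) using ac idealD(3)[OF mp1_ideal b(1)] idealD(3)[OF Q b(2)] by (simp add: r_distr)
        ultimately show "a \<otimes> b \<in> E K (nn m) <+> Q" unfolding set_add_iff by blast
      qed
    qed
  qed
  have Tfin: "ideal_length R M (T m) \<noteq> \<infinity>" for m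
    unfolding T_def by (rule finite_length_Jpow[OF M Q QM])
  define S where "S m = rat_of_nat (the_enat (ideal_length R M (T m)))" for m
  \<comment> \<open>The layer from T_m to T_(m+1) has the length given by h_K, because
    \<open>Q\<close> meets I^n + K only in \<open>K\<close>.\<close>
  have dS: "dif S m = hlen K (nn m)" if m: "N \<le> m" for m
  proof -
    let ?A = "E K (nn m)" and ?B = "E K (nn (Suc m))"
    have A: "ideal ?A R" and B: "ideal ?B R" by (rule E_ideal[OF K])+
    have BA: "?B \<subseteq> ?A" using E_bump_subset[OF K, of 0 "nn m"] by (simp add: bump_nn)
    have BQ: "ideal (?B <+> Q) R" by (rule add_ideals[OF B Q])
    have "?A \<inter> Q = K" by (rule N2) (use m in \<open>auto simp: nn_def N_def\<close>)
    then have "?A \<inter> (?B <+> Q) = ?B <+> K" using ideal_modular[OF A B Q BA] by simp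
    also have "\<dots> = ?B" by (rule ideal_sum_absorb[OF B K K_sub_E[OF K]])
    finally have inter: "?A \<inter> (?B <+> Q) = ?B" .
    have "?A <+> (?B <+> Q) = ?A <+> Q"
    proof
      show "?A <+> (?B <+> Q) \<subseteq> ?A <+> Q"
        using ideal_sum_upper[OF A Q] BA by (intro ideal_sum_least add_ideals[OF A Q] BQ) auto
      show "?A <+> Q \<subseteq> ?A <+> (?B <+> Q)" using ideal_sum_upper(2)[OF B Q] by (intro ideal_sum_mono) auto
    qed
    then have "ideal_length R (T m) (T (Suc m)) = ideal_length R ?A ?B"
      using ideal_length_sum[OF A BQ] inter by (simp add: ET)
    moreover have "ideal_length R M (T (Suc m)) = ideal_length R M (T m) + ideal_length R (T m) (T (Suc m))"
      by (rule ideal_length_add[OF M T T T_Suc TM])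
    ultimately have "ideal_length R M (T (Suc m)) = ideal_length R M (T m) + ideal_length R ?A ?B" by simp
    then show ?thesis
      using Tfin[of m] Tfin[of "Suc m"] unfolding dif_def S_def hlen_def bump_nn
      by (cases "ideal_length R M (T m)"; cases "ideal_length R ?A ?B") auto
  qed
  have evS: "eventually (\<lambda>m. (dif ^^ Suc D) S m = e) sequentially"
  proof -
    have "eventually (\<lambda>m. dif S m = hlen K (nn m)) sequentially"
      using dS unfolding eventually_sequentially by blast
    from dif_pow_cong[OF this, of D]
    have "eventually (\<lambda>m. (dif ^^ Suc D) S m = (dif ^^ D) (\<lambda>m. hlen K (nn m)) m) sequentially"
      by (simp only: funpow_Suc_right o_apply)
    moreover have "(dif ^^ D) (\<lambda>m. hlen K (nn m)) m = e" if "N \<le> m" for m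
    proof -
      have "(dif ^^ D) (\<lambda>m. hlen K (nn m)) m = fdiffs (replicate D 0) (hlen K) (nn m)"
        using dif_pow_fdiffs[of D "hlen K" "\<lambda>_. N" m] by (simp only: nn_def)
      also have "\<dots> = e" by (rule N1) (use that in \<open>auto simp: nn_def N_def\<close>)
      finally show ?thesis .
    qed
    then have "eventually (\<lambda>m. (dif ^^ D) (\<lambda>m. hlen K (nn m)) m = e) sequentially"
      unfolding eventually_sequentially by blast
    ultimately show ?thesis by eventually_elim simp
  qed
  obtain c where c: "\<And>m. M \<inter> (Jpow m <+> Q) \<subseteq> Jpow (m - c) \<cdot> M <+> Q"
    using artin_rees_J[OF Q M QM] by blast
  \<comment> \<open>R/(J^m + Q) is cut at J^m + M. The remaining length is at most S m because T_m
    lies in the intersection of M with J^m + Q, and at least S (m - c) by Artin--Rees.\<close>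
  have bounds: "hs M m + S (m - c) \<le> hs Q m \<and> hs Q m \<le> hs M m + S m" for m
  proof -
    let ?B = "Jpow m <+> Q"
    have B: "ideal ?B R" by (rule JQ_ideal[OF Q])
    have MB: "ideal (M <+> ?B) R" by (rule add_ideals[OF M B])
    have MBeq: "M <+> ?B = Jpow m <+> M"
    proof
      have u: "Jpow m \<subseteq> Jpow m <+> M" "M \<subseteq> Jpow m <+> M" using ideal_sum_upper[OF Jpow_ideal M] by auto
      show "M <+> ?B \<subseteq> Jpow m <+> M"
        using u QM by (intro ideal_sum_least JQ_ideal[OF M]) auto
      show "Jpow m <+> M \<subseteq> M <+> ?B"
        using ideal_sum_upper[OF M B] ideal_sum_upper[OF Jpow_ideal Q] by (intro ideal_sum_least MB) blast+
    qed
    have l: "ideal_length R (carrier R) ?B = ideal_length R (carrier R) (Jpow m <+> M) + ideal_length R M (M \<inter> ?B)"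
      using ideal_length_add[OF oneideal MB B ideal_sum_upper(2)[OF M B] idealD(1)[OF MB]] ideal_length_sum[OF M B]
      by (simp add: MBeq)
    have "T m \<subseteq> M \<inter> ?B"
    proof -
      have "Jpow m \<cdot> M \<subseteq> ?B" using ideal_prod_inter[OF Jpow_ideal M] ideal_sum_upper(1)[OF Jpow_ideal Q] by blast
      then have "T m \<subseteq> ?B" unfolding T_def using ideal_sum_upper(2)[OF Jpow_ideal Q] by (intro ideal_sum_least B) auto
      then show ?thesis using TM by blast
    qed
    then have l2: "ideal_length R M (M \<inter> ?B) \<le> ideal_length R M (T m)" by (intro ideal_length_mono) auto
    have l3: "ideal_length R M (T (m - c)) \<le> ideal_length R M (M \<inter> ?B)"
      using c[of m] unfolding T_def by (intro ideal_length_mono) auto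
    obtain a where a: "ideal_length R (carrier R) ?B = enat a" using hs_enat[OF Q] by blast
    obtain b where b: "ideal_length R (carrier R) (Jpow m <+> M) = enat b" using hs_enat[OF M] by blast
    obtain t where t: "ideal_length R M (T m) = enat t" using Tfin[of m] by auto
    obtain t' where t': "ideal_length R M (T (m - c)) = enat t'" using Tfin[of "m - c"] by auto
    obtain v where v: "ideal_length R M (M \<inter> ?B) = enat v" using l2 t by (cases "ideal_length R M (M \<inter> ?B)") auto
    have "a = b + v" "v \<le> t" "t' \<le> v" using l l2 l3 a b t t' v by simp_all
    then have "b + t' \<le> a" "a \<le> b + t" by simp_all
    then have "rat_of_nat b + rat_of_nat t' \<le> rat_of_nat a" "rat_of_nat a \<le> rat_of_nat b + rat_of_nat t"
      by (simp_all flip: of_nat_add)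
    then show ?thesis using a b t t' by (simp add: hs_def S_def)
  qed
  \<comment> \<open>dim R/M is at most \<open>D\<close>, so \<open>hs M\<close> disappears under D +
    1 differences.\<close>
  have "\<not> spec_chain M (Suc D)" using spec_chain_satur_plus[OF K] dim unfolding M_def Q_def by blast
  then have evM: "eventually (\<lambda>m. (dif ^^ Suc D) (hs M) m = 0) sequentially" by (rule hs_degree_le[OF M])
  have "eventually (\<lambda>m. (dif ^^ Suc (Suc D)) (hs Q) m = 0) sequentially"
    using hs_degree_le[OF Q] dim unfolding Q_def by blast
  then have "eventually (\<lambda>m. dif ((dif ^^ Suc D) (hs Q)) m = 0) sequentially" by simp
  then obtain h where evQ: "eventually (\<lambda>m. (dif ^^ Suc D) (hs Q) m = h) sequentially"
    by (rule dif_zero_imp_const)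
  have ev1: "eventually (\<lambda>m. (dif ^^ Suc D) (\<lambda>m. hs M m + S m) m = e) sequentially"
    using evM evS by eventually_elim (simp add: dif_pow_add del: funpow.simps)
  have ev2: "eventually (\<lambda>m. (dif ^^ Suc D) (\<lambda>m. hs M m + S (m - c)) m = e) sequentially"
    using evM eventually_dif_pow_delay[OF evS, of c] by eventually_elim (simp add: dif_pow_add del: funpow.simps)
  have "h \<le> e" by (rule dif_pow_compare[OF evQ ev1]) (use bounds in simp)
  moreover have "e \<le> h" by (rule dif_pow_compare[OF ev2 evQ]) (use bounds in simp)
  ultimately have "h = e" by simp
  then show ?thesis using evQ unfolding Q_def by simp
qed

text \<open>The recursion runs on the accumulated ideal of R instead of on successive quotient
  rings; \<open>superficial_sequence_of_type_iff\<close> is the link to the definition.\<close>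

fun sup_seq :: "'a set \<Rightarrow> nat list \<Rightarrow> 'a list \<Rightarrow> bool" where
  "sup_seq K [] [] \<longleftrightarrow> True"
| "sup_seq K (i # \<sigma>) (x # xs) \<longleftrightarrow> i \<le> s \<and> x \<in> I i \<and> \<not> nilp_mod K \<and> superficial_mod K i x \<and>
     sup_seq (K <+> PIdl x) \<sigma> xs"
| "sup_seq K _ _ \<longleftrightarrow> False"

fun seq_ideal :: "'a set \<Rightarrow> 'a list \<Rightarrow> 'a set" where
  "seq_ideal K [] = K"
| "seq_ideal K (x # xs) = seq_ideal (K <+> PIdl x) xs"

lemma sup_seq_length: "sup_seq K \<sigma> xs \<Longrightarrow> length \<sigma> = length xs"
  by (induction K \<sigma> xs rule: sup_seq.induct) auto

lemma seq_ideal_ideal: "ideal K R \<Longrightarrow> set xs \<subseteq> carrier R \<Longrightarrow> ideal (seq_ideal K xs) R"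
  by (induction xs arbitrary: K) (auto intro: mem_sum_cgenideal_self(3))

lemma sup_seq_carrier: "sup_seq K \<sigma> xs \<Longrightarrow> set xs \<subseteq> carrier R"
  by (induction K \<sigma> xs rule: sup_seq.induct) (auto simp: superficial_mod_def)

text \<open>Each element contributes a shift of the argument in its own direction, and the shifts
  add up to \<open>fold bump \<sigma>\<close>.\<close>

lemma sup_seq_hlen:
  assumes "ideal K R" "sup_seq K \<sigma> xs"
  shows "eventually (\<lambda>n. hlen (seq_ideal K xs) (fold bump \<sigma> n) = fdiffs \<sigma> (hlen K) n) large"
  using assms
proof (induction K \<sigma> xs rule: sup_seq.induct)
  case (2 K i \<sigma> x xs)
  have x: "i \<le> s" "x \<in> I i" "superficial_mod K i x" "sup_seq (K <+> PIdl x) \<sigma> xs" using 2 by auto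
  have xc: "x \<in> carrier R" using x(3) by (simp add: superficial_mod_def)
  let ?K = "K <+> PIdl x"
  have K': "ideal ?K R" by (rule mem_sum_cgenideal_self(3)[OF 2(2) xc])
  have "eventually (\<lambda>n. hlen ?K (bump i n) = fdiff i (hlen K) n) large"
    using superficial_mod_hlen[OF 2(2) x(1,2,3)] by (simp add: fdiff_def)
  from fdiffs_cong[OF this, of \<sigma>]
  have "eventually (\<lambda>n. fdiffs \<sigma> (hlen ?K) (bump i n) = fdiffs \<sigma> (fdiff i (hlen K)) n) large"
    by (simp only: fdiffs_bump)
  moreover have "eventually (\<lambda>n. hlen (seq_ideal ?K xs) (fold bump \<sigma> (bump i n)) = fdiffs \<sigma> (hlen ?K) (bump i n)) large"
    using eventually_large_bump[OF 2(1)[OF K' x(4)]] .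
  ultimately show ?case by eventually_elim simp
qed auto

lemma sup_seq_prime_chain:
  assumes "ideal K R" "sup_seq K \<sigma> xs" "prime_chain (seq_ideal K xs) d"
  shows "prime_chain K (d + length xs)"
  using assms
proof (induction K \<sigma> xs rule: sup_seq.induct)
  case (2 K i \<sigma> x xs)
  have xc: "x \<in> carrier R" using 2(3) by (simp add: superficial_mod_def)
  have "prime_chain (K <+> PIdl x) (d + length xs)"
    using 2(1)[OF mem_sum_cgenideal_self(3)[OF 2(2) xc]] 2(3,4) by simp
  then show ?case using superficial_mod_prime_chain[OF 2(2)] 2(3) by auto
qed auto

text \<open>Were the product ideal nilpotent modulo the ideal reached so far, the length function
  and all its further differences would vanish. So a nonzero difference allows the choice of
  superficial elements to go on to the end.\<close>

lemma sup_seq_exists: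
  assumes "ideal K R" "set \<sigma> \<subseteq> {..s}" "\<not> eventually (\<lambda>n. fdiffs \<sigma> (hlen K) n = 0) large"
  shows "\<exists>xs. sup_seq K \<sigma> xs"
  using assms
proof (induction \<sigma> arbitrary: K)
  case Nil
  then show ?case by (intro exI[of _ "[]"]) simp
next
  case (Cons i \<sigma>)
  have i: "i \<le> s" using Cons.prems by simp
  have nn: "\<not> nilp_mod K"
  proof
    assume "nilp_mod K"
    from fdiffs_cong[OF nilp_mod_hlen[OF Cons.prems(1) this], of "i # \<sigma>"]
    show False using Cons.prems(3) by (simp only: fdiffs_zero)
  qed
  obtain x where x: "x \<in> I i" "superficial_mod K i x"
    using superficial_mod_exists[OF Cons.prems(1) i] by blast
  have xc: "x \<in> carrier R" using x(2) by (simp add: superficial_mod_def)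
  let ?K = "K <+> PIdl x"
  have K': "ideal ?K R" by (rule mem_sum_cgenideal_self(3)[OF Cons.prems(1) xc])
  have "\<not> eventually (\<lambda>n. fdiffs \<sigma> (hlen ?K) n = 0) large"
  proof
    assume "eventually (\<lambda>n. fdiffs \<sigma> (hlen ?K) n = 0) large"
    from eventually_large_bump[OF this, of i]
    have z: "eventually (\<lambda>n. fdiffs \<sigma> (hlen ?K) (bump i n) = 0) large" .
    have "eventually (\<lambda>n. hlen ?K (bump i n) = fdiff i (hlen K) n) large"
      using superficial_mod_hlen[OF Cons.prems(1) i x] by (simp add: fdiff_def)
    from fdiffs_cong[OF this, of \<sigma>]
    have "eventually (\<lambda>n. fdiffs \<sigma> (hlen ?K) (bump i n) = fdiffs (i # \<sigma>) (hlen K) n) large"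
      by (simp only: fdiffs_bump fdiffs_Cons)
    with z have "eventually (\<lambda>n. fdiffs (i # \<sigma>) (hlen K) n = 0) large" by eventually_elim simp
    then show False using Cons.prems(3) by simp
  qed
  then obtain xs where "sup_seq ?K \<sigma> xs" using Cons.IH[OF K'] Cons.prems(2) by auto
  then show ?case using i x nn by (intro exI[of _ "x # xs"]) simp
qed

lemma eventually_large_fold_bumpD:
  "eventually (\<lambda>n. P (fold bump \<sigma> n)) large \<Longrightarrow> eventually P large"
proof (induction \<sigma>)
  case (Cons i \<sigma>)
  then have "eventually (\<lambda>n. P (fold bump \<sigma> (bump i n))) large" by simp
  then have "eventually (\<lambda>n. P (fold bump \<sigma> n)) large"
    by (rule eventually_large_bumpD[where P = "\<lambda>n. P (fold bump \<sigma> n)"])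
  then show ?case by (rule Cons.IH)
qed simp

lemma fdiffs_fold_bump: "fdiffs \<tau> (\<lambda>n. f (fold bump \<sigma> n)) = (\<lambda>n. fdiffs \<tau> f (fold bump \<sigma> n))"
proof (induction \<sigma> arbitrary: f)
  case (Cons i \<sigma>)
  show ?case using fdiffs_bump[of \<tau> "\<lambda>n. f (fold bump \<sigma> n)" i] Cons by simp
qed simp

text \<open>Each element of the sequence costs a chain of primes at least one step, so the saturated
  quotient has dimension at most D + 1 and \<open>hs_compare\<close> applies. As degree and
  dimension agree, its constant (D + 1)-st difference is nonzero exactly if that dimension is
  reached.\<close>

theorem sup_seq_hs:
  assumes K: "ideal K R" and seq: "sup_seq K \<sigma> xs"
    and e: "eventually (\<lambda>n. fdiffs (\<sigma> @ replicate D 0) (hlen K) n = e) large"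
    and dim: "\<not> prime_chain K (Suc (Suc (D + length xs)))"
  shows "eventually (\<lambda>m. (dif ^^ Suc D) (hs (satur (seq_ideal K xs))) m = e) sequentially"
    and "e \<noteq> 0 \<longleftrightarrow> spec_chain (satur (seq_ideal K xs)) (Suc D)"
    and "\<not> spec_chain (satur (seq_ideal K xs)) (Suc (Suc D))"
proof -
  let ?L = "seq_ideal K xs"
  have L: "ideal ?L R" by (rule seq_ideal_ideal[OF K sup_seq_carrier[OF seq]])
  have "eventually (\<lambda>n. fdiffs (replicate D 0) (\<lambda>n. hlen ?L (fold bump \<sigma> n)) n
      = fdiffs (replicate D 0) (fdiffs \<sigma> (hlen K)) n) large"
    by (rule fdiffs_cong[OF sup_seq_hlen[OF K seq]])
  with e have "eventually (\<lambda>n. fdiffs (replicate D 0) (hlen ?L) (fold bump \<sigma> n) = e) large"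
    unfolding fdiffs_append fdiffs_fold_bump by eventually_elim simp
  then have ev: "eventually (\<lambda>n. fdiffs (replicate D 0) (hlen ?L) n = e) large"
    by (rule eventually_large_fold_bumpD[where P = "\<lambda>n. fdiffs (replicate D 0) (hlen ?L) n = e"])
  show no: "\<not> spec_chain (satur ?L) (Suc (Suc D))"
    using sup_seq_prime_chain[OF K seq, of "Suc (Suc D)"] dim prime_chain_iff_spec_chain[OF L] by auto
  show hs: "eventually (\<lambda>m. (dif ^^ Suc D) (hs (satur ?L)) m = e) sequentially"
    by (rule hs_compare[OF L ev no])
  show "e \<noteq> 0 \<longleftrightarrow> spec_chain (satur ?L) (Suc D)"
  proof
    assume "e \<noteq> 0"
    show "spec_chain (satur ?L) (Suc D)"
    proof (rule ccontr)
      assume "\<not> spec_chain (satur ?L) (Suc D)"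
      then have "eventually (\<lambda>m. (dif ^^ Suc D) (hs (satur ?L)) m = 0) sequentially"
        by (rule hs_degree_le[OF satur_ideal[OF L]])
      with hs have "eventually (\<lambda>m::nat. e = 0) sequentially" by eventually_elim simp
      then show False using \<open>e \<noteq> 0\<close> by simp
    qed
  next
    assume "spec_chain (satur ?L) (Suc D)"
    then show "e \<noteq> 0" using hs_degree_ge[OF satur_ideal[OF L]] hs by blast
  qed
qed

end

section \<open>Quotient rings\<close>

context cring
begin

lemma coset_eq_iff:
  assumes "ideal B R" "x \<in> carrier R" "y \<in> carrier R"
  shows "B +> x = B +> y \<longleftrightarrow> x \<ominus> y \<in> B"
  using quotient_eq_iff_same_a_r_cos[OF assms] by blast

lemma coset_add:
  assumes "ideal B R" "x \<in> carrier R" "y \<in> carrier R"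
  shows "(B +> x) <+> (B +> y) = B +> (x \<oplus> y)"
  by (rule ideal.a_rcos_sum[OF assms])

lemma coset_zero: "ideal B R \<Longrightarrow> B +> \<zero> = B"
  by (rule a_rcos_zero) (simp_all add: idealD(2))

lemma mem_coset_self: "ideal B R \<Longrightarrow> x \<in> carrier R \<Longrightarrow> x \<in> B +> x"
proof -
  assume "ideal B R" "x \<in> carrier R"
  then have "\<zero> \<in> B" "x = \<zero> \<oplus> x" by (simp_all add: idealD(2))
  then show ?thesis unfolding a_r_coset_def' by blast
qed

lemma mem_coset_eq:
  assumes "ideal B R" "x \<in> carrier R" "y \<in> B +> x"
  shows "y \<in> carrier R" "B +> y = B +> x"
proof -
  obtain b where b: "b \<in> B" "y = b \<oplus> x" using assms(3) by (auto simp: a_r_coset_def')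
  have bc: "b \<in> carrier R" by (rule idealD(3)[OF assms(1) b(1)])
  show "y \<in> carrier R" using b bc assms(2) by simp
  have "y \<ominus> x = b" unfolding b(2) using bc assms(2) by (rule add_minus_cancel(1))
  then show "B +> y = B +> x"
    using coset_eq_iff[OF assms(1) \<open>y \<in> carrier R\<close> assms(2)] b(1) by simp
qed

lemma coset_mem_image_iff:
  assumes "ideal B R" "ideal C R" "B \<subseteq> C" "x \<in> carrier R"
  shows "B +> x \<in> (+>) B ` C \<longleftrightarrow> x \<in> C"
proof
  assume "B +> x \<in> (+>) B ` C"
  then obtain c where c: "c \<in> C" "B +> x = B +> c" by blast
  have cc: "c \<in> carrier R" by (rule idealD(3)[OF assms(2) c(1)])
  have "x \<ominus> c \<in> C" using coset_eq_iff[OF assms(1,4) cc] c(2) assms(3) by blast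
  then have "(x \<ominus> c) \<oplus> c \<in> C" using c(1) by (rule idealD(4)[OF assms(2)])
  then show "x \<in> C" using assms(4) cc by (simp add: a_minus_def a_assoc l_neg)
qed simp

text \<open>Submodules of A/B correspond to ideals between \<open>B\<close> and \<open>A\<close> by
  taking the union of their cosets.\<close>

lemma module_length_quot:
  assumes A: "ideal A R" and B: "ideal B R" and BA: "B \<subseteq> A"
  shows "module_length R (quot_module (ideal_module R A) B) = ideal_length R A B"
proof -
  let ?M = "quot_module (ideal_module R A) B"
  have car: "x \<in> carrier R" if "x \<in> A" for x using that by (rule idealD(3)[OF A])
  have carM: "carrier ?M = (+>) B ` A"
    by (auto simp: quot_module_def ideal_module_def A_RCOSETS_def RCOSETS_def a_r_coset_def r_coset_def)
  have addM: "X \<oplus>\<^bsub>?M\<^esub> Y = X <+> Y" for X Y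
    by (simp add: quot_module_def ideal_module_def set_add_def set_mult_def)
  have zeroM: "\<zero>\<^bsub>?M\<^esub> = B" by (simp add: quot_module_def)
  have smultM: "a \<odot>\<^bsub>?M\<^esub> (B +> x) = B +> (a \<otimes> x)" if a: "a \<in> carrier R" and x: "x \<in> A" for a x
  proof -
    have "B +> (a \<otimes> y) = B +> (a \<otimes> x)" if "y \<in> B +> x" for y
    proof -
      have y: "y \<in> carrier R" "B +> y = B +> x" using mem_coset_eq[OF B car[OF x] that] by auto
      then have "y \<ominus> x \<in> B" using coset_eq_iff[OF B y(1) car[OF x]] by simp
      then have "a \<otimes> (y \<ominus> x) \<in> B" using a by (rule idealD(7)[OF B])
      then have "a \<otimes> y \<ominus> a \<otimes> x \<in> B" using a y(1) car[OF x] by (simp add: a_minus_def r_distr r_minus)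
      then show ?thesis using coset_eq_iff[OF B] a y(1) car[OF x] by simp
    qed
    moreover have "B +> x \<noteq> {}" using mem_coset_self[OF B car[OF x]] by blast
    ultimately have "(\<Union>y\<in>B +> x. B +> (a \<otimes> y)) = B +> (a \<otimes> x)" by (intro SUP_eq_const)
    then show ?thesis
      by (simp add: quot_module_def ideal_module_def a_r_coset_def r_coset_def)
  qed
  \<comment> \<open>The group structure is needed to identify the additive inverse of B + x, under
    which a submodule must be closed.\<close>
  have grp: "group (add_monoid ?M)"
  proof (rule groupI)
    show "\<one>\<^bsub>add_monoid ?M\<^esub> \<in> carrier (add_monoid ?M)"
      using coset_zero[OF B] idealD(2)[OF A] by (auto simp: carM zeroM)
    fix X Y Z assume "X \<in> carrier (add_monoid ?M)"
    then obtain x where x: "x \<in> A" "X = B +> x" by (auto simp: carM)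
    show "\<one>\<^bsub>add_monoid ?M\<^esub> \<otimes>\<^bsub>add_monoid ?M\<^esub> X = X"
      using coset_add[OF B zero_closed car[OF x(1)]] car[OF x(1)] coset_zero[OF B]
      by (simp add: addM zeroM x(2))
    show "\<exists>Y\<in>carrier (add_monoid ?M). Y \<otimes>\<^bsub>add_monoid ?M\<^esub> X = \<one>\<^bsub>add_monoid ?M\<^esub>"
      using coset_add[OF B a_inv_closed[OF car[OF x(1)]] car[OF x(1)]] car[OF x(1)] coset_zero[OF B]
        idealD(6)[OF A x(1)]
      by (intro bexI[of _ "B +> \<ominus> x"]) (auto simp: addM zeroM carM x(2) l_neg)
    assume "Y \<in> carrier (add_monoid ?M)"
    then obtain y where y: "y \<in> A" "Y = B +> y" by (auto simp: carM)
    show "X \<otimes>\<^bsub>add_monoid ?M\<^esub> Y \<in> carrier (add_monoid ?M)"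
      using coset_add[OF B car[OF x(1)] car[OF y(1)]] idealD(4)[OF A x(1) y(1)]
      by (auto simp: addM carM x(2) y(2))
    assume "Z \<in> carrier (add_monoid ?M)"
    then obtain z where z: "z \<in> A" "Z = B +> z" by (auto simp: carM)
    show "X \<otimes>\<^bsub>add_monoid ?M\<^esub> Y \<otimes>\<^bsub>add_monoid ?M\<^esub> Z = X \<otimes>\<^bsub>add_monoid ?M\<^esub> (Y \<otimes>\<^bsub>add_monoid ?M\<^esub> Z)"
      using car[OF x(1)] car[OF y(1)] car[OF z(1)]
      by (simp add: addM x(2) y(2) z(2) coset_add[OF B] a_assoc)
  qed
  have sub: "submodule ((+>) B ` C) R ?M" if C: "ideal C R" "B \<subseteq> C" "C \<subseteq> A" for C
  proof (intro submodule.intro subgroup.intro submodule_axioms.intro)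
    show "(+>) B ` C \<subseteq> carrier (add_monoid ?M)" using C(3) by (auto simp: carM)
    show "\<one>\<^bsub>add_monoid ?M\<^esub> \<in> (+>) B ` C"
      using coset_zero[OF B] idealD(2)[OF C(1)] by (auto simp: zeroM intro: image_eqI[of _ _ \<zero>])
    fix X assume "X \<in> (+>) B ` C"
    then obtain x where x: "x \<in> C" "X = B +> x" by blast
    have xA: "x \<in> A" using x(1) C(3) by blast
    show "X \<otimes>\<^bsub>add_monoid ?M\<^esub> Y \<in> (+>) B ` C" if Y: "Y \<in> (+>) B ` C" for Y
    proof -
      from Y obtain y where y: "y \<in> C" "Y = B +> y" by blast
      have "y \<in> A" using y(1) C(3) by blast
      then show ?thesis
        using coset_add[OF B car[OF xA] car[of y]] idealD(4)[OF C(1) x(1) y(1)] by (simp add: addM x(2) y(2))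
    qed
    have "inv\<^bsub>add_monoid ?M\<^esub> X = B +> \<ominus> x"
    proof (rule group.inv_equality[OF grp])
      show "(B +> \<ominus> x) \<otimes>\<^bsub>add_monoid ?M\<^esub> X = \<one>\<^bsub>add_monoid ?M\<^esub>"
        using coset_add[OF B a_inv_closed[OF car[OF xA]] car[OF xA]] car[OF xA] coset_zero[OF B]
        by (simp add: addM zeroM x(2) l_neg)
      show "X \<in> carrier (add_monoid ?M)" "B +> \<ominus> x \<in> carrier (add_monoid ?M)"
        using xA idealD(6)[OF A xA] x(2) by (auto simp: carM)
    qed
    then show "inv\<^bsub>add_monoid ?M\<^esub> X \<in> (+>) B ` C" using idealD(6)[OF C(1) x(1)] by simp
    show "a \<odot>\<^bsub>?M\<^esub> X \<in> (+>) B ` C" if a: "a \<in> carrier R" for a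
      using smultM[OF a xA] idealD(7)[OF C(1) x(1) a] by (simp add: x(2))
  qed
  have memU: "x \<in> \<Union>N \<longleftrightarrow> x \<in> carrier R \<and> B +> x \<in> N" if N: "submodule N R ?M" for N x
  proof
    have NA: "N \<subseteq> (+>) B ` A" using subgroup.subset[OF submodule.axioms(1)[OF N]] by (simp add: carM)
    assume "x \<in> \<Union>N"
    then obtain a where a: "a \<in> A" "B +> a \<in> N" "x \<in> B +> a" using NA by blast
    then show "x \<in> carrier R \<and> B +> x \<in> N" using mem_coset_eq[OF B car[OF a(1)] a(3)] by simp
  next
    assume "x \<in> carrier R \<and> B +> x \<in> N"
    then show "x \<in> \<Union>N" using mem_coset_self[OF B, of x] by blast
  qed
  show ?thesis
    unfolding module_length_def ideal_length_def
      chain_length_def[of "{N. ideal N R \<and> B \<subseteq> N \<and> N \<subseteq> A}", symmetric]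
  proof -
    have "chain_length {N. submodule N R ?M} = chain_length {N. ideal N R \<and> B \<subseteq> N \<and> N \<subseteq> A}"
    proof (rule chain_length_eq_map[of _ Union _ "\<lambda>C. (+>) B ` C"])
      fix N assume "N \<in> {N. submodule N R ?M}"
      then have N: "submodule N R ?M" by simp
      note sg = submodule.axioms(1)[OF N]
      have NA: "N \<subseteq> (+>) B ` A" using subgroup.subset[OF sg] by (simp add: carM)
      have NinA: "x \<in> A" if "x \<in> \<Union>N" for x
        using memU[OF N] that NA coset_mem_image_iff[OF B A BA] by blast
      have BN: "B \<in> N" using subgroup.one_closed[OF sg] by (simp add: zeroM)
      have "ideal (\<Union>N) R"
      proof (rule idealI_simple)
        show "\<Union>N \<subseteq> carrier R" using memU[OF N] by blast
        show "\<zero> \<in> \<Union>N" using BN idealD(2)[OF B] by blast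
        fix x assume x: "x \<in> \<Union>N"
        show "x \<oplus> y \<in> \<Union>N" if y: "y \<in> \<Union>N" for y
          using subgroup.m_closed[OF sg, of "B +> x" "B +> y"] x y coset_add[OF B, of x y]
          by (simp add: memU[OF N] addM del: Union_iff)
        show "r \<otimes> x \<in> \<Union>N" if r: "r \<in> carrier R" for r
          using submodule.smult_closed[OF N r, of "B +> x"] smultM[OF r NinA[OF x]] x r
          by (simp add: memU[OF N] del: Union_iff)
      qed
      then show "\<Union>N \<in> {N. ideal N R \<and> B \<subseteq> N \<and> N \<subseteq> A}" using BN NinA by blast
      show "(+>) B ` \<Union>N = N"
      proof
        show "(+>) B ` \<Union>N \<subseteq> N" using memU[OF N] by blast
        show "N \<subseteq> (+>) B ` \<Union>N"
        proof
          fix X assume X: "X \<in> N"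
          then obtain a where a: "a \<in> A" "X = B +> a" using NA by blast
          then have "a \<in> \<Union>N" using memU[OF N] X car by blast
          then show "X \<in> (+>) B ` \<Union>N" using a(2) by blast
        qed
      qed
    next
      fix C assume "C \<in> {N. ideal N R \<and> B \<subseteq> N \<and> N \<subseteq> A}"
      then have C: "ideal C R" "B \<subseteq> C" "C \<subseteq> A" by auto
      show "(+>) B ` C \<in> {N. submodule N R ?M}" using sub[OF C] by simp
      show "\<Union> ((+>) B ` C) = C" using ideal_incl_iff[OF B C(1)] C(2) by simp
    qed auto
    then show "Sup {enat n |n. \<exists>N. (\<forall>i\<le>n. submodule (N i) R ?M) \<and> (\<forall>i<n. N i \<subset> N (Suc i))}
        = chain_length {N. ideal N R \<and> B \<subseteq> N \<and> N \<subseteq> A}"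
      by (simp add: chain_length_def has_chain_def)
  qed
qed

end

section \<open>Ideals, lengths and primes in a quotient ring\<close>

context cring
begin

context
  fixes K assumes K: "ideal K R"
begin

lemma quot_cring: "cring (R Quot K)"
  by (rule ideal.quotient_is_cring[OF K is_cring])

lemma quot_carrier: "carrier (R Quot K) = (+>) K ` carrier R"
  by (auto simp: FactRing_def A_RCOSETS_def')

lemma quot_zero: "\<zero>\<^bsub>R Quot K\<^esub> = K"
  by (simp add: FactRing_def)

lemma quot_mult:
  "x \<in> carrier R \<Longrightarrow> y \<in> carrier R \<Longrightarrow> (K +> x) \<otimes>\<^bsub>R Quot K\<^esub> (K +> y) = K +> (x \<otimes> y)"
  using ring_hom_mult[OF ideal.rcos_ring_hom[OF K]] by simp

lemma quot_add:
  "x \<in> carrier R \<Longrightarrow> y \<in> carrier R \<Longrightarrow> (K +> x) \<oplus>\<^bsub>R Quot K\<^esub> (K +> y) = K +> (x \<oplus> y)"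
  using ring_hom_add[OF ideal.rcos_ring_hom[OF K]] by simp

lemma quot_image_ideal: "ideal A R \<Longrightarrow> ideal ((+>) K ` A) (R Quot K)"
  by (rule ring_ideal_imp_quot_ideal[OF K])

lemma quot_image_prod:
  assumes A: "ideal A R" and B: "ideal B R"
  shows "(+>) K ` (A \<cdot> B) = ((+>) K ` A) \<cdot>\<^bsub>R Quot K\<^esub> ((+>) K ` B)"
proof
  have AB: "x \<in> carrier R" if "x \<in> A \<cdot> B" for x
    using idealD(3)[OF ideal_prod_is_ideal[OF A B] that] .
  show "(+>) K ` (A \<cdot> B) \<subseteq> ((+>) K ` A) \<cdot>\<^bsub>R Quot K\<^esub> ((+>) K ` B)"
  proof (rule image_subsetI)
    fix x assume "x \<in> A \<cdot> B"
    then show "K +> x \<in> ((+>) K ` A) \<cdot>\<^bsub>R Quot K\<^esub> ((+>) K ` B)"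
    proof induction
      case (prod a b)
      then show ?case
        using quot_mult[OF idealD(3)[OF A prod(1)] idealD(3)[OF B prod(2)]]
          ideal_prod.prod[of "K +> a" "(+>) K ` A" "K +> b" "(+>) K ` B" "R Quot K"] by simp
    next
      case (sum x y)
      then show ?case
        using quot_add[OF AB[OF sum(1)] AB[OF sum(2)]] ideal_prod.sum[OF sum(3,4)] by simp
    qed
  qed
  show "((+>) K ` A) \<cdot>\<^bsub>R Quot K\<^esub> ((+>) K ` B) \<subseteq> (+>) K ` (A \<cdot> B)"
  proof
    fix X assume "X \<in> ((+>) K ` A) \<cdot>\<^bsub>R Quot K\<^esub> ((+>) K ` B)"
    then show "X \<in> (+>) K ` (A \<cdot> B)"
    proof induction
      case (prod X Y)
      then obtain a b where ab: "a \<in> A" "b \<in> B" "X = K +> a" "Y = K +> b" by blast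
      then show ?case
        using quot_mult[OF idealD(3)[OF A ab(1)] idealD(3)[OF B ab(2)]] ideal_prod.prod[OF ab(1,2), of R] by simp
    next
      case (sum X Y)
      then obtain x y where xy: "x \<in> A \<cdot> B" "y \<in> A \<cdot> B" "X = K +> x" "Y = K +> y" by blast
      then show ?case
        using quot_add[OF AB[OF xy(1)] AB[OF xy(2)]] ideal_prod.sum[OF xy(1,2)] by simp
    qed
  qed
qed

lemma quot_image_pow:
  assumes A: "ideal A R"
  shows "(+>) K ` (A [^]\<^bsub>ideals_set R\<^esub> (n::nat)) = ((+>) K ` A) [^]\<^bsub>ideals_set (R Quot K)\<^esub> n"
proof -
  interpret R: comm_monoid "ideals_set R" by (rule ideals_set_is_comm_monoid)
  interpret S: comm_monoid "ideals_set (R Quot K)" by (rule cring.ideals_set_is_comm_monoid[OF quot_cring])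
  have iA: "ideal (A [^]\<^bsub>ideals_set R\<^esub> (n::nat)) R" for n
    using R.nat_pow_closed[of A n] A by (simp add: ideals_set_def)
  show ?thesis
  proof (induction n)
    case 0
    then show ?case by (simp add: ideals_set_def quot_carrier)
  next
    case (Suc n)
    have "A [^]\<^bsub>ideals_set R\<^esub> Suc n = (A [^]\<^bsub>ideals_set R\<^esub> n) \<cdot> A"
      by (simp add: R.nat_pow_Suc ideals_set_def)
    moreover have "((+>) K ` A) [^]\<^bsub>ideals_set (R Quot K)\<^esub> Suc n
        = (((+>) K ` A) [^]\<^bsub>ideals_set (R Quot K)\<^esub> n) \<cdot>\<^bsub>R Quot K\<^esub> ((+>) K ` A)"
      by (simp add: S.nat_pow_Suc ideals_set_def)
    ultimately show ?case using quot_image_prod[OF iA A] Suc by simp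
  qed
qed

lemma quot_image_finprod:
  assumes "finite X" "\<And>j. j \<in> X \<Longrightarrow> ideal (F j) R"
  shows "(+>) K ` (finprod (ideals_set R) F X) = finprod (ideals_set (R Quot K)) (\<lambda>j. (+>) K ` F j) X"
proof -
  interpret R: comm_monoid "ideals_set R" by (rule ideals_set_is_comm_monoid)
  interpret S: comm_monoid "ideals_set (R Quot K)" by (rule cring.ideals_set_is_comm_monoid[OF quot_cring])
  show ?thesis
    using assms
  proof (induction X rule: finite_induct)
    case empty
    have "\<one>\<^bsub>ideals_set R\<^esub> = carrier R" "\<one>\<^bsub>ideals_set (R Quot K)\<^esub> = carrier (R Quot K)"
      by (simp_all add: ideals_set_def)
    then show ?case
      unfolding R.finprod_empty S.finprod_empty by (simp add: quot_carrier)
  next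
    case (insert j X)
    have F: "F \<in> X \<rightarrow> carrier (ideals_set R)" "F j \<in> carrier (ideals_set R)"
      using insert.prems by (auto simp: ideals_set_def)
    have FS: "(\<lambda>j. (+>) K ` F j) \<in> X \<rightarrow> carrier (ideals_set (R Quot K))"
      "(+>) K ` F j \<in> carrier (ideals_set (R Quot K))"
      using insert.prems quot_image_ideal by (auto simp: ideals_set_def)
    have fi: "ideal (finprod (ideals_set R) F X) R"
      using R.finprod_closed[OF F(1)] by (simp add: ideals_set_def)
    have "finprod (ideals_set R) F (insert j X) = F j \<cdot> finprod (ideals_set R) F X"
      using R.finprod_insert[OF insert.hyps F] by (simp add: ideals_set_def)
    moreover have "finprod (ideals_set (R Quot K)) (\<lambda>j. (+>) K ` F j) (insert j X)
        = ((+>) K ` F j) \<cdot>\<^bsub>R Quot K\<^esub> finprod (ideals_set (R Quot K)) (\<lambda>j. (+>) K ` F j) X"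
      using S.finprod_insert[OF insert.hyps FS] by (simp add: ideals_set_def)
    ultimately show ?case using quot_image_prod[OF _ fi, of "F j"] insert by simp
  qed
qed

lemma quot_image_sum_kernel:
  assumes "ideal A R"
  shows "(+>) K ` (A <+> K) = (+>) K ` A"
proof
  show "(+>) K ` A \<subseteq> (+>) K ` (A <+> K)" using ideal_sum_upper(1)[OF assms K] by (rule image_mono)
  show "(+>) K ` (A <+> K) \<subseteq> (+>) K ` A"
  proof (rule image_subsetI)
    fix x assume "x \<in> A <+> K"
    then obtain a k where ak: "a \<in> A" "k \<in> K" "x = a \<oplus> k" by (auto simp: set_add_iff)
    have c: "a \<in> carrier R" "k \<in> carrier R" using idealD(3)[OF assms ak(1)] idealD(3)[OF K ak(2)] .
    have "x \<ominus> a = k" unfolding ak(3) using c by (rule add_minus_cancel(2))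
    then have "K +> x = K +> a" using coset_eq_iff[OF K, of x a] c ak(2,3) by simp
    then show "K +> x \<in> (+>) K ` A" using ak(1) by simp
  qed
qed

lemma quot_image_eq_iff:
  assumes "ideal A R" "K \<subseteq> A" "ideal B R" "K \<subseteq> B"
  shows "(+>) K ` A = (+>) K ` B \<longleftrightarrow> A = B"
proof
  assume eq: "(+>) K ` A = (+>) K ` B"
  have "x \<in> A \<longleftrightarrow> x \<in> B" if "x \<in> carrier R" for x
    using coset_mem_image_iff[OF K assms(1,2) that] coset_mem_image_iff[OF K assms(3,4) that] eq by simp
  then show "A = B" using idealD(1)[OF assms(1)] idealD(1)[OF assms(3)] by blast
qed simp

lemma quot_image_subset_iff:
  assumes "ideal A R" "K \<subseteq> A" "ideal B R" "K \<subseteq> B"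
  shows "(+>) K ` A \<subseteq> (+>) K ` B \<longleftrightarrow> A \<subseteq> B"
proof
  assume s: "(+>) K ` A \<subseteq> (+>) K ` B"
  show "A \<subseteq> B"
  proof
    fix x assume x: "x \<in> A"
    then show "x \<in> B" using coset_mem_image_iff[OF K assms(3,4) idealD(3)[OF assms(1) x]] s by blast
  qed
qed (rule image_mono)

lemma quot_image_inter:
  assumes "ideal A R" "K \<subseteq> A" "ideal B R" "K \<subseteq> B"
  shows "(+>) K ` A \<inter> (+>) K ` B = (+>) K ` (A \<inter> B)"
proof
  show "(+>) K ` A \<inter> (+>) K ` B \<subseteq> (+>) K ` (A \<inter> B)"
  proof
    fix X assume X: "X \<in> (+>) K ` A \<inter> (+>) K ` B"
    then obtain a where a: "a \<in> A" "X = K +> a" by blast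
    then have "a \<in> B" using coset_mem_image_iff[OF K assms(3,4) idealD(3)[OF assms(1) a(1)]] X by blast
    then show "X \<in> (+>) K ` (A \<inter> B)" using a by blast
  qed
qed blast

lemma quot_colon:
  assumes A: "ideal A R" "K \<subseteq> A" and x: "x \<in> carrier R"
  shows "colon (R Quot K) ((+>) K ` A) {K +> x} = (+>) K ` (colon R A {x})"
proof -
  have "K +> y \<in> colon (R Quot K) ((+>) K ` A) {K +> x} \<longleftrightarrow> y \<in> colon R A {x}" if y: "y \<in> carrier R" for y
  proof -
    have "(K +> y) \<otimes>\<^bsub>R Quot K\<^esub> (K +> x) \<in> (+>) K ` A \<longleftrightarrow> y \<otimes> x \<in> A"
      using quot_mult[OF y x] coset_mem_image_iff[OF K A, of "y \<otimes> x"] x y by simp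
    moreover have "K +> y \<in> carrier (R Quot K)" unfolding quot_carrier using y by (rule imageI)
    ultimately show ?thesis using y by (simp add: colon_def)
  qed
  moreover have "colon (R Quot K) ((+>) K ` A) {K +> x} \<subseteq> (+>) K ` carrier R"
    unfolding quot_carrier[symmetric] by (auto simp: colon_def)
  moreover have "colon R A {x} \<subseteq> carrier R" by (auto simp: colon_def)
  ultimately show ?thesis by blast
qed

lemma quot_smult_image:
  assumes "ideal A R" "x \<in> carrier R"
  shows "(\<lambda>y. (K +> x) \<otimes>\<^bsub>R Quot K\<^esub> y) ` ((+>) K ` A) = (+>) K ` ((\<lambda>y. x \<otimes> y) ` A)"
  unfolding image_image using quot_mult[OF assms(2) idealD(3)[OF assms(1)]] by (intro image_cong) auto

lemma quot_cgenideal: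
  assumes "x \<in> carrier R"
  shows "PIdl\<^bsub>R Quot K\<^esub> (K +> x) = (+>) K ` (PIdl x)"
proof
  show "PIdl\<^bsub>R Quot K\<^esub> (K +> x) \<subseteq> (+>) K ` (PIdl x)"
  proof
    fix Y assume "Y \<in> PIdl\<^bsub>R Quot K\<^esub> (K +> x)"
    then obtain r where r: "r \<in> carrier R" "Y = (K +> r) \<otimes>\<^bsub>R Quot K\<^esub> (K +> x)"
      unfolding cgenideal_def quot_carrier by blast
    then have "Y = K +> (r \<otimes> x)" using quot_mult assms by simp
    moreover have "r \<otimes> x \<in> PIdl x" unfolding cgenideal_iff using r(1) by blast
    ultimately show "Y \<in> (+>) K ` (PIdl x)" by blast
  qed
  show "(+>) K ` (PIdl x) \<subseteq> PIdl\<^bsub>R Quot K\<^esub> (K +> x)"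
  proof (rule image_subsetI)
    fix y assume "y \<in> PIdl x"
    then obtain r where r: "r \<in> carrier R" "y = r \<otimes> x" unfolding cgenideal_iff by blast
    then have "K +> y = (K +> r) \<otimes>\<^bsub>R Quot K\<^esub> (K +> x)" using quot_mult assms by simp
    moreover have "K +> r \<in> carrier (R Quot K)" unfolding quot_carrier using r(1) by (rule imageI)
    ultimately show "K +> y \<in> PIdl\<^bsub>R Quot K\<^esub> (K +> x)" unfolding cgenideal_def by blast
  qed
qed

lemma quot_image_eq_zero_iff:
  assumes "ideal A R"
  shows "(+>) K ` A = {\<zero>\<^bsub>R Quot K\<^esub>} \<longleftrightarrow> A \<subseteq> K"
proof -
  have "K +> a = K \<longleftrightarrow> a \<in> K" if "a \<in> carrier R" for a
    using coset_eq_iff[OF K that zero_closed] coset_zero[OF K] that by (simp add: a_minus_def)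
  then have "(\<forall>a\<in>A. K +> a = K) \<longleftrightarrow> A \<subseteq> K" using idealD(3)[OF assms] by blast
  moreover have "(+>) K ` A = {K} \<longleftrightarrow> (\<forall>a\<in>A. K +> a = K)" using idealD(2)[OF assms] by auto
  ultimately show ?thesis by (simp add: quot_zero)
qed

lemma quot_ideal_length:
  assumes A: "ideal A R" "K \<subseteq> A" and B: "ideal B R" "K \<subseteq> B"
  shows "ideal_length (R Quot K) ((+>) K ` A) ((+>) K ` B) = ideal_length R A B"
  unfolding ideal_length_def
proof (rule chain_length_eq_map[of _ Union _ "\<lambda>C. (+>) K ` C"])
  note bij = quot_ideal_correspondence[OF K]
  fix X assume "X \<in> {N. ideal N (R Quot K) \<and> (+>) K ` B \<subseteq> N \<and> N \<subseteq> (+>) K ` A}"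
  then have X: "ideal X (R Quot K)" "(+>) K ` B \<subseteq> X" "X \<subseteq> (+>) K ` A" by auto
  have "X \<in> (\<lambda>J. (+>) K ` J) ` {J. ideal J R \<and> K \<subseteq> J}" using bij X(1) unfolding bij_betw_def by blast
  then obtain C where C: "ideal C R" "K \<subseteq> C" "X = (+>) K ` C" by blast
  have U: "\<Union>X = C" using ideal_incl_iff[OF K C(1)] C(2,3) by simp
  then show "(+>) K ` \<Union>X = X" using C(3) by simp
  show "\<Union>X \<in> {N. ideal N R \<and> B \<subseteq> N \<and> N \<subseteq> A}"
    using X(2,3) U C quot_image_subset_iff[OF B C(1,2)] quot_image_subset_iff[OF C(1,2) A] by simp
next
  fix C assume "C \<in> {N. ideal N R \<and> B \<subseteq> N \<and> N \<subseteq> A}"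
  then have C: "ideal C R" "B \<subseteq> C" "C \<subseteq> A" by auto
  show "(+>) K ` C \<in> {N. ideal N (R Quot K) \<and> (+>) K ` B \<subseteq> N \<and> N \<subseteq> (+>) K ` A}"
    using quot_image_ideal[OF C(1)] C(2,3) by (simp add: image_mono)
  have "K \<subseteq> C" using B(2) C(2) by blast
  then show "\<Union> ((+>) K ` C) = C" using ideal_incl_iff[OF K C(1)] by simp
qed (auto intro: Union_mono)

lemma quot_prime_image:
  assumes P: "primeideal P R" and KP: "K \<subseteq> P"
  shows "primeideal ((+>) K ` P) (R Quot K)"
proof (rule primeidealI[OF quot_image_ideal quot_cring])
  show iP: "ideal P R" by (rule primeideal.axioms(1)[OF P])
  show "carrier (R Quot K) \<noteq> (+>) K ` P"
    unfolding quot_carrier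
    using quot_image_eq_iff[OF oneideal idealD(1)[OF K] iP KP] primeideal.I_notcarr[OF P] by simp
  fix X Y assume "X \<in> carrier (R Quot K)" "Y \<in> carrier (R Quot K)" and XY: "X \<otimes>\<^bsub>R Quot K\<^esub> Y \<in> (+>) K ` P"
  then obtain x y where xy: "x \<in> carrier R" "y \<in> carrier R" "X = K +> x" "Y = K +> y"
    unfolding quot_carrier by blast
  then have "x \<otimes> y \<in> P" using XY quot_mult coset_mem_image_iff[OF K iP KP, of "x \<otimes> y"] by simp
  then show "X \<in> (+>) K ` P \<or> Y \<in> (+>) K ` P" using primeideal.I_prime[OF P xy(1,2)] xy(3,4) by blast
qed

lemma quot_prime_Union:
  assumes P: "primeideal P (R Quot K)"
  shows "primeideal (\<Union>P) R" "K \<subseteq> \<Union>P" "(+>) K ` \<Union>P = P"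
proof -
  have iP: "ideal P (R Quot K)" by (rule primeideal.axioms(1)[OF P])
  have "P \<in> (\<lambda>J. (+>) K ` J) ` {J. ideal J R \<and> K \<subseteq> J}"
    using quot_ideal_correspondence[OF K] iP unfolding bij_betw_def by blast
  then obtain C where C: "ideal C R" "K \<subseteq> C" "P = (+>) K ` C" by blast
  have U: "\<Union>P = C" using ideal_incl_iff[OF K C(1)] C(2,3) by simp
  show "K \<subseteq> \<Union>P" "(+>) K ` \<Union>P = P" using U C by simp_all
  show "primeideal (\<Union>P) R"
    unfolding U
  proof (rule primeidealI[OF C(1) is_cring])
    show "carrier R \<noteq> C" using primeideal.I_notcarr[OF P] C(3) quot_carrier by blast
    fix x y assume xy: "x \<in> carrier R" "y \<in> carrier R" "x \<otimes> y \<in> C"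
    have "K +> x \<in> carrier (R Quot K)" "K +> y \<in> carrier (R Quot K)" unfolding quot_carrier using xy by auto
    moreover have "(K +> x) \<otimes>\<^bsub>R Quot K\<^esub> (K +> y) \<in> P" unfolding C(3) using quot_mult xy by simp
    ultimately have "K +> x \<in> P \<or> K +> y \<in> P" by (rule primeideal.I_prime[OF P])
    then show "x \<in> C \<or> y \<in> C"
      unfolding C(3) using coset_mem_image_iff[OF K C(1,2)] xy by blast
  qed
qed

text \<open>Unions of cosets and images under the quotient map translate prime chains; containment
  of \<open>K\<close> has to be required only of the least prime.\<close>

lemma quot_chain_iff:
  "(\<exists>P :: nat \<Rightarrow> 'a set set. (\<forall>i\<le>n. primeideal (P i) (R Quot K)) \<and> (\<forall>i<n. P i \<subset> P (Suc i))) \<longleftrightarrow>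
   (\<exists>P :: nat \<Rightarrow> 'a set. (\<forall>i\<le>n. primeideal (P i) R) \<and> (\<forall>i<n. P i \<subset> P (Suc i)) \<and> K \<subseteq> P 0)"
proof
  assume "\<exists>P :: nat \<Rightarrow> 'a set set. (\<forall>i\<le>n. primeideal (P i) (R Quot K)) \<and> (\<forall>i<n. P i \<subset> P (Suc i))"
  then obtain P :: "nat \<Rightarrow> 'a set set" where P: "\<forall>i\<le>n. primeideal (P i) (R Quot K)" "\<forall>i<n. P i \<subset> P (Suc i)"
    by (elim exE conjE)
  have "\<Union>(P i) \<subset> \<Union>(P (Suc i))" if "i < n" for i
  proof -
    have "P i \<subset> P (Suc i)" using P(2) that by simp
    moreover have p: "primeideal (P i) (R Quot K)" "primeideal (P (Suc i)) (R Quot K)"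
      using P(1) that by simp_all
    note quot_prime_Union(3)[OF p(1)] quot_prime_Union(3)[OF p(2)]
    ultimately have "\<Union>(P i) \<subseteq> \<Union>(P (Suc i))" "\<Union>(P i) \<noteq> \<Union>(P (Suc i))"
      by (blast, metis psubset_eq)
    then show ?thesis by blast
  qed
  moreover have "\<forall>i\<le>n. primeideal (\<Union>(P i)) R" using P(1) quot_prime_Union(1) by simp
  moreover have "K \<subseteq> \<Union>(P 0)" using P(1) quot_prime_Union(2)[of "P 0"] by simp
  ultimately show "\<exists>P :: nat \<Rightarrow> 'a set. (\<forall>i\<le>n. primeideal (P i) R) \<and> (\<forall>i<n. P i \<subset> P (Suc i)) \<and> K \<subseteq> P 0"
    by (intro exI[of _ "\<lambda>i. \<Union>(P i)"]) simp
next
  assume "\<exists>P :: nat \<Rightarrow> 'a set. (\<forall>i\<le>n. primeideal (P i) R) \<and> (\<forall>i<n. P i \<subset> P (Suc i)) \<and> K \<subseteq> P 0"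
  then obtain P :: "nat \<Rightarrow> 'a set" where P: "\<forall>i\<le>n. primeideal (P i) R" "\<forall>i<n. P i \<subset> P (Suc i)" "K \<subseteq> P 0"
    by (elim exE conjE)
  have KP: "K \<subseteq> P i" if "i \<le> n" for i
    using that
  proof (induction i)
    case (Suc i)
    then have "K \<subseteq> P i" "P i \<subset> P (Suc i)" using P(2) by simp_all
    then show ?case by blast
  qed (use P in simp)
  have "(+>) K ` P i \<subset> (+>) K ` P (Suc i)" if "i < n" for i
  proof -
    have i: "ideal (P i) R" "ideal (P (Suc i)) R" "K \<subseteq> P i" "K \<subseteq> P (Suc i)" "P i \<subset> P (Suc i)"
      using P(1,2) KP that by (auto intro: primeideal.axioms(1))
    then show ?thesis using quot_image_eq_iff[OF i(1,3,2,4)] by blast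
  qed
  moreover have "\<forall>i\<le>n. primeideal ((+>) K ` P i) (R Quot K)" using P(1) KP quot_prime_image by simp
  ultimately show "\<exists>P :: nat \<Rightarrow> 'a set set. (\<forall>i\<le>n. primeideal (P i) (R Quot K)) \<and> (\<forall>i<n. P i \<subset> P (Suc i))"
    by (intro exI[of _ "\<lambda>i. (+>) K ` P i"]) simp
qed

end

end

section \<open>Dimension and superficial elements in quotient rings\<close>

context local_primary_family
begin

lemma krull_dim_quot:
  assumes "ideal Q R"
  shows "krull_dim (R Quot Q) = Sup {ereal (real n) | n. spec_chain Q n}"
  unfolding krull_dim_def spec_chain_def quot_chain_iff[OF assms] ..

text \<open>Chain lengths are downward closed integers, so a finite supremum is attained.\<close>

lemma krull_dim_quot_eq_iff:
  assumes "ideal Q R"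
  shows "krull_dim (R Quot Q) = ereal (real d) \<longleftrightarrow> spec_chain Q d \<and> \<not> spec_chain Q (Suc d)"
proof
  assume r: "spec_chain Q d \<and> \<not> spec_chain Q (Suc d)"
  have le: "n \<le> d" if "spec_chain Q n" for n
    using r spec_chain_le[OF that, of "Suc d"] by (meson not_less_eq_eq)
  show "krull_dim (R Quot Q) = ereal (real d)"
    unfolding krull_dim_quot[OF assms]
    by (rule antisym) (use r le in \<open>auto intro!: Sup_least Sup_upper\<close>)
next
  assume l: "krull_dim (R Quot Q) = ereal (real d)"
  then have S: "Sup {ereal (real n) | n. spec_chain Q n} = ereal (real d)"
    by (simp add: krull_dim_quot[OF assms])
  have le: "n \<le> d" if "spec_chain Q n" for n
  proof -
    have "ereal (real n) \<le> ereal (real d)" unfolding S[symmetric] using that by (intro Sup_upper) blast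
    then show ?thesis by simp
  qed
  have "spec_chain Q d"
  proof (rule ccontr)
    assume no: "\<not> spec_chain Q d"
    show False
    \<comment> \<open>For d = 0 the absence of chains makes the supremum -\<infinity> instead of
      0.\<close>
    proof (cases d)
      case 0
      then have "{ereal (real n) | n. spec_chain Q n} = {}" using no spec_chain_le by auto
      then show False using S by (simp only: Sup_empty) (simp add: bot_ereal_def)
    next
      case (Suc d')
      have "n \<le> d'" if "spec_chain Q n" for n
        using no spec_chain_le[OF that, of d] Suc by (metis not_less_eq_eq)
      then have "Sup {ereal (real n) | n. spec_chain Q n} \<le> ereal (real d')"
        by (intro Sup_least) auto
      then show False unfolding S using Suc by simp
    qed
  qed
  then show "spec_chain Q d \<and> \<not> spec_chain Q (Suc d)" using le[of "Suc d"] by auto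
qed

lemma quot_image_mp:
  assumes K: "ideal K R"
  shows "multi_power (R Quot K) s (\<lambda>j. quot_ext R K (I j)) n = (+>) K ` mp n"
proof -
  interpret S: comm_monoid "ideals_set (R Quot K)" by (rule cring.ideals_set_is_comm_monoid[OF quot_cring[OF K]])
  have "(+>) K ` mp n = finprod (ideals_set (R Quot K)) (\<lambda>j. (+>) K ` (I j [^]\<^bsub>ideals_set R\<^esub> n j)) {..s}"
    unfolding multi_power_def using I_ideal ideal_pow by (intro quot_image_finprod[OF K]) auto
  also have "\<dots> = multi_power (R Quot K) s (\<lambda>j. quot_ext R K (I j)) n"
    unfolding multi_power_def
  proof (rule S.finprod_cong')
    show "(\<lambda>j. quot_ext R K (I j) [^]\<^bsub>ideals_set (R Quot K)\<^esub> n j) \<in> {..s} \<rightarrow> carrier (ideals_set (R Quot K))"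
      using quot_image_ideal[OF K] I_ideal by (auto simp: quot_ext_def ideals_set_def intro!: S.nat_pow_closed[simplified ideals_set_def, simplified])
    fix j assume "j \<in> {..s}"
    then show "(+>) K ` (I j [^]\<^bsub>ideals_set R\<^esub> n j) = quot_ext R K (I j) [^]\<^bsub>ideals_set (R Quot K)\<^esub> n j"
      unfolding quot_ext_def using I_ideal by (intro quot_image_pow[OF K]) auto
  qed simp
  finally show ?thesis by simp
qed

text \<open>Coordinates beyond \<open>s\<close> are filled up with the threshold, which
  \<open>P\<close> cannot notice.\<close>

lemma eventually_large_iff_depends:
  assumes "\<And>n m. (\<And>j. j \<le> s \<Longrightarrow> n j = m j) \<Longrightarrow> P n \<longleftrightarrow> P m"
  shows "(\<exists>N. \<forall>n. (\<forall>j\<le>s. N \<le> n j) \<longrightarrow> P n) \<longleftrightarrow> eventually P large"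
proof
  assume "\<exists>N. \<forall>n. (\<forall>j\<le>s. N \<le> n j) \<longrightarrow> P n"
  then show "eventually P large" unfolding eventually_large by auto
next
  assume "eventually P large"
  then obtain N where N: "\<And>n. \<forall>j. N \<le> n j \<Longrightarrow> P n" unfolding eventually_large by blast
  have "P n" if n: "\<forall>j\<le>s. N \<le> n j" for n
  proof -
    have "P (\<lambda>j. if j \<le> s then n j else N)" using n by (intro N) auto
    then show ?thesis using assms[of n "\<lambda>j. if j \<le> s then n j else N"] by simp
  qed
  then show "\<exists>N. \<forall>n. (\<forall>j\<le>s. N \<le> n j) \<longrightarrow> P n" by blast
qed

lemma finprod_pow_mp: "finprod (ideals_set R) I {..s} [^]\<^bsub>ideals_set R\<^esub> (n::nat) = mp (\<lambda>_. n)"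
proof (induction n)
  case 0
  then show ?case by (simp add: mp_zero)
next
  case (Suc n)
  have "mp (\<lambda>_. 1) = finprod (ideals_set R) I {..s}"
    unfolding multi_power_def using I_ideal
    by (intro ids.finprod_cong') (auto simp: ids.nat_pow_Suc one_ideal_prod)
  then show ?case using Suc mp_const_add[of n 1] by (simp add: ids.nat_pow_Suc)
qed

lemma nonnilpotent_quot_iff:
  assumes K: "ideal K R"
  shows "nonnilpotent_ideal (R Quot K) (finprod (ideals_set (R Quot K)) (\<lambda>j. quot_ext R K (I j)) {..s})
    \<longleftrightarrow> \<not> nilp_mod K"
proof -
  let ?F = "finprod (ideals_set R) I {..s}"
  have F: "ideal ?F R" using ids.finprod_closed[of I "{..s}"] I_ideal by (simp add: Pi_def)
  have "finprod (ideals_set (R Quot K)) (\<lambda>j. quot_ext R K (I j)) {..s} = (+>) K ` ?F"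
    unfolding quot_ext_def using I_ideal by (intro quot_image_finprod[OF K, symmetric]) auto
  then have "(finprod (ideals_set (R Quot K)) (\<lambda>j. quot_ext R K (I j)) {..s}) [^]\<^bsub>ideals_set (R Quot K)\<^esub> n
      = (+>) K ` mp (\<lambda>_. n)" for n :: nat
    using quot_image_pow[OF K F, of n] by (simp add: finprod_pow_mp)
  then show ?thesis
    unfolding nonnilpotent_ideal_def nilp_mod_def using quot_image_eq_zero_iff[OF K mp_ideal] by simp
qed

text \<open>All ideals in conditions (a) and (b) can be written as images of ideals that contain
  \<open>K\<close>. On such ideals taking images is injective and commutes with intersections and
  with colons by an element.\<close>

lemma superficial_at_quot_iff:
  assumes K: "ideal K R" and x: "x \<in> I i" "i \<le> s"
  shows "superficial_at (R Quot K) s (\<lambda>j. quot_ext R K (I j)) i (K +> x)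
    \<longleftrightarrow> \<not> nilp_mod K \<and> superficial_mod K i x"
proof -
  have xc: "x \<in> carrier R" by (rule idealD(3)[OF I_ideal[OF x(2)] x(1)])
  let ?S = "R Quot K" and ?h = "(+>) K"
  have hE: "?h ` mp n = ?h ` E K n" for n
    unfolding E_def using quot_image_sum_kernel[OF K mp_ideal] by simp
  have prod: "quot_ext R K (I 0) \<cdot>\<^bsub>?S\<^esub> (?h ` mp n) = ?h ` E K (bump 0 n)" for n
    using quot_image_prod[OF K J_ideal mp_ideal, of n] mp_bump[of 0 n] by (simp add: quot_ext_def hE[symmetric])
  note EI = E_ideal[OF K] and KE = K_sub_E[OF K]
  have a: "colon ?S (quot_ext R K (I 0) \<cdot>\<^bsub>?S\<^esub> multi_power ?S s (\<lambda>j. quot_ext R K (I j)) (n(i := Suc (n i)))) {K +> x}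
        \<inter> multi_power ?S s (\<lambda>j. quot_ext R K (I j)) n
      = quot_ext R K (I 0) \<cdot>\<^bsub>?S\<^esub> multi_power ?S s (\<lambda>j. quot_ext R K (I j)) n
    \<longleftrightarrow> colon R (E K (bump 0 (bump i n))) {x} \<inter> E K n = E K (bump 0 n)" for n
  proof -
    have c: "ideal (colon R (E K (bump 0 (bump i n))) {x}) R" by (rule colon_ideal[OF EI]) (use xc in simp)
    have Kc: "K \<subseteq> colon R (E K (bump 0 (bump i n))) {x}"
      unfolding mem_colon_singleton subset_iff
      using subsetD[OF KE idealD(8)[OF K _ xc]] idealD(3)[OF K] by blast
    have "colon ?S (?h ` E K (bump 0 (bump i n))) {K +> x} \<inter> ?h ` E K n
        = ?h ` (colon R (E K (bump 0 (bump i n))) {x} \<inter> E K n)"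
      using quot_colon[OF K EI KE xc] quot_image_inter[OF K c Kc EI KE] by simp
    moreover have "?h ` (colon R (E K (bump 0 (bump i n))) {x} \<inter> E K n) = ?h ` E K (bump 0 n)
        \<longleftrightarrow> colon R (E K (bump 0 (bump i n))) {x} \<inter> E K n = E K (bump 0 n)"
      by (rule quot_image_eq_iff[OF K i_intersect[OF c EI] _ EI KE]) (use Kc KE in blast)
    ultimately show ?thesis
      unfolding quot_image_mp[OF K] bump_def[symmetric] prod hE prod[unfolded hE] by simp
  qed
  have b: "(PIdl\<^bsub>?S\<^esub> (K +> x)) \<inter> multi_power ?S s (\<lambda>j. quot_ext R K (I j)) (n(i := Suc (n i)))
      = (\<lambda>y. (K +> x) \<otimes>\<^bsub>?S\<^esub> y) ` multi_power ?S s (\<lambda>j. quot_ext R K (I j)) n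
    \<longleftrightarrow> (PIdl x <+> K) \<inter> E K (bump i n) = (\<lambda>y. x \<otimes> y) ` mp n <+> K" for n
  proof -
    have X: "ideal (PIdl x) R" by (rule cgenideal_ideal[OF xc])
    have sm: "ideal ((\<lambda>y. x \<otimes> y) ` mp n) R" by (rule smult_ideal[OF mp_ideal xc])
    have XK: "ideal (PIdl x <+> K) R" "K \<subseteq> PIdl x <+> K" by (rule add_ideals[OF X K], rule ideal_sum_upper(2)[OF X K])
    have smK: "ideal ((\<lambda>y. x \<otimes> y) ` mp n <+> K) R" "K \<subseteq> (\<lambda>y. x \<otimes> y) ` mp n <+> K"
      by (rule add_ideals[OF sm K], rule ideal_sum_upper(2)[OF sm K])
    have "(PIdl\<^bsub>?S\<^esub> (K +> x)) \<inter> ?h ` mp (bump i n) = ?h ` ((PIdl x <+> K) \<inter> E K (bump i n))"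
      using quot_cgenideal[OF K xc] quot_image_sum_kernel[OF K X] quot_image_inter[OF K XK EI KE]
      by (simp add: hE)
    moreover have "(\<lambda>y. (K +> x) \<otimes>\<^bsub>?S\<^esub> y) ` (?h ` mp n) = ?h ` ((\<lambda>y. x \<otimes> y) ` mp n <+> K)"
      using quot_smult_image[OF K mp_ideal xc] quot_image_sum_kernel[OF K sm] by simp
    moreover have "?h ` ((PIdl x <+> K) \<inter> E K (bump i n)) = ?h ` ((\<lambda>y. x \<otimes> y) ` mp n <+> K)
        \<longleftrightarrow> (PIdl x <+> K) \<inter> E K (bump i n) = (\<lambda>y. x \<otimes> y) ` mp n <+> K"
      by (rule quot_image_eq_iff[OF K i_intersect[OF XK(1) EI] _ smK]) (use XK KE in blast)
    ultimately show ?thesis unfolding quot_image_mp[OF K] bump_def[symmetric] by simp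
  qed
  have Econg: "E K n = E K m" "mp n = mp m" "E K (bump 0 n) = E K (bump 0 m)" "E K (bump i n) = E K (bump i m)"
    "E K (bump 0 (bump i n)) = E K (bump 0 (bump i m))" if "\<And>j. j \<le> s \<Longrightarrow> n j = m j" for n m
    by (intro E_cong[OF K] mp_cong; simp add: bump_apply that)+
  have ev1: "(\<exists>N. \<forall>n. (\<forall>j\<le>s. N \<le> n j) \<longrightarrow> colon R (E K (bump 0 (bump i n))) {x} \<inter> E K n = E K (bump 0 n))
      \<longleftrightarrow> eventually (\<lambda>n. colon R (E K (bump 0 (bump i n))) {x} \<inter> E K n = E K (bump 0 n)) large"
  proof (rule eventually_large_iff_depends)
    fix n m :: "nat \<Rightarrow> nat" assume nm: "\<And>j. j \<le> s \<Longrightarrow> n j = m j"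
    show "(colon R (E K (bump 0 (bump i n))) {x} \<inter> E K n = E K (bump 0 n))
        = (colon R (E K (bump 0 (bump i m))) {x} \<inter> E K m = E K (bump 0 m))"
      using Econg[of n m, OF nm] by (simp only:)
  qed
  have ev2: "(\<exists>N. \<forall>n. (\<forall>j\<le>s. N \<le> n j) \<longrightarrow> (PIdl x <+> K) \<inter> E K (bump i n) = (\<lambda>y. x \<otimes> y) ` mp n <+> K)
      \<longleftrightarrow> eventually (\<lambda>n. (PIdl x <+> K) \<inter> E K (bump i n) = (\<lambda>y. x \<otimes> y) ` mp n <+> K) large"
  proof (rule eventually_large_iff_depends)
    fix n m :: "nat \<Rightarrow> nat" assume nm: "\<And>j. j \<le> s \<Longrightarrow> n j = m j"
    show "((PIdl x <+> K) \<inter> E K (bump i n) = (\<lambda>y. x \<otimes> y) ` mp n <+> K)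
        = ((PIdl x <+> K) \<inter> E K (bump i m) = (\<lambda>y. x \<otimes> y) ` mp m <+> K)"
      using Econg[of n m, OF nm] by (simp only:)
  qed
  have "K +> x \<in> quot_ext R K (I i)" unfolding quot_ext_def using x(1) by (rule imageI)
  then show ?thesis
    unfolding superficial_at_def superficial_mod_def nonnilpotent_quot_iff[OF K] a b ev1 ev2
    using x(2) xc by blast
qed

section \<open>Mixed multiplicities\<close>

lemma Idl_insert: "X \<subseteq> carrier R \<Longrightarrow> x \<in> carrier R \<Longrightarrow> Idl (insert x X) = Idl X <+> PIdl x"
proof
  assume X: "X \<subseteq> carrier R" and x: "x \<in> carrier R"
  have I: "ideal (Idl X) R" "ideal (PIdl x) R" "ideal (Idl (insert x X)) R"
    using X x by (simp_all add: genideal_ideal cgenideal_ideal)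
  have "insert x X \<subseteq> Idl (insert x X)" by (rule genideal_self) (use X x in simp)
  then have "Idl X \<subseteq> Idl (insert x X)" "PIdl x \<subseteq> Idl (insert x X)"
    using genideal_minimal[OF I(3)] cgenideal_minimal[OF I(3)] by simp_all
  then show "Idl X <+> PIdl x \<subseteq> Idl (insert x X)" by (rule ideal_sum_least[OF I(3)])
  have "insert x X \<subseteq> Idl X <+> PIdl x"
    using ideal_sum_upper[OF I(1,2)] genideal_self[OF X] cgenideal_self[OF x] by blast
  then show "Idl (insert x X) \<subseteq> Idl X <+> PIdl x" by (rule genideal_minimal[OF add_ideals[OF I(1,2)]])
qed

lemma seq_ideal_Idl:
  "X \<subseteq> carrier R \<Longrightarrow> set xs \<subseteq> carrier R \<Longrightarrow> seq_ideal (Idl X) xs = Idl (X \<union> set xs)"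
proof (induction xs arbitrary: X)
  case (Cons x xs)
  then show ?case using Cons.IH[of "insert x X"] Idl_insert[of X x] by simp
qed simp

lemma Idl_empty: "Idl {} = {\<zero>}"
  proof
  show "Idl {} \<subseteq> {\<zero>}" by (rule genideal_minimal[OF zeroideal]) simp
  show "{\<zero>} \<subseteq> Idl {}" using idealD(2)[OF genideal_ideal[of "{}"]] by simp
qed

text \<open>The starting set \<open>X\<close> is arbitrary so that the induction can move the head
  of the list into it.\<close>

lemma sup_seq_Idl_iff:
  assumes "X \<subseteq> carrier R"
  shows "sup_seq (Idl X) \<sigma> xs \<longleftrightarrow> length \<sigma> = length xs \<and>
    (\<forall>i<length xs. \<sigma> ! i \<le> s \<and> xs ! i \<in> I (\<sigma> ! i) \<and> \<not> nilp_mod (Idl (X \<union> set (take i xs))) \<and>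
      superficial_mod (Idl (X \<union> set (take i xs))) (\<sigma> ! i) (xs ! i))"
  using assms
proof (induction xs arbitrary: X \<sigma>)
  case Nil
  then show ?case by (cases \<sigma>) simp_all
next
  case (Cons x xs)
  show ?case
  proof (cases \<sigma>)
    case Nil
    then show ?thesis by simp
  next
    case \<sigma>: (Cons i \<tau>)
    show ?thesis
    proof (cases "i \<le> s \<and> x \<in> I i")
      case False
      then show ?thesis unfolding \<sigma> by (auto simp: All_less_Suc2)
    next
      case True
      then have x: "x \<in> carrier R" using idealD(3)[OF I_ideal] by blast
      have "insert x X \<subseteq> carrier R" using x Cons.prems by simp
      note IH = Cons.IH[OF this, of \<tau>]
      show ?thesis unfolding \<sigma> using True IH Idl_insert[OF Cons.prems x] by (auto simp: All_less_Suc2)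
    qed
  qed
qed

lemma superficial_sequence_of_type_iff:
  "superficial_sequence_of_type R s I k xs \<longleftrightarrow>
    (\<exists>\<sigma>. sup_seq {\<zero>} \<sigma> xs \<and> set \<sigma> \<subseteq> {1..s} \<and> (\<forall>j\<in>{1..s}. count_list \<sigma> j = k j))"
proof -
  have "superficial_sequence R s I \<sigma> xs \<and> (\<forall>i<length xs. \<sigma> ! i \<in> {1..s} \<and> xs ! i \<in> I (\<sigma> ! i))
      \<longleftrightarrow> sup_seq {\<zero>} \<sigma> xs \<and> set \<sigma> \<subseteq> {1..s}" (is "?L \<longleftrightarrow> ?R") for \<sigma>
  proof -
    have at: "superficial_at (R Quot Idl (set (take i xs))) s (\<lambda>j. quot_ext R (Idl (set (take i xs))) (I j)) (\<sigma> ! i)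
          (Idl (set (take i xs)) +> (xs ! i))
        \<longleftrightarrow> \<not> nilp_mod (Idl (set (take i xs))) \<and> superficial_mod (Idl (set (take i xs))) (\<sigma> ! i) (xs ! i)"
      if "set xs \<subseteq> carrier R" "\<sigma> ! i \<le> s" "xs ! i \<in> I (\<sigma> ! i)" for i
    proof (rule superficial_at_quot_iff[OF genideal_ideal that(3,2)])
      show "set (take i xs) \<subseteq> carrier R" using that(1) set_take_subset[of i xs] by blast
    qed
    have iff: "sup_seq {\<zero>} \<sigma> xs \<longleftrightarrow> length \<sigma> = length xs \<and>
      (\<forall>i<length xs. \<sigma> ! i \<le> s \<and> xs ! i \<in> I (\<sigma> ! i) \<and> \<not> nilp_mod (Idl (set (take i xs))) \<and>
        superficial_mod (Idl (set (take i xs))) (\<sigma> ! i) (xs ! i))"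
      using sup_seq_Idl_iff[of "{}" \<sigma> xs] by (simp add: Idl_empty)
    show ?thesis
    proof
      assume L: ?L
      then have "length \<sigma> = length xs" "set xs \<subseteq> carrier R" unfolding superficial_sequence_def by simp_all
      moreover have "\<sigma> ! i \<le> s \<and> xs ! i \<in> I (\<sigma> ! i) \<and> \<not> nilp_mod (Idl (set (take i xs))) \<and>
        superficial_mod (Idl (set (take i xs))) (\<sigma> ! i) (xs ! i)" if i: "i < length xs" for i
      proof -
        have "\<sigma> ! i \<le> s" "xs ! i \<in> I (\<sigma> ! i)" using L i by simp_all
        moreover have "superficial_at (R Quot Idl (set (take i xs))) s (\<lambda>j. quot_ext R (Idl (set (take i xs))) (I j)) (\<sigma> ! i)
          (Idl (set (take i xs)) +> (xs ! i))"
          using L i unfolding superficial_sequence_def Let_def by simp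
        ultimately show ?thesis using at[OF \<open>set xs \<subseteq> carrier R\<close>] by blast
      qed
      ultimately show ?R using L unfolding iff by (simp add: subset_code(1) all_set_conv_all_nth)
    next
      assume R: ?R
      then have len: "length \<sigma> = length xs" and xs: "set xs \<subseteq> carrier R"
        using sup_seq_length sup_seq_carrier by blast+
      have i: "\<sigma> ! i \<le> s" "xs ! i \<in> I (\<sigma> ! i)" "\<not> nilp_mod (Idl (set (take i xs)))"
        "superficial_mod (Idl (set (take i xs))) (\<sigma> ! i) (xs ! i)" if "i < length xs" for i
        using R that unfolding iff by simp_all
      have "\<sigma> ! i \<in> {1..s}" if "i < length xs" for i
        by (rule subsetD[OF conjunct2[OF R] nth_mem]) (simp add: that len)
      then show ?L
        unfolding superficial_sequence_def Let_def using len xs i at[OF xs] by simp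
    qed
  qed
  then show ?thesis unfolding superficial_sequence_of_type_def by (intro iff_exI) blast
qed

text \<open>The power \<open>mp1 1\<close> is the product over 1, ..., s, because its factor with
  index 0 has exponent 0.\<close>

lemma saturation_eq: "saturation R K (finprod (ideals_set R) I {1..s}) = satur K"
proof -
  let ?II = "finprod (ideals_set R) I {1..s}"
  have c: "(\<lambda>j. I j [^]\<^bsub>ideals_set R\<^esub> ((\<lambda>_. 1 :: nat)(0 := 0)) j) \<in> {1..s} \<rightarrow> carrier (ideals_set R)"
    by (rule funcsetI) (use I_ideal in \<open>simp add: ideal_pow del: fun_upd_apply\<close>)
  have "mp1 1 = (\<Otimes>\<^bsub>ideals_set R\<^esub>j\<in>insert 0 {1..s}. I j [^]\<^bsub>ideals_set R\<^esub> ((\<lambda>_. 1 :: nat)(0 := 0)) j)"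
    unfolding mp1_def multi_power_def by (rule arg_cong[where f = "finprod _ _"]) auto
  also have "\<dots> = carrier R \<cdot> (\<Otimes>\<^bsub>ideals_set R\<^esub>j\<in>{1..s}. I j [^]\<^bsub>ideals_set R\<^esub> ((\<lambda>_. 1 :: nat)(0 := 0)) j)"
    using ids.finprod_insert[OF _ _ c] oneideal by simp
  also have "(\<Otimes>\<^bsub>ideals_set R\<^esub>j\<in>{1..s}. I j [^]\<^bsub>ideals_set R\<^esub> ((\<lambda>_. 1 :: nat)(0 := 0)) j) = ?II"
    using I_ideal by (intro ids.finprod_cong') (auto simp: ids.nat_pow_Suc one_ideal_prod)
  also have "carrier R \<cdot> ?II = ?II"
    using ids.finprod_closed[of I "{1..s}"] I_ideal by (intro one_ideal_prod) (auto simp: Pi_def)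
  finally have II: "mp1 1 = ?II" .
  have "?II [^]\<^bsub>ideals_set R\<^esub> n = mp1 n" for n :: nat
  proof (induction n)
    case 0
    then show ?case by (simp add: mp1_0)
  next
    case (Suc n)
    then show ?case using mp1_add[of n 1] unfolding II by (simp add: ids.nat_pow_Suc)
  qed
  then show ?thesis unfolding saturation_def satur_eq by simp
qed

lemma mpoly_eval_cong:
  assumes "\<forall>m\<in>Poly_Mapping.keys p. Poly_Mapping.keys m \<subseteq> {..s}" "\<And>j. j \<le> s \<Longrightarrow> n j = m j"
  shows "mpoly_eval p n = mpoly_eval p m"
  unfolding mpoly_eval_def
proof (intro sum.cong prod.cong arg_cong2[where f = times] refl)
  fix x j assume "x \<in> Poly_Mapping.keys p" "j \<in> Poly_Mapping.keys x"
  then have "j \<le> s" using assms(1) by blast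
  then show "rat_of_nat (n j) ^ Poly_Mapping.lookup x j = rat_of_nat (m j) ^ Poly_Mapping.lookup x j"
    by (simp add: assms(2))
qed

lemma is_bhattacharya_poly_iff:
  "is_bhattacharya_poly R s I p \<longleftrightarrow> (\<forall>m\<in>Poly_Mapping.keys p. Poly_Mapping.keys m \<subseteq> {..s}) \<and>
    eventually (\<lambda>n. hlen {\<zero>} n = mpoly_eval p n) large"
proof -
  have len: "(\<exists>l. module_length R (quot_module (ideal_module R (mp n)) (mp (n(0 := Suc (n 0))))) = enat l
      \<and> of_nat l = x) \<longleftrightarrow> hlen {\<zero>} n = x" for n and x :: rat
  proof -
    have E: "E {\<zero>} n = mp n" for n
      unfolding E_def using idealD(2)[OF mp_ideal[of n]] by (intro ideal_sum_absorb mp_ideal zeroideal) simp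
    obtain l where l: "ideal_length R (E {\<zero>} n) (E {\<zero>} (bump 0 n)) = enat l"
      using hlen_finite[OF zeroideal, of n] by auto
    have "module_length R (quot_module (ideal_module R (mp n)) (mp (bump 0 n))) = ideal_length R (mp n) (mp (bump 0 n))"
      using E_bump_subset[OF zeroideal, of 0 n] by (intro module_length_quot mp_ideal) (simp add: E)
    then show ?thesis using l by (simp add: bump_def hlen_def E)
  qed
  have "(\<exists>N. \<forall>n. (\<forall>j\<le>s. N \<le> n j) \<longrightarrow> hlen {\<zero>} n = mpoly_eval p n)
      \<longleftrightarrow> eventually (\<lambda>n. hlen {\<zero>} n = mpoly_eval p n) large"
    if p: "\<forall>m\<in>Poly_Mapping.keys p. Poly_Mapping.keys m \<subseteq> {..s}"
  proof (rule eventually_large_iff_depends)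
    fix n m :: "nat \<Rightarrow> nat" assume nm: "\<And>j. j \<le> s \<Longrightarrow> n j = m j"
    have "hlen {\<zero>} n = hlen {\<zero>} m"
      by (rule hlen_depends_on[OF zeroideal, unfolded depends_on_def, rule_format]) (rule nm)
    then show "(hlen {\<zero>} n = mpoly_eval p n) = (hlen {\<zero>} m = mpoly_eval p m)"
      using mpoly_eval_cong[OF p nm] by simp
  qed
  then show ?thesis unfolding is_bhattacharya_poly_def len by blast
qed

text \<open>Uniqueness of the polynomial resolves the description in
  \<open>mixed_multiplicity\<close>; the differences along \<open>\<tau>\<close> then extract k_0!
  ... k_s! times the coefficient.\<close>

lemma mixed_multiplicity_eq:
  assumes deg: "pdeg s (Suc (\<Sum>j\<le>s. k j)) (hlen {\<zero>})"
    and \<tau>: "set \<tau> \<subseteq> {..s}" "\<And>j. j \<le> s \<Longrightarrow> count_list \<tau> j = k j"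
  shows "eventually (\<lambda>n. fdiffs \<tau> (hlen {\<zero>}) n = mixed_multiplicity R s I k) large"
proof -
  obtain p where p: "\<forall>m\<in>Poly_Mapping.keys p. Poly_Mapping.keys m \<subseteq> {..s}
      \<and> (\<Sum>j\<le>s. Poly_Mapping.lookup m j) < Suc (\<Sum>j\<le>s. k j)"
    "eventually (\<lambda>n. hlen {\<zero>} n = mpoly_eval p n) large"
    using pdeg_imp_mpoly[OF deg hlen_depends_on[OF zeroideal]] by (elim exE conjE)
  have "(THE p. is_bhattacharya_poly R s I p) = p"
  proof (rule the_equality)
    show "is_bhattacharya_poly R s I p" unfolding is_bhattacharya_poly_iff using p by blast
    fix q assume "is_bhattacharya_poly R s I q"
    then have q: "\<forall>m\<in>Poly_Mapping.keys q. Poly_Mapping.keys m \<subseteq> {..s}"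
      "eventually (\<lambda>n. hlen {\<zero>} n = mpoly_eval q n) large"
      unfolding is_bhattacharya_poly_iff by simp_all
    from q(2) p(2) have "eventually (\<lambda>n. mpoly_eval q n = mpoly_eval p n) large" by eventually_elim simp
    then show "q = p" using p(1) q(1) by (intro mpoly_unique) auto
  qed
  then have m: "mixed_multiplicity R s I k = (\<Prod>j\<le>s. fact (k j)) * Poly_Mapping.lookup p (mono_exp s k)"
    by (simp add: mixed_multiplicity_def mono_exp_def)
  have "(\<Sum>j\<le>s. k j) = (\<Sum>j\<le>s. count_list \<tau> j)" using \<tau>(2) by simp
  also have "\<dots> = length \<tau>" using \<tau>(1) by (intro sum_count_set) auto
  finally have "fdiffs \<tau> (mpoly_eval p) n = mixed_multiplicity R s I k" for n
    unfolding m using p(1) \<tau> by (intro fdiffs_mpoly_eval) (auto simp: less_Suc_eq_le)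
  then show ?thesis using fdiffs_cong[OF p(2), of \<tau>] by simp
qed

lemma is_hilbert_samuel_poly_quot_iff:
  assumes Q: "ideal Q R"
  shows "is_hilbert_samuel_poly (R Quot Q) (quot_ext R Q (I 0)) p \<longleftrightarrow>
    eventually (\<lambda>n. hs Q (Suc n) = poly p (of_nat n)) sequentially"
proof -
  let ?S = "R Quot Q"
  have len: "module_length ?S (quot_module (ideal_module ?S (carrier ?S)) (quot_ext R Q (I 0) [^]\<^bsub>ideals_set ?S\<^esub> m))
      = ideal_length R (carrier R) (Jpow m <+> Q)" for m
  proof -
    have JQ: "ideal (Jpow m <+> Q) R" "Q \<subseteq> Jpow m <+> Q"
      by (rule JQ_ideal[OF Q], rule ideal_sum_upper(2)[OF Jpow_ideal Q])
    have pow: "quot_ext R Q (I 0) [^]\<^bsub>ideals_set ?S\<^esub> m = (+>) Q ` (Jpow m <+> Q)"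
      using quot_image_pow[OF Q J_ideal, of m] quot_image_sum_kernel[OF Q Jpow_ideal, of m]
      by (simp add: quot_ext_def Jpow_def)
    note S = quot_cring[OF Q]
    have "module_length ?S (quot_module (ideal_module ?S (carrier ?S)) ((+>) Q ` (Jpow m <+> Q)))
        = ideal_length ?S (carrier ?S) ((+>) Q ` (Jpow m <+> Q))"
    proof (rule cring.module_length_quot[OF S])
      show "ideal (carrier ?S) ?S" by (rule ring.oneideal[OF cring.axioms(1)[OF S]])
      show "ideal ((+>) Q ` (Jpow m <+> Q)) ?S" by (rule quot_image_ideal[OF Q JQ(1)])
      then show "(+>) Q ` (Jpow m <+> Q) \<subseteq> carrier ?S"
        by (rule additive_subgroup.a_subset[OF ideal.axioms(1)])
    qed
    also have "\<dots> = ideal_length R (carrier R) (Jpow m <+> Q)"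
      unfolding quot_carrier[OF Q] using idealD(1)[OF Q]
      by (intro quot_ideal_length[OF Q oneideal _ JQ]) simp
    finally show ?thesis unfolding pow .
  qed
  have "(\<exists>l. ideal_length R (carrier R) (Jpow m <+> Q) = enat l \<and> of_nat l = x) \<longleftrightarrow> hs Q m = x" for m and x :: rat
    using hs_enat[OF Q, of m] by (auto simp: hs_def)
  then show ?thesis unfolding is_hilbert_samuel_poly_def eventually_sequentially len by simp
qed

text \<open>The polynomial belongs to the shifted function \<open>u\<close>, but a shift does not
  alter an eventually constant d-th difference, so d! times the coefficient is still
  \<open>e\<close>.\<close>

lemma hilbert_samuel_multiplicity_quot:
  assumes Q: "ideal Q R" and dim: "spec_chain Q d" "\<not> spec_chain Q (Suc d)"
    and e: "eventually (\<lambda>m. (dif ^^ d) (hs Q) m = e) sequentially"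
  shows "hilbert_samuel_multiplicity (R Quot Q) (quot_ext R Q (I 0)) = e"
proof -
  define u where "u n = hs Q (n + 1)" for n
  have krull: "krull_dim (R Quot Q) = ereal (real d)" using dim krull_dim_quot_eq_iff[OF Q] by blast
  have shift: "eventually (\<lambda>m. (dif ^^ D) u m = a) sequentially"
    if "eventually (\<lambda>m. (dif ^^ D) (hs Q) m = a) sequentially" for D a
    unfolding u_def dif_pow_shift using that eventually_sequentially_Suc[of "\<lambda>m. (dif ^^ D) (hs Q) m = a"] by simp
  have "eventually (\<lambda>m. (dif ^^ Suc d) u m = 0) sequentially"
    by (rule shift[OF hs_degree_le[OF Q dim(2)]])
  then obtain p where p: "\<forall>i\<ge>Suc d. coeff p i = 0" "eventually (\<lambda>m. u m = poly p (of_nat m)) sequentially"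
    using dif_pow_imp_poly by blast
  have "eventually (\<lambda>m. (dif ^^ d) u m = fact d * coeff p d) sequentially"
    using dif_pow_cong[OF p(2), of d] by eventually_elim (use p(1) in \<open>simp add: dif_pow_poly\<close>)
  with shift[OF e] have "eventually (\<lambda>m::nat. e = fact d * coeff p d) sequentially" by eventually_elim simp
  then have ep: "e = fact d * coeff p d" by simp
  have hsp: "is_hilbert_samuel_poly (R Quot Q) (quot_ext R Q (I 0)) p"
    unfolding is_hilbert_samuel_poly_quot_iff[OF Q] using p(2) by (simp add: u_def)
  have unique: "q = p" if "is_hilbert_samuel_poly (R Quot Q) (quot_ext R Q (I 0)) q" for q
  proof (rule poly_unique_sequentially)
    show "eventually (\<lambda>m. poly q (of_nat m) = poly p (of_nat m)) sequentially"
      using that hsp unfolding is_hilbert_samuel_poly_quot_iff[OF Q] by eventually_elim simp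
  qed
  show ?thesis
    unfolding hilbert_samuel_multiplicity_def
  proof (rule the_equality)
    show "\<exists>d p. krull_dim (R Quot Q) = ereal (real d) \<and>
        is_hilbert_samuel_poly (R Quot Q) (quot_ext R Q (I 0)) p \<and> e = fact d * coeff p d"
      using krull hsp ep by blast
    fix e' assume "\<exists>d p. krull_dim (R Quot Q) = ereal (real d) \<and>
        is_hilbert_samuel_poly (R Quot Q) (quot_ext R Q (I 0)) p \<and> e' = fact d * coeff p d"
    then show "e' = e" using krull ep unique by auto
  qed
qed

section \<open>Mixed multiplicities of a fixed type\<close>

context
  fixes k :: "nat \<Rightarrow> nat"
  assumes dim: "krull_dim (R Quot satur {\<zero>}) = ereal (real (Suc (\<Sum>j\<le>s. k j)))"
begin

lemma not_prime_chain_zero: "\<not> prime_chain {\<zero>} (Suc (Suc (\<Sum>j\<le>s. k j)))"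
  using dim unfolding krull_dim_quot_eq_iff[OF satur_ideal[OF zeroideal]] prime_chain_iff_spec_chain[OF zeroideal]
  by blast

lemma hlen_zero_pdeg: "pdeg s (Suc (\<Sum>j\<le>s. k j)) (hlen {\<zero>})"
proof -
  obtain D where D: "pdeg s D (hlen {\<zero>})" "D = 0 \<or> prime_chain {\<zero>} D"
    using hlen_pdeg[OF zeroideal] by (elim exE conjE)
  have "D \<le> Suc (\<Sum>j\<le>s. k j)"
  proof (rule ccontr)
    assume a: "\<not> D \<le> Suc (\<Sum>j\<le>s. k j)"
    then have "spec_chain (satur {\<zero>}) D" using D(2) prime_chain_iff_spec_chain[OF zeroideal] by auto
    then have "spec_chain (satur {\<zero>}) (Suc (Suc (\<Sum>j\<le>s. k j)))" by (rule spec_chain_le) (use a in simp)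
    then show False using not_prime_chain_zero prime_chain_iff_spec_chain[OF zeroideal] by blast
  qed
  then show ?thesis using D(1) pdeg_mono by blast
qed

lemma sum_k_split: "(\<Sum>j\<le>s. k j) = k 0 + (\<Sum>j\<in>{1..s}. k j)"
proof -
  have "{..s} = insert 0 {1..s}" by auto
  then show ?thesis by simp
qed

lemma count_list_replicate: "count_list (replicate n x) y = (if x = y then n else 0)"
  by (auto simp: count_list_eq_length_filter)

lemma eventually_fdiffs_mixed_multiplicity:
  assumes "set \<sigma> \<subseteq> {1..s}" "\<forall>j\<in>{1..s}. count_list \<sigma> j = k j"
  shows "eventually (\<lambda>n. fdiffs (\<sigma> @ replicate (k 0) 0) (hlen {\<zero>}) n = mixed_multiplicity R s I k) large"
proof (rule mixed_multiplicity_eq[OF hlen_zero_pdeg])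
  show "set (\<sigma> @ replicate (k 0) 0) \<subseteq> {..s}" using assms(1) by auto
  fix j assume j: "j \<le> s"
  show "count_list (\<sigma> @ replicate (k 0) 0) j = k j"
  proof (cases "j = 0")
    case True
    then have "j \<notin> set \<sigma>" using assms(1) by auto
    then show ?thesis using True by (simp add: count_list_replicate)
  next
    case False
    then show ?thesis using assms(2) j by (simp add: count_list_replicate)
  qed
qed

text \<open>The common source of both statements: \<open>sup_seq_hs\<close> with K = 0 and D = k_0.
  The count q - 1 = k_0 + t turns the bound q on the chains over 0 into the bound k_0 + 1 for
  Q.\<close>

lemma superficial_sequence_facts:
  assumes "superficial_sequence_of_type R s I k xs"
  defines "Q \<equiv> satur (Idl (set xs))"
  shows "ideal Q R"
    and "mixed_multiplicity R s I k \<noteq> 0 \<longleftrightarrow> spec_chain Q (Suc (k 0))"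
    and "\<not> spec_chain Q (Suc (Suc (k 0)))"
    and "eventually (\<lambda>m. (dif ^^ Suc (k 0)) (hs Q) m = mixed_multiplicity R s I k) sequentially"
    and "(\<Sum>j\<le>s. k j) = k 0 + length xs"
proof -
  obtain \<sigma> where \<sigma>: "sup_seq {\<zero>} \<sigma> xs" "set \<sigma> \<subseteq> {1..s}" "\<forall>j\<in>{1..s}. count_list \<sigma> j = k j"
    using assms(1) unfolding superficial_sequence_of_type_iff by (elim exE conjE)
  have xs: "set xs \<subseteq> carrier R" by (rule sup_seq_carrier[OF \<sigma>(1)])
  have Q: "satur (seq_ideal {\<zero>} xs) = Q"
    unfolding Q_def using seq_ideal_Idl[of "{}" xs] xs by (simp add: Idl_empty)
  show "ideal Q R" unfolding Q_def by (rule satur_ideal[OF genideal_ideal[OF xs]])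
  have "(\<Sum>j\<in>{1..s}. k j) = (\<Sum>j\<in>{1..s}. count_list \<sigma> j)" using \<sigma>(3) by simp
  also have "\<dots> = length xs" using \<sigma>(2) sup_seq_length[OF \<sigma>(1)] by (subst sum_count_set) auto
  finally show sum: "(\<Sum>j\<le>s. k j) = k 0 + length xs" using sum_k_split by simp
  have no: "\<not> prime_chain {\<zero>} (Suc (Suc (k 0 + length xs)))" using not_prime_chain_zero sum by simp
  note * = sup_seq_hs[OF zeroideal \<sigma>(1) eventually_fdiffs_mixed_multiplicity[OF \<sigma>(2,3)] no, unfolded Q]
  show "mixed_multiplicity R s I k \<noteq> 0 \<longleftrightarrow> spec_chain Q (Suc (k 0))" by (rule *(2))
  show "\<not> spec_chain Q (Suc (Suc (k 0)))" by (rule *(3))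
  show "eventually (\<lambda>m. (dif ^^ Suc (k 0)) (hs Q) m = mixed_multiplicity R s I k) sequentially" by (rule *(1))
qed

text \<open>Since q - t = k_0 + 1, the condition says that the saturated quotient attains the
  largest possible dimension.\<close>

lemma mixed_multiplicity_nonzero_iff:
  assumes "superficial_sequence_of_type R s I k xs"
  shows "mixed_multiplicity R s I k \<noteq> 0 \<longleftrightarrow> krull_dim (R Quot satur (Idl (set xs)))
      = krull_dim (R Quot satur {\<zero>}) - ereal (real (length xs))"
proof -
  note * = superficial_sequence_facts[OF assms]
  have "krull_dim (R Quot satur {\<zero>}) - ereal (real (length xs)) = ereal (real (Suc (k 0)))"
    unfolding dim *(5) by simp
  then show ?thesis using *(2,3) krull_dim_quot_eq_iff[OF *(1), of "Suc (k 0)"] by simp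
qed

lemma mixed_multiplicity_eq_hilbert_samuel:
  assumes "superficial_sequence_of_type R s I k xs" "mixed_multiplicity R s I k \<noteq> 0"
  shows "mixed_multiplicity R s I k
    = hilbert_samuel_multiplicity (R Quot satur (Idl (set xs))) (quot_ext R (satur (Idl (set xs))) (I 0))"
proof -
  note * = superficial_sequence_facts[OF assms(1)]
  have "spec_chain (satur (Idl (set xs))) (Suc (k 0))" using *(2) assms(2) by blast
  then show ?thesis by (rule hilbert_samuel_multiplicity_quot[OF *(1) _ *(3,4), symmetric])
qed

lemma superficial_sequence_of_type_exists:
  assumes nz: "mixed_multiplicity R s I k \<noteq> 0"
  shows "\<exists>xs. superficial_sequence_of_type R s I k xs"
proof -
  \<comment> \<open>The differences in the direction of J come after the sequence, so their number
    is set to 0 here; \<open>replicate (k 0) 0\<close> supplies them below.\<close>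
  define k' where "k' = k(0 := 0)"
  obtain \<sigma> where \<sigma>: "set \<sigma> \<subseteq> {..s}" "\<And>j. j \<le> s \<Longrightarrow> count_list \<sigma> j = k' j"
    using exists_list_count[of s k'] by metis
  have "0 \<notin> set \<sigma>" using \<sigma>(2)[of 0] by (simp add: k'_def count_list_0_iff)
  have S: "set \<sigma> \<subseteq> {1..s}"
  proof
    fix j assume "j \<in> set \<sigma>"
    then show "j \<in> {1..s}" using \<sigma>(1) \<open>0 \<notin> set \<sigma>\<close> by (cases "j = 0") auto
  qed
  have c: "\<forall>j\<in>{1..s}. count_list \<sigma> j = k j" using \<sigma>(2) by (simp add: k'_def)
  have "\<not> eventually (\<lambda>n. fdiffs \<sigma> (hlen {\<zero>}) n = 0) large"
  proof
    assume "eventually (\<lambda>n. fdiffs \<sigma> (hlen {\<zero>}) n = 0) large"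
    from fdiffs_cong[OF this, of "replicate (k 0) 0"]
    have "eventually (\<lambda>n. fdiffs (\<sigma> @ replicate (k 0) 0) (hlen {\<zero>}) n = 0) large"
      by (simp only: fdiffs_append fdiffs_zero)
    with eventually_fdiffs_mixed_multiplicity[OF S c]
    have "eventually (\<lambda>n. mixed_multiplicity R s I k = 0) large" by eventually_elim simp
    then show False using nz unfolding eventually_large by auto
  qed
  then obtain xs where "sup_seq {\<zero>} \<sigma> xs" using sup_seq_exists[OF zeroideal \<sigma>(1)] by blast
  then show ?thesis unfolding superficial_sequence_of_type_iff using S c by blast
qed

end

end

theorem theorem4p5:
  fixes R :: "('a, 'm) ring_scheme"
    and \<nn> J II :: "'a set"
    and I :: "nat \<Rightarrow> 'a set"
    and s :: nat
    and k :: "nat \<Rightarrow> nat"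
  assumes noetherian: "noetherian_ring R"
    and local: "local_ring R \<nn>"
    and dim_pos: "krull_dim R > 0"
    and residue_field: "infinite (carrier (R Quot \<nn>))"
    and J: "primary_to R \<nn> J"
    and I_zero: "I 0 = J"
    and I_ideal: "\<And>j. j \<in> {1..s} \<Longrightarrow> ideal (I j) R"
    and II: "II = finprod (ideals_set R) I {1..s}"
    and II_nonnilpotent: "nonnilpotent_ideal R II"
    and k_sum: "ereal (real (\<Sum>j\<le>s. k j)) = krull_dim (R Quot saturation R {\<zero>\<^bsub>R\<^esub>} II) - 1"
  shows "(mixed_multiplicity R s I k \<noteq> 0 \<longleftrightarrow>
            (\<exists>xs. superficial_sequence_of_type R s I k xs \<and>
                  krull_dim (R Quot saturation R (Idl\<^bsub>R\<^esub> (set xs)) II)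
                    = krull_dim (R Quot saturation R {\<zero>\<^bsub>R\<^esub>} II) - ereal (real (length xs))))
       \<and> (\<forall>xs K. mixed_multiplicity R s I k \<noteq> 0 \<and> superficial_sequence_of_type R s I k xs \<and>
                 K = saturation R (Idl\<^bsub>R\<^esub> (set xs)) II \<longrightarrow>
                 mixed_multiplicity R s I k
                   = hilbert_samuel_multiplicity (R Quot K) (quot_ext R K J))"
proof -
  interpret cring R using local by (simp add: local_ring_def)
  have "ideal (I j) R" if "j \<le> s" for j
  proof (cases "j = 0")
    case True
    then show ?thesis using J I_zero by (simp add: primary_to_def primary_ideal_def)
  qed (use that I_ideal in simp)
  moreover note noetherian_ring.axioms(2)[OF noetherian]
  ultimately interpret local_primary_family R s I \<nn>
    by (intro local_primary_family.intro local_ideal_family.intro ideal_family.intro ideal_family_axioms.intro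
        local_ideal_family_axioms.intro local_primary_family_axioms.intro is_cring noetherian local residue_field)
      (simp_all only: I_zero J)
  have sat: "saturation R A II = satur A" for A unfolding II by (rule saturation_eq)
  \<comment> \<open>\<open>k_sum\<close> equates the dimension minus 1 with a real number, which
    excludes the infinite values.\<close>
  have dim: "krull_dim (R Quot satur {\<zero>\<^bsub>R\<^esub>}) = ereal (real (Suc (\<Sum>j\<le>s. k j)))"
    using k_sum unfolding sat by (cases "krull_dim (R Quot satur {\<zero>\<^bsub>R\<^esub>})") (auto simp: one_ereal_def)
  show ?thesis
    unfolding sat I_zero[symmetric]
  proof (intro conjI allI impI iffI)
    assume nz: "mixed_multiplicity R s I k \<noteq> 0"
    obtain xs where xs: "superficial_sequence_of_type R s I k xs"
      using superficial_sequence_of_type_exists[OF dim nz] by (elim exE)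
    then show "\<exists>xs. superficial_sequence_of_type R s I k xs \<and> krull_dim (R Quot satur (Idl\<^bsub>R\<^esub> (set xs)))
        = krull_dim (R Quot satur {\<zero>\<^bsub>R\<^esub>}) - ereal (real (length xs))"
      using mixed_multiplicity_nonzero_iff[OF dim xs] nz by (intro exI[of _ xs] conjI) simp_all
  next
    assume "\<exists>xs. superficial_sequence_of_type R s I k xs \<and> krull_dim (R Quot satur (Idl\<^bsub>R\<^esub> (set xs)))
        = krull_dim (R Quot satur {\<zero>\<^bsub>R\<^esub>}) - ereal (real (length xs))"
    then show "mixed_multiplicity R s I k \<noteq> 0"
      by (elim exE conjE) (simp only: mixed_multiplicity_nonzero_iff[OF dim])
  next
    fix xs K
    assume a: "mixed_multiplicity R s I k \<noteq> 0 \<and> superficial_sequence_of_type R s I k xs \<and> K = satur (Idl\<^bsub>R\<^esub> (set xs))"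
    then have K: "K = satur (Idl\<^bsub>R\<^esub> (set xs))" by simp
    show "mixed_multiplicity R s I k = hilbert_samuel_multiplicity (R Quot K) (quot_ext R K (I 0))"
      unfolding K using a by (intro mixed_multiplicity_eq_hilbert_samuel[OF dim]) simp_all
  qed
qed

end
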